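(* Let $n\ge3$ and let $M$ be a dyadic number with $0<M\le\frac14$. Let $1\le p,q\le\infty$ satisfy $q>\frac n{n-1}$, $\frac2p+\frac nq<n$ and $\frac2p+\frac1q\le2$. Then there is a constant $C=C(p,q,n,M)$ such that $$\|(fd\sigma)^{\vee}(gd\sigma)^{\vee}\|_{L^q_{t,x}(\mathbb R\times\mathbb R^{n-1})}\le C\|f\|_{L^p(S_1)}\|g\|_{L^p(S_2)} \tag{$*$}$$ for all $f\in\mathcal L_1\cap L^p(S_1)$ and $g\in\mathcal L_M\cap L^p(S_2)$. These estimates are sharp except for certain endpoints: if $1\le p,q\le\infty$ and $( * )$ holds for all such $f,g$ with some finite constant $C$, then $q\ge\frac n{n-1}$, $\frac2p+\frac nq\le n$ and $\frac2p+\frac1q\le2$.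
   Context: Points of $\mathbb R\times\mathbb R^{n-1}$ are written $(t,x)$ or $(\tau,\xi)$. $S=\{(\tau,\xi)\in\mathbb R\times\mathbb R^{n-1}:\tau=|\xi|^2\}$ is the paraboloid, with measure $d\sigma$ given by $\int_S f\,d\sigma=\int_{\mathbb R^{n-1}}f(|\xi|^2,\xi)\,d\xi$. For $f$ on $S$, $$(fd\sigma)^{\vee}(t,x)=\int_{\mathbb R^{n-1}}f(|\xi|^2,\xi)e^{i(x\cdot\xi+t|\xi|^2)}\,d\xi .$$ A function is cylindrically symmetric if it is invariant under rotations of the $\mathbb R^{n-1}$ variable. A dyadic number is a number $2^j$, $j\in\mathbb Z$. For dyadic $M$, $\mathcal L_M$ is the class of cylindrically symmetric functions supported on $\{(\tau,\xi)\in S: M\le|\xi|\le2M\}$. $S_1=\{(\tau,\xi)\in S:1\le|\xi|\le2\}$, $S_2=\{(\tau,\xi)\in S:M\le|\xi|\le2M\}$, both with the measure $d\sigma$. *)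

theory Defs
  imports "HOL-Analysis.Analysis" "HOL-Probability.Essential_Supremum"
begin

text \<open>
  Lebesgue norms with exponent \<open>p \<in> [1,\<infinity>]\<close>, the exponent and the value being extended
  nonnegative reals. In \<^typ>\<open>ennreal\<close> one has \<open>c / \<infinity> = 0\<close> for finite \<open>c\<close>, so conditions on
  \<open>1/p\<close> carry the usual convention at \<open>p = \<infinity>\<close>.
\<close>

definition Lp_norm :: "'a measure \<Rightarrow> ennreal \<Rightarrow> ('a \<Rightarrow> complex) \<Rightarrow> ennreal" where
  "Lp_norm \<mu> p f =
    (if p = \<infinity> then esssup \<mu> (\<lambda>x. ennreal (cmod (f x)))
     else let I = (\<integral>\<^sup>+ x. ennreal (cmod (f x) powr enn2real p) \<partial>\<mu>)
          in if I = \<infinity> then \<infinity> else ennreal (enn2real I powr (1 / enn2real p)))"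

definition Lp_space :: "'a measure \<Rightarrow> ennreal \<Rightarrow> ('a \<Rightarrow> complex) set" where
  "Lp_space \<mu> p = {f \<in> borel_measurable \<mu>. Lp_norm \<mu> p f < \<infinity>}"

definition dyadic :: "real \<Rightarrow> bool" where
  "dyadic M \<longleftrightarrow> (\<exists>j::int. M = 2 powi j)"

text \<open>
  The space \<open>\<real>\<^sup>n\<^sup>-\<^sup>1\<close> is \<^typ>\<open>real ^ 'd\<close>, so that \<open>n = CARD('d) + 1\<close>. A function on the paraboloid
  is represented by a function on \<^typ>\<open>real \<times> (real ^ 'd)\<close>; every notion below depends only on its
  restriction to the paraboloid.
\<close>

definition paraboloid :: "(real \<times> (real ^ 'd)) set" where
  "paraboloid = {(\<tau>, \<xi>). \<tau> = (norm \<xi>)\<^sup>2}"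

definition shell :: "real \<Rightarrow> (real \<times> (real ^ 'd)) set" where
  "shell M = {(\<tau>, \<xi>) \<in> paraboloid. M \<le> norm \<xi> \<and> norm \<xi> \<le> 2 * M}"

text \<open>
  The measure \<open>d\<sigma>\<close>, as a Borel measure on the ambient space concentrated on the paraboloid;
  the lemma below is its defining property.
\<close>

definition sigma_measure :: "(real \<times> (real ^ 'd)) measure" where
  "sigma_measure = distr lborel borel (\<lambda>\<xi>. ((norm \<xi>)\<^sup>2, \<xi>))"

lemma nn_integral_sigma_measure:
  fixes f :: "real \<times> (real ^ 'd) \<Rightarrow> ennreal"
  assumes "f \<in> borel_measurable borel"
  shows "(\<integral>\<^sup>+ z\<in>paraboloid. f z \<partial>sigma_measure) = (\<integral>\<^sup>+ \<xi>. f ((norm \<xi>)\<^sup>2, \<xi>) \<partial>lborel)"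
proof -
  have "closed (paraboloid :: (real \<times> (real ^ 'd)) set)"
    unfolding paraboloid_def case_prod_unfold
    by (intro closed_Collect_eq continuous_intros)
  then have [measurable]: "(paraboloid :: (real \<times> (real ^ 'd)) set) \<in> sets borel"
    by (rule borel_closed)
  have [measurable]: "(\<lambda>\<xi>::real ^ 'd. ((norm \<xi>)\<^sup>2, \<xi>)) \<in> lborel \<rightarrow>\<^sub>M borel"
    by (intro borel_measurable_continuous_onI continuous_intros | subst measurable_lborel2)+
  note [measurable] = assms
  show ?thesis
    unfolding sigma_measure_def
    by (subst nn_integral_distr) (measurable, auto simp: paraboloid_def intro!: nn_integral_cong)
qed

text \<open>\<open>(f d\<sigma>)\<^sup>\<or>\<close>\<close>

definition extension :: "(real \<times> (real ^ 'd) \<Rightarrow> complex) \<Rightarrow> real \<times> (real ^ 'd) \<Rightarrow> complex" where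
  "extension f = (\<lambda>(t, x).
     LINT \<xi>|lborel. f ((norm \<xi>)\<^sup>2, \<xi>) * exp (\<i> * complex_of_real (x \<bullet> \<xi> + t * (norm \<xi>)\<^sup>2)))"

definition cylindrically_symmetric :: "(real \<times> (real ^ 'd) \<Rightarrow> complex) \<Rightarrow> bool" where
  "cylindrically_symmetric f \<longleftrightarrow>
    (\<forall>A. rotation_matrix A \<longrightarrow> (\<forall>(\<tau>, \<xi>) \<in> paraboloid. f (\<tau>, A *v \<xi>) = f (\<tau>, \<xi>)))"

definition cyl_class :: "real \<Rightarrow> (real \<times> (real ^ 'd) \<Rightarrow> complex) set" where
  "cyl_class M = {f. cylindrically_symmetric f \<and> (\<forall>z \<in> paraboloid - shell M. f z = 0)}"

text \<open>Both factors on the right are taken in \<open>L\<^sup>p\<close> with respect to \<open>d\<sigma>\<close> on the respective shell.\<close>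

definition bilinear_estimate ::
  "'d::finite itself \<Rightarrow> real \<Rightarrow> ennreal \<Rightarrow> ennreal \<Rightarrow> real \<Rightarrow> bool" where
  "bilinear_estimate _ M p q C \<longleftrightarrow>
    (\<forall>f g :: real \<times> (real ^ 'd) \<Rightarrow> complex.
       f \<in> cyl_class 1 \<inter> Lp_space (restrict_space sigma_measure (shell 1)) p \<longrightarrow>
       g \<in> cyl_class M \<inter> Lp_space (restrict_space sigma_measure (shell M)) p \<longrightarrow>
       Lp_norm lborel q (\<lambda>z. extension f z * extension g z)
         \<le> ennreal C * Lp_norm (restrict_space sigma_measure (shell 1)) p f
             * Lp_norm (restrict_space sigma_measure (shell M)) p g)"

end

theory Submission
  imports Defs "HOL-Probability.Probability"
begin

text \<open>
  In polar coordinates a cylindrically symmetric function becomes a function \<open>F\<close> of \<open>s = \<bar>\<xi>\<bar>\<close>, and its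
  extension is \<open>\<integral> F(s) exp(i t s\<^sup>2) K(\<bar>x\<bar> s) ds\<close>, where \<open>K\<close> is the Fourier transform of the sphere. From the
  differential equation satisfied by \<open>K\<close> one gets \<open>K(r) = r\<^sup>-\<^sup>D\<^sup>/\<^sup>2 (2 Re (a e\<^sup>i\<^sup>r) + O(1/r))\<close> with
  \<open>D = n - 2\<close> and \<open>a \<noteq> 0\<close>. To leading order the extensions of \<open>f\<close> and \<open>g\<close> are thus extensions from
  a parabola in the plane. The frequencies of \<open>f\<close> and \<open>g\<close> are separated, which makes the two pieces of
  parabola transversal, so their product obeys a bilinear \<open>L\<^sup>2\<close> estimate, with weight \<open>r\<^sup>2\<^sup>D\<close>. At a fixed
  radius, Hausdorff-Young in \<open>t\<close> gives an \<open>L\<^sup>q\<close> estimate. Interpolating the two and summing over the level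
  sets of \<open>F\<close> and \<open>G\<close> gives the range of exponents claimed.

  The necessary conditions come from three pairs of examples: waves that spread over the annulus
  \<open>\<bar>x\<bar> \<approx> R\<close>, coming from all of \<open>[1, 2]\<close> and \<open>[M, 2M]\<close> or from intervals of length \<open>1/R\<close>, with
  the phases chosen so that both waves are in the annulus at the same times; and indicators of intervals
  of length \<open>\<delta>\<close> near the origin for times up to \<open>1/\<delta>\<close>.
\<close>

section \<open>Polar coordinates\<close>

text \<open>The conditions on p are traded for one working exponent between \<open>dual2 q\<close>
  and 2. The inequality 2/p + 1/q \<le> 2 says p \<ge> \<open>dual2 q\<close>, the exponent from
  which Hausdorff-Young reaches \<open>L\<^sup>2\<^sup>q\<close> in time, hence
  \<open>L\<^sup>q\<close> for a product. For p > 2 one lowers p to 2, the shells having finite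
  measure; at p = 2 the condition 2/p + n/q < n reads q > n/(n-1). The obstacle: at a fixed radius
  the product decays only like r^(-D), against the volume element r^D, which suffices just for (q-1)
  D > 1. Transversality yields one further power of r in the square, on average, but it costs
  \<open>L\<^sup>2\<close> norms of the inputs, while p may be below 2. On a level set the
  \<open>L\<^sup>2\<close> norm is controlled by the \<open>L\<^sup>p\<close> norm at a price
  growing with the height, and lowering the exponent to \<open>dual2 q\<close> gains with the
  height. The share \<theta> of the \<open>L\<^sup>2\<close> estimate must be large enough for
  convergence in r and small enough for convergence over the heights; the strict inequality 2/p +
  n/q < n leaves room for such a \<theta>.\<close>

lemma lborel_distr_orthogonal:
  fixes f :: "'a::euclidean_space \<Rightarrow> 'a"
  assumes f: "orthogonal_transformation f"
  shows "distr lborel borel f = lborel"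
proof (rule measure_eqI)
  have lin: "linear f" using f by (rule orthogonal_transformation_linear)
  have nf: "norm (f x) = norm x" for x using f by (rule orthogonal_transformation_norm)
  have [measurable]: "f \<in> borel_measurable borel"
    using lin by (intro borel_measurable_continuous_onI linear_continuous_on) (simp add: linear_conv_bounded_linear)
  let ?\<mu> = "distr lborel borel f"
  fix E assume "E \<in> sets ?\<mu>"
  then have [measurable]: "E \<in> sets borel" by simp
  have inj: "bij f" using f by (rule orthogonal_transformation_bij)
  have sh: "(\<integral>\<^sup>+ y. g (x + y) \<partial>?\<mu>) = (\<integral>\<^sup>+ y. g y \<partial>?\<mu>)" if [measurable]: "g \<in> borel_measurable borel" for g :: "'a \<Rightarrow> ennreal" and x
  proof -
    obtain z where z: "f z = x" using inj by (metis bij_pointE)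
    have "(\<integral>\<^sup>+ y. g (x + y) \<partial>?\<mu>) = (\<integral>\<^sup>+ y. g (f (z + y)) \<partial>lborel)"
      by (subst nn_integral_distr) (auto simp: linear_add[OF lin] z)
    also have "\<dots> = (\<integral>\<^sup>+ y. g (f y) \<partial>distr lborel borel ((+) z))"
      by (subst nn_integral_distr) auto
    also have "\<dots> = (\<integral>\<^sup>+ y. g y \<partial>?\<mu>)"
      by (subst nn_integral_distr) (auto simp: lborel_distr_plus)
    finally show ?thesis .
  qed
  have shl: "(\<integral>\<^sup>+ y. g (y - x) \<partial>lborel) = (\<integral>\<^sup>+ y. g y \<partial>lborel)" if [measurable]: "g \<in> borel_measurable borel" for g :: "'a \<Rightarrow> ennreal" and x
  proof -
    have "(\<integral>\<^sup>+ y. g (y - x) \<partial>lborel) = (\<integral>\<^sup>+ y. g y \<partial>distr lborel borel ((+) (-x)))"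
      by (subst nn_integral_distr) auto
    then show ?thesis by (simp add: lborel_distr_plus)
  qed
  interpret M: sigma_finite_measure ?\<mu>
  proof
    show "\<exists>A. countable A \<and> A \<subseteq> sets ?\<mu> \<and> \<Union>A = space ?\<mu> \<and> (\<forall>a\<in>A. emeasure ?\<mu> a \<noteq> \<infinity>)"
    proof (intro exI[of _ "range (\<lambda>n::nat. ball (0::'a) n)"] conjI ballI)
      show "\<Union>(range (\<lambda>n::nat. ball (0::'a) n)) = space ?\<mu>"
        by (auto simp: space_distr intro: reals_Archimedean2)
      fix a assume "a \<in> range (\<lambda>n::nat. ball (0::'a) n)"
      then obtain n :: nat where a: "a = ball 0 n" by auto
      have "emeasure ?\<mu> a = emeasure lborel (ball (0::'a) n)"
        unfolding a by (subst emeasure_distr) (auto simp: vimage_def nf ball_def)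
      then show "emeasure ?\<mu> a \<noteq> \<infinity>" by (simp add: emeasure_ball)
    qed auto
  qed
  interpret P: pair_sigma_finite "lborel :: 'a measure" ?\<mu> ..
  let ?B = "ball (0::'a) 1"
  have [measurable]: "?B \<in> sets borel" by simp
  have B: "emeasure ?\<mu> ?B = emeasure lborel ?B"
    by (subst emeasure_distr) (auto simp: vimage_def nf ball_def)
  \<comment> \<open>Uniqueness of a translation-invariant measure: the pairs with \<open>x\<close>
    in the ball and \<open>x + y\<close> in \<open>E\<close> are counted in both orders of
    integration. This gives \<open>?\<mu> E\<close> times the volume of the ball on one side and the
    volume of \<open>E\<close> times \<open>?\<mu> ?B\<close> on the other; the ball has the same
    measure for both because \<open>f\<close> preserves norms.\<close>
  have "emeasure lborel ?B * emeasure ?\<mu> E = (\<integral>\<^sup>+ x. indicator ?B x * (\<integral>\<^sup>+ y. indicator E (x + y) \<partial>?\<mu>) \<partial>lborel)"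
  proof -
    have "(\<integral>\<^sup>+ y. indicator E (x + y) \<partial>?\<mu>) = emeasure ?\<mu> E" for x
      by (subst sh) auto
    then show ?thesis by (simp only:) (subst nn_integral_multc; measurable; simp)
  qed
  also have "\<dots> = (\<integral>\<^sup>+ x. \<integral>\<^sup>+ y. indicator ?B x * indicator E (x + y) \<partial>?\<mu> \<partial>lborel)"
    by (intro nn_integral_cong nn_integral_cmult[symmetric]) simp
  also have "\<dots> = (\<integral>\<^sup>+ y. \<integral>\<^sup>+ x. indicator ?B x * indicator E (x + y) \<partial>lborel \<partial>?\<mu>)"
    by (rule P.Fubini'[symmetric]) measurable
  also have "\<dots> = (\<integral>\<^sup>+ y. \<integral>\<^sup>+ x. indicator ?B (x - y) * indicator E x \<partial>lborel \<partial>?\<mu>)"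
  proof (rule nn_integral_cong)
    fix y
    show "(\<integral>\<^sup>+ x. indicator ?B x * indicator E (x + y) \<partial>lborel) = (\<integral>\<^sup>+ x. indicator ?B (x - y) * indicator E x \<partial>lborel)"
      using shl[of "\<lambda>x. indicator ?B x * indicator E (x + y)" y] by simp
  qed
  also have "\<dots> = (\<integral>\<^sup>+ x. \<integral>\<^sup>+ y. indicator ?B (x - y) * indicator E x \<partial>?\<mu> \<partial>lborel)"
    by (rule P.Fubini') measurable
  also have "\<dots> = (\<integral>\<^sup>+ x. indicator E x * emeasure ?\<mu> ?B \<partial>lborel)"
  proof (rule nn_integral_cong)
    fix x
    have "(\<integral>\<^sup>+ y. indicator ?B (x - y) * indicator E x \<partial>?\<mu>) = indicator E x * (\<integral>\<^sup>+ y. indicator ?B (- x + y) \<partial>?\<mu>)"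
      by (subst nn_integral_cmult[symmetric])
         (auto intro!: nn_integral_cong simp: indicator_def norm_minus_commute)
    also have "(\<integral>\<^sup>+ y. indicator ?B (- x + y) \<partial>?\<mu>) = emeasure ?\<mu> ?B"
      by (subst sh) auto
    finally show "(\<integral>\<^sup>+ y. indicator ?B (x - y) * indicator E x \<partial>?\<mu>) = indicator E x * emeasure ?\<mu> ?B" .
  qed
  also have "\<dots> = emeasure lborel ?B * emeasure lborel E"
    by (simp add: nn_integral_multc B mult.commute)
  finally show "emeasure ?\<mu> E = emeasure lborel E"
    using unit_ball_vol_pos[OF of_nat_0_le_iff[of "DIM('a)"]]
    by (subst (asm) ennreal_mult_cancel_left) (auto simp: emeasure_ball emeasure_lborel_ball_finite ennreal_eq_0_iff not_le dest: sym)
qed simp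

text \<open>The normalised surface measure of the unit sphere, obtained by pushing the uniform
  distribution of the ball outwards along rays. The origin, where \<open>sgn\<close> is 0, is a null
  set.\<close>

definition sphere_measure :: "'a::euclidean_space measure" where
  "sphere_measure = distr (uniform_measure lborel (ball 0 1)) borel sgn"

text \<open>\<open>d * unit_ball_vol d\<close> is the area of the unit sphere in dimension
  \<open>d\<close>; it sits in the radial factor because \<open>sphere_measure\<close> has total
  mass 1.\<close>

definition radial_measure :: "nat \<Rightarrow> real measure" where
  "radial_measure d = density lborel (\<lambda>s. ennreal (d * unit_ball_vol d * s ^ (d - 1)) * indicator {0<..} s)"

lemma sets_radial_measure [simp, measurable_cong]: "sets (radial_measure d) = sets borel"
  by (simp add: radial_measure_def)

lemma space_radial_measure [simp]: "space (radial_measure d) = UNIV"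
  by (simp add: radial_measure_def)

lemma sets_sphere_measure [simp, measurable_cong]: "sets (sphere_measure :: 'a::euclidean_space measure) = sets borel"
  by (simp add: sphere_measure_def)

lemma space_sphere_measure [simp]: "space (sphere_measure :: 'a::euclidean_space measure) = UNIV"
  by (simp add: sphere_measure_def)

lemma measurable_sgn_euclidean [measurable]: "(sgn :: 'a::euclidean_space \<Rightarrow> 'a) \<in> borel_measurable borel"
  by (simp add: sgn_div_norm[abs_def])

lemma emeasure_lborel_unit_ball: "emeasure lborel (ball (0::'a::euclidean_space) 1) = ennreal (unit_ball_vol DIM('a))"
  by (simp add: emeasure_ball)

lemma measurable_sgn_uniform [measurable]:
  "sgn \<in> uniform_measure lborel (ball (0::'a::euclidean_space) 1) \<rightarrow>\<^sub>M (borel :: 'a measure)"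
  using measurable_sgn_euclidean by (simp cong: measurable_cong_sets)

lemma prob_space_sphere_measure: "prob_space (sphere_measure :: 'a::euclidean_space measure)"
  unfolding sphere_measure_def
  by (intro prob_space.prob_space_distr prob_space_uniform_measure)
     (auto simp: emeasure_ball ennreal_eq_0_iff not_le)

lemma emeasure_sphere_measure:
  assumes [measurable]: "B \<in> sets borel"
  shows "emeasure lborel {x::'a::euclidean_space. norm x < 1 \<and> sgn x \<in> B} = unit_ball_vol DIM('a) * emeasure sphere_measure B"
proof -
  have "emeasure sphere_measure B = emeasure lborel (ball 0 1 \<inter> (sgn -` B)) / emeasure lborel (ball (0::'a) 1)"
    unfolding sphere_measure_def
    by (subst emeasure_distr) (auto intro!: emeasure_uniform_measure measurable_sets_borel[OF measurable_sgn_euclidean])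
  also have "ball 0 1 \<inter> (sgn -` B) = {x::'a. norm x < 1 \<and> sgn x \<in> B}" by auto
  finally have *: "emeasure sphere_measure B = emeasure lborel {x::'a. norm x < 1 \<and> sgn x \<in> B} / unit_ball_vol DIM('a)"
    by (simp add: emeasure_lborel_unit_ball)
  show ?thesis
    unfolding * ennreal_times_divide
    by (subst mult.commute, subst ennreal_mult_divide_eq) (auto simp: ennreal_eq_0_iff not_le)
qed

lemma emeasure_lborel_cone:
  assumes [measurable]: "B \<in> sets borel" and r: "0 < r"
  shows "emeasure lborel {x::'a::euclidean_space. norm x < r \<and> sgn x \<in> B} =
    ennreal (unit_ball_vol DIM('a) * r ^ DIM('a)) * emeasure sphere_measure B"
proof -
  let ?S = "\<lambda>r. {x::'a. norm x < r \<and> sgn x \<in> B}"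
  have *: "(\<lambda>x. r *\<^sub>R x) -` ?S r = ?S 1"
    using r by (auto simp: sgn_scaleR)
  have "emeasure lborel (?S r) = emeasure (density (distr lborel borel (\<lambda>x::'a. 0 + r *\<^sub>R x)) (\<lambda>_. \<bar>r\<bar>^DIM('a))) (?S r)"
    by (subst lborel_affine[of r 0]) (use r in auto)
  also have "\<dots> = ennreal (r ^ DIM('a)) * emeasure lborel ((\<lambda>x. r *\<^sub>R x) -` ?S r)"
    using r by (simp add: emeasure_density nn_integral_cmult emeasure_distr)
  finally show ?thesis
    unfolding * using r by (simp add: emeasure_sphere_measure ennreal_mult mult_ac)
qed

lemma emeasure_radial_measure_lessThan:
  assumes d: "0 < d"
  shows "emeasure (radial_measure d) {..<r} = (if r \<le> 0 then 0 else ennreal (unit_ball_vol d * r ^ d))"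
proof (cases "r \<le> 0")
  case True
  then show ?thesis
    by (auto simp: radial_measure_def emeasure_density indicator_def intro!: nn_integral_0_iff_AE[THEN iffD2])
next
  case False
  have "emeasure (radial_measure d) {..<r} = (\<integral>\<^sup>+ s. ennreal (d * unit_ball_vol d * s ^ (d - 1)) * indicator {0..r} s \<partial>lborel)"
  proof -
    have "AE s in lborel. s \<noteq> 0 \<and> s \<noteq> r" 
      using AE_lborel_singleton[of 0] AE_lborel_singleton[of r] by eventually_elim simp
    then have "AE s in lborel. ennreal (d * unit_ball_vol d * s ^ (d - 1)) * indicator {0<..} s * indicator {..<r} s =
        ennreal (d * unit_ball_vol d * s ^ (d - 1)) * indicator {0..r} s"
      by eventually_elim (auto simp: indicator_def)
    then show ?thesis
      by (simp add: radial_measure_def emeasure_density nn_integral_cong_AE)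
  qed
  also have "\<dots> = ennreal (unit_ball_vol d * r ^ d - unit_ball_vol d * 0 ^ d)"
    using False d by (intro nn_integral_FTC_Icc) (auto intro!: derivative_eq_intros)
  finally show ?thesis using False d by simp
qed

lemma sigma_finite_radial_measure:
  assumes d: "0 < d" shows "sigma_finite_measure (radial_measure d)"
proof
  show "\<exists>A. countable A \<and> A \<subseteq> sets (radial_measure d) \<and> \<Union>A = space (radial_measure d) \<and> (\<forall>a\<in>A. emeasure (radial_measure d) a \<noteq> \<infinity>)"
    by (intro exI[of _ "range (\<lambda>n::nat. {..<real n})"])
       (auto simp: emeasure_radial_measure_lessThan[OF d] intro: reals_Archimedean2)
qed

text \<open>A product measure is determined by rectangles \<open>A \<times> B\<close>. For a fixed
  set \<open>B\<close> of directions both sides are measures in the radial variable, and they agree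
  on the half-lines \<open>{..<r}\<close> because the cone over \<open>B\<close> of radius
  \<open>r\<close> is a dilate of the one of radius 1.\<close>

theorem polar_coordinates:
  "distr lborel (borel \<Otimes>\<^sub>M borel) (\<lambda>x::'a::euclidean_space. (norm x, sgn x)) =
    radial_measure DIM('a) \<Otimes>\<^sub>M sphere_measure"
proof (rule pair_measure_eqI[symmetric])
  interpret S: prob_space "sphere_measure :: 'a measure" by (rule prob_space_sphere_measure)
  show "sigma_finite_measure (sphere_measure :: 'a measure)" ..
  show "sigma_finite_measure (radial_measure DIM('a))" by (intro sigma_finite_radial_measure) simp
  show "sets (radial_measure DIM('a) \<Otimes>\<^sub>M (sphere_measure :: 'a measure)) = sets (distr lborel (borel \<Otimes>\<^sub>M borel) (\<lambda>x::'a. (norm x, sgn x)))"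
    by (simp cong: sets_pair_measure_cong)
  fix A B assume "A \<in> sets (radial_measure DIM('a))" "B \<in> sets (sphere_measure :: 'a measure)"
  then have [measurable]: "A \<in> sets borel" "B \<in> sets borel" by auto
  let ?N1 = "distr (density lborel (\<lambda>x::'a. indicator B (sgn x))) borel norm"
  let ?N2 = "scale_measure (emeasure sphere_measure B) (radial_measure DIM('a))"
  have N1: "emeasure ?N1 C = emeasure lborel {x::'a. norm x \<in> C \<and> sgn x \<in> B}" if [measurable]: "C \<in> sets borel" for C
    by (subst emeasure_distr, simp, simp, subst emeasure_density)
       (auto intro!: measurable_sets_borel[OF borel_measurable_norm] simp: nn_integral_indicator[symmetric] simp del: nn_integral_indicator intro!: nn_integral_cong simp: indicator_def)
  have fin: "emeasure sphere_measure B \<noteq> \<infinity>" by simp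
  have eq: "emeasure ?N1 {..<r} = emeasure ?N2 {..<r}" for r
  proof (cases "r \<le> 0")
    case True
    have "\<not> norm x < r" for x :: 'a using True norm_ge_zero[of x] by linarith
    then show ?thesis using True by (simp add: N1 emeasure_radial_measure_lessThan)
  next
    case False
    then show ?thesis
      using emeasure_lborel_cone[of B r] by (simp add: N1 emeasure_radial_measure_lessThan mult.commute)
  qed
  have "?N1 = ?N2"
  proof (rule measure_eqI_generator_eq[where E="range lessThan" and \<Omega>=UNIV and A="\<lambda>n::nat. {..<real n}"])
    show "Int_stable (range (lessThan :: real \<Rightarrow> _))" 
      unfolding Int_stable_def by (metis (no_types, lifting) greaterThan_Int_greaterThan rangeE rangeI)
    show "sets ?N1 = sigma_sets UNIV (range lessThan)" by (simp add: borel_Iio)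
    show "sets ?N2 = sigma_sets UNIV (range lessThan)" by (simp add: borel_Iio)
    show "emeasure ?N1 {..<real i} \<noteq> \<infinity>" for i
      unfolding eq using fin by (simp add: emeasure_radial_measure_lessThan ennreal_mult_eq_top_iff)
    show "(\<Union>i. {..<real i}) = UNIV" by (auto intro: reals_Archimedean2)
  qed (auto simp: eq)
  then have "emeasure ?N1 A = emeasure ?N2 A" by simp
  then show "emeasure (radial_measure DIM('a)) A * emeasure sphere_measure B = emeasure (distr lborel (borel \<Otimes>\<^sub>M borel) (\<lambda>x::'a. (norm x, sgn x))) (A \<times> B)"
    by (subst emeasure_distr) (auto simp: N1 mult.commute vimage_def)
qed

section \<open>Asymptotics of solutions of Bessel-type equations\<close>

text \<open>Beyond \<open>x\<close> the function oscillates by at most \<open>B / x\<close>, so its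
  values along the integers form a Cauchy sequence, and the limit inherits the rate.\<close>

lemma limit_of_inverse_modulus:
  fixes p :: "real \<Rightarrow> real"
  assumes p: "\<And>x y. 1 \<le> x \<Longrightarrow> x \<le> y \<Longrightarrow> \<bar>p y - p x\<bar> \<le> B / x - B / y" and B: "0 \<le> B"
  shows "\<exists>L. \<forall>x\<ge>1. \<bar>p x - L\<bar> \<le> B / x"
proof -
  have bd: "\<bar>p y - p x\<bar> \<le> B / x" if "1 \<le> x" "x \<le> y" for x y
    using p[OF that] B that by (smt (verit) divide_nonneg_nonneg)
  have "Cauchy (\<lambda>n. p (real (Suc n)))"
  proof (rule metric_CauchyI)
    fix e :: real assume e: "0 < e"
    obtain N :: nat where N: "2 * B / e < real N" using reals_Archimedean2 by blast
    have "dist (p (real (Suc m))) (p (real (Suc n))) < e" if "m \<ge> N" "n \<ge> N" for m n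
    proof -
      have *: "\<bar>p (real (Suc k)) - p (real (Suc N))\<bar> \<le> B / real (Suc N)" if "k \<ge> N" for k
        by (rule bd) (use that in auto)
      have "2 * (B / real (Suc N)) < e"
        using N e by (simp add: field_simps)
      then show ?thesis using *[OF that(1)] *[OF that(2)] unfolding dist_real_def by linarith
    qed
    then show "\<exists>M. \<forall>m\<ge>M. \<forall>n\<ge>M. dist (p (real (Suc m))) (p (real (Suc n))) < e" by blast
  qed
  then obtain L where L: "(\<lambda>n. p (real (Suc n))) \<longlonglongrightarrow> L"
    using Cauchy_convergent_iff convergent_def by blast
  have "\<bar>p x - L\<bar> \<le> B / x" if "1 \<le> x" for x
  proof (rule LIMSEQ_le_const2)
    show "(\<lambda>n. \<bar>p x - p (real (Suc n))\<bar>) \<longlonglongrightarrow> \<bar>p x - L\<bar>" by (intro tendsto_intros L)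
    obtain N :: nat where N: "x \<le> real N" using real_arch_simple by blast
    show "\<exists>N. \<forall>n\<ge>N. \<bar>p x - p (real (Suc n))\<bar> \<le> B / x"
    proof (intro exI[of _ N] allI impI)
      fix n assume "N \<le> n"
      then have "x \<le> real (Suc n)" using N by simp
      from bd[OF that this] show "\<bar>p x - p (real (Suc n))\<bar> \<le> B / x" by simp
    qed
  qed
  then show ?thesis by blast
qed

text \<open>\<open>p + B / x\<close> is nonincreasing and \<open>p - B / x\<close> nondecreasing;
  comparing endpoints takes the place of integrating \<open>p'\<close>.\<close>

lemma bounded_by_inverse_square_derivative:
  fixes p p' :: "real \<Rightarrow> real"
  assumes p: "\<And>x. 1 \<le> x \<Longrightarrow> (p has_real_derivative p' x) (at x)" and p': "\<And>x. 1 \<le> x \<Longrightarrow> \<bar>p' x\<bar> \<le> B / x\<^sup>2"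
    and xy: "1 \<le> x" "x \<le> y"
  shows "\<bar>p y - p x\<bar> \<le> B / x - B / y"
proof -
  have "p y + B / y \<le> p x + B / x"
  proof (rule DERIV_nonpos_imp_nonincreasing[OF xy(2)])
    fix z assume z: "x \<le> z" "z \<le> y"
    have "((\<lambda>x. p x + B / x) has_real_derivative (p' z - B / z\<^sup>2)) (at z)"
      using z xy by (auto intro!: derivative_eq_intros p simp: power2_eq_square)
    moreover have "p' z - B / z\<^sup>2 \<le> 0" using p'[of z] z xy by linarith
    ultimately show "\<exists>D. ((\<lambda>x. p x + B / x) has_real_derivative D) (at z) \<and> D \<le> 0" by blast
  qed
  moreover have "p x - B / x \<le> p y - B / y"
  proof (rule DERIV_nonneg_imp_nondecreasing[OF xy(2)])
    fix z assume z: "x \<le> z" "z \<le> y"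
    have "((\<lambda>x. p x - B / x) has_real_derivative (p' z + B / z\<^sup>2)) (at z)"
      using z xy by (auto intro!: derivative_eq_intros p simp: power2_eq_square)
    moreover have "p' z + B / z\<^sup>2 \<ge> 0" using p'[of z] z xy by linarith
    ultimately show "\<exists>D. ((\<lambda>x. p x - B / x) has_real_derivative D) (at z) \<and> 0 \<le> D" by blast
  qed
  ultimately show ?thesis by linarith
qed

text \<open>The substitution \<open>u = r powr (m / 2) * K\<close> removes the first-order term and
  leaves u'' = (c/r^2 - 1) u, an integrable perturbation of the harmonic oscillator. Its energy
  \<open>E\<close> satisfies |E'| \<le> |c| E / r^2, so that
  \<open>E * exp (\<bar>c\<bar> / r)\<close> decreases and
  \<open>E * exp (- \<bar>c\<bar> / r)\<close> increases: the solution stays bounded and cannot die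
  out. Undoing the rotation of the oscillator leaves coordinates with derivative O(1/r^2), whose
  limits make up \<open>a\<close>.\<close>

theorem bessel_asymptotics:
  fixes K K1 K2 :: "real \<Rightarrow> real"
  assumes K: "\<And>r. (K has_real_derivative K1 r) (at r)" and K1: "\<And>r. (K1 has_real_derivative K2 r) (at r)"
    and ode: "\<And>r. 0 < r \<Longrightarrow> K2 r + m / r * K1 r + K r = 0" and K0: "K 0 \<noteq> 0"
  shows "\<exists>a C. a \<noteq> 0 \<and> 0 \<le> C \<and> (\<forall>r\<ge>1. \<bar>r powr (m / 2) * K r - 2 * Re (a * cis r)\<bar> \<le> C / r)"
proof -
  define u where "u r = r powr (m / 2) * K r" for r
  define v where "v r = r powr (m / 2) * (K1 r + m / (2 * r) * K r)" for r
  define c where "c = m\<^sup>2 / 4 - m / 2"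
  have du: "(u has_real_derivative v r) (at r)" if r: "0 < r" for r
  proof -
    have "((\<lambda>r. r powr (m / 2)) has_real_derivative (m / 2 * r powr (m / 2 - 1))) (at r)"
      using r by (auto intro!: derivative_eq_intros simp: powr_diff)
    note D = DERIV_mult[OF this K[of r]]
    have eq: "v r = m / 2 * r powr (m / 2 - 1) * K r + K1 r * r powr (m / 2)"
    proof -
      have pw: "r powr (m / 2 - 1) = r powr (m / 2) / r" using r by (simp add: powr_diff)
      show ?thesis unfolding v_def pw using r by (simp add: field_simps)
    qed
    show ?thesis unfolding eq u_def[abs_def] by (rule D)
  qed
  have dv: "(v has_real_derivative (c / r\<^sup>2 - 1) * u r) (at r)" if r: "0 < r" for r
  proof -
    have 1: "((\<lambda>r. r powr (m / 2)) has_real_derivative (m / 2 * r powr (m / 2 - 1))) (at r)"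
      using r by (auto intro!: derivative_eq_intros simp: powr_diff)
    have 2: "((\<lambda>r. K1 r + m / (2 * r) * K r) has_real_derivative (K2 r + (m / (2 * r) * K1 r - m / (2 * r\<^sup>2) * K r))) (at r)"
      using r by (auto intro!: derivative_eq_intros K K1 simp: power2_eq_square field_simps)
    have K2: "K2 r = - (m / r * K1 r) - K r" using ode[OF r] by linarith
    have pw: "r powr (m / 2 - 1) = r powr (m / 2) / r" using r by (simp add: powr_diff)
    have eq: "(K2 r + (m / (2 * r) * K1 r - m / (2 * r\<^sup>2) * K r)) * r powr (m / 2) + m / 2 * r powr (m / 2 - 1) * (K1 r + m / (2 * r) * K r)
        = (c / r\<^sup>2 - 1) * u r"
      unfolding K2 u_def c_def pw using r by (simp add: field_simps power2_eq_square)
    show ?thesis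
      unfolding v_def[abs_def] eq[symmetric] using DERIV_mult[OF 1 2] by (simp add: add.commute)
  qed
  define E where "E r = (u r)\<^sup>2 + (v r)\<^sup>2" for r
  have dE: "(E has_real_derivative 2 * c * u r * v r / r\<^sup>2) (at r)" if r: "0 < r" for r
    unfolding E_def[abs_def] using r
    by (auto intro!: derivative_eq_intros du dv simp: field_simps power2_eq_square)
  have E0: "0 \<le> E r" for r by (simp add: E_def)
  have cuv: "\<bar>2 * c * u r * v r\<bar> \<le> \<bar>c\<bar> * E r" for r
  proof -
    have "2 * \<bar>u r * v r\<bar> \<le> E r"
      using sum_squares_bound[of "\<bar>u r\<bar>" "\<bar>v r\<bar>"] by (simp add: E_def abs_mult)
    from mult_left_mono[OF this, of "\<bar>c\<bar>"] show ?thesis by (simp add: abs_mult mult_ac)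
  qed
  have up: "E y * exp (\<bar>c\<bar> / y) \<le> E x * exp (\<bar>c\<bar> / x)" if xy: "0 < x" "x \<le> y" for x y
  proof (rule DERIV_nonpos_imp_nonincreasing[OF xy(2)])
    fix z assume z: "x \<le> z" "z \<le> y"
    have "((\<lambda>x. E x * exp (\<bar>c\<bar> / x)) has_real_derivative ((2 * c * u z * v z - \<bar>c\<bar> * E z) / z\<^sup>2 * exp (\<bar>c\<bar> / z))) (at z)"
      using z xy by (auto intro!: derivative_eq_intros dE simp: power2_eq_square field_simps)
    moreover have "(2 * c * u z * v z - \<bar>c\<bar> * E z) / z\<^sup>2 * exp (\<bar>c\<bar> / z) \<le> 0"
      using cuv[of z] by (intro mult_nonpos_nonneg divide_nonpos_nonneg) auto
    ultimately show "\<exists>D. ((\<lambda>x. E x * exp (\<bar>c\<bar> / x)) has_real_derivative D) (at z) \<and> D \<le> 0" by blast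
  qed
  have lo: "E x * exp (- \<bar>c\<bar> / x) \<le> E y * exp (- \<bar>c\<bar> / y)" if xy: "0 < x" "x \<le> y" for x y
  proof (rule DERIV_nonneg_imp_nondecreasing[OF xy(2)])
    fix z assume z: "x \<le> z" "z \<le> y"
    have "((\<lambda>x. E x * exp (- \<bar>c\<bar> / x)) has_real_derivative ((2 * c * u z * v z + \<bar>c\<bar> * E z) / z\<^sup>2 * exp (- \<bar>c\<bar> / z))) (at z)"
      using z xy by (auto intro!: derivative_eq_intros dE simp: power2_eq_square field_simps)
    moreover have "(2 * c * u z * v z + \<bar>c\<bar> * E z) / z\<^sup>2 * exp (- \<bar>c\<bar> / z) \<ge> 0"
      using cuv[of z] by (intro mult_nonneg_nonneg divide_nonneg_nonneg) auto
    ultimately show "\<exists>D. ((\<lambda>x. E x * exp (- \<bar>c\<bar> / x)) has_real_derivative D) (at z) \<and> 0 \<le> D" by blast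
  qed
  \<comment> \<open>Zero energy at 1 would propagate inwards through \<open>lo\<close>, so
    \<open>K\<close> would vanish on (0, 1], against continuity at 0 and
    \<open>K 0 \<noteq> 0\<close>.\<close>
  have E1: "0 < E 1"
  proof (rule ccontr)
    assume "\<not> 0 < E 1"
    then have E10: "E 1 = 0" using E0[of 1] by linarith
    have "K x = 0" if x: "0 < x" "x \<le> 1" for x
    proof -
      have "E x * exp (- \<bar>c\<bar> / x) \<le> 0" using lo[OF x] E10 by simp
      then have "E x \<le> 0" by (simp add: mult_le_0_iff)
      then have "u x = 0" using E0[of x] by (simp add: E_def sum_power2_le_zero_iff)
      then show ?thesis using x by (simp add: u_def)
    qed
    then have "eventually (\<lambda>x. K x = 0) (at_right 0)"
      by (auto simp: eventually_at_right_field intro!: exI[of _ 1])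
    then have "(K \<longlongrightarrow> 0) (at_right 0)" by (simp add: tendsto_eventually)
    moreover have "(K \<longlongrightarrow> K 0) (at_right 0)"
      using DERIV_isCont[OF K[of 0]] by (auto simp: isCont_def intro: tendsto_within_subset)
    ultimately show False using K0 tendsto_unique[of "at_right (0::real)"] by auto
  qed
  define B0 where "B0 = sqrt (E 1 * exp \<bar>c\<bar>)"
  have Eub: "E r \<le> E 1 * exp \<bar>c\<bar>" if "1 \<le> r" for r
  proof -
    have "E r * 1 \<le> E r * exp (\<bar>c\<bar> / r)" using that E0 by (intro mult_left_mono) auto
    also have "\<dots> \<le> E 1 * exp \<bar>c\<bar>" using up[of 1 r] that by simp
    finally show ?thesis by simp
  qed
  have ub: "\<bar>u r\<bar> \<le> B0" if "1 \<le> r" for r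
    unfolding B0_def using Eub[OF that] by (intro real_le_rsqrt) (simp add: E_def, smt (verit) zero_le_power2)
  have Elb: "E 1 * exp (- \<bar>c\<bar>) \<le> E r" if "1 \<le> r" for r
  proof -
    have "E 1 * exp (- \<bar>c\<bar>) \<le> E r * exp (- \<bar>c\<bar> / r)" using lo[of 1 r] that by simp
    also have "\<dots> \<le> E r * 1" using that E0 by (intro mult_left_mono) auto
    finally show ?thesis by simp
  qed
  define B where "B = \<bar>c\<bar> * B0 / 2"
  have B: "0 \<le> B" unfolding B_def B0_def by (intro divide_nonneg_nonneg mult_nonneg_nonneg) (auto simp: E0)
  \<comment> \<open>\<open>p + \<i> q\<close> is \<open>(u - \<i> v) * cis (- r) / 2\<close>. The
    factor \<open>cis (- r)\<close> cancels the free rotation, and only the perturbation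
    \<open>c / r\<^sup>2\<close> survives in the derivatives.\<close>
  define p where "p r = (u r * cos r - v r * sin r) / 2" for r
  define q where "q r = - (u r * sin r + v r * cos r) / 2" for r
  have dp: "(p has_real_derivative - sin r * c * u r / (2 * r\<^sup>2)) (at r)" if "1 \<le> r" for r
    unfolding p_def[abs_def] using that
    by (auto intro!: derivative_eq_intros du dv simp: field_simps)
  have dq: "(q has_real_derivative - cos r * c * u r / (2 * r\<^sup>2)) (at r)" if "1 \<le> r" for r
    unfolding q_def[abs_def] using that
    by (auto intro!: derivative_eq_intros du dv simp: field_simps)
  have key: "\<bar>- z * c * u r / (2 * r\<^sup>2)\<bar> \<le> B / r\<^sup>2" if "1 \<le> r" "\<bar>z\<bar> \<le> 1" for z r
  proof -
    have "\<bar>z\<bar> * \<bar>c\<bar> * \<bar>u r\<bar> \<le> 1 * \<bar>c\<bar> * B0" using ub[OF that(1)] that by (intro mult_mono) auto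
    then show ?thesis by (simp add: abs_mult B_def divide_right_mono field_simps)
  qed
  obtain Lp where Lp: "\<And>x. 1 \<le> x \<Longrightarrow> \<bar>p x - Lp\<bar> \<le> B / x"
    using limit_of_inverse_modulus[OF bounded_by_inverse_square_derivative[OF dp key[OF _ abs_sin_le_one]] B] by blast
  obtain Lq where Lq: "\<And>x. 1 \<le> x \<Longrightarrow> \<bar>q x - Lq\<bar> \<le> B / x"
    using limit_of_inverse_modulus[OF bounded_by_inverse_square_derivative[OF dq key[OF _ abs_cos_le_one]] B] by blast
  define a where "a = Complex Lp Lq"
  have p2: "2 * p r = u r * cos r - v r * sin r" and q2: "2 * q r = - (u r * sin r + v r * cos r)" for r
    by (simp_all add: p_def q_def)
  have u_eq: "u r = 2 * (p r * cos r - q r * sin r)" for r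
  proof -
    have "2 * (p r * cos r - q r * sin r) = (2 * p r) * cos r - (2 * q r) * sin r" by (simp add: algebra_simps)
    also have "\<dots> = u r * ((sin r)\<^sup>2 + (cos r)\<^sup>2)"
      unfolding p2 q2 by algebra
    finally have "2 * (p r * cos r - q r * sin r) = u r * ((sin r)\<^sup>2 + (cos r)\<^sup>2)" .
    then show ?thesis by simp
  qed
  have E_eq: "E r = 4 * ((p r)\<^sup>2 + (q r)\<^sup>2)" for r
  proof -
    have "4 * ((p r)\<^sup>2 + (q r)\<^sup>2) = (2 * p r)\<^sup>2 + (2 * q r)\<^sup>2" by simp
    also have "\<dots> = E r * ((sin r)\<^sup>2 + (cos r)\<^sup>2)"
      unfolding p2 q2 E_def by algebra
    finally have "4 * ((p r)\<^sup>2 + (q r)\<^sup>2) = E r * ((sin r)\<^sup>2 + (cos r)\<^sup>2)" .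
    then show ?thesis by simp
  qed
  \<comment> \<open>If both limits were 0, then \<open>p\<close> and \<open>q\<close> would be
    O(1/x), and the energy, which is \<open>4 * (p\<^sup>2 + q\<^sup>2)\<close>, would tend to 0
    against the lower bound \<open>Elb\<close>.\<close>
  have "a \<noteq> 0"
  proof
    assume "a = 0"
    then have "Lp = 0" "Lq = 0" by (simp_all add: a_def complex_eq_iff)
    then have pq: "\<bar>p x\<bar> \<le> B / x" "\<bar>q x\<bar> \<le> B / x" if "1 \<le> x" for x using Lp[OF that] Lq[OF that] by auto
    have le: "E 1 * exp (- \<bar>c\<bar>) \<le> 8 * (B / x)\<^sup>2" if "1 \<le> x" for x
    proof -
      have "(p x)\<^sup>2 \<le> (B / x)\<^sup>2" "(q x)\<^sup>2 \<le> (B / x)\<^sup>2" using pq[OF that] by (auto intro!: power2_le_iff_abs_le[THEN iffD2] order_trans[OF abs_ge_zero])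
      from mult_left_mono[OF add_mono[OF this], of 4]
      have "4 * ((p x)\<^sup>2 + (q x)\<^sup>2) \<le> 4 * ((B / x)\<^sup>2 + (B / x)\<^sup>2)" by simp
      also have "\<dots> = 8 * (B / x)\<^sup>2" by simp
      finally have "4 * ((p x)\<^sup>2 + (q x)\<^sup>2) \<le> 8 * (B / x)\<^sup>2" .
      then show ?thesis using Elb[OF that] unfolding E_eq[of x] by (rule order_trans[rotated])
    qed
    have "((\<lambda>x. 8 * (B / x)\<^sup>2) \<longlongrightarrow> 8 * 0\<^sup>2) at_top"
      by (intro tendsto_intros tendsto_divide_0[OF tendsto_const] filterlim_at_top_imp_at_infinity filterlim_ident)
    then have "E 1 * exp (- \<bar>c\<bar>) \<le> 8 * 0\<^sup>2"
      by (rule tendsto_lowerbound) (auto intro!: eventually_at_top_linorderI[of 1] le)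
    then show False using E1 by (simp add: mult_le_0_iff)
  qed
  moreover have "\<bar>r powr (m / 2) * K r - 2 * Re (a * cis r)\<bar> \<le> (4 * B) / r" if r: "1 \<le> r" for r
  proof -
    have "r powr (m / 2) * K r - 2 * Re (a * cis r) = 2 * ((p r - Lp) * cos r - (q r - Lq) * sin r)"
      using u_eq[of r] by (simp add: a_def u_def algebra_simps)
    also have "\<bar>\<dots>\<bar> \<le> 2 * (\<bar>p r - Lp\<bar> * \<bar>cos r\<bar> + \<bar>q r - Lq\<bar> * \<bar>sin r\<bar>)"
      using abs_triangle_ineq4[of "(p r - Lp) * cos r" "(q r - Lq) * sin r"]
      by (simp add: abs_mult del: distrib_left_numeral right_diff_distrib_numeral)
    also have "\<dots> \<le> 2 * (B / r * 1 + B / r * 1)"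
      using Lp[OF r] Lq[OF r] by (intro mult_left_mono add_mono mult_mono) auto
    finally show ?thesis by simp
  qed
  ultimately show ?thesis using B by (intro exI[of _ a] exI[of _ "4 * B"]) auto
qed

section \<open>The Fourier transform of the sphere\<close>

lemma uniform_ball_orthogonal:
  fixes f :: "'a::euclidean_space \<Rightarrow> 'a"
  assumes f: "orthogonal_transformation f"
  shows "distr (uniform_measure lborel (ball 0 1)) borel f = uniform_measure lborel (ball 0 1)"
proof (rule measure_eqI)
  have lin: "linear f" using f by (rule orthogonal_transformation_linear)
  have [measurable]: "f \<in> borel_measurable borel"
    using lin by (intro borel_measurable_continuous_onI linear_continuous_on) (simp add: linear_conv_bounded_linear)
  have f': "f \<in> uniform_measure lborel (ball 0 1) \<rightarrow>\<^sub>M borel" by (simp cong: measurable_cong_sets)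
  fix A assume "A \<in> sets (distr (uniform_measure lborel (ball 0 1)) borel f)"
  then have [measurable]: "A \<in> sets borel" by simp
  have "ball 0 1 \<inter> f -` A = f -` (ball 0 1 \<inter> A)"
    using orthogonal_transformation_norm[OF f] by auto
  then have "emeasure lborel (ball 0 1 \<inter> f -` A) = emeasure (distr lborel borel f) (ball 0 1 \<inter> A)"
    by (subst emeasure_distr) auto
  also have "\<dots> = emeasure lborel (ball 0 1 \<inter> A)" by (simp add: lborel_distr_orthogonal[OF f])
  finally have eq: "emeasure lborel (ball 0 1 \<inter> f -` A) = emeasure lborel (ball 0 1 \<inter> A)" .
  have "f -` A \<in> sets borel" by (rule measurable_sets_borel[of f borel]) auto
  with eq show "emeasure (distr (uniform_measure lborel (ball 0 1)) borel f) A = emeasure (uniform_measure lborel (ball 0 1)) A"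
    using f' by (simp add: emeasure_distr)
qed simp

lemma sphere_measure_orthogonal:
  fixes f :: "'a::euclidean_space \<Rightarrow> 'a"
  assumes f: "orthogonal_transformation f"
  shows "distr sphere_measure borel f = sphere_measure"
proof -
  have lin: "linear f" using f by (rule orthogonal_transformation_linear)
  have [measurable]: "f \<in> borel_measurable borel"
    using lin by (intro borel_measurable_continuous_onI linear_continuous_on) (simp add: linear_conv_bounded_linear)
  have f': "f \<in> uniform_measure lborel (ball 0 1) \<rightarrow>\<^sub>M borel" by (simp cong: measurable_cong_sets)
  have comm: "f \<circ> sgn = sgn \<circ> f"
    by (auto simp: sgn_div_norm orthogonal_transformation_norm[OF f] linear_cmul[OF lin])
  have "distr sphere_measure borel f = distr (uniform_measure lborel (ball 0 1)) borel (f \<circ> sgn)"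
    unfolding sphere_measure_def by (subst distr_distr) auto
  also have "\<dots> = distr (distr (uniform_measure lborel (ball 0 1)) borel f) borel sgn"
    unfolding comm using f' by (subst distr_distr) auto
  finally show ?thesis
    by (simp add: uniform_ball_orthogonal[OF f] sphere_measure_def)
qed

lemma AE_sphere_measure_norm: "AE \<omega> in (sphere_measure :: 'a::euclidean_space measure). norm \<omega> = 1"
proof -
  have "AE x in uniform_measure lborel (ball (0::'a) 1). norm (sgn x) = 1"
  proof (rule AE_uniform_measureI)
    have "AE x in lborel. x \<noteq> (0::'a)" by (rule AE_lborel_singleton)
    then show "AE x in lborel. x \<in> ball (0::'a) 1 \<longrightarrow> norm (sgn x) = 1"
      by eventually_elim (simp add: norm_sgn)
  qed simp
  then show ?thesis
    unfolding sphere_measure_def by (subst AE_distr_iff) auto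
qed

lemma integrable_sphere_measure_bounded:
  fixes f :: "'a::euclidean_space \<Rightarrow> 'b::{banach, second_countable_topology}"
  assumes "f \<in> borel_measurable borel" "\<And>\<omega>. norm \<omega> = 1 \<Longrightarrow> norm (f \<omega>) \<le> B"
  shows "integrable sphere_measure f"
proof -
  interpret prob_space "sphere_measure :: 'a measure" by (rule prob_space_sphere_measure)
  show ?thesis
    using AE_sphere_measure_norm assms
    by (intro integrable_const_bound[where B=B]) (auto simp: measurable_cong_sets[OF sets_sphere_measure refl] elim!: eventually_mono)
qed

text \<open>The full Fourier transform of the sphere: the sine part is odd under the reflection
  \<omega> to -\<omega> and integrates to 0, as \<open>sphere_measure_exp\<close> makes
  explicit.\<close>

definition sphere_hat :: "'a::euclidean_space \<Rightarrow> real" where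
  "sphere_hat x = (LINT \<omega>|sphere_measure. cos (x \<bullet> \<omega>))"

lemma sphere_hat_0 [simp]: "sphere_hat 0 = 1"
  using prob_space.prob_space[OF prob_space_sphere_measure] by (simp add: sphere_hat_def)

lemma abs_sphere_hat_le: "\<bar>sphere_hat x\<bar> \<le> 1"
proof -
  interpret prob_space "sphere_measure :: 'a measure" by (rule prob_space_sphere_measure)
  have "\<bar>sphere_hat x\<bar> \<le> (LINT \<omega>|sphere_measure. \<bar>cos (x \<bullet> \<omega>)\<bar>)"
    unfolding sphere_hat_def by (rule integral_abs_bound)
  also have "\<dots> \<le> (LINT \<omega>|(sphere_measure :: 'a measure). 1)"
    by (intro integral_mono integrable_sphere_measure_bounded[where B=1]) auto
  finally show ?thesis using prob_space by simp
qed

lemma sphere_hat_orthogonal: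
  fixes f :: "'a::euclidean_space \<Rightarrow> 'a"
  assumes f: "orthogonal_transformation f"
  shows "sphere_hat (f x) = sphere_hat x"
proof -
  have lin: "linear f" using f by (rule orthogonal_transformation_linear)
  have [measurable]: "f \<in> borel_measurable borel"
    using lin by (intro borel_measurable_continuous_onI linear_continuous_on) (simp add: linear_conv_bounded_linear)
  have "sphere_hat (f x) = (LINT \<omega>|distr sphere_measure borel f. cos (f x \<bullet> \<omega>))"
    by (simp add: sphere_hat_def sphere_measure_orthogonal[OF f])
  also have "\<dots> = (LINT \<omega>|sphere_measure. cos (f x \<bullet> f \<omega>))"
    by (subst integral_distr) (auto simp: measurable_cong_sets[OF sets_sphere_measure refl])
  finally show ?thesis using f by (simp add: sphere_hat_def orthogonal_transformation_def)
qed

lemma sphere_hat_radial: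
  fixes x y :: "real ^ 'd::finite"
  assumes "norm x = norm y" shows "sphere_hat x = sphere_hat y"
proof -
  obtain f where "orthogonal_transformation f" "f x = y"
    using orthogonal_transformation_exists[OF assms] by blast
  then show ?thesis using sphere_hat_orthogonal[of f x] by simp
qed

lemma sphere_measure_exp:
  fixes x :: "'a::euclidean_space"
  shows "(LINT \<omega>|sphere_measure. exp (\<i> * complex_of_real (x \<bullet> \<omega>))) = complex_of_real (sphere_hat x)"
proof -
  have odd: "(LINT \<omega>|sphere_measure. sin (x \<bullet> \<omega>)) = 0"
  proof -
    have ot: "orthogonal_transformation (uminus :: 'a \<Rightarrow> 'a)"
      by (auto simp: orthogonal_transformation_def linear_uminus)
    have "(LINT \<omega>|sphere_measure. sin (x \<bullet> \<omega>)) = (LINT \<omega>|distr sphere_measure borel (uminus :: 'a \<Rightarrow> 'a). sin (x \<bullet> \<omega>))"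
      by (simp add: sphere_measure_orthogonal[OF ot])
    also have "\<dots> = (LINT \<omega>|sphere_measure. sin (x \<bullet> (- \<omega>)))"
      by (subst integral_distr) (auto simp: measurable_cong_sets[OF sets_sphere_measure refl])
    finally show ?thesis by simp
  qed
  have "(LINT \<omega>|sphere_measure. exp (\<i> * complex_of_real (x \<bullet> \<omega>))) =
      (LINT \<omega>|sphere_measure. complex_of_real (cos (x \<bullet> \<omega>)) + \<i> * complex_of_real (sin (x \<bullet> \<omega>)))"
    by (intro Bochner_Integration.integral_cong refl) (simp add: exp_Euler cos_of_real sin_of_real)
  also have "\<dots> = complex_of_real (sphere_hat x) + \<i> * complex_of_real (LINT \<omega>|sphere_measure. sin (x \<bullet> \<omega>))"
    unfolding sphere_hat_def
    by (subst Bochner_Integration.integral_add)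
       (auto intro!: integrable_of_real integrable_mult_right integrable_sphere_measure_bounded[where B=1])
  finally show ?thesis using odd by simp
qed

lemma measurable_sphere_hat [measurable]: "sphere_hat \<in> borel_measurable borel"
proof -
  interpret prob_space "sphere_measure :: 'a measure" by (rule prob_space_sphere_measure)
  have "(\<lambda>(x, \<omega>::'a). cos (x \<bullet> \<omega>)) \<in> borel_measurable (borel \<Otimes>\<^sub>M sphere_measure)" 
    by (simp cong: measurable_cong_sets sets_pair_measure_cong)
  then show ?thesis
    unfolding sphere_hat_def[abs_def] by (intro borel_measurable_lebesgue_integral) 
qed

lemma nn_integral_radial:
  assumes [measurable]: "h \<in> borel_measurable borel"
  shows "(\<integral>\<^sup>+ x. h (norm (x::'a::euclidean_space)) \<partial>lborel) = (\<integral>\<^sup>+ s. h s \<partial>radial_measure DIM('a))"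
proof -
  interpret S: prob_space "sphere_measure :: 'a measure" by (rule prob_space_sphere_measure)
  have "(\<integral>\<^sup>+ x. h (norm (x::'a)) \<partial>lborel) = (\<integral>\<^sup>+ z. h (fst z) \<partial>distr lborel (borel \<Otimes>\<^sub>M borel) (\<lambda>x::'a. (norm x, sgn x)))"
    by (subst nn_integral_distr) auto
  also have "\<dots> = (\<integral>\<^sup>+ s. \<integral>\<^sup>+ \<omega>. h s \<partial>(sphere_measure :: 'a measure) \<partial>radial_measure DIM('a))"
    unfolding polar_coordinates by (subst S.nn_integral_fst[symmetric]) auto
  finally show ?thesis using S.emeasure_space_1 by simp
qed

lemma radial_exponential_integral:
  fixes F :: "real \<Rightarrow> complex" and x :: "'a::euclidean_space"
  assumes F: "integrable (radial_measure DIM('a)) F"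
  shows "(LINT \<xi>|lborel. F (norm \<xi>) * exp (\<i> * complex_of_real (x \<bullet> \<xi>))) =
    (LINT s|radial_measure DIM('a). F s * complex_of_real (sphere_hat (s *\<^sub>R x)))"
proof -
  interpret S: prob_space "sphere_measure :: 'a measure" by (rule prob_space_sphere_measure)
  interpret R: sigma_finite_measure "radial_measure DIM('a)" by (intro sigma_finite_radial_measure) simp
  interpret P: pair_sigma_finite "radial_measure DIM('a)" "sphere_measure :: 'a measure" ..
  have [measurable]: "F \<in> borel_measurable borel"
    using borel_measurable_integrable[OF F] by (simp cong: measurable_cong_sets)
  let ?g = "\<lambda>(s, \<omega>::'a). F s * exp (\<i> * complex_of_real (x \<bullet> (s *\<^sub>R \<omega>)))"
  have gm: "?g \<in> borel_measurable (borel \<Otimes>\<^sub>M borel)" by measurable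
  have "(LINT \<xi>|lborel. F (norm \<xi>) * exp (\<i> * complex_of_real (x \<bullet> \<xi>))) = (LINT \<xi>|lborel. ?g (norm \<xi>, sgn (\<xi>::'a)))"
  proof (intro Bochner_Integration.integral_cong refl)
    fix \<xi> :: 'a
    have "norm \<xi> *\<^sub>R sgn \<xi> = \<xi>" by (cases "\<xi> = 0") (simp_all add: sgn_div_norm)
    then show "F (norm \<xi>) * exp (\<i> * complex_of_real (x \<bullet> \<xi>)) = ?g (norm \<xi>, sgn \<xi>)"
      by (simp only: case_prod_conv)
  qed
  also have "\<dots> = (LINT z|distr lborel (borel \<Otimes>\<^sub>M borel) (\<lambda>\<xi>::'a. (norm \<xi>, sgn \<xi>)). ?g z)"
    using gm by (subst integral_distr) auto
  also have "\<dots> = (LINT z|(radial_measure DIM('a) \<Otimes>\<^sub>M sphere_measure). ?g z)" by (simp only: polar_coordinates)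
  also have "\<dots> = (LINT s|radial_measure DIM('a). LINT \<omega>|sphere_measure. ?g (s, \<omega>))"
  proof (rule P.integral_fst'[symmetric])
    have "integrable (radial_measure DIM('a) \<Otimes>\<^sub>M (sphere_measure :: 'a measure)) (\<lambda>z. F (fst z))"
      using P.Fubini_integrable[of "\<lambda>z. F (fst z)"] F S.prob_space by (simp add: integrable_norm)
    then show "integrable (radial_measure DIM('a) \<Otimes>\<^sub>M (sphere_measure :: 'a measure)) ?g"
      by (rule Bochner_Integration.integrable_bound)
         (use gm in \<open>auto simp: norm_mult cong: measurable_cong_sets sets_pair_measure_cong\<close>)
  qed
  also have "\<dots> = (LINT s|radial_measure DIM('a). F s * complex_of_real (sphere_hat (s *\<^sub>R x)))"
    using sphere_measure_exp[of "_ *\<^sub>R x"] by (simp add: inner_scaleR_left[symmetric] del: inner_scaleR_left)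
  finally show ?thesis .
qed

section \<open>Derivatives of the spherical Fourier transform along a ray\<close>

lemma has_real_derivative_quadratic_bound:
  fixes f :: "real \<Rightarrow> real"
  assumes f: "\<And>h. \<bar>f (x + h) - f x - h * D\<bar> \<le> C * h\<^sup>2"
  shows "(f has_real_derivative D) (at x)"
  unfolding DERIV_def
proof (rule Lim_null_comparison[THEN Lim_null[THEN iffD2]])
  show "\<forall>\<^sub>F h in at 0. norm ((f (x + h) - f x) / h - D) \<le> C * \<bar>h\<bar>"
  proof (rule eventually_at_filter[THEN iffD2], rule always_eventually, intro allI impI)
    fix h :: real assume "h \<noteq> 0"
    then have "norm ((f (x + h) - f x) / h - D) = \<bar>f (x + h) - f x - h * D\<bar> / \<bar>h\<bar>"
      by (simp add: field_simps flip: abs_divide)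
    also have "\<dots> \<le> C * h\<^sup>2 / \<bar>h\<bar>" by (intro divide_right_mono f) simp
    also have "\<dots> = C * \<bar>h\<bar>" using \<open>h \<noteq> 0\<close> by (cases "h > 0") (auto simp: power2_eq_square)
    finally show "norm ((f (x + h) - f x) / h - D) \<le> C * \<bar>h\<bar>" .
  qed
  have "((\<lambda>h. C * \<bar>h\<bar>) \<longlongrightarrow> C * \<bar>0\<bar>) (at 0)" by (intro tendsto_intros)
  then show "((\<lambda>h. C * \<bar>h\<bar>) \<longlongrightarrow> 0) (at 0)" by simp
qed

lemma abs_sin_diff_le: "\<bar>sin x - sin y\<bar> \<le> \<bar>x - y :: real\<bar>"
proof -
  have "\<bar>sin x - sin y\<bar> = 2 * (\<bar>sin ((x - y) / 2)\<bar> * \<bar>cos ((x + y) / 2)\<bar>)"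
    by (simp add: sin_diff_sin abs_mult)
  also have "\<dots> \<le> 2 * (\<bar>(x - y) / 2\<bar> * 1)"
    by (intro mult_left_mono mult_mono abs_sin_x_le_abs_x) auto
  finally show ?thesis by simp
qed

lemma cos_first_order: "\<bar>cos (x + h) - cos x + h * sin x\<bar> \<le> (h::real)\<^sup>2"
proof -
  obtain z where z: "\<bar>z - x\<bar> \<le> \<bar>h\<bar>" "cos (x + h) - cos x = h * (- sin z)"
  proof (cases "h = 0")
    case True
    then show ?thesis using that[of x] by simp
  next
    case False
    then have ne: "x \<noteq> x + h" by simp
    have d: "\<And>y. (cos has_real_derivative - sin y) (at y)" by (auto intro!: derivative_eq_intros)
    show ?thesis
    proof (cases "h > 0")
      case True
      obtain z where "x < z" "z < x + h" "cos (x + h) - cos x = (x + h - x) * (- sin z)"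
        using MVT2[of x "x + h" cos "\<lambda>z. - sin z"] d True by auto
      then show ?thesis by (intro that[of z]) auto
    next
      case False
      with \<open>h \<noteq> 0\<close> have "h < 0" by simp
      obtain z where "x + h < z" "z < x" "cos x - cos (x + h) = (x - (x + h)) * (- sin z)"
        using MVT2[of "x + h" x cos "\<lambda>z. - sin z"] d \<open>h < 0\<close> by auto
      then show ?thesis by (intro that[of z]) auto
    qed
  qed
  have "\<bar>cos (x + h) - cos x + h * sin x\<bar> = \<bar>h\<bar> * \<bar>sin x - sin z\<bar>"
    unfolding z(2) by (simp add: abs_mult[symmetric] algebra_simps)
  also have "\<dots> \<le> \<bar>h\<bar> * \<bar>h\<bar>"
    using abs_sin_diff_le[of x z] z(1) by (intro mult_left_mono) (auto simp: abs_minus_commute)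
  finally show ?thesis by (simp add: power2_eq_square)
qed

lemma sin_first_order: "\<bar>sin (x + h) - sin x - h * cos x\<bar> \<le> (h::real)\<^sup>2"
  using cos_first_order[of "x - pi / 2" h] by (simp add: cos_diff sin_diff cos_add sin_add algebra_simps)

lemma cos_second_order: "\<bar>cos h - 1 + h\<^sup>2 / 2\<bar> \<le> \<bar>h::real\<bar> ^ 3"
proof -
  obtain t where "cos h = (\<Sum>m<3. cos_coeff m * h ^ m) + cos (t + 1/2 * real 3 * pi) / fact 3 * h ^ 3"
    using Maclaurin_cos_expansion[of h 3] by blast
  then have "cos h - 1 + h\<^sup>2 / 2 = cos (t + 1/2 * real 3 * pi) / 6 * h ^ 3"
    by (simp add: numeral_eq_Suc cos_coeff_def)
  also have "\<bar>\<dots>\<bar> \<le> 1 * \<bar>h\<bar> ^ 3"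
    unfolding abs_mult power_abs using abs_cos_le_one[of "t + 1/2 * real 3 * pi"]
    by (intro mult_right_mono) (simp_all del: abs_cos_le_one)
  finally show ?thesis by simp
qed

lemma abs_integral_sphere_measure_le:
  fixes f :: "'a::euclidean_space \<Rightarrow> real"
  assumes [measurable]: "f \<in> borel_measurable borel" and f: "\<And>\<omega>. norm \<omega> = 1 \<Longrightarrow> \<bar>f \<omega>\<bar> \<le> B"
  shows "\<bar>LINT \<omega>|sphere_measure. f \<omega>\<bar> \<le> B"
proof -
  interpret prob_space "sphere_measure :: 'a measure" by (rule prob_space_sphere_measure)
  obtain \<omega>0 :: 'a where "norm \<omega>0 = 1" using vector_choose_size[of 1] by auto
  then have B: "0 \<le> B" using f[of \<omega>0] by linarith
  have "\<bar>LINT \<omega>|sphere_measure. f \<omega>\<bar> \<le> (LINT \<omega>|sphere_measure. \<bar>f \<omega>\<bar>)" by (rule integral_abs_bound)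
  also have "\<dots> \<le> (LINT \<omega>|(sphere_measure :: 'a measure). B)"
    using AE_sphere_measure_norm f B
    by (intro integral_mono_AE integrable_sphere_measure_bounded[where B=B]) (auto elim!: eventually_mono)
  finally show ?thesis using prob_space by simp
qed

lemma inner_sphere_le: "norm e = 1 \<Longrightarrow> norm \<omega> = 1 \<Longrightarrow> \<bar>e \<bullet> \<omega>\<bar> \<le> 1"
  using Cauchy_Schwarz_ineq2[of e \<omega>] by simp

text \<open>Differentiation under the integral sign: since
  \<open>\<bar>e \<bullet> \<omega>\<bar> \<le> 1\<close> on the sphere, the Taylor remainder of the
  cosine is at most \<open>h\<^sup>2\<close> uniformly in \<omega> and survives averaging over a
  probability measure.\<close>

lemma sphere_hat_deriv:
  fixes e :: "'a::euclidean_space"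
  assumes e: "norm e = 1"
  shows "((\<lambda>r. sphere_hat (r *\<^sub>R e)) has_real_derivative - (LINT \<omega>|sphere_measure. (e \<bullet> \<omega>) * sin (r * (e \<bullet> \<omega>)))) (at r)"
proof (rule has_real_derivative_quadratic_bound[where C=1])
  fix h
  note [simp] = inner_sphere_le[OF e]
  have i1: "integrable sphere_measure (\<lambda>\<omega>. cos (s * (e \<bullet> \<omega>)))" for s
    by (rule integrable_sphere_measure_bounded[where B=1]) auto
  have i2: "integrable sphere_measure (\<lambda>\<omega>. (e \<bullet> \<omega>) * sin (s * (e \<bullet> \<omega>)))" for s
    by (rule integrable_sphere_measure_bounded[where B=1]) (auto simp: abs_mult intro!: mult_le_one)
  have "sphere_hat ((r + h) *\<^sub>R e) - sphere_hat (r *\<^sub>R e) - h * - (LINT \<omega>|sphere_measure. (e \<bullet> \<omega>) * sin (r * (e \<bullet> \<omega>)))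
     = (LINT \<omega>|sphere_measure. cos ((r + h) * (e \<bullet> \<omega>)) - cos (r * (e \<bullet> \<omega>)) + h * ((e \<bullet> \<omega>) * sin (r * (e \<bullet> \<omega>))))"
    unfolding sphere_hat_def using i1 i2 by simp
  also have "\<bar>\<dots>\<bar> \<le> h\<^sup>2"
  proof (rule abs_integral_sphere_measure_le)
    fix \<omega> :: 'a assume "norm \<omega> = 1"
    then have 1: "\<bar>e \<bullet> \<omega>\<bar> \<le> 1" by simp
    have "\<bar>cos ((r + h) * (e \<bullet> \<omega>)) - cos (r * (e \<bullet> \<omega>)) + h * ((e \<bullet> \<omega>) * sin (r * (e \<bullet> \<omega>)))\<bar> \<le> (h * (e \<bullet> \<omega>))\<^sup>2"
      using cos_first_order[of "r * (e \<bullet> \<omega>)" "h * (e \<bullet> \<omega>)"] by (simp add: algebra_simps)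
    also have "\<dots> = h\<^sup>2 * (e \<bullet> \<omega>)\<^sup>2" by (simp add: power_mult_distrib)
    also have "\<dots> \<le> h\<^sup>2 * 1" using 1 by (intro mult_left_mono) (simp_all add: abs_square_le_1)
    finally show "\<bar>cos ((r + h) * (e \<bullet> \<omega>)) - cos (r * (e \<bullet> \<omega>)) + h * ((e \<bullet> \<omega>) * sin (r * (e \<bullet> \<omega>)))\<bar> \<le> h\<^sup>2" by simp
  qed simp
  finally show "\<bar>sphere_hat ((r + h) *\<^sub>R e) - sphere_hat (r *\<^sub>R e) - h * - (LINT \<omega>|sphere_measure. (e \<bullet> \<omega>) * sin (r * (e \<bullet> \<omega>)))\<bar> \<le> 1 * h\<^sup>2"
    by simp
qed

lemma sphere_hat_deriv2:
  fixes e :: "'a::euclidean_space"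
  assumes e: "norm e = 1"
  shows "((\<lambda>r. - (LINT \<omega>|sphere_measure. (e \<bullet> \<omega>) * sin (r * (e \<bullet> \<omega>)))) has_real_derivative
    - (LINT \<omega>|sphere_measure. (e \<bullet> \<omega>)\<^sup>2 * cos (r * (e \<bullet> \<omega>)))) (at r)"
proof (rule has_real_derivative_quadratic_bound[where C=1])
  fix h
  note [simp] = inner_sphere_le[OF e]
  have i1: "integrable sphere_measure (\<lambda>\<omega>. (e \<bullet> \<omega>)\<^sup>2 * cos (s * (e \<bullet> \<omega>)))" for s
    by (rule integrable_sphere_measure_bounded[where B=1]) (auto simp: abs_mult abs_square_le_1 intro!: mult_le_one)
  have i2: "integrable sphere_measure (\<lambda>\<omega>. (e \<bullet> \<omega>) * sin (s * (e \<bullet> \<omega>)))" for s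
    by (rule integrable_sphere_measure_bounded[where B=1]) (auto simp: abs_mult intro!: mult_le_one)
  have "- (LINT \<omega>|sphere_measure. (e \<bullet> \<omega>) * sin ((r + h) * (e \<bullet> \<omega>))) - - (LINT \<omega>|sphere_measure. (e \<bullet> \<omega>) * sin (r * (e \<bullet> \<omega>)))
        - h * - (LINT \<omega>|sphere_measure. (e \<bullet> \<omega>)\<^sup>2 * cos (r * (e \<bullet> \<omega>)))
     = - (LINT \<omega>|sphere_measure. (e \<bullet> \<omega>) * sin ((r + h) * (e \<bullet> \<omega>)) - (e \<bullet> \<omega>) * sin (r * (e \<bullet> \<omega>)) - h * ((e \<bullet> \<omega>)\<^sup>2 * cos (r * (e \<bullet> \<omega>))))"
    using i1 i2 by simp
  also have "\<bar>\<dots>\<bar> \<le> h\<^sup>2"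
    unfolding abs_minus_cancel
  proof (rule abs_integral_sphere_measure_le)
    fix \<omega> :: 'a assume "norm \<omega> = 1"
    then have 1: "\<bar>e \<bullet> \<omega>\<bar> \<le> 1" by simp
    have "\<bar>(e \<bullet> \<omega>) * sin ((r + h) * (e \<bullet> \<omega>)) - (e \<bullet> \<omega>) * sin (r * (e \<bullet> \<omega>)) - h * ((e \<bullet> \<omega>)\<^sup>2 * cos (r * (e \<bullet> \<omega>)))\<bar>
      = \<bar>e \<bullet> \<omega>\<bar> * \<bar>sin (r * (e \<bullet> \<omega>) + h * (e \<bullet> \<omega>)) - sin (r * (e \<bullet> \<omega>)) - (h * (e \<bullet> \<omega>)) * cos (r * (e \<bullet> \<omega>))\<bar>"
      unfolding abs_mult[symmetric] by (simp add: algebra_simps power2_eq_square)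
    also have "\<dots> \<le> 1 * (h * (e \<bullet> \<omega>))\<^sup>2"
      using sin_first_order 1 by (intro mult_mono) auto
    also have "\<dots> = h\<^sup>2 * (e \<bullet> \<omega>)\<^sup>2" by (simp add: power_mult_distrib)
    also have "\<dots> \<le> h\<^sup>2 * 1" using 1 by (intro mult_left_mono) (simp_all add: abs_square_le_1)
    finally show "\<bar>(e \<bullet> \<omega>) * sin ((r + h) * (e \<bullet> \<omega>)) - (e \<bullet> \<omega>) * sin (r * (e \<bullet> \<omega>)) - h * ((e \<bullet> \<omega>)\<^sup>2 * cos (r * (e \<bullet> \<omega>)))\<bar> \<le> h\<^sup>2" by simp
  qed simp
  finally show "\<bar>- (LINT \<omega>|sphere_measure. (e \<bullet> \<omega>) * sin ((r + h) * (e \<bullet> \<omega>))) - - (LINT \<omega>|sphere_measure. (e \<bullet> \<omega>) * sin (r * (e \<bullet> \<omega>)))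
        - h * - (LINT \<omega>|sphere_measure. (e \<bullet> \<omega>)\<^sup>2 * cos (r * (e \<bullet> \<omega>)))\<bar> \<le> 1 * h\<^sup>2"
    by simp
qed

text \<open>The second difference of the radial function \<^const>\<open>sphere_hat\<close> at \<open>r e\<close> in a direction \<open>e'\<close>
  orthogonal to \<open>e\<close> is governed by its first radial derivative.\<close>
lemma sphere_hat_orthogonal_direction:
  fixes e e' :: "real ^ 'd::finite"
  assumes e: "norm e = 1" and e': "norm e' = 1" and ee': "e \<bullet> e' = 0" and r: "0 < r"
  shows "(LINT \<omega>|sphere_measure. (e' \<bullet> \<omega>)\<^sup>2 * cos (r * (e \<bullet> \<omega>))) = (LINT \<omega>|sphere_measure. (e \<bullet> \<omega>) * sin (r * (e \<bullet> \<omega>))) / r"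
    (is "?A = ?D / r")
proof -
  note [simp] = inner_sphere_le[OF e] inner_sphere_le[OF e']
  define K where "K r = sphere_hat (r *\<^sub>R e)" for r
  have K: "(K has_real_derivative - ?D) (at r)"
    unfolding K_def[abs_def] using sphere_hat_deriv[OF e] by simp
  have i1: "integrable sphere_measure (\<lambda>\<omega>. (e' \<bullet> \<omega>)\<^sup>2 * cos (r * (e \<bullet> \<omega>)))"
    by (rule integrable_sphere_measure_bounded[where B=1]) (auto simp: abs_mult abs_square_le_1 intro!: mult_le_one)
  have i2: "integrable sphere_measure (\<lambda>\<omega>. cos (x \<bullet> \<omega>))" for x :: "real ^ 'd"
    by (rule integrable_sphere_measure_bounded[where B=1]) auto
  have i3: "integrable sphere_measure (\<lambda>\<omega>. cos (h * (e' \<bullet> \<omega>)) * cos (r * (e \<bullet> \<omega>)))" for h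
    by (rule integrable_sphere_measure_bounded[where B=1]) (auto simp: abs_mult intro!: mult_le_one)
  \<comment> \<open>The points \<open>r e + h e'\<close> and \<open>r e - h e'\<close> have the same
    length, so radiality gives the same value at both. Adding their cosines turns the sum into a
    product that is even in \<open>h\<close>; hence the expansion \<open>est\<close> has no linear
    term.\<close>
  have Kh: "K (sqrt (r\<^sup>2 + h\<^sup>2)) = (LINT \<omega>|sphere_measure. cos (h * (e' \<bullet> \<omega>)) * cos (r * (e \<bullet> \<omega>)))" for h
  proof -
    have n: "norm (r *\<^sub>R e + s *\<^sub>R e') = sqrt (r\<^sup>2 + s\<^sup>2)" for s
      using e e' ee' by (simp add: norm_eq_sqrt_inner inner_add_left inner_add_right inner_commute[of e' e] power2_eq_square)
    have *: "sphere_hat (r *\<^sub>R e + s *\<^sub>R e') = K (sqrt (r\<^sup>2 + s\<^sup>2))" for s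
      unfolding K_def by (rule sphere_hat_radial) (use n[of s] e in simp)
    have "2 * K (sqrt (r\<^sup>2 + h\<^sup>2)) = sphere_hat (r *\<^sub>R e + h *\<^sub>R e') + sphere_hat (r *\<^sub>R e + (-h) *\<^sub>R e')"
      unfolding * by simp
    also have "\<dots> = (LINT \<omega>|sphere_measure. cos ((r *\<^sub>R e + h *\<^sub>R e') \<bullet> \<omega>) + cos ((r *\<^sub>R e + (-h) *\<^sub>R e') \<bullet> \<omega>))"
      unfolding sphere_hat_def by (rule Bochner_Integration.integral_add[symmetric]; rule i2)
    also have "\<dots> = (LINT \<omega>|sphere_measure. 2 * (cos (h * (e' \<bullet> \<omega>)) * cos (r * (e \<bullet> \<omega>))))"
      by (intro Bochner_Integration.integral_cong refl) (simp add: inner_add_left inner_diff_left cos_add cos_diff)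
    finally show ?thesis by simp
  qed
  have Kr: "K r = (LINT \<omega>|sphere_measure. cos (r * (e \<bullet> \<omega>)))" by (simp add: K_def sphere_hat_def)
  have i4: "integrable sphere_measure (\<lambda>\<omega>. cos (r * (e \<bullet> \<omega>)))" using i2[of "r *\<^sub>R e"] by simp
  have est: "\<bar>K (sqrt (r\<^sup>2 + h\<^sup>2)) - K r + h\<^sup>2 / 2 * ?A\<bar> \<le> \<bar>h\<bar> ^ 3" for h
  proof -
    have "K (sqrt (r\<^sup>2 + h\<^sup>2)) - K r + h\<^sup>2 / 2 * ?A = (LINT \<omega>|sphere_measure. cos (h * (e' \<bullet> \<omega>)) * cos (r * (e \<bullet> \<omega>)) - cos (r * (e \<bullet> \<omega>)) + h\<^sup>2 / 2 * ((e' \<bullet> \<omega>)\<^sup>2 * cos (r * (e \<bullet> \<omega>))))"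
      unfolding Kh Kr using i1 i3 i4 by simp
    also have "\<bar>\<dots>\<bar> \<le> \<bar>h\<bar> ^ 3"
    proof (rule abs_integral_sphere_measure_le)
      fix \<omega> :: "real ^ 'd" assume "norm \<omega> = 1"
      then have 1: "\<bar>e' \<bullet> \<omega>\<bar> \<le> 1" by simp
      have "\<bar>cos (h * (e' \<bullet> \<omega>)) * cos (r * (e \<bullet> \<omega>)) - cos (r * (e \<bullet> \<omega>)) + h\<^sup>2 / 2 * ((e' \<bullet> \<omega>)\<^sup>2 * cos (r * (e \<bullet> \<omega>)))\<bar>
        = \<bar>cos (h * (e' \<bullet> \<omega>)) - 1 + (h * (e' \<bullet> \<omega>))\<^sup>2 / 2\<bar> * \<bar>cos (r * (e \<bullet> \<omega>))\<bar>"
        unfolding abs_mult[symmetric] by (simp add: algebra_simps power_mult_distrib)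
      also have "\<dots> \<le> \<bar>h * (e' \<bullet> \<omega>)\<bar> ^ 3 * 1"
        by (intro mult_mono cos_second_order) auto
      also have "\<dots> \<le> \<bar>h\<bar> ^ 3"
        using 1 by (simp add: abs_mult power_mult_distrib mult_left_le power_le_one)
      finally show "\<bar>cos (h * (e' \<bullet> \<omega>)) * cos (r * (e \<bullet> \<omega>)) - cos (r * (e \<bullet> \<omega>)) + h\<^sup>2 / 2 * ((e' \<bullet> \<omega>)\<^sup>2 * cos (r * (e \<bullet> \<omega>)))\<bar> \<le> \<bar>h\<bar> ^ 3" .
    qed simp
    finally show ?thesis .
  qed
  \<comment> \<open>In the variable w = h^2 the difference quotient has two evaluations from the
    right: the chain rule through \<open>sqrt\<close> gives a multiple of the radial derivative, and
    \<open>est\<close> gives the average of \<open>(e' \<bullet> \<omega>)\<^sup>2 * cos (r * (e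
    \<bullet> \<omega>))\<close>. Uniqueness of limits identifies them.\<close>
  have "((\<lambda>w. K (sqrt (r\<^sup>2 + w))) has_real_derivative - ?D * (inverse r / 2)) (at 0)"
  proof (rule DERIV_chain2[where f=K and g="\<lambda>w. sqrt (r\<^sup>2 + w)"])
    show "(K has_real_derivative - ?D) (at (sqrt (r\<^sup>2 + 0)))" using K r by simp
    show "((\<lambda>w. sqrt (r\<^sup>2 + w)) has_real_derivative inverse r / 2) (at 0)"
      using r by (auto intro!: derivative_eq_intros)
  qed
  then have "((\<lambda>w. (K (sqrt (r\<^sup>2 + w)) - K r) / w) \<longlongrightarrow> - ?D * (inverse r / 2)) (at 0)"
    using r by (simp add: DERIV_def)
  then have lim1: "((\<lambda>w. (K (sqrt (r\<^sup>2 + w)) - K r) / w) \<longlongrightarrow> - ?D * (inverse r / 2)) (at_right 0)"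
    by (rule filterlim_mono) (auto simp: at_le)
  have lim2: "((\<lambda>w. (K (sqrt (r\<^sup>2 + w)) - K r) / w) \<longlongrightarrow> - ?A / 2) (at_right 0)"
  proof (rule Lim_null_comparison[THEN Lim_null[THEN iffD2]])
    show "\<forall>\<^sub>F w in at_right 0. norm ((K (sqrt (r\<^sup>2 + w)) - K r) / w - - ?A / 2) \<le> sqrt w"
    proof (rule eventually_at_right_less[THEN eventually_mono])
      fix w :: real assume w: "0 < w"
      have "(K (sqrt (r\<^sup>2 + w)) - K r) / w - - ?A / 2 = (K (sqrt (r\<^sup>2 + (sqrt w)\<^sup>2)) - K r + (sqrt w)\<^sup>2 / 2 * ?A) / w"
        using w by (simp add: field_simps)
      then have "norm ((K (sqrt (r\<^sup>2 + w)) - K r) / w - - ?A / 2) = \<bar>K (sqrt (r\<^sup>2 + (sqrt w)\<^sup>2)) - K r + (sqrt w)\<^sup>2 / 2 * ?A\<bar> / w"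
        using w by (simp only: real_norm_def abs_divide)
      also have "\<dots> \<le> \<bar>sqrt w\<bar> ^ 3 / w" using w by (intro divide_right_mono est) simp
      also have "\<dots> = sqrt w" using w by (simp add: power3_eq_cube)
      finally show "norm ((K (sqrt (r\<^sup>2 + w)) - K r) / w - - ?A / 2) \<le> sqrt w" .
    qed
    have "(sqrt \<longlongrightarrow> sqrt 0) (at_right 0)" by (intro tendsto_intros)
    then show "(sqrt \<longlongrightarrow> 0) (at_right 0)" by simp
  qed
  have "- ?D * (inverse r / 2) = - ?A / 2" using tendsto_unique[OF _ lim1 lim2] by simp
  then show ?thesis using r by (simp add: field_simps)
qed

text \<open>The squares of the coordinates of \<omega> add up to 1 on the sphere; in other words
  \<open>sphere_hat\<close> is minus its own Laplacian. On the axis \<open>e\<close> the coordinate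
  \<open>k\<close> contributes the second radial derivative up to sign, and each of the other
  \<open>CARD('d) - 1\<close> coordinates contributes the first one divided by \<open>r\<close>, by
  \<open>sphere_hat_orthogonal_direction\<close>.\<close>

lemma sphere_hat_ode:
  fixes k :: "'d::finite"
  defines "e \<equiv> axis k (1::real)"
  assumes r: "0 < r"
  shows "- (LINT \<omega>|sphere_measure. (e \<bullet> \<omega>)\<^sup>2 * cos (r * (e \<bullet> \<omega>))) +
     real (CARD('d) - 1) / r * (- (LINT \<omega>|sphere_measure. (e \<bullet> \<omega>) * sin (r * (e \<bullet> \<omega>)))) + sphere_hat (r *\<^sub>R e) = 0"
proof -
  have n: "norm (axis j (1::real)) = 1" for j :: 'd by simp
  have ne: "norm e = 1" by (simp add: e_def)
  let ?I = "\<lambda>j. LINT \<omega>|sphere_measure. (axis j 1 \<bullet> \<omega>)\<^sup>2 * cos (r * (e \<bullet> \<omega>))"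
  have i: "integrable sphere_measure (\<lambda>\<omega>. (axis j 1 \<bullet> \<omega>)\<^sup>2 * cos (r * (e \<bullet> \<omega>)))" for j :: 'd
    using inner_sphere_le[OF n[of j]] inner_sphere_le[OF ne]
    by (intro integrable_sphere_measure_bounded[where B=1]) (auto simp: abs_mult abs_square_le_1 intro!: mult_le_one)
  have "sphere_hat (r *\<^sub>R e) = (LINT \<omega>|sphere_measure. (\<Sum>j\<in>UNIV. (axis j 1 \<bullet> \<omega>)\<^sup>2 * cos (r * (e \<bullet> \<omega>))))"
    unfolding sphere_hat_def
  proof (rule integral_cong_AE)
    show "AE \<omega> in sphere_measure. cos (r *\<^sub>R e \<bullet> \<omega>) = (\<Sum>j\<in>UNIV. (axis j 1 \<bullet> \<omega>)\<^sup>2 * cos (r * (e \<bullet> \<omega>)))"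
      using AE_sphere_measure_norm
    proof eventually_elim
      fix \<omega> :: "real ^ 'd" assume "norm \<omega> = 1"
      then have "(\<Sum>j\<in>UNIV. (\<omega> $ j)\<^sup>2) = 1"
        by (simp add: norm_vec_def L2_set_def)
      then show "cos (r *\<^sub>R e \<bullet> \<omega>) = (\<Sum>j\<in>UNIV. (axis j 1 \<bullet> \<omega>)\<^sup>2 * cos (r * (e \<bullet> \<omega>)))"
        by (simp add: sum_distrib_right[symmetric] inner_axis')
    qed
  qed simp_all
  also have "\<dots> = (\<Sum>j\<in>UNIV. ?I j)" by (rule Bochner_Integration.integral_sum) (rule i)
  also have "\<dots> = ?I k + (\<Sum>j\<in>UNIV - {k}. ?I j)" by (subst sum.remove[of _ k]) auto
  also have "(\<Sum>j\<in>UNIV - {k}. ?I j) = (\<Sum>j\<in>UNIV - {k}. (LINT \<omega>|sphere_measure. (e \<bullet> \<omega>) * sin (r * (e \<bullet> \<omega>))) / r)"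
    by (intro sum.cong refl sphere_hat_orthogonal_direction ne n r) (auto simp: e_def inner_axis_axis)
  finally show ?thesis by (simp add: e_def card_Diff_subset)
qed

lemma sphere_hat_asymptotics:
  fixes e :: "real ^ 'd::finite"
  assumes "norm e = 1"
  shows "\<exists>a C. a \<noteq> 0 \<and> 0 \<le> C \<and> (\<forall>r\<ge>1. \<bar>r powr (real (CARD('d) - 1) / 2) * sphere_hat (r *\<^sub>R e) - 2 * Re (a * cis r)\<bar> \<le> C / r)"
proof -
  define k :: 'd where "k = undefined"
  have *: "sphere_hat (r *\<^sub>R e) = sphere_hat (r *\<^sub>R axis k (1::real))" for r
    by (rule sphere_hat_radial) (simp add: assms)
  show ?thesis
    unfolding *
    by (rule bessel_asymptotics[OF sphere_hat_deriv sphere_hat_deriv2 sphere_hat_ode]) auto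
qed

section \<open>\<open>L\<^sup>2\<close> estimates for the parabola\<close>

text \<open>The Fourier transform of the weight \<open>exp (- (\<sigma> * t)\<^sup>2 / 2)\<close>,
  with total integral 2 pi for every \<sigma>. It is the regularised delta function that arises when
  oscillating exponentials are integrated over all times.\<close>

definition gauss :: "real \<Rightarrow> real \<Rightarrow> real" where
  "gauss \<sigma> y = sqrt (2 * pi) / \<sigma> * exp (- (y / \<sigma>)\<^sup>2 / 2)"

lemma measurable_cis [measurable]: "cis \<in> borel_measurable borel"
  by (intro borel_measurable_continuous_onI continuous_intros)

lemma measurable_cnj [measurable]: "cnj \<in> borel_measurable borel"
  by (intro borel_measurable_continuous_onI continuous_intros)

lemma gauss_nonneg: "0 < \<sigma> \<Longrightarrow> 0 \<le> gauss \<sigma> y"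
  by (simp add: gauss_def)

lemma measurable_gauss [measurable]: "gauss \<sigma> \<in> borel_measurable borel"
  by (simp add: gauss_def[abs_def])

lemma gauss_eq_normal_density: "0 < \<sigma> \<Longrightarrow> gauss \<sigma> y = 2 * pi * normal_density 0 \<sigma> y"
  by (simp add: gauss_def normal_density_def real_sqrt_mult power_divide field_simps)

lemma nn_integral_gauss:
  assumes \<sigma>: "0 < \<sigma>"
  shows "(\<integral>\<^sup>+ y. ennreal (gauss \<sigma> (a - y)) \<partial>lborel) = ennreal (2 * pi)"
proof -
  have 1: "(\<integral>\<^sup>+ y. ennreal (normal_density a \<sigma> y) \<partial>lborel) = ennreal (LINT y|lborel. normal_density a \<sigma> y)"
    using \<sigma> by (intro nn_integral_eq_integral) auto
  have "(\<integral>\<^sup>+ y. ennreal (gauss \<sigma> (a - y)) \<partial>lborel) = (\<integral>\<^sup>+ y. ennreal (2 * pi) * ennreal (normal_density a \<sigma> y) \<partial>lborel)"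
    using \<sigma> by (intro nn_integral_cong)
      (simp add: gauss_eq_normal_density ennreal_mult[symmetric] normal_density_def power2_commute)
  also have "\<dots> = ennreal (2 * pi) * ennreal (LINT y|lborel. normal_density a \<sigma> y)"
    using \<sigma> by (subst nn_integral_cmult) (simp_all only: 1, simp)
  finally show ?thesis using \<sigma> by simp
qed

lemma gauss_fourier:
  assumes \<sigma>: "0 < \<sigma>"
  shows "(LINT t|lborel. complex_of_real (exp (- (\<sigma> * t)\<^sup>2 / 2)) * cis (t * y)) = complex_of_real (gauss \<sigma> y)"
proof -
  have "complex_of_real (exp (- (y / \<sigma>)\<^sup>2 / 2)) = char std_normal_distribution (y / \<sigma>)"
    by (simp add: char_std_normal_distribution)
  also have "\<dots> = (LINT x|lborel. std_normal_density x *\<^sub>R iexp (y / \<sigma> * x))"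
    unfolding char_def by (subst integral_density) auto
  also have "\<dots> = (LINT t|lborel. \<bar>\<sigma>\<bar> *\<^sub>R (std_normal_density (0 + \<sigma> * t) *\<^sub>R iexp (y / \<sigma> * (0 + \<sigma> * t))))"
    using \<sigma> lborel_integral_real_affine[of \<sigma> "\<lambda>x. std_normal_density x *\<^sub>R iexp (y / \<sigma> * x)" 0]
    by (simp only: integral_scaleR_right)
  also have "\<dots> = (LINT t|lborel. complex_of_real (\<sigma> / sqrt (2 * pi)) * (complex_of_real (exp (- (\<sigma> * t)\<^sup>2 / 2)) * cis (t * y)))"
    using \<sigma> by (intro Bochner_Integration.integral_cong refl)
      (simp add: std_normal_density_def scaleR_conv_of_real cis_conv_exp mult_ac)
  also have "\<dots> = complex_of_real (\<sigma> / sqrt (2 * pi)) * (LINT t|lborel. complex_of_real (exp (- (\<sigma> * t)\<^sup>2 / 2)) * cis (t * y))"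
    by simp
  finally show ?thesis using \<sigma>
    by (simp add: gauss_def field_simps flip: of_real_mult)
qed

lemma integrable_exp_gauss:
  fixes \<sigma> :: real
  assumes \<sigma>: "0 < \<sigma>"
  shows "integrable lborel (\<lambda>t. exp (- (\<sigma> * t)\<^sup>2 / 2))"
proof -
  have "(\<lambda>t. exp (- (\<sigma> * t)\<^sup>2 / 2)) = (\<lambda>t. sqrt (2 * pi) / \<sigma> * normal_density 0 (1 / \<sigma>) t)"
    using \<sigma> by (auto simp: normal_density_def power_divide power_mult_distrib real_sqrt_divide real_sqrt_mult field_simps fun_eq_iff)
  then show ?thesis using \<sigma> by (simp only:) (intro integrable_mult_right integrable_normal_density; simp)
qed

lemma (in pair_sigma_finite)
  fixes f :: "'a \<Rightarrow> complex" and g :: "'b \<Rightarrow> complex"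
  assumes f: "integrable M1 f" and g: "integrable M2 g"
  shows integrable_pair_mult: "integrable (M1 \<Otimes>\<^sub>M M2) (\<lambda>z. f (fst z) * g (snd z))"
    and integral_pair_mult: "(LINT z|(M1 \<Otimes>\<^sub>M M2). f (fst z) * g (snd z)) = (LINT x|M1. f x) * (LINT y|M2. g y)"
proof -
  have [measurable]: "f \<in> borel_measurable M1" "g \<in> borel_measurable M2" using f g by auto
  show i: "integrable (M1 \<Otimes>\<^sub>M M2) (\<lambda>z. f (fst z) * g (snd z))"
    using f g by (intro Fubini_integrable) (auto simp: norm_mult integrable_norm)
  have "(LINT x|M1. LINT y|M2. f x * g y) = (LINT z|(M1 \<Otimes>\<^sub>M M2). f (fst z) * g (snd z))"
    using integral_fst'[OF i] by simp
  then show "(LINT z|(M1 \<Otimes>\<^sub>M M2). f (fst z) * g (snd z)) = (LINT x|M1. f x) * (LINT y|M2. g y)"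
    using f g by simp
qed

lemma ennreal_norm_integral_le: "ennreal (norm (LINT x|M. f x)) \<le> (\<integral>\<^sup>+ x. ennreal (norm (f x)) \<partial>M)"
  by (cases "integrable M f") (auto simp: integral_norm_bound_ennreal not_integrable_integral_eq)

text \<open>A \<open>TT\<^sup>*\<close> argument: the kernel of \<open>T\<^sup>*T\<close> is handled by Schur's test.\<close>
lemma schur_test_TTstar:
  fixes h :: "'a \<Rightarrow> complex" and e :: "'b \<Rightarrow> 'a \<Rightarrow> complex" and k :: "'a \<Rightarrow> 'a \<Rightarrow> real"
  assumes \<mu>: "sigma_finite_measure \<mu>" and \<nu>: "finite_measure \<nu>"
    and h: "integrable \<mu> h" and e[measurable]: "(\<lambda>(y, a). e y a) \<in> borel_measurable (\<nu> \<Otimes>\<^sub>M \<mu>)"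
    and e1: "\<And>y a. cmod (e y a) \<le> 1"
    and A: "\<And>a. a \<notin> A \<Longrightarrow> h a = 0"
    and k[measurable]: "(\<lambda>(a, b). k a b) \<in> borel_measurable (\<mu> \<Otimes>\<^sub>M \<mu>)"
    and k0: "\<And>a b. 0 \<le> k a b" and ksym: "\<And>a b. k a b = k b a"
    and ek: "\<And>a b. a \<in> A \<Longrightarrow> b \<in> A \<Longrightarrow> cmod (LINT y|\<nu>. e y a * cnj (e y b)) \<le> k a b"
    and kB: "\<And>a. a \<in> A \<Longrightarrow> (\<integral>\<^sup>+ b. ennreal (k a b) \<partial>\<mu>) \<le> B"
  shows "(\<integral>\<^sup>+ y. ennreal ((cmod (LINT a|\<mu>. h a * e y a))\<^sup>2) \<partial>\<nu>) \<le> B * (\<integral>\<^sup>+ a. ennreal ((cmod (h a))\<^sup>2) \<partial>\<mu>)"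
proof -
  interpret \<mu>: sigma_finite_measure \<mu> by fact
  interpret \<nu>: finite_measure \<nu> by fact
  interpret \<mu>\<mu>: pair_sigma_finite \<mu> \<mu> ..
  interpret \<mu>\<mu>s: sigma_finite_measure "\<mu> \<Otimes>\<^sub>M \<mu>" by (rule \<mu>\<mu>.sigma_finite_measure_axioms)
  interpret P: pair_sigma_finite "\<mu> \<Otimes>\<^sub>M \<mu>" \<nu> ..
  have [measurable]: "h \<in> borel_measurable \<mu>" using h by auto
  let ?H = "\<lambda>(a, b). h a * cnj (h b)"
  define S where "S y = (LINT a|\<mu>. h a * e y a)" for y
  have S_m[measurable]: "S \<in> borel_measurable \<nu>"
    unfolding S_def[abs_def] by (intro \<mu>.borel_measurable_lebesgue_integral) measurable
  have Sb: "cmod (S y) \<le> (LINT a|\<mu>. cmod (h a))" if "y \<in> space \<nu>" for y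
  proof -
    have [measurable]: "(\<lambda>a. e y a) \<in> borel_measurable \<mu>" using measurable_compose[OF measurable_Pair1'[OF that] e] by simp
    have "cmod (S y) \<le> (LINT a|\<mu>. cmod (h a * e y a))" unfolding S_def by (rule integral_norm_bound)
    also have "\<dots> \<le> (LINT a|\<mu>. cmod (h a))"
      by (intro integral_mono Bochner_Integration.integrable_bound[OF integrable_norm[OF h]] integrable_norm[OF h])
         (auto simp: norm_mult intro!: mult_left_le e1)
    finally show ?thesis .
  qed
  have H: "integrable (\<mu> \<Otimes>\<^sub>M \<mu>) ?H"
    using \<mu>\<mu>.integrable_pair_mult[of h "\<lambda>b. cnj (h b)"] h by (simp add: split_def)
  let ?Q = "\<lambda>z. h (fst (fst z)) * cnj (h (snd (fst z))) * (e (snd z) (fst (fst z)) * cnj (e (snd z) (snd (fst z))))"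
  have Q: "integrable ((\<mu> \<Otimes>\<^sub>M \<mu>) \<Otimes>\<^sub>M \<nu>) ?Q"
  proof (rule Bochner_Integration.integrable_bound)
    show "integrable ((\<mu> \<Otimes>\<^sub>M \<mu>) \<Otimes>\<^sub>M \<nu>) (\<lambda>z. ?H (fst z))"
      using P.Fubini_integrable[of "\<lambda>z. ?H (fst z)"] H by (simp add: integrable_norm)
    have m: "(\<lambda>z. (snd z, fst (fst z))) \<in> ((\<mu> \<Otimes>\<^sub>M \<mu>) \<Otimes>\<^sub>M \<nu>) \<rightarrow>\<^sub>M (\<nu> \<Otimes>\<^sub>M \<mu>)"
        "(\<lambda>z. (snd z, snd (fst z))) \<in> ((\<mu> \<Otimes>\<^sub>M \<mu>) \<Otimes>\<^sub>M \<nu>) \<rightarrow>\<^sub>M (\<nu> \<Otimes>\<^sub>M \<mu>)"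
      by (intro measurable_Pair measurable_snd measurable_compose[OF measurable_fst measurable_fst] measurable_compose[OF measurable_fst measurable_snd])+
    have e': "(\<lambda>z. e (snd z) (fst (fst z))) \<in> borel_measurable ((\<mu> \<Otimes>\<^sub>M \<mu>) \<Otimes>\<^sub>M \<nu>)"
        "(\<lambda>z. e (snd z) (snd (fst z))) \<in> borel_measurable ((\<mu> \<Otimes>\<^sub>M \<mu>) \<Otimes>\<^sub>M \<nu>)"
      using measurable_compose[OF m(1) e] measurable_compose[OF m(2) e] by simp_all
    have hm: "h \<in> borel_measurable \<mu>" by measurable
    have h': "(\<lambda>z. h (fst (fst z))) \<in> borel_measurable ((\<mu> \<Otimes>\<^sub>M \<mu>) \<Otimes>\<^sub>M \<nu>)" "(\<lambda>z. h (snd (fst z))) \<in> borel_measurable ((\<mu> \<Otimes>\<^sub>M \<mu>) \<Otimes>\<^sub>M \<nu>)"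
      by (rule measurable_compose[OF measurable_compose[OF measurable_fst measurable_fst] hm] measurable_compose[OF measurable_compose[OF measurable_fst measurable_snd] hm])+
    show "?Q \<in> borel_measurable ((\<mu> \<Otimes>\<^sub>M \<mu>) \<Otimes>\<^sub>M \<nu>)"
      by (intro borel_measurable_times e' h' measurable_compose[OF _ measurable_cnj])
    show "AE z in (\<mu> \<Otimes>\<^sub>M \<mu>) \<Otimes>\<^sub>M \<nu>. norm (?Q z) \<le> norm (?H (fst z))"
      using e1 by (intro AE_I2) (auto simp: norm_mult intro!: mult_left_le mult_le_one)
  qed
  have SS: "complex_of_real ((cmod (S y))\<^sup>2) = (LINT z|(\<mu> \<Otimes>\<^sub>M \<mu>). ?Q (z, y))" if y: "y \<in> space \<nu>" for y
  proof -
    have [measurable]: "(\<lambda>a. e y a) \<in> borel_measurable \<mu>" using measurable_compose[OF measurable_Pair1'[OF y] e] by simp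
    have i: "integrable \<mu> (\<lambda>a. h a * e y a)"
      by (rule Bochner_Integration.integrable_bound[OF integrable_norm[OF h]]) (auto simp: norm_mult intro!: mult_left_le e1)
    have "complex_of_real ((cmod (S y))\<^sup>2) = S y * cnj (S y)" by (rule complex_norm_square)
    also have "cnj (S y) = (LINT a|\<mu>. cnj (h a * e y a))" unfolding S_def by (rule Bochner_Integration.integral_cnj[symmetric])
    also have "S y * \<dots> = (LINT z|(\<mu> \<Otimes>\<^sub>M \<mu>). (h (fst z) * e y (fst z)) * cnj (h (snd z) * e y (snd z)))"
    proof -
      have "integrable \<mu> (\<lambda>a. cnj (h a * e y a))" using i by (simp only: complex_integrable_cnj)
      then show ?thesis unfolding S_def by (subst \<mu>\<mu>.integral_pair_mult[OF i]) auto
    qed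
    finally show ?thesis by (simp add: split_def mult_ac)
  qed
  have iS: "integrable \<nu> (\<lambda>y. (cmod (S y))\<^sup>2)"
    by (rule \<nu>.integrable_const_bound[where B="(LINT a|\<mu>. cmod (h a))\<^sup>2"]) (auto intro!: power_mono Sb)
  have "complex_of_real (LINT y|\<nu>. (cmod (S y))\<^sup>2) = (LINT y|\<nu>. LINT z|(\<mu> \<Otimes>\<^sub>M \<mu>). ?Q (z, y))"
    unfolding integral_complex_of_real[symmetric] by (intro Bochner_Integration.integral_cong refl SS)
  also have "\<dots> = (LINT z|(\<mu> \<Otimes>\<^sub>M \<mu>). LINT y|\<nu>. ?Q (z, y))"
    using P.Fubini_integral[of "\<lambda>z y. ?Q (z, y)"] Q by (simp add: split_def)
  also have "\<dots> = (LINT z|(\<mu> \<Otimes>\<^sub>M \<mu>). ?H z * (LINT y|\<nu>. e y (fst z) * cnj (e y (snd z))))"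
    by (intro Bochner_Integration.integral_cong refl) (auto simp: split_def)
  finally have c: "(LINT z|(\<mu> \<Otimes>\<^sub>M \<mu>). ?H z * (LINT y|\<nu>. e y (fst z) * cnj (e y (snd z)))) = complex_of_real (LINT y|\<nu>. (cmod (S y))\<^sup>2)" ..
  have eq: "(LINT y|\<nu>. (cmod (S y))\<^sup>2) = cmod (LINT z|(\<mu> \<Otimes>\<^sub>M \<mu>). ?H z * (LINT y|\<nu>. e y (fst z) * cnj (e y (snd z))))"
    unfolding c by simp
  have "(\<integral>\<^sup>+ y. ennreal ((cmod (S y))\<^sup>2) \<partial>\<nu>) = ennreal (LINT y|\<nu>. (cmod (S y))\<^sup>2)"
    by (rule nn_integral_eq_integral[OF iS]) simp
  also have "\<dots> \<le> (\<integral>\<^sup>+ z. ennreal (cmod (?H z * (LINT y|\<nu>. e y (fst z) * cnj (e y (snd z))))) \<partial>(\<mu> \<Otimes>\<^sub>M \<mu>))"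
    unfolding eq by (rule ennreal_norm_integral_le)
  \<comment> \<open>The inequality 2xy \<le> x^2 + y^2 separates the two values of \<open>h\<close>;
    the two resulting terms coincide by the symmetry of \<open>k\<close>, so that a bound for the
    integral of \<open>k\<close> in one variable is enough.\<close>
  also have "\<dots> \<le> (\<integral>\<^sup>+ z. ennreal ((cmod (h (fst z)))\<^sup>2 / 2 * k (fst z) (snd z)) + ennreal ((cmod (h (snd z)))\<^sup>2 / 2 * k (fst z) (snd z)) \<partial>(\<mu> \<Otimes>\<^sub>M \<mu>))"
  proof (intro nn_integral_mono)
    fix z
    have "cmod (?H z * (LINT y|\<nu>. e y (fst z) * cnj (e y (snd z)))) \<le> cmod (h (fst z)) * cmod (h (snd z)) * k (fst z) (snd z)"
    proof (cases "fst z \<in> A \<and> snd z \<in> A")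
      case True
      then show ?thesis using ek[of "fst z" "snd z"] by (auto simp: split_def norm_mult intro!: mult_left_mono)
    next
      case False
      then show ?thesis using A by (auto simp: split_def)
    qed
    also have "\<dots> \<le> ((cmod (h (fst z)))\<^sup>2 / 2 + (cmod (h (snd z)))\<^sup>2 / 2) * k (fst z) (snd z)"
      using sum_squares_bound[of "cmod (h (fst z))" "cmod (h (snd z))"]
      by (intro mult_right_mono k0) simp
    finally show "ennreal (cmod (?H z * (LINT y|\<nu>. e y (fst z) * cnj (e y (snd z))))) \<le>
        ennreal ((cmod (h (fst z)))\<^sup>2 / 2 * k (fst z) (snd z)) + ennreal ((cmod (h (snd z)))\<^sup>2 / 2 * k (fst z) (snd z))"
      using k0 by (simp add: ennreal_plus[symmetric] distrib_right del: ennreal_plus)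
  qed
  also have "\<dots> = (\<integral>\<^sup>+ a. \<integral>\<^sup>+ b. ennreal ((cmod (h a))\<^sup>2 / 2 * k a b) \<partial>\<mu> \<partial>\<mu>) + (\<integral>\<^sup>+ b. \<integral>\<^sup>+ a. ennreal ((cmod (h b))\<^sup>2 / 2 * k a b) \<partial>\<mu> \<partial>\<mu>)"
  proof (subst nn_integral_add)
    have 1: "(\<integral>\<^sup>+ z. ennreal ((cmod (h (fst z)))\<^sup>2 / 2 * k (fst z) (snd z)) \<partial>(\<mu> \<Otimes>\<^sub>M \<mu>)) = (\<integral>\<^sup>+ a. \<integral>\<^sup>+ b. ennreal ((cmod (h a))\<^sup>2 / 2 * k a b) \<partial>\<mu> \<partial>\<mu>)"
      by (subst \<mu>.nn_integral_fst[symmetric]) auto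
    have 2: "(\<integral>\<^sup>+ z. ennreal ((cmod (h (snd z)))\<^sup>2 / 2 * k (fst z) (snd z)) \<partial>(\<mu> \<Otimes>\<^sub>M \<mu>)) = (\<integral>\<^sup>+ b. \<integral>\<^sup>+ a. ennreal ((cmod (h b))\<^sup>2 / 2 * k a b) \<partial>\<mu> \<partial>\<mu>)"
      by (subst \<mu>\<mu>.nn_integral_snd[symmetric]) auto
    show "(\<integral>\<^sup>+ z. ennreal ((cmod (h (fst z)))\<^sup>2 / 2 * k (fst z) (snd z)) \<partial>(\<mu> \<Otimes>\<^sub>M \<mu>)) + (\<integral>\<^sup>+ z. ennreal ((cmod (h (snd z)))\<^sup>2 / 2 * k (fst z) (snd z)) \<partial>(\<mu> \<Otimes>\<^sub>M \<mu>)) =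
      (\<integral>\<^sup>+ a. \<integral>\<^sup>+ b. ennreal ((cmod (h a))\<^sup>2 / 2 * k a b) \<partial>\<mu> \<partial>\<mu>) + (\<integral>\<^sup>+ b. \<integral>\<^sup>+ a. ennreal ((cmod (h b))\<^sup>2 / 2 * k a b) \<partial>\<mu> \<partial>\<mu>)"
      unfolding 1 2 ..
  qed measurable
  also have "(\<integral>\<^sup>+ b. \<integral>\<^sup>+ a. ennreal ((cmod (h b))\<^sup>2 / 2 * k a b) \<partial>\<mu> \<partial>\<mu>) = (\<integral>\<^sup>+ a. \<integral>\<^sup>+ b. ennreal ((cmod (h a))\<^sup>2 / 2 * k a b) \<partial>\<mu> \<partial>\<mu>)"
    by (subst ksym) simp
  also have "(\<integral>\<^sup>+ a. \<integral>\<^sup>+ b. ennreal ((cmod (h a))\<^sup>2 / 2 * k a b) \<partial>\<mu> \<partial>\<mu>) + (\<integral>\<^sup>+ a. \<integral>\<^sup>+ b. ennreal ((cmod (h a))\<^sup>2 / 2 * k a b) \<partial>\<mu> \<partial>\<mu>)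
      = (\<integral>\<^sup>+ a. 2 * (\<integral>\<^sup>+ b. ennreal ((cmod (h a))\<^sup>2 / 2 * k a b) \<partial>\<mu>) \<partial>\<mu>)"
    by (subst nn_integral_cmult) (auto simp: mult_2)
  also have "\<dots> \<le> (\<integral>\<^sup>+ a. B * ennreal ((cmod (h a))\<^sup>2) \<partial>\<mu>)"
  proof (intro nn_integral_mono)
    fix a assume a: "a \<in> space \<mu>"
    have [measurable]: "k a \<in> borel_measurable \<mu>" using measurable_compose[OF measurable_Pair1'[OF a] k] by simp
    show "2 * (\<integral>\<^sup>+ b. ennreal ((cmod (h a))\<^sup>2 / 2 * k a b) \<partial>\<mu>) \<le> B * ennreal ((cmod (h a))\<^sup>2)"
    proof (cases "a \<in> A")
      case True
      have "2 * (\<integral>\<^sup>+ b. ennreal ((cmod (h a))\<^sup>2 / 2 * k a b) \<partial>\<mu>) = ennreal 2 * ennreal ((cmod (h a))\<^sup>2 / 2) * (\<integral>\<^sup>+ b. ennreal (k a b) \<partial>\<mu>)"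
        using k0 by (subst ennreal_mult) (auto simp: nn_integral_cmult mult.assoc)
      also have "ennreal 2 * ennreal ((cmod (h a))\<^sup>2 / 2) = ennreal ((cmod (h a))\<^sup>2)"
        by (subst ennreal_mult[symmetric]) auto
      also have "\<dots> * (\<integral>\<^sup>+ b. ennreal (k a b) \<partial>\<mu>) \<le> ennreal ((cmod (h a))\<^sup>2) * B"
        using kB[OF True] by (intro mult_left_mono) auto
      finally show ?thesis by (simp add: mult.commute)
    next
      case False
      then show ?thesis using A by simp
    qed
  qed
  also have "\<dots> = B * (\<integral>\<^sup>+ a. ennreal ((cmod (h a))\<^sup>2) \<partial>\<mu>)" by (rule nn_integral_cmult) measurable
  finally show ?thesis unfolding S_def .
qed

lemma gauss_mult_gauss:
  assumes "0 < \<sigma>"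
  shows "gauss \<sigma> y * gauss \<sigma> x = 2 * pi / \<sigma>\<^sup>2 * exp (- ((y\<^sup>2 + x\<^sup>2) / (2 * \<sigma>\<^sup>2)))"
proof -
  have 1: "sqrt (2 * pi) / \<sigma> * (sqrt (2 * pi) / \<sigma>) = 2 * pi / \<sigma>\<^sup>2"
    by (simp add: power2_eq_square)
  have 2: "- (y / \<sigma>)\<^sup>2 / 2 + - (x / \<sigma>)\<^sup>2 / 2 = - ((y\<^sup>2 + x\<^sup>2) / (2 * \<sigma>\<^sup>2))"
    by (simp add: power_divide add_divide_distrib mult.commute[of 2])
  have "gauss \<sigma> y * gauss \<sigma> x = (sqrt (2 * pi) / \<sigma> * (sqrt (2 * pi) / \<sigma>)) * (exp (- (y / \<sigma>)\<^sup>2 / 2) * exp (- (x / \<sigma>)\<^sup>2 / 2))"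
    by (simp add: gauss_def)
  then show ?thesis unfolding 1 exp_add[symmetric] 2 .
qed

lemma gauss_commute: "gauss \<sigma> (a - b) = gauss \<sigma> (b - a)"
  by (simp add: gauss_def power_divide power2_commute)

lemma exp_gauss_LIMSEQ: "(\<lambda>n. exp (- (t / real (Suc n))\<^sup>2 / 2)) \<longlonglongrightarrow> 1"
proof -
  have "(\<lambda>n. t / real (Suc n)) \<longlonglongrightarrow> 0"
    using tendsto_mult[OF tendsto_const[of t] LIMSEQ_inverse_real_of_nat] by (simp add: divide_inverse)
  then have "(\<lambda>n. exp (- (t / real (Suc n))\<^sup>2 / 2)) \<longlonglongrightarrow> exp (- 0\<^sup>2 / 2)"
    by (intro tendsto_intros) auto
  then show ?thesis by simp
qed

lemma finite_measure_gauss_density: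
  assumes \<sigma>: "0 < \<sigma>"
  shows "finite_measure (density lborel (\<lambda>t::real. ennreal (exp (- (\<sigma> * t)\<^sup>2 / 2))))"
proof
  have "(\<integral>\<^sup>+ t. ennreal (exp (- (\<sigma> * t)\<^sup>2 / 2)) \<partial>lborel) = ennreal (LINT t|lborel. exp (- (\<sigma> * t)\<^sup>2 / 2))"
    by (intro nn_integral_eq_integral integrable_exp_gauss \<sigma>) auto
  then show "emeasure (density lborel (\<lambda>t::real. ennreal (exp (- (\<sigma> * t)\<^sup>2 / 2)))) (space (density lborel (\<lambda>t::real. ennreal (exp (- (\<sigma> * t)\<^sup>2 / 2))))) \<noteq> \<infinity>"
    by (simp add: emeasure_density)
qed

text \<open>The TT* argument exchanges integrals over a finite measure, which is obtained by a
  Gaussian weight in the dual variables. The weight increases to 1, and by monotone convergence a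
  bound independent of \<open>n\<close> carries over to the unweighted integral.\<close>

lemma nn_integral_gauss_limit:
  assumes [measurable]: "f \<in> borel_measurable M" "g \<in> borel_measurable M"
    and le: "\<And>n. (\<integral>\<^sup>+ x. ennreal (exp (- (g x / real (Suc n))\<^sup>2 / 2)) * f x \<partial>M) \<le> C"
  shows "(\<integral>\<^sup>+ x. f x \<partial>M) \<le> C"
proof (rule LIMSEQ_le_const2)
  show "(\<lambda>n. \<integral>\<^sup>+ x. ennreal (exp (- (g x / real (Suc n))\<^sup>2 / 2)) * f x \<partial>M) \<longlonglongrightarrow> (\<integral>\<^sup>+ x. f x \<partial>M)"
  proof (rule nn_integral_LIMSEQ)
    show "incseq (\<lambda>n x. ennreal (exp (- (g x / real (Suc n))\<^sup>2 / 2)) * f x)"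
      by (auto simp: incseq_def le_fun_def power_divide intro!: mult_right_mono ennreal_leI divide_left_mono divide_right_mono power_mono mult_pos_pos)
    fix x
    have "(\<lambda>n. ennreal (exp (- (g x / real (Suc n))\<^sup>2 / 2)) * f x) \<longlonglongrightarrow> ennreal 1 * f x"
      by (intro tendsto_mult_ennreal tendsto_ennrealI exp_gauss_LIMSEQ tendsto_const) auto
    then show "(\<lambda>n. ennreal (exp (- (g x / real (Suc n))\<^sup>2 / 2)) * f x) \<longlonglongrightarrow> f x" by simp
  qed measurable
qed (use le in auto)

text \<open>The TT* kernel is \<open>gauss \<sigma> (a\<^sup>2 - b\<^sup>2)\<close>. On the support
  a + b \<ge> m, hence |a^2 - b^2| \<ge> m |a - b|, and the kernel is dominated by
  \<open>gauss (\<sigma> / m) (a - b) / m\<close>. The integral of the latter is 2 pi / m for every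
  \<sigma>, so the bound is uniform while the regularisation is removed.\<close>

lemma plancherel_parabola:
  fixes F :: "real \<Rightarrow> complex"
  assumes F: "integrable lborel F" and m: "0 < m" and supp: "\<And>s. s < m \<Longrightarrow> F s = 0"
  shows "(\<integral>\<^sup>+ t. ennreal ((cmod (LINT s|lborel. F s * cis (t * s\<^sup>2)))\<^sup>2) \<partial>lborel)
    \<le> ennreal (2 * pi / m) * (\<integral>\<^sup>+ s. ennreal ((cmod (F s))\<^sup>2) \<partial>lborel)"
proof (rule nn_integral_gauss_limit[where g="\<lambda>t. t"])
  have [measurable]: "F \<in> borel_measurable borel" using F by auto
  show [measurable]: "(\<lambda>t. ennreal ((cmod (LINT s|lborel. F s * cis (t * s\<^sup>2)))\<^sup>2)) \<in> borel_measurable lborel"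
    by measurable
  fix n
  define \<sigma> where "\<sigma> = 1 / real (Suc n)"
  have \<sigma>: "0 < \<sigma>" by (simp add: \<sigma>_def)
  let ?\<nu> = "density lborel (\<lambda>t::real. ennreal (exp (- (\<sigma> * t)\<^sup>2 / 2)))"
  have "(\<integral>\<^sup>+ t. ennreal (exp (- (t / real (Suc n))\<^sup>2 / 2)) * ennreal ((cmod (LINT s|lborel. F s * cis (t * s\<^sup>2)))\<^sup>2) \<partial>lborel)
    = (\<integral>\<^sup>+ t. ennreal ((cmod (LINT s|lborel. F s * cis (t * s\<^sup>2)))\<^sup>2) \<partial>?\<nu>)"
    by (subst nn_integral_density) (simp_all add: \<sigma>_def)
  also have "\<dots> \<le> ennreal (2 * pi / m) * (\<integral>\<^sup>+ s. ennreal ((cmod (F s))\<^sup>2) \<partial>lborel)"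
  proof (rule schur_test_TTstar[where A="{m..}" and k="\<lambda>a b. gauss (\<sigma> / m) (a - b) / m"])
    show "sigma_finite_measure (lborel :: real measure)" ..
    show "finite_measure ?\<nu>" by (rule finite_measure_gauss_density[OF \<sigma>])
    show "(\<lambda>(y, a). cis (y * a\<^sup>2)) \<in> borel_measurable (?\<nu> \<Otimes>\<^sub>M lborel)"
      by measurable
    show "0 \<le> gauss (\<sigma> / m) (a - b) / m" for a b using m \<sigma> by (intro divide_nonneg_nonneg gauss_nonneg) auto
    show "gauss (\<sigma> / m) (a - b) / m = gauss (\<sigma> / m) (b - a) / m" for a b by (simp only: gauss_commute[of _ a b])
    show "(\<integral>\<^sup>+ b. ennreal (gauss (\<sigma> / m) (a - b) / m) \<partial>lborel) \<le> ennreal (2 * pi / m)" for a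
    proof -
      have "(\<integral>\<^sup>+ b. ennreal (gauss (\<sigma> / m) (a - b) / m) \<partial>lborel) = (\<integral>\<^sup>+ b. ennreal (1 / m) * ennreal (gauss (\<sigma> / m) (a - b)) \<partial>lborel)"
        using m \<sigma> by (intro nn_integral_cong) (simp add: ennreal_mult[symmetric] gauss_nonneg)
      also have "\<dots> = ennreal (1 / m) * ennreal (2 * pi)"
        using m \<sigma> by (subst nn_integral_cmult) (simp_all add: nn_integral_gauss)
      finally show ?thesis using m by (simp add: ennreal_mult[symmetric])
    qed
    fix a b assume "a \<in> {m..}" "b \<in> {m..}"
    then have ab: "m \<le> a" "m \<le> b" by auto
    have "(LINT y|?\<nu>. cis (y * a\<^sup>2) * cnj (cis (y * b\<^sup>2))) = (LINT t|lborel. exp (- (\<sigma> * t)\<^sup>2 / 2) *\<^sub>R (cis (t * a\<^sup>2) * cnj (cis (t * b\<^sup>2))))"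
      by (subst integral_density) auto
    also have "\<dots> = (LINT t|lborel. complex_of_real (exp (- (\<sigma> * t)\<^sup>2 / 2)) * cis (t * (a\<^sup>2 - b\<^sup>2)))"
      by (intro Bochner_Integration.integral_cong refl) (simp add: scaleR_conv_of_real cis_cnj cis_mult algebra_simps)
    also have "\<dots> = complex_of_real (gauss \<sigma> (a\<^sup>2 - b\<^sup>2))" by (rule gauss_fourier[OF \<sigma>])
    finally have "cmod (LINT y|?\<nu>. cis (y * a\<^sup>2) * cnj (cis (y * b\<^sup>2))) = gauss \<sigma> (a\<^sup>2 - b\<^sup>2)"
      using gauss_nonneg[OF \<sigma>] by simp
    also have "\<dots> \<le> gauss (\<sigma> / m) (a - b) / m"
    proof -
      have "\<bar>m * (a - b)\<bar> \<le> \<bar>(a + b) * (a - b)\<bar>"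
        unfolding abs_mult using ab m by (intro mult_right_mono) auto
      then have "(m * (a - b))\<^sup>2 \<le> (a\<^sup>2 - b\<^sup>2)\<^sup>2"
        by (simp add: abs_le_square_iff power2_eq_square algebra_simps)
      then have "(m * (a - b))\<^sup>2 / \<sigma>\<^sup>2 / 2 \<le> (a\<^sup>2 - b\<^sup>2)\<^sup>2 / \<sigma>\<^sup>2 / 2"
        by (intro divide_right_mono) auto
      then show ?thesis
        using m \<sigma> by (simp add: gauss_def power_divide power_mult_distrib field_simps)
    qed
    finally show "cmod (LINT y|?\<nu>. cis (y * a\<^sup>2) * cnj (cis (y * b\<^sup>2))) \<le> gauss (\<sigma> / m) (a - b) / m" .
  qed (use F supp in auto)
  finally show "(\<integral>\<^sup>+ t. ennreal (exp (- (t / real (Suc n))\<^sup>2 / 2)) * ennreal ((cmod (LINT s|lborel. F s * cis (t * s\<^sup>2)))\<^sup>2) \<partial>lborel)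
    \<le> ennreal (2 * pi / m) * (\<integral>\<^sup>+ s. ennreal ((cmod (F s))\<^sup>2) \<partial>lborel)" .
qed simp

text \<open>The frequencies of the two factors are separated, so
  \<open>(s, s') \<mapsto> (s\<^sup>2 + s'\<^sup>2, e s + e' s')\<close> is bi-Lipschitz from below on the supports.\<close>
lemma transversality:
  fixes s s' u u' e e' :: real
  assumes "1 \<le> s" "1 \<le> u" "0 \<le> s'" "s' \<le> 1/2" "0 \<le> u'" "u' \<le> 1/2" and e: "e = 1 \<or> e = -1" and e': "e' = 1 \<or> e' = -1"
  shows "(s - u)\<^sup>2 + (s' - u')\<^sup>2 \<le> 9 * (((s\<^sup>2 + s'\<^sup>2) - (u\<^sup>2 + u'\<^sup>2))\<^sup>2 + ((e * s + e' * s') - (e * u + e' * u'))\<^sup>2)"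
proof -
  define a b where "a = s - u" and "b = s' - u'"
  define x y where "x = (e * s + e' * s') - (e * u + e' * u')" and "y = (s\<^sup>2 + s'\<^sup>2) - (u\<^sup>2 + u'\<^sup>2)"
  have e1: "\<bar>e\<bar> = 1" "\<bar>e'\<bar> = 1" "e * e = 1" "e' * e' = 1" using e e' by auto
  have x: "x = e * a + e' * b" and y: "y = a * (s + u) + b * (s' + u')"
    by (simp_all add: x_def y_def a_def b_def algebra_simps power2_eq_square)
  \<comment> \<open>The combination of \<open>x\<close> and \<open>y\<close> that eliminates
    \<open>b\<close>. The remaining coefficient of \<open>a\<close> is at least 1, because
    \<open>s + u\<close> is at least 2 and \<open>s' + u'\<close> at most 1: this is where the
    separation of the frequencies enters.\<close>
  have "y - e' * (s' + u') * x = a * (s + u) + b * (s' + u') - e' * e * ((s' + u') * a) - (e' * e') * ((s' + u') * b)"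
    unfolding x y by (simp add: algebra_simps)
  then have eq: "y - e' * (s' + u') * x = a * ((s + u) - e' * e * (s' + u'))"
    using e1 by (simp add: algebra_simps)
  have "e' * e * (s' + u') \<le> 1" using e e' assms by auto
  then have ge: "1 \<le> (s + u) - e' * e * (s' + u')" using assms by linarith
  then have "\<bar>a\<bar> * 1 \<le> \<bar>a\<bar> * \<bar>(s + u) - e' * e * (s' + u')\<bar>" by (intro mult_left_mono) auto
  also have "\<dots> = \<bar>y - e' * (s' + u') * x\<bar>" unfolding eq abs_mult ..
  also have "\<dots> \<le> \<bar>y\<bar> + \<bar>s' + u'\<bar> * \<bar>x\<bar>"
    using abs_triangle_ineq4[of y "e' * (s' + u') * x"] e1 by (simp add: abs_mult)
  also have "\<dots> \<le> \<bar>y\<bar> + 1 * \<bar>x\<bar>" using assms by (intro add_left_mono mult_right_mono) auto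
  finally have a: "\<bar>a\<bar> \<le> \<bar>x\<bar> + \<bar>y\<bar>" by simp
  have "\<bar>b\<bar> = \<bar>x - e * a\<bar>" unfolding x using e1 by (simp add: abs_mult)
  also have "\<dots> \<le> \<bar>x\<bar> + \<bar>a\<bar>" using abs_triangle_ineq4[of x "e * a"] e1 by (simp add: abs_mult)
  finally have b: "\<bar>b\<bar> \<le> 2 * \<bar>x\<bar> + \<bar>y\<bar>" using a by linarith
  have "\<bar>a\<bar>\<^sup>2 + \<bar>b\<bar>\<^sup>2 \<le> (\<bar>x\<bar> + \<bar>y\<bar>)\<^sup>2 + (2 * \<bar>x\<bar> + \<bar>y\<bar>)\<^sup>2"
    using a b by (intro add_mono power_mono) auto
  also have "\<dots> = 5 * \<bar>x\<bar>\<^sup>2 + 2 * \<bar>y\<bar>\<^sup>2 + 3 * (2 * \<bar>x\<bar> * \<bar>y\<bar>)" by (simp add: power2_eq_square algebra_simps)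
  also have "\<dots> \<le> 5 * \<bar>x\<bar>\<^sup>2 + 2 * \<bar>y\<bar>\<^sup>2 + 3 * (\<bar>x\<bar>\<^sup>2 + \<bar>y\<bar>\<^sup>2)"
    by (intro add_left_mono mult_left_mono sum_squares_bound) auto
  also have "\<dots> \<le> 9 * (y\<^sup>2 + x\<^sup>2)" by simp
  finally show ?thesis by (simp add: a_def b_def x_def y_def)
qed

text \<open>The product of the two integrals is a single oscillatory integral over pairs (s, s')
  with amplitude F(s) G(s'), so Schur's test applies in two variables. Its kernel is a product of
  Gaussians in the differences of \<open>s\<^sup>2 + s'\<^sup>2\<close> and of
  \<open>e * s + e' * s'\<close>; \<open>transversality\<close> bounds it by a product of Gaussians
  in the differences of s and of s'. The constant is 9 (2 pi)^2.\<close>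

lemma bilinear_parabola:
  fixes F G :: "real \<Rightarrow> complex"
  assumes F: "integrable lborel F" and G: "integrable lborel G"
    and suppF: "\<And>s. s < 1 \<Longrightarrow> F s = 0" and suppG: "\<And>s. s < 0 \<or> 1/2 < s \<Longrightarrow> G s = 0"
    and e: "e = 1 \<or> e = -1" and e': "e' = 1 \<or> e' = -1"
  shows "(\<integral>\<^sup>+ z. ennreal ((cmod ((LINT s|lborel. F s * cis (fst z * s\<^sup>2 + snd z * (e * s))) *
        (LINT s|lborel. G s * cis (fst z * s\<^sup>2 + snd z * (e' * s)))))\<^sup>2) \<partial>(lborel \<Otimes>\<^sub>M lborel))
    \<le> ennreal (36 * pi\<^sup>2) * ((\<integral>\<^sup>+ s. ennreal ((cmod (F s))\<^sup>2) \<partial>lborel) * (\<integral>\<^sup>+ s. ennreal ((cmod (G s))\<^sup>2) \<partial>lborel))"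
proof -
  have [measurable]: "F \<in> borel_measurable borel" "G \<in> borel_measurable borel" using F G by auto
  let ?L2 = "lborel \<Otimes>\<^sub>M lborel :: (real \<times> real) measure"
  define h where "h = (\<lambda>a. F (fst a) * G (snd a))"
  define ph where "ph = (\<lambda>(z::real\<times>real) (a::real\<times>real). fst z * ((fst a)\<^sup>2 + (snd a)\<^sup>2) + snd z * (e * fst a + e' * snd a))"
  have h: "integrable ?L2 h" unfolding h_def by (rule lborel_pair.integrable_pair_mult[OF F G])
  have [measurable]: "h \<in> borel_measurable ?L2" using h by auto
  have prod: "(LINT s|lborel. F s * cis (fst z * s\<^sup>2 + snd z * (e * s))) * (LINT s|lborel. G s * cis (fst z * s\<^sup>2 + snd z * (e' * s)))
     = (LINT a|?L2. h a * cis (ph z a))" for z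
  proof -
    have "integrable lborel (\<lambda>s. F s * cis (fst z * s\<^sup>2 + snd z * (e * s)))"
      by (rule Bochner_Integration.integrable_bound[OF F]) (auto simp: norm_mult)
    moreover have "integrable lborel (\<lambda>s. G s * cis (fst z * s\<^sup>2 + snd z * (e' * s)))"
      by (rule Bochner_Integration.integrable_bound[OF G]) (auto simp: norm_mult)
    ultimately show ?thesis
      by (subst lborel_pair.integral_pair_mult[symmetric])
         (auto simp: h_def ph_def cis_mult[symmetric] algebra_simps intro!: Bochner_Integration.integral_cong)
  qed
  have nnprod: "(\<integral>\<^sup>+ a. ennreal ((cmod (h a))\<^sup>2) \<partial>?L2) = (\<integral>\<^sup>+ s. ennreal ((cmod (F s))\<^sup>2) \<partial>lborel) * (\<integral>\<^sup>+ s. ennreal ((cmod (G s))\<^sup>2) \<partial>lborel)"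
    by (subst lborel.nn_integral_fst[symmetric])
       (simp_all add: h_def norm_mult power_mult_distrib ennreal_mult nn_integral_cmult nn_integral_multc)
  have mS: "(\<lambda>z. ennreal ((cmod (LINT a|?L2. h a * cis (ph z a)))\<^sup>2)) \<in> borel_measurable ?L2"
    unfolding ph_def by measurable
  define w where "w n t = exp (- (t / real (Suc n))\<^sup>2 / 2)" for n t
  have w0: "0 \<le> w n t" for n t by (simp add: w_def)
  have [measurable]: "w n \<in> borel_measurable borel" for n by (simp add: w_def[abs_def])
  have fin: "finite_measure (density ?L2 (\<lambda>z. ennreal (w n (fst z) * w n (snd z))))" for n
  proof
    have "(\<integral>\<^sup>+ t. ennreal (w n t) \<partial>lborel) < \<infinity>"
      using finite_measure.emeasure_finite[OF finite_measure_gauss_density[of "1 / real (Suc n)"], of UNIV]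
      by (simp add: emeasure_density w_def less_top)
    then have "(\<integral>\<^sup>+ z. ennreal (w n (fst z) * w n (snd z)) \<partial>?L2) < \<infinity>"
      by (subst lborel.nn_integral_fst[symmetric])
         (simp_all add: ennreal_mult w0 nn_integral_cmult nn_integral_multc ennreal_mult_less_top)
    moreover have "emeasure (density ?L2 (\<lambda>z. ennreal (w n (fst z) * w n (snd z)))) (space (density ?L2 (\<lambda>z. ennreal (w n (fst z) * w n (snd z)))))
        = (\<integral>\<^sup>+ z. ennreal (w n (fst z) * w n (snd z)) \<partial>?L2)"
      by (subst emeasure_density) (use sets.top[of ?L2] in \<open>auto intro!: nn_integral_cong simp: space_pair_measure\<close>)
    ultimately show "emeasure (density ?L2 (\<lambda>z. ennreal (w n (fst z) * w n (snd z)))) (space (density ?L2 (\<lambda>z. ennreal (w n (fst z) * w n (snd z))))) \<noteq> \<infinity>"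
      by simp
  qed
  have main: "(\<integral>\<^sup>+ z. ennreal (w n (fst z) * w n (snd z)) * ennreal ((cmod (LINT a|?L2. h a * cis (ph z a)))\<^sup>2) \<partial>?L2)
      \<le> ennreal (36 * pi\<^sup>2) * (\<integral>\<^sup>+ a. ennreal ((cmod (h a))\<^sup>2) \<partial>?L2)" for n
  proof -
    define \<sigma> where "\<sigma> = 1 / real (Suc n)"
    have \<sigma>: "0 < \<sigma>" by (simp add: \<sigma>_def)
    have w: "w n t = exp (- (\<sigma> * t)\<^sup>2 / 2)" for t by (simp add: w_def \<sigma>_def)
    let ?\<nu> = "density ?L2 (\<lambda>z. ennreal (w n (fst z) * w n (snd z)))"
    \<comment> \<open>The loss of 9 in the squared distance means Gaussians three times as wide; the
      prefactor 9 restores their common peak value \<open>2 * pi / \<sigma>\<^sup>2\<close>.\<close>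
    let ?k = "\<lambda>a b. 9 * (gauss (3 * \<sigma>) (fst a - fst b) * gauss (3 * \<sigma>) (snd a - snd b))"
    have "(\<integral>\<^sup>+ z. ennreal (w n (fst z) * w n (snd z)) * ennreal ((cmod (LINT a|?L2. h a * cis (ph z a)))\<^sup>2) \<partial>?L2)
      = (\<integral>\<^sup>+ z. ennreal ((cmod (LINT a|?L2. h a * cis (ph z a)))\<^sup>2) \<partial>?\<nu>)"
      using mS by (subst nn_integral_density) simp_all
    also have "\<dots> \<le> ennreal (36 * pi\<^sup>2) * (\<integral>\<^sup>+ a. ennreal ((cmod (h a))\<^sup>2) \<partial>?L2)"
    proof (rule schur_test_TTstar[where A="{1..} \<times> {0..1/2}" and k="?k"])
      show "sigma_finite_measure ?L2" by (rule lborel_pair.sigma_finite_measure_axioms)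
      show "finite_measure ?\<nu>" by (rule fin)
      show "integrable ?L2 h" by (rule h)
      show "(\<lambda>(y, a). cis (ph y a)) \<in> borel_measurable (?\<nu> \<Otimes>\<^sub>M ?L2)"
        unfolding ph_def by measurable
      show "h a = 0" if "a \<notin> {1..} \<times> {0..1/2}" for a
        using that suppF[of "fst a"] suppG[of "snd a"] by (cases a) (auto simp: h_def not_le)
      show "0 \<le> ?k a b" for a b using \<sigma> by (simp add: gauss_nonneg)
      show "?k a b = ?k b a" for a b
        by (simp only: gauss_commute[of _ "fst a"] gauss_commute[of _ "snd a"])
      show "(\<lambda>(a, b). ?k a b) \<in> borel_measurable (?L2 \<Otimes>\<^sub>M ?L2)" by measurable
      show "(\<integral>\<^sup>+ b. ennreal (?k a b) \<partial>?L2) \<le> ennreal (36 * pi\<^sup>2)" for a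
      proof -
        have "(\<integral>\<^sup>+ b. ennreal (?k a b) \<partial>?L2) = (\<integral>\<^sup>+ b. ennreal 9 * (ennreal (gauss (3 * \<sigma>) (fst a - fst b)) * ennreal (gauss (3 * \<sigma>) (snd a - snd b))) \<partial>?L2)"
          using \<sigma> by (intro nn_integral_cong) (simp add: ennreal_mult gauss_nonneg)
        also have "\<dots> = ennreal 9 * (ennreal (2 * pi) * ennreal (2 * pi))"
          using \<sigma> by (subst lborel.nn_integral_fst[symmetric])
            (simp_all add: nn_integral_cmult nn_integral_multc nn_integral_gauss)
        also have "\<dots> = ennreal (36 * pi\<^sup>2)"
          by (simp add: ennreal_mult[symmetric] power2_eq_square del: ennreal_numeral)
        finally show ?thesis by simp
      qed
      fix a b :: "real \<times> real" assume "a \<in> {1..} \<times> {0..1/2::real}" "b \<in> {1..} \<times> {0..1/2::real}"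
      then have ab: "1 \<le> fst a" "0 \<le> snd a" "snd a \<le> 1/2" "1 \<le> fst b" "0 \<le> snd b" "snd b \<le> 1/2" by auto
      define Y X where "Y = ((fst a)\<^sup>2 + (snd a)\<^sup>2) - ((fst b)\<^sup>2 + (snd b)\<^sup>2)" and "X = (e * fst a + e' * snd a) - (e * fst b + e' * snd b)"
      have "(LINT z|?\<nu>. cis (ph z a) * cnj (cis (ph z b))) = (LINT z|?L2. (w n (fst z) * w n (snd z)) *\<^sub>R (cis (ph z a) * cnj (cis (ph z b))))"
        using w0 by (subst integral_density) (auto simp: ph_def)
      also have "\<dots> = (LINT z|?L2. (complex_of_real (w n (fst z)) * cis (fst z * Y)) * (complex_of_real (w n (snd z)) * cis (snd z * X)))"
        by (intro Bochner_Integration.integral_cong refl)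
           (simp add: scaleR_conv_of_real cis_cnj cis_mult ph_def X_def Y_def algebra_simps)
      also have "\<dots> = (LINT t|lborel. complex_of_real (w n t) * cis (t * Y)) * (LINT t|lborel. complex_of_real (w n t) * cis (t * X))"
      proof (rule lborel_pair.integral_pair_mult)
        have i: "integrable lborel (w n)" unfolding w by (rule integrable_exp_gauss[OF \<sigma>])
        show "integrable lborel (\<lambda>t. complex_of_real (w n t) * cis (t * Y))" for Y
          by (rule Bochner_Integration.integrable_bound[OF i]) (auto simp: norm_mult w0)
        then show "integrable lborel (\<lambda>t. complex_of_real (w n t) * cis (t * X))" .
      qed
      also have "\<dots> = complex_of_real (gauss \<sigma> Y * gauss \<sigma> X)"
        unfolding w using gauss_fourier[OF \<sigma>] by simp
      finally have "cmod (LINT z|?\<nu>. cis (ph z a) * cnj (cis (ph z b))) = gauss \<sigma> Y * gauss \<sigma> X"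
        using gauss_nonneg[OF \<sigma>] by (simp add: norm_mult)
      also have "\<dots> \<le> ?k a b"
      proof -
        have tr: "(fst a - fst b)\<^sup>2 + (snd a - snd b)\<^sup>2 \<le> 9 * (Y\<^sup>2 + X\<^sup>2)"
          unfolding X_def Y_def by (rule transversality) (use ab e e' in auto)
        have "(fst a - fst b)\<^sup>2 + (snd a - snd b)\<^sup>2 \<le> 9 * (Y\<^sup>2 + X\<^sup>2)" by (rule tr)
        then have "((fst a - fst b)\<^sup>2 + (snd a - snd b)\<^sup>2) / (2 * (3 * \<sigma>)\<^sup>2) \<le> (Y\<^sup>2 + X\<^sup>2) / (2 * \<sigma>\<^sup>2)"
          using \<sigma> by (simp add: power_mult_distrib divide_simps)
        then have "2 * pi / \<sigma>\<^sup>2 * exp (- ((Y\<^sup>2 + X\<^sup>2) / (2 * \<sigma>\<^sup>2)))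
            \<le> 2 * pi / \<sigma>\<^sup>2 * exp (- (((fst a - fst b)\<^sup>2 + (snd a - snd b)\<^sup>2) / (2 * (3 * \<sigma>)\<^sup>2)))"
          by (intro mult_left_mono) auto
        also have "\<dots> = 9 * (2 * pi / (3 * \<sigma>)\<^sup>2 * exp (- (((fst a - fst b)\<^sup>2 + (snd a - snd b)\<^sup>2) / (2 * (3 * \<sigma>)\<^sup>2))))"
          by (simp add: power_mult_distrib)
        finally have "gauss \<sigma> Y * gauss \<sigma> X \<le> ?k a b"
          using \<sigma> by (simp only: gauss_mult_gauss gauss_mult_gauss[of "3 * \<sigma>"] mult_pos_pos zero_less_numeral)
        then show ?thesis .
      qed
      finally show "cmod (LINT z|?\<nu>. cis (ph z a) * cnj (cis (ph z b))) \<le> ?k a b" .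
    qed simp
    finally show ?thesis .
  qed
  have "(\<integral>\<^sup>+ z. ennreal ((cmod (LINT a|?L2. h a * cis (ph z a)))\<^sup>2) \<partial>?L2) \<le> ennreal (36 * pi\<^sup>2) * (\<integral>\<^sup>+ a. ennreal ((cmod (h a))\<^sup>2) \<partial>?L2)"
  proof (rule nn_integral_gauss_limit[where g="\<lambda>z. sqrt ((fst z)\<^sup>2 + (snd z)\<^sup>2)"])
    fix n
    have "exp (- (sqrt ((fst z)\<^sup>2 + (snd z)\<^sup>2) / real (Suc n))\<^sup>2 / 2) = w n (fst z) * w n (snd z)" for z
      unfolding w_def by (simp add: power_divide add_divide_distrib flip: exp_add)
    then show "(\<integral>\<^sup>+ z. ennreal (exp (- (sqrt ((fst z)\<^sup>2 + (snd z)\<^sup>2) / real (Suc n))\<^sup>2 / 2)) * ennreal ((cmod (LINT a|?L2. h a * cis (ph z a)))\<^sup>2) \<partial>?L2)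
      \<le> ennreal (36 * pi\<^sup>2) * (\<integral>\<^sup>+ a. ennreal ((cmod (h a))\<^sup>2) \<partial>?L2)"
      using main[of n] by simp
  qed (use mS in measurable)
  then show ?thesis unfolding prod nnprod .
qed

section \<open>The Hausdorff-Young inequality\<close>

lemma nn_integral_powr_from_0:
  assumes "-1 < a" "0 \<le> (L::real)"
  shows "(\<integral>\<^sup>+ x. ennreal (x powr a) * indicator {0..L} x \<partial>lborel) = ennreal (L powr (a + 1) / (a + 1))"
  using has_integral_powr_from_0[OF assms]
  by (intro nn_integral_has_integral_lebesgue'[of _ "\<lambda>x. x powr a"]) auto

lemma nn_integral_powr_to_inf:
  assumes "a < -1" "0 < (L::real)"
  shows "(\<integral>\<^sup>+ x. ennreal (x powr a) * indicator {L..} x \<partial>lborel) = ennreal (- (L powr (a + 1)) / (a + 1))"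
  using has_integral_powr_to_inf[OF assms]
  by (intro nn_integral_has_integral_lebesgue'[of _ "\<lambda>x. x powr a"]) auto

text \<open>Marcinkiewicz interpolation between \<open>L\<^sup>1 \<rightarrow> L\<^sup>\<infinity>\<close> and \<open>L\<^sup>2 \<rightarrow> L\<^sup>2\<close>. At height \<open>\<lambda>\<close> the input is cut
  where \<open>\<lambda> \<bar>h\<bar>\<^sup>p\<^sup>-\<^sup>1 = 2\<close>: the large part then contributes at most \<open>\<lambda> / 2\<close> to the output.\<close>
lemma hausdorff_young_normalized:
  fixes e :: "real \<Rightarrow> real \<Rightarrow> complex" and h :: "real \<Rightarrow> complex"
  assumes e[measurable]: "(\<lambda>(t, s). e t s) \<in> borel_measurable (borel \<Otimes>\<^sub>M borel)"
    and e1: "\<And>t s. cmod (e t s) \<le> 1"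
    and L2: "\<And>h. integrable lborel h \<Longrightarrow> (\<And>s. s \<notin> A \<Longrightarrow> h s = 0) \<Longrightarrow>
      (\<integral>\<^sup>+ t. ennreal ((cmod (LINT s|lborel. h s * e t s))\<^sup>2) \<partial>lborel) \<le> ennreal B * (\<integral>\<^sup>+ s. ennreal ((cmod (h s))\<^sup>2) \<partial>lborel)"
    and p: "1 < p" "p < 2" and B: "0 \<le> B"
    and h: "integrable lborel h" and supp: "\<And>s. s \<notin> A \<Longrightarrow> h s = 0"
    and hp: "(\<integral>\<^sup>+ s. ennreal (cmod (h s) powr p) \<partial>lborel) \<le> 1"
  defines "P \<equiv> p / (p - 1)"
  shows "(\<integral>\<^sup>+ t. ennreal (cmod (LINT s|lborel. h s * e t s) powr P) \<partial>lborel) \<le> ennreal (2 powr (P + 1) * (B * (2 powr (P - 2) / (P - 2))))"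
proof -
  have P: "2 < P" using p by (simp add: P_def field_simps)
  have hm[measurable]: "h \<in> borel_measurable borel" using h by auto
  define h2 where "h2 l s = (if l * cmod (h s) powr (p - 1) \<le> 2 then h s else 0)" for l s
  have h2m[measurable]: "(\<lambda>(l, s). h2 l s) \<in> borel_measurable (borel \<Otimes>\<^sub>M borel)" unfolding h2_def by measurable
  have h2m'[measurable]: "h2 l \<in> borel_measurable borel" for l unfolding h2_def[abs_def] by measurable
  have em'[measurable]: "e t \<in> borel_measurable borel" for t
    using measurable_compose[OF measurable_Pair1' e] by simp
  have h2i: "integrable lborel (h2 l)" for l
    by (rule Bochner_Integration.integrable_bound[OF h]) (auto simp: h2_def)
  have ie: "integrable lborel (\<lambda>s. f s * e t s)" if "integrable lborel f" for f t
    by (rule Bochner_Integration.integrable_bound[OF that]) (use that in \<open>auto simp: norm_mult intro!: mult_left_le e1\<close>)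
  define T where "T t = cmod (LINT s|lborel. h s * e t s)" for t
  define T2 where "T2 l t = cmod (LINT s|lborel. h2 l s * e t s)" for l t
  have T2m[measurable]: "(\<lambda>(l, t). T2 l t) \<in> borel_measurable (borel \<Otimes>\<^sub>M borel)"
    unfolding T2_def by measurable
  have Tm[measurable]: "T \<in> borel_measurable borel"
    unfolding T_def[abs_def] by measurable
  have split: "T t - l / 2 \<le> T2 l t" if l: "0 < l" for t l
  proof -
    have "(\<integral>\<^sup>+ s. ennreal (cmod (h s - h2 l s)) \<partial>lborel) \<le> (\<integral>\<^sup>+ s. ennreal (l / 2) * ennreal (cmod (h s) powr p) \<partial>lborel)"
    proof (rule nn_integral_mono)
      fix s
      have "cmod (h s - h2 l s) \<le> l / 2 * cmod (h s) powr p"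
      proof (cases "l * cmod (h s) powr (p - 1) \<le> 2")
        case True
        then show ?thesis using l by (simp add: h2_def)
      next
        case False
        then have hs: "h s \<noteq> 0" using p by auto
        have "cmod (h s) * 1 \<le> cmod (h s) * (l / 2 * cmod (h s) powr (p - 1))"
          using False by (intro mult_left_mono) auto
        also have "\<dots> = l / 2 * cmod (h s) powr p"
          using hs by (simp add: powr_diff)
        finally show ?thesis using False by (simp add: h2_def)
      qed
      then show "ennreal (cmod (h s - h2 l s)) \<le> ennreal (l / 2) * ennreal (cmod (h s) powr p)"
        using l by (simp add: ennreal_mult[symmetric] ennreal_leI)
    qed
    also have "\<dots> \<le> ennreal (l / 2) * 1"
      using hp by (subst nn_integral_cmult) (auto simp del: mult_1_right intro!: mult_left_mono)
    finally have 1: "(\<integral>\<^sup>+ s. ennreal (cmod (h s - h2 l s)) \<partial>lborel) \<le> ennreal (l / 2)" by simp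
    have "ennreal (cmod (LINT s|lborel. (h s - h2 l s) * e t s)) \<le> (\<integral>\<^sup>+ s. ennreal (cmod ((h s - h2 l s) * e t s)) \<partial>lborel)"
      by (rule integral_norm_bound_ennreal) (intro ie Bochner_Integration.integrable_diff h h2i)
    also have "\<dots> \<le> (\<integral>\<^sup>+ s. ennreal (cmod (h s - h2 l s)) \<partial>lborel)"
      by (intro nn_integral_mono ennreal_leI) (auto simp: norm_mult intro!: mult_left_le e1)
    finally have "ennreal (cmod (LINT s|lborel. (h s - h2 l s) * e t s)) \<le> ennreal (l / 2)" using 1 by (rule order_trans)
    then have 2: "cmod (LINT s|lborel. (h s - h2 l s) * e t s) \<le> l / 2" using l by simp
    have "(LINT s|lborel. (h s - h2 l s) * e t s) = (LINT s|lborel. h s * e t s) - (LINT s|lborel. h2 l s * e t s)"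
      by (subst Bochner_Integration.integral_diff[symmetric]) (auto intro!: ie h h2i simp: left_diff_distrib)
    then show ?thesis using 2 norm_triangle_ineq2[of "LINT s|lborel. h s * e t s" "LINT s|lborel. h2 l s * e t s"]
      unfolding T_def T2_def by simp
  qed
  \<comment> \<open>A layer-cake bound that keeps only the heights between T/2 and T: there
    \<open>split\<close> gives \<open>T2 l t \<ge> T t - l / 2 \<ge> T t / 2\<close>. Writing
    l^(P-3) as l^(P-2) / l bounds it from below whatever the sign of P - 3.\<close>
  have pw: "ennreal (T t powr P) \<le> ennreal (2 powr (P + 1)) * (\<integral>\<^sup>+ l. ennreal (l powr (P - 3) * (T2 l t)\<^sup>2) * indicator {0<..} l \<partial>lborel)" for t
  proof (cases "T t = 0")
    case False
    define y where "y = T t"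
    have y: "0 < y" using False by (simp add: y_def T_def)
    have "ennreal (2 powr (- (P + 1)) * y powr P) = (\<integral>\<^sup>+ l. ennreal ((y / 2) powr (P - 2) / y * (y / 2)\<^sup>2) * indicator {y/2..y} l \<partial>lborel)"
    proof -
      have "(y / 2) powr (P - 2) / y * (y / 2)\<^sup>2 * (y / 2) = 2 powr (- (P + 1)) * y powr P"
        using y by (simp add: powr_divide powr_diff powr_minus powr_add power2_eq_square field_simps)
      then show ?thesis using y
        by (subst nn_integral_cmult_indicator) (simp_all add: ennreal_mult[symmetric])
    qed
    also have "\<dots> \<le> (\<integral>\<^sup>+ l. ennreal (l powr (P - 3) * (T2 l t)\<^sup>2) * indicator {0<..} l \<partial>lborel)"
    proof (rule nn_integral_mono)
      fix l
      show "ennreal ((y / 2) powr (P - 2) / y * (y / 2)\<^sup>2) * indicator {y/2..y} l \<le> ennreal (l powr (P - 3) * (T2 l t)\<^sup>2) * indicator {0<..} l"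
      proof (cases "l \<in> {y/2..y}")
        case True
        then have l: "0 < l" "y / 2 \<le> l" "l \<le> y" using y by auto
        have "(y / 2) powr (P - 2) / y \<le> l powr (P - 2) / l"
          using l y P by (intro frac_le powr_mono2) auto
        also have "\<dots> = l powr (P - 3)" using l by (simp add: powr_diff field_simps power2_eq_square power3_eq_cube)
        finally have 1: "(y / 2) powr (P - 2) / y \<le> l powr (P - 3)" .
        have "y / 2 \<le> T2 l t" using split[OF l(1), of t] l by (simp add: y_def)
        then have "(y / 2) powr (P - 2) / y * (y / 2)\<^sup>2 \<le> l powr (P - 3) * (T2 l t)\<^sup>2"
          using 1 y by (intro mult_mono power_mono) auto
        then show ?thesis using True l by (simp add: ennreal_leI)
      qed simp
    qed
    finally have "ennreal (2 powr (P + 1)) * ennreal (2 powr (- (P + 1)) * y powr P) \<le> ennreal (2 powr (P + 1)) * \<dots>"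
      by (rule mult_left_mono) simp
    moreover have "ennreal (2 powr (P + 1)) * ennreal (2 powr (- (P + 1)) * y powr P) = ennreal (T t powr P)"
      by (subst ennreal_mult[symmetric]) (auto simp: y_def mult.assoc[symmetric] simp flip: powr_add)
    ultimately show ?thesis by simp
  qed (use P in simp)
  have "(\<integral>\<^sup>+ t. ennreal (T t powr P) \<partial>lborel) \<le> (\<integral>\<^sup>+ t. ennreal (2 powr (P + 1)) * (\<integral>\<^sup>+ l. ennreal (l powr (P - 3) * (T2 l t)\<^sup>2) * indicator {0<..} l \<partial>lborel) \<partial>lborel)"
    by (intro nn_integral_mono pw)
  also have "\<dots> = ennreal (2 powr (P + 1)) * (\<integral>\<^sup>+ t. \<integral>\<^sup>+ l. ennreal (l powr (P - 3) * (T2 l t)\<^sup>2) * indicator {0<..} l \<partial>lborel \<partial>lborel)"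
    by (rule nn_integral_cmult) measurable
  also have "(\<integral>\<^sup>+ t. \<integral>\<^sup>+ l. ennreal (l powr (P - 3) * (T2 l t)\<^sup>2) * indicator {0<..} l \<partial>lborel \<partial>lborel)
      = (\<integral>\<^sup>+ l. \<integral>\<^sup>+ t. ennreal (l powr (P - 3) * (T2 l t)\<^sup>2) * indicator {0<..} l \<partial>lborel \<partial>lborel)"
    by (rule lborel_pair.Fubini') measurable
  also have "\<dots> \<le> (\<integral>\<^sup>+ l. \<integral>\<^sup>+ s. ennreal B * (ennreal (l powr (P - 3) * (cmod (h2 l s))\<^sup>2) * indicator {0<..} l) \<partial>lborel \<partial>lborel)"
  proof (rule nn_integral_mono)
    fix l :: real
    have "(\<integral>\<^sup>+ t. ennreal (l powr (P - 3) * (T2 l t)\<^sup>2) * indicator {0<..} l \<partial>lborel) = ennreal (l powr (P - 3)) * indicator {0<..} l * (\<integral>\<^sup>+ t. ennreal ((T2 l t)\<^sup>2) \<partial>lborel)"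
      by (subst nn_integral_cmult[symmetric]) (auto simp: ennreal_mult mult_ac)
    also have "\<dots> \<le> ennreal (l powr (P - 3)) * indicator {0<..} l * (ennreal B * (\<integral>\<^sup>+ s. ennreal ((cmod (h2 l s))\<^sup>2) \<partial>lborel))"
      unfolding T2_def by (intro mult_left_mono L2 h2i) (auto simp: h2_def supp)
    also have "\<dots> = (\<integral>\<^sup>+ s. (ennreal (l powr (P - 3)) * indicator {0<..} l * ennreal B) * ennreal ((cmod (h2 l s))\<^sup>2) \<partial>lborel)"
      by (subst nn_integral_cmult) (auto simp: mult.assoc)
    also have "\<dots> = (\<integral>\<^sup>+ s. ennreal B * (ennreal (l powr (P - 3) * (cmod (h2 l s))\<^sup>2) * indicator {0<..} l) \<partial>lborel)"
      by (intro nn_integral_cong) (auto simp: ennreal_mult mult_ac)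
    finally show "(\<integral>\<^sup>+ t. ennreal (l powr (P - 3) * (T2 l t)\<^sup>2) * indicator {0<..} l \<partial>lborel)
        \<le> (\<integral>\<^sup>+ s. ennreal B * (ennreal (l powr (P - 3) * (cmod (h2 l s))\<^sup>2) * indicator {0<..} l) \<partial>lborel)" .
  qed
  also have "\<dots> = (\<integral>\<^sup>+ s. \<integral>\<^sup>+ l. ennreal B * (ennreal (l powr (P - 3) * (cmod (h2 l s))\<^sup>2) * indicator {0<..} l) \<partial>lborel \<partial>lborel)"
    by (rule lborel_pair.Fubini') measurable
  also have "\<dots> \<le> (\<integral>\<^sup>+ s. ennreal (B * (2 powr (P - 2) / (P - 2))) * ennreal (cmod (h s) powr p) \<partial>lborel)"
  proof (rule nn_integral_mono)
    fix s :: real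
    show "(\<integral>\<^sup>+ l. ennreal B * (ennreal (l powr (P - 3) * (cmod (h2 l s))\<^sup>2) * indicator {0<..} l) \<partial>lborel) \<le> ennreal (B * (2 powr (P - 2) / (P - 2))) * ennreal (cmod (h s) powr p)"
    proof (cases "h s = 0")
      case False
      define z where "z = cmod (h s)"
      have z: "0 < z" using False by (simp add: z_def)
      \<comment> \<open>For fixed \<open>s\<close> the cut becomes an upper bound \<open>L\<close>
        for the height \<open>l\<close>. Integrating l^(P-3) up to \<open>L\<close> gives a multiple
        of L^(P-2), and since (1 - p)(P - 2) = p - 2 this turns the square of |h| into its power
        \<open>p\<close>.\<close>
      define L where "L = 2 * z powr (1 - p)"
      have L: "0 < L" using z by (simp add: L_def)
      have iff: "l * z powr (p - 1) \<le> 2 \<longleftrightarrow> l \<le> L" for l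
        using z by (simp add: L_def powr_diff field_simps)
      have "(\<integral>\<^sup>+ l. ennreal B * (ennreal (l powr (P - 3) * (cmod (h2 l s))\<^sup>2) * indicator {0<..} l) \<partial>lborel)
        \<le> (\<integral>\<^sup>+ l. ennreal (B * z\<^sup>2) * (ennreal (l powr (P - 3)) * indicator {0..L} l) \<partial>lborel)"
        using B by (intro nn_integral_mono)
          (auto simp: h2_def iff indicator_def ennreal_mult[symmetric] z_def[symmetric])
      also have "\<dots> = ennreal (B * z\<^sup>2) * ennreal (L powr (P - 3 + 1) / (P - 3 + 1))"
        using P L by (subst nn_integral_cmult) (auto simp: nn_integral_powr_from_0)
      also have "\<dots> = ennreal (B * (2 powr (P - 2) / (P - 2)) * z powr p)"
      proof -
        have "(1 - p) * (P - 2) = p - 2" using p by (simp add: P_def field_simps)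
        then have "L powr (P - 2) = 2 powr (P - 2) * z powr (p - 2)"
          using z by (simp add: L_def powr_mult powr_powr)
        moreover have "z powr p = z powr (p - 2) * z\<^sup>2"
          using z by (simp add: powr_diff)
        ultimately show ?thesis using B P by (simp add: ennreal_mult[symmetric] mult_ac)
      qed
      also have "\<dots> = ennreal (B * (2 powr (P - 2) / (P - 2))) * ennreal (cmod (h s) powr p)"
        unfolding z_def using B P by (intro ennreal_mult) auto
      finally show ?thesis .
    qed (simp add: h2_def)
  qed
  also have "\<dots> \<le> ennreal (B * (2 powr (P - 2) / (P - 2))) * 1"
    using hp by (subst nn_integral_cmult) (auto simp del: mult_1_right intro!: mult_left_mono)
  finally have "(\<integral>\<^sup>+ t. ennreal (T t powr P) \<partial>lborel) \<le> ennreal (2 powr (P + 1)) * ennreal (B * (2 powr (P - 2) / (P - 2)))"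
    by (simp add: mult_left_mono)
  also have "\<dots> = ennreal (2 powr (P + 1) * (B * (2 powr (P - 2) / (P - 2))))"
    using B P by (intro ennreal_mult[symmetric]) auto
  finally show ?thesis unfolding T_def .
qed

theorem hausdorff_young:
  fixes e :: "real \<Rightarrow> real \<Rightarrow> complex" and h :: "real \<Rightarrow> complex"
  assumes e: "(\<lambda>(t, s). e t s) \<in> borel_measurable (borel \<Otimes>\<^sub>M borel)"
    and e1: "\<And>t s. cmod (e t s) \<le> 1"
    and L2: "\<And>h. integrable lborel h \<Longrightarrow> (\<And>s. s \<notin> A \<Longrightarrow> h s = 0) \<Longrightarrow>
      (\<integral>\<^sup>+ t. ennreal ((cmod (LINT s|lborel. h s * e t s))\<^sup>2) \<partial>lborel) \<le> ennreal B * (\<integral>\<^sup>+ s. ennreal ((cmod (h s))\<^sup>2) \<partial>lborel)"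
    and p: "1 < p" "p < 2" and B: "0 \<le> B"
    and h: "integrable lborel h" and supp: "\<And>s. s \<notin> A \<Longrightarrow> h s = 0"
    and N: "0 < N" and hp: "(\<integral>\<^sup>+ s. ennreal (cmod (h s) powr p) \<partial>lborel) \<le> ennreal (N powr p)"
  defines "P \<equiv> p / (p - 1)"
  shows "(\<integral>\<^sup>+ t. ennreal (cmod (LINT s|lborel. h s * e t s) powr P) \<partial>lborel)
    \<le> ennreal (2 powr (P + 1) * (B * (2 powr (P - 2) / (P - 2))) * N powr P)"
proof -
  have P: "2 < P" using p by (simp add: P_def field_simps)
  let ?g = "\<lambda>s. h s / complex_of_real N"
  have hm[measurable]: "h \<in> borel_measurable borel" using h by auto
  note e[measurable]
  have hTm: "(\<lambda>t. cmod (LINT s|lborel. h s * e t s) powr P / N powr P) \<in> borel_measurable borel"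
    by measurable
  have "(\<integral>\<^sup>+ t. ennreal (cmod (LINT s|lborel. ?g s * e t s) powr P) \<partial>lborel) \<le> ennreal (2 powr (P + 1) * (B * (2 powr (P - 2) / (P - 2))))"
    unfolding P_def
  proof (rule hausdorff_young_normalized[OF e e1 L2 p B])
    have "(\<integral>\<^sup>+ s. ennreal (cmod (?g s) powr p) \<partial>lborel) = (\<integral>\<^sup>+ s. ennreal (N powr - p) * ennreal (cmod (h s) powr p) \<partial>lborel)"
      using N by (intro nn_integral_cong) (simp add: norm_divide powr_divide powr_minus ennreal_mult[symmetric] field_simps)
    also have "\<dots> = ennreal (N powr - p) * (\<integral>\<^sup>+ s. ennreal (cmod (h s) powr p) \<partial>lborel)"
      by (rule nn_integral_cmult) measurable
    also have "\<dots> \<le> ennreal (N powr - p) * ennreal (N powr p)" using hp by (intro mult_left_mono) auto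
    also have "\<dots> = 1" using N by (subst ennreal_mult[symmetric]) (auto simp: powr_minus)
    finally show "(\<integral>\<^sup>+ s. ennreal (cmod (?g s) powr p) \<partial>lborel) \<le> 1" .
  qed (use h supp in auto)
  then have "ennreal (N powr P) * (\<integral>\<^sup>+ t. ennreal (cmod (LINT s|lborel. ?g s * e t s) powr P) \<partial>lborel)
     \<le> ennreal (N powr P) * ennreal (2 powr (P + 1) * (B * (2 powr (P - 2) / (P - 2))))"
    by (rule mult_left_mono) simp
  moreover have "ennreal (N powr P) * (\<integral>\<^sup>+ t. ennreal (cmod (LINT s|lborel. ?g s * e t s) powr P) \<partial>lborel)
      = (\<integral>\<^sup>+ t. ennreal (cmod (LINT s|lborel. h s * e t s) powr P) \<partial>lborel)"
    using N by (subst nn_integral_cmult[symmetric])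
      (auto intro!: nn_integral_cong simp: norm_divide powr_divide ennreal_mult[symmetric] hTm)
  ultimately show ?thesis using B P by (simp add: ennreal_mult[symmetric] mult_ac)
qed

text \<open>Young's inequality with the weights that are optimal for norms \<open>a\<close> and
  \<open>b\<close>; in this form upper bounds for the two norms are all that enters, and the
  integrals may be handled as extended reals.\<close>

lemma nn_integral_Cauchy_Schwarz_bound:
  fixes f g :: "'a \<Rightarrow> real"
  assumes [measurable]: "f \<in> borel_measurable M" "g \<in> borel_measurable M"
    and ab: "0 < a" "0 < b"
    and f: "(\<integral>\<^sup>+ x. ennreal ((f x)\<^sup>2) \<partial>M) \<le> ennreal (a\<^sup>2)" and g: "(\<integral>\<^sup>+ x. ennreal ((g x)\<^sup>2) \<partial>M) \<le> ennreal (b\<^sup>2)"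
  shows "(\<integral>\<^sup>+ x. ennreal (f x * g x) \<partial>M) \<le> ennreal (a * b)"
proof -
  have "(\<integral>\<^sup>+ x. ennreal (f x * g x) \<partial>M) \<le> (\<integral>\<^sup>+ x. ennreal (b / (2 * a)) * ennreal ((f x)\<^sup>2) + ennreal (a / (2 * b)) * ennreal ((g x)\<^sup>2) \<partial>M)"
  proof (rule nn_integral_mono)
    fix x
    have "0 \<le> (b * f x - a * g x)\<^sup>2" by simp
    then have "2 * (a * b) * (f x * g x) \<le> b\<^sup>2 * (f x)\<^sup>2 + a\<^sup>2 * (g x)\<^sup>2"
      by (simp add: power2_diff power_mult_distrib mult_ac)
    then have "f x * g x \<le> (b\<^sup>2 * (f x)\<^sup>2 + a\<^sup>2 * (g x)\<^sup>2) / (2 * (a * b))"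
      using ab by (simp add: field_simps)
    also have "\<dots> = b / (2 * a) * (f x)\<^sup>2 + a / (2 * b) * (g x)\<^sup>2"
      using ab by (simp add: field_simps power2_eq_square)
    finally show "ennreal (f x * g x) \<le> ennreal (b / (2 * a)) * ennreal ((f x)\<^sup>2) + ennreal (a / (2 * b)) * ennreal ((g x)\<^sup>2)"
      using ab by (simp add: ennreal_mult[symmetric] ennreal_plus[symmetric] ennreal_leI del: ennreal_plus)
  qed
  also have "\<dots> = ennreal (b / (2 * a)) * (\<integral>\<^sup>+ x. ennreal ((f x)\<^sup>2) \<partial>M) + ennreal (a / (2 * b)) * (\<integral>\<^sup>+ x. ennreal ((g x)\<^sup>2) \<partial>M)"
    by (subst nn_integral_add) (simp_all add: nn_integral_cmult)
  also have "\<dots> \<le> ennreal (b / (2 * a)) * ennreal (a\<^sup>2) + ennreal (a / (2 * b)) * ennreal (b\<^sup>2)"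
    using f g by (intro add_mono mult_left_mono) auto
  also have "\<dots> = ennreal (a * b)"
    using ab by (simp add: ennreal_mult[symmetric] ennreal_plus[symmetric] power2_eq_square field_simps del: ennreal_plus)
  finally show ?thesis .
qed

section \<open>Hausdorff-Young for the parabola, with a bounded multiplier\<close>

lemma integrable_parabola:
  fixes F b :: "real \<Rightarrow> complex"
  assumes F: "integrable lborel F" and supp: "\<And>s. s \<notin> {m..2*m} \<Longrightarrow> F s = 0"
    and b[measurable]: "b \<in> borel_measurable borel" and bk: "\<And>s. s \<in> {m..2*m} \<Longrightarrow> cmod (b s) \<le> \<kappa>"
  shows "integrable lborel (\<lambda>s. F s * b s)"
proof (rule Bochner_Integration.integrable_bound)
  show "integrable lborel (\<lambda>s. \<kappa> * cmod (F s))" using F by simp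
  show "AE s in lborel. norm (F s * b s) \<le> norm (\<kappa> * cmod (F s))"
  proof (intro AE_I2)
    fix s
    show "norm (F s * b s) \<le> norm (\<kappa> * cmod (F s))"
    proof (cases "s \<in> {m..2*m}")
      case True
      then have "cmod (F s) * cmod (b s) \<le> cmod (F s) * \<kappa>" by (intro mult_left_mono bk) auto
      then show ?thesis using abs_ge_self[of "\<kappa> * cmod (F s)"] by (simp add: norm_mult mult.commute del: abs_mult abs_ge_self)
    qed (simp add: supp)
  qed
qed (use F in auto)

text \<open>The multiplier \<open>b\<close> stands for the radial kernel at one fixed radius, so the
  constant must depend on it only through its bound \<kappa>. The case p = 2 is Plancherel itself
  and is treated apart, because the interpolation constant contains 1/(P - 2).\<close>

lemma parabola_hausdorff_young:
  assumes m: "0 < m" and p: "1 < p" "p \<le> 2"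
  shows "\<exists>C\<ge>0. \<forall>(F::real \<Rightarrow> complex) b \<kappa> N. integrable lborel F \<longrightarrow> (\<forall>s. s \<notin> {m..2*m} \<longrightarrow> F s = 0) \<longrightarrow>
     b \<in> borel_measurable borel \<longrightarrow> (\<forall>s\<in>{m..2*m}. cmod (b s) \<le> \<kappa>) \<longrightarrow> 0 < \<kappa> \<longrightarrow> 0 < N \<longrightarrow>
     (\<integral>\<^sup>+ s. ennreal (cmod (F s) powr p) \<partial>lborel) \<le> ennreal (N powr p) \<longrightarrow>
     (\<integral>\<^sup>+ t. ennreal (cmod (LINT s|lborel. F s * (cis (t * s\<^sup>2) * b s)) powr (p / (p - 1))) \<partial>lborel) \<le> ennreal (C * (\<kappa> * N) powr (p / (p - 1)))"
proof (cases "p = 2")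
  case True
  show ?thesis
  proof (intro exI[of _ "2 * pi / m"] conjI allI impI)
    show "0 \<le> 2 * pi / m" using m by simp
    fix F b :: "real \<Rightarrow> complex" and \<kappa> N :: real
    assume F: "integrable lborel F" and supp: "\<forall>s. s \<notin> {m..2*m} \<longrightarrow> F s = 0" and b[measurable]: "b \<in> borel_measurable borel"
      and bk: "\<forall>s\<in>{m..2*m}. cmod (b s) \<le> \<kappa>" and k: "0 < \<kappa>" and N: "0 < N"
      and Fp: "(\<integral>\<^sup>+ s. ennreal (cmod (F s) powr p) \<partial>lborel) \<le> ennreal (N powr p)"
    have [measurable]: "F \<in> borel_measurable borel" using F by auto
    have Fb: "integrable lborel (\<lambda>s. F s * b s)"
      by (rule integrable_parabola[OF F]) (use supp bk in auto)
    have P2: "p / (p - 1) = 2" using True by simp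
    have "(\<integral>\<^sup>+ t. ennreal (cmod (LINT s|lborel. F s * (cis (t * s\<^sup>2) * b s)) powr (p / (p - 1))) \<partial>lborel)
      = (\<integral>\<^sup>+ t. ennreal ((cmod (LINT s|lborel. (F s * b s) * cis (t * s\<^sup>2)))\<^sup>2) \<partial>lborel)"
      unfolding P2 by (simp add: mult_ac)
    also have "\<dots> \<le> ennreal (2 * pi / m) * (\<integral>\<^sup>+ s. ennreal ((cmod (F s * b s))\<^sup>2) \<partial>lborel)"
      by (rule plancherel_parabola[OF Fb m]) (use supp m in auto)
    also have "(\<integral>\<^sup>+ s. ennreal ((cmod (F s * b s))\<^sup>2) \<partial>lborel) \<le> (\<integral>\<^sup>+ s. ennreal (\<kappa>\<^sup>2) * ennreal (cmod (F s) powr p) \<partial>lborel)"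
    proof (intro nn_integral_mono)
      fix s
      show "ennreal ((cmod (F s * b s))\<^sup>2) \<le> ennreal (\<kappa>\<^sup>2) * ennreal (cmod (F s) powr p)"
      proof (cases "s \<in> {m..2*m}")
        case True
        then have "(cmod (b s))\<^sup>2 * (cmod (F s))\<^sup>2 \<le> \<kappa>\<^sup>2 * (cmod (F s))\<^sup>2"
          using bk by (intro mult_right_mono power_mono) auto
        then show ?thesis using \<open>p = 2\<close> by (simp add: norm_mult power_mult_distrib ennreal_mult[symmetric] ennreal_leI mult.commute)
      qed (use supp in simp)
    qed
    also have "\<dots> \<le> ennreal (\<kappa>\<^sup>2) * ennreal (N powr p)"
      using Fp by (subst nn_integral_cmult) (auto intro!: mult_left_mono)
    also have "ennreal (2 * pi / m) * (ennreal (\<kappa>\<^sup>2) * ennreal (N powr p)) = ennreal (2 * pi / m * (\<kappa> * N) powr (p / (p - 1)))"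
      unfolding P2 using m k N True by (simp add: ennreal_mult[symmetric] power_mult_distrib)
    finally show "(\<integral>\<^sup>+ t. ennreal (cmod (LINT s|lborel. F s * (cis (t * s\<^sup>2) * b s)) powr (p / (p - 1))) \<partial>lborel) \<le> ennreal (2 * pi / m * (\<kappa> * N) powr (p / (p - 1)))"
      by (simp add: mult_left_mono)
  qed
next
  case False
  then have p2: "p < 2" using p by simp
  define P where "P = p / (p - 1)"
  have P: "2 < P" using p p2 by (simp add: P_def field_simps)
  define C where "C = 2 powr (P + 1) * (2 * pi / m * (2 powr (P - 2) / (P - 2)))"
  show ?thesis
    unfolding P_def[symmetric]
  proof (intro exI[of _ C] conjI allI impI)
    show "0 \<le> C" using m P by (simp add: C_def)
    fix F b :: "real \<Rightarrow> complex" and \<kappa> N :: real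
    assume F: "integrable lborel F" and supp: "\<forall>s. s \<notin> {m..2*m} \<longrightarrow> F s = 0" and b[measurable]: "b \<in> borel_measurable borel"
      and bk: "\<forall>s\<in>{m..2*m}. cmod (b s) \<le> \<kappa>" and k: "0 < \<kappa>" and N: "0 < N"
      and Fp: "(\<integral>\<^sup>+ s. ennreal (cmod (F s) powr p) \<partial>lborel) \<le> ennreal (N powr p)"
    have [measurable]: "F \<in> borel_measurable borel" using F by auto
    \<comment> \<open>Dividing by \<kappa> and cutting off outside the support makes the multiplier
      at most 1 everywhere, as \<open>hausdorff_young\<close> demands; the power of \<kappa> is
      restored at the end.\<close>
    define b' where "b' s = (if s \<in> {m..2*m} then b s / complex_of_real \<kappa> else 0)" for s
    have b'[measurable]: "b' \<in> borel_measurable borel" unfolding b'_def[abs_def] by measurable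
    have b'1: "cmod (b' s) \<le> 1" for s using bk k by (auto simp: b'_def norm_divide)
    have "(\<integral>\<^sup>+ t. ennreal (cmod (LINT s|lborel. F s * (cis (t * s\<^sup>2) * b' s)) powr P) \<partial>lborel) \<le> ennreal (C * N powr P)"
      unfolding P_def C_def
    proof (rule hausdorff_young[where A="{m..2*m}"])
      fix h :: "real \<Rightarrow> complex" assume h: "integrable lborel h" and hs: "\<And>s. s \<notin> {m..2*m} \<Longrightarrow> h s = 0"
      have [measurable]: "h \<in> borel_measurable borel" using h by auto
      have hb: "integrable lborel (\<lambda>s. h s * b' s)"
        by (rule integrable_parabola[OF h hs, where \<kappa>=1]) (use b'1 in auto)
      have "(\<integral>\<^sup>+ t. ennreal ((cmod (LINT s|lborel. h s * (cis (t * s\<^sup>2) * b' s)))\<^sup>2) \<partial>lborel)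
        = (\<integral>\<^sup>+ t. ennreal ((cmod (LINT s|lborel. (h s * b' s) * cis (t * s\<^sup>2)))\<^sup>2) \<partial>lborel)"
        by (simp add: mult_ac)
      also have "\<dots> \<le> ennreal (2 * pi / m) * (\<integral>\<^sup>+ s. ennreal ((cmod (h s * b' s))\<^sup>2) \<partial>lborel)"
        by (rule plancherel_parabola[OF hb m]) (use hs in auto)
      also have "\<dots> \<le> ennreal (2 * pi / m) * (\<integral>\<^sup>+ s. ennreal ((cmod (h s))\<^sup>2) \<partial>lborel)"
        by (intro mult_left_mono nn_integral_mono ennreal_leI power_mono) (auto simp: norm_mult intro!: mult_left_le b'1)
      finally show "(\<integral>\<^sup>+ t. ennreal ((cmod (LINT s|lborel. h s * (cis (t * s\<^sup>2) * b' s)))\<^sup>2) \<partial>lborel)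
        \<le> ennreal (2 * pi / m) * (\<integral>\<^sup>+ s. ennreal ((cmod (h s))\<^sup>2) \<partial>lborel)" .
    qed (use p p2 m F supp N Fp b'1 in \<open>auto simp: norm_mult\<close>)
    then have "ennreal (\<kappa> powr P) * (\<integral>\<^sup>+ t. ennreal (cmod (LINT s|lborel. F s * (cis (t * s\<^sup>2) * b' s)) powr P) \<partial>lborel) \<le> ennreal (\<kappa> powr P) * ennreal (C * N powr P)"
      by (rule mult_left_mono) simp
    also have "\<dots> = ennreal (C * (\<kappa> * N) powr P)"
      using k N m P by (subst ennreal_mult[symmetric]) (auto simp: powr_mult C_def mult_ac)
    also have "ennreal (\<kappa> powr P) * (\<integral>\<^sup>+ t. ennreal (cmod (LINT s|lborel. F s * (cis (t * s\<^sup>2) * b' s)) powr P) \<partial>lborel)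
      = (\<integral>\<^sup>+ t. ennreal (cmod (LINT s|lborel. F s * (cis (t * s\<^sup>2) * b s)) powr P) \<partial>lborel)"
    proof -
      have "ennreal (\<kappa> powr P) * ennreal (cmod (LINT s|lborel. F s * (cis (t * s\<^sup>2) * b' s)) powr P) = ennreal (cmod (LINT s|lborel. F s * (cis (t * s\<^sup>2) * b s)) powr P)" for t
      proof -
        have "(LINT s|lborel. F s * (cis (t * s\<^sup>2) * b s)) = (LINT s|lborel. complex_of_real \<kappa> * (F s * (cis (t * s\<^sup>2) * b' s)))"
          using k supp by (intro Bochner_Integration.integral_cong refl) (auto simp: b'_def)
        also have "\<dots> = complex_of_real \<kappa> * (LINT s|lborel. F s * (cis (t * s\<^sup>2) * b' s))" by simp
        finally show ?thesis using k by (simp add: norm_mult powr_mult ennreal_mult)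
      qed
      then show ?thesis by (subst nn_integral_cmult[symmetric]) simp_all
    qed
    finally show "(\<integral>\<^sup>+ t. ennreal (cmod (LINT s|lborel. F s * (cis (t * s\<^sup>2) * b s)) powr P) \<partial>lborel) \<le> ennreal (C * (\<kappa> * N) powr P)" .
  qed
qed

text \<open>The exponent conjugate to \<open>2q\<close>.\<close>
definition dual2 :: "real \<Rightarrow> real" where "dual2 q = 2 * q / (2 * q - 1)"

lemma dual2: assumes "1 \<le> q" shows "1 < dual2 q" "dual2 q \<le> 2" "dual2 q / (dual2 q - 1) = 2 * q"
proof -
  have e: "dual2 q - 1 = 1 / (2 * q - 1)" using assms by (simp add: dual2_def field_simps)
  have "0 < dual2 q - 1" unfolding e using assms by simp
  then show "1 < dual2 q" by simp
  show "dual2 q \<le> 2" using assms by (simp add: dual2_def field_simps)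
  show "dual2 q / (dual2 q - 1) = 2 * q" unfolding e using assms by (simp add: dual2_def field_simps)
qed

text \<open>\<open>N\<close> is an upper bound for the \<open>L\<^sup>p\<close> norm, not its value.
  Keeping it positive allows division by \<open>N\<close> and negative powers of it, even when
  \<open>F\<close> vanishes.\<close>

definition admissible :: "real \<Rightarrow> real \<Rightarrow> (real \<Rightarrow> complex) \<Rightarrow> real \<Rightarrow> bool" where
  "admissible m p F N \<longleftrightarrow> integrable lborel F \<and> (\<forall>s. s \<notin> {m..2*m} \<longrightarrow> F s = 0) \<and> 0 < N \<and>
     (\<integral>\<^sup>+ s. ennreal (cmod (F s) powr p) \<partial>lborel) \<le> ennreal (N powr p)"

lemma admissible_integrable: "admissible m p F N \<Longrightarrow> integrable lborel F"
  by (simp add: admissible_def)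

lemma admissible_measurable: "admissible m p F N \<Longrightarrow> F \<in> borel_measurable borel"
  using borel_measurable_integrable[of lborel F] by (simp add: admissible_def)

text \<open>Cauchy-Schwarz in time splits the \<open>L\<^sup>q\<close> norm of the product into the
  \<open>L\<^sup>2\<^sup>q\<close> norms of the factors, and Hausdorff-Young reaches 2q from its
  conjugate exponent \<open>dual2 q\<close>.\<close>

lemma parabola_product_fixed_radius:
  assumes m: "0 < m" "0 < m'" and q: "1 \<le> q"
  shows "\<exists>C\<ge>0. \<forall>F G b b' \<kappa> \<kappa>' N N'. admissible m (dual2 q) F N \<longrightarrow> admissible m' (dual2 q) G N' \<longrightarrow>
     b \<in> borel_measurable borel \<longrightarrow> (\<forall>s\<in>{m..2*m}. cmod (b s) \<le> \<kappa>) \<longrightarrow> 0 < \<kappa> \<longrightarrow>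
     b' \<in> borel_measurable borel \<longrightarrow> (\<forall>s\<in>{m'..2*m'}. cmod (b' s) \<le> \<kappa>') \<longrightarrow> 0 < \<kappa>' \<longrightarrow>
     (\<integral>\<^sup>+ t. ennreal (cmod ((LINT s|lborel. F s * (cis (t * s\<^sup>2) * b s)) * (LINT s|lborel. G s * (cis (t * s\<^sup>2) * b' s))) powr q) \<partial>lborel)
       \<le> ennreal (C * (\<kappa> * \<kappa>' * (N * N')) powr q)"
proof -
  obtain C1 where C1: "0 \<le> C1" and H1: "\<And>F b \<kappa> N. integrable lborel F \<Longrightarrow> (\<forall>s. s \<notin> {m..2*m} \<longrightarrow> F s = 0) \<Longrightarrow>
     b \<in> borel_measurable borel \<Longrightarrow> (\<forall>s\<in>{m..2*m}. cmod (b s) \<le> \<kappa>) \<Longrightarrow> 0 < \<kappa> \<Longrightarrow> 0 < N \<Longrightarrow>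
     (\<integral>\<^sup>+ s. ennreal (cmod (F s) powr dual2 q) \<partial>lborel) \<le> ennreal (N powr dual2 q) \<Longrightarrow>
     (\<integral>\<^sup>+ t. ennreal (cmod (LINT s|lborel. F s * (cis (t * s\<^sup>2) * b s)) powr (2 * q)) \<partial>lborel) \<le> ennreal (C1 * (\<kappa> * N) powr (2 * q))"
    using parabola_hausdorff_young[OF m(1) dual2(1,2)[OF q]] unfolding dual2(3)[OF q] by blast
  obtain C2 where C2: "0 \<le> C2" and H2: "\<And>F b \<kappa> N. integrable lborel F \<Longrightarrow> (\<forall>s. s \<notin> {m'..2*m'} \<longrightarrow> F s = 0) \<Longrightarrow>
     b \<in> borel_measurable borel \<Longrightarrow> (\<forall>s\<in>{m'..2*m'}. cmod (b s) \<le> \<kappa>) \<Longrightarrow> 0 < \<kappa> \<Longrightarrow> 0 < N \<Longrightarrow>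
     (\<integral>\<^sup>+ s. ennreal (cmod (F s) powr dual2 q) \<partial>lborel) \<le> ennreal (N powr dual2 q) \<Longrightarrow>
     (\<integral>\<^sup>+ t. ennreal (cmod (LINT s|lborel. F s * (cis (t * s\<^sup>2) * b s)) powr (2 * q)) \<partial>lborel) \<le> ennreal (C2 * (\<kappa> * N) powr (2 * q))"
    using parabola_hausdorff_young[OF m(2) dual2(1,2)[OF q]] unfolding dual2(3)[OF q] by blast
  define C where "C = (C1 + 1) * (C2 + 1)"
  show ?thesis
  proof (intro exI[of _ C] conjI allI impI)
    show "0 \<le> C" using C1 C2 by (simp add: C_def)
    fix F G b b' \<kappa> \<kappa>' N N'
    assume F: "admissible m (dual2 q) F N" and G: "admissible m' (dual2 q) G N'"
      and b[measurable]: "b \<in> borel_measurable borel" and bk: "\<forall>s\<in>{m..2*m}. cmod (b s) \<le> \<kappa>" and k: "0 < \<kappa>"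
      and b'[measurable]: "b' \<in> borel_measurable borel" and bk': "\<forall>s\<in>{m'..2*m'}. cmod (b' s) \<le> \<kappa>'" and k': "0 < \<kappa>'"
    note [measurable] = admissible_measurable[OF F] admissible_measurable[OF G]
    have N: "0 < N" "0 < N'" using F G by (auto simp: admissible_def)
    define X where "X t = cmod (LINT s|lborel. F s * (cis (t * s\<^sup>2) * b s)) powr q" for t
    define Y where "Y t = cmod (LINT s|lborel. G s * (cis (t * s\<^sup>2) * b' s)) powr q" for t
    have [measurable]: "X \<in> borel_measurable lborel" "Y \<in> borel_measurable lborel"
      unfolding X_def[abs_def] Y_def[abs_def] by measurable
    have sq: "(z powr q)\<^sup>2 = z powr (2 * q)" for z :: real
      by (simp add: power2_eq_square powr_add[symmetric])
    have x: "(\<integral>\<^sup>+ t. ennreal ((X t)\<^sup>2) \<partial>lborel) \<le> ennreal (((C1 + 1) * (\<kappa> * N) powr q)\<^sup>2)"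
    proof -
      have "(\<integral>\<^sup>+ t. ennreal ((X t)\<^sup>2) \<partial>lborel) \<le> ennreal (C1 * (\<kappa> * N) powr (2 * q))"
        unfolding X_def sq by (rule H1) (use F bk k in \<open>auto simp: admissible_def\<close>)
      also have "C1 * (\<kappa> * N) powr (2 * q) \<le> (C1 + 1)\<^sup>2 * (\<kappa> * N) powr (2 * q)"
        using C1 by (intro mult_right_mono) (auto simp: power2_eq_square algebra_simps)
      finally show ?thesis by (simp add: power_mult_distrib sq ennreal_leI)
    qed
    have y: "(\<integral>\<^sup>+ t. ennreal ((Y t)\<^sup>2) \<partial>lborel) \<le> ennreal (((C2 + 1) * (\<kappa>' * N') powr q)\<^sup>2)"
    proof -
      have "(\<integral>\<^sup>+ t. ennreal ((Y t)\<^sup>2) \<partial>lborel) \<le> ennreal (C2 * (\<kappa>' * N') powr (2 * q))"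
        unfolding Y_def sq by (rule H2) (use G bk' k' in \<open>auto simp: admissible_def\<close>)
      also have "C2 * (\<kappa>' * N') powr (2 * q) \<le> (C2 + 1)\<^sup>2 * (\<kappa>' * N') powr (2 * q)"
        using C2 by (intro mult_right_mono) (auto simp: power2_eq_square algebra_simps)
      finally show ?thesis by (simp add: power_mult_distrib sq ennreal_leI)
    qed
    have "(\<integral>\<^sup>+ t. ennreal (X t * Y t) \<partial>lborel) \<le> ennreal (((C1 + 1) * (\<kappa> * N) powr q) * ((C2 + 1) * (\<kappa>' * N') powr q))"
      by (rule nn_integral_Cauchy_Schwarz_bound) (use x y C1 C2 k k' N in auto)
    also have "((C1 + 1) * (\<kappa> * N) powr q) * ((C2 + 1) * (\<kappa>' * N') powr q) = C * (\<kappa> * \<kappa>' * (N * N')) powr q"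
      using k k' N by (simp add: C_def powr_mult mult_ac)
    finally show "(\<integral>\<^sup>+ t. ennreal (cmod ((LINT s|lborel. F s * (cis (t * s\<^sup>2) * b s)) * (LINT s|lborel. G s * (cis (t * s\<^sup>2) * b' s))) powr q) \<partial>lborel)
       \<le> ennreal (C * (\<kappa> * \<kappa>' * (N * N')) powr q)"
      by (simp add: X_def Y_def norm_mult powr_mult)
  qed
qed

section \<open>Radial kernels at a fixed radius\<close>

lemma admissible_mult:
  assumes F: "admissible m p F N" and c[measurable]: "c \<in> borel_measurable borel" and w: "0 < w" and p: "0 \<le> p"
    and cw: "\<And>s. s \<in> {m..2*m} \<Longrightarrow> cmod (c s) \<le> w"
  shows "admissible m p (\<lambda>s. F s * c s) (w * N)"
  unfolding admissible_def
proof (intro conjI allI impI)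
  have supp: "F s = 0" if "s \<notin> {m..2*m}" for s using F that by (simp add: admissible_def)
  have N: "0 < N" using F by (simp add: admissible_def)
  note [measurable] = admissible_measurable[OF F]
  show "integrable lborel (\<lambda>s. F s * c s)"
    by (rule integrable_parabola[OF admissible_integrable[OF F] supp c cw])
  show "F s * c s = 0" if "s \<notin> {m..2*m}" for s using supp[OF that] by simp
  show "0 < w * N" using w N by simp
  have "(\<integral>\<^sup>+ s. ennreal (cmod (F s * c s) powr p) \<partial>lborel) \<le> (\<integral>\<^sup>+ s. ennreal (w powr p) * ennreal (cmod (F s) powr p) \<partial>lborel)"
  proof (rule nn_integral_mono)
    fix s
    have "cmod (F s * c s) powr p \<le> w powr p * cmod (F s) powr p"
    proof (cases "s \<in> {m..2*m}")
      case True
      then have "cmod (c s) powr p \<le> w powr p" using p cw[OF True] by (intro powr_mono2) auto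
      then have "cmod (c s) powr p * cmod (F s) powr p \<le> w powr p * cmod (F s) powr p" by (rule mult_right_mono) simp
      then show ?thesis by (simp add: norm_mult powr_mult mult.commute)
    qed (simp add: supp)
    then show "ennreal (cmod (F s * c s) powr p) \<le> ennreal (w powr p) * ennreal (cmod (F s) powr p)"
      by (simp add: ennreal_mult[symmetric] ennreal_leI)
  qed
  also have "\<dots> \<le> ennreal (w powr p) * ennreal (N powr p)"
    using F by (subst nn_integral_cmult) (auto simp: admissible_def intro!: mult_left_mono)
  finally show "(\<integral>\<^sup>+ s. ennreal (cmod (F s * c s) powr p) \<partial>lborel) \<le> ennreal ((w * N) powr p)"
    using w N by (simp add: powr_mult ennreal_mult)
qed

text \<open>A crude form of Hoelder's inequality: for z = |F|/N one has
  \<open>z powr p' \<le> 1 + z powr p\<close>. The support has length \<open>m \<le> 1\<close>, so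
  the integral is at most 2, and 2 is at most \<open>2 powr p'\<close>.\<close>

lemma admissible_exponent_mono:
  assumes F: "admissible m p F N" and p': "1 \<le> p'" "p' \<le> p" and m: "0 < m" "m \<le> 1"
  shows "admissible m p' F (2 * N)"
  unfolding admissible_def
proof (intro conjI)
  have supp: "F s = 0" if "s \<notin> {m..2*m}" for s using F that by (simp add: admissible_def)
  have N: "0 < N" using F by (simp add: admissible_def)
  note [measurable] = admissible_measurable[OF F]
  have "(\<integral>\<^sup>+ s. ennreal (cmod (F s) powr p') \<partial>lborel) \<le> (\<integral>\<^sup>+ s. ennreal (N powr p') * (indicator {m..2*m} s + ennreal (N powr - p) * ennreal (cmod (F s) powr p)) \<partial>lborel)"
  proof (rule nn_integral_mono)
    fix s
    show "ennreal (cmod (F s) powr p') \<le> ennreal (N powr p') * (indicator {m..2*m} s + ennreal (N powr - p) * ennreal (cmod (F s) powr p))"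
    proof (cases "s \<in> {m..2*m}")
      case True
      define z where "z = cmod (F s) / N"
      have z: "0 \<le> z" using N by (simp add: z_def)
      have "z powr p' \<le> 1 + z powr p"
      proof (cases "z \<le> 1")
        case True
        then have "z powr p' \<le> 1" using z p' by (intro powr_le1) auto
        then show ?thesis by (simp add: add_increasing2)
      next
        case False
        then have "z powr p' \<le> z powr p" using p' by (intro powr_mono) auto
        then show ?thesis by simp
      qed
      then have "N powr p' * z powr p' \<le> N powr p' * (1 + z powr p)" by (intro mult_left_mono) auto
      then have "cmod (F s) powr p' \<le> N powr p' * (1 + N powr - p * cmod (F s) powr p)"
        using N by (simp add: z_def powr_divide powr_minus field_simps)
      then have "ennreal (cmod (F s) powr p') \<le> ennreal (N powr p' * (1 + N powr - p * cmod (F s) powr p))" by (rule ennreal_leI)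
      also have "\<dots> = ennreal (N powr p') * (1 + ennreal (N powr - p) * ennreal (cmod (F s) powr p))"
        by (simp add: ennreal_mult ennreal_plus)
      finally show ?thesis using True by simp
    qed (use supp p' in simp)
  qed
  also have "\<dots> = ennreal (N powr p') * (ennreal m + ennreal (N powr - p) * (\<integral>\<^sup>+ s. ennreal (cmod (F s) powr p) \<partial>lborel))"
    using m by (subst nn_integral_cmult, simp, subst nn_integral_add) (simp_all add: nn_integral_cmult)
  also have "\<dots> \<le> ennreal (N powr p') * (1 + ennreal (N powr - p) * ennreal (N powr p))"
    using F m by (intro mult_left_mono add_mono) (auto simp: admissible_def)
  also have "\<dots> = ennreal (2 * N powr p')"
  proof -
    have "ennreal (N powr - p) * ennreal (N powr p) = 1" using N by (simp add: ennreal_mult[symmetric] powr_minus)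
    then show ?thesis by (simp add: ennreal_mult mult.commute)
  qed
  also have "\<dots> \<le> ennreal ((2 * N) powr p')"
    using N p' by (intro ennreal_leI) (simp add: powr_mult powr_mono[of 1 p' 2, simplified])
  finally show "(\<integral>\<^sup>+ s. ennreal (cmod (F s) powr p') \<partial>lborel) \<le> ennreal ((2 * N) powr p')" .
qed (use F in \<open>auto simp: admissible_def\<close>)

text \<open>The Fourier transform of the sphere along a ray enters the upper bounds only through these properties.\<close>
locale radial_kernel =
  fixes d :: nat and K :: "real \<Rightarrow> real" and a :: complex and C0 :: real
  assumes d: "2 \<le> d" and K_measurable [measurable]: "K \<in> borel_measurable borel" and K_le: "\<And>r. \<bar>K r\<bar> \<le> 1"
    and K_asymp: "\<And>r. 1 \<le> r \<Longrightarrow> \<bar>r powr (real (d - 1) / 2) * K r - 2 * Re (a * cis r)\<bar> \<le> C0 / r"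
    and a: "a \<noteq> 0" and C0: "0 \<le> C0"
begin

definition D :: real where "D = real (d - 1)"

lemma D: "1 \<le> D" "D + 1 = real d" using d by (auto simp: D_def)

definition U :: "real \<Rightarrow> real" where "U r = r powr (D / 2) * K r"

lemma U_measurable [measurable]: "U \<in> borel_measurable borel"
  unfolding U_def[abs_def] by measurable

text \<open>One constant for three purposes: it dominates \<open>C0\<close>, the bound
  \<open>1 + 2 * cmod a\<close> for the error on (0, 1), and \<open>\<bar>U r\<bar>\<close> for all
  r > 0. Small arguments cannot be excluded, since the kernel is evaluated at \<open>r * s\<close>
  with \<open>s\<close> as small as M, even when r \<ge> 1.\<close>

definition C1 :: real where "C1 = C0 + 1 + 2 * cmod a"

lemma C1: "0 < C1" using C0 by (simp add: C1_def add_nonneg_pos add_pos_nonneg)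

lemma Re_a_cis: "\<bar>2 * Re (a * cis r)\<bar> \<le> 2 * cmod a"
  using abs_Re_le_cmod[of "a * cis r"] by (simp add: norm_mult)

lemma U_asymp: assumes r: "0 < r" shows "\<bar>U r - 2 * Re (a * cis r)\<bar> \<le> C1 / r"
proof (cases "1 \<le> r")
  case True
  have "\<bar>U r - 2 * Re (a * cis r)\<bar> \<le> C0 / r" using K_asymp[OF True] by (simp add: U_def D_def)
  also have "\<dots> \<le> C1 / r" using r by (intro divide_right_mono) (auto simp: C1_def)
  finally show ?thesis .
next
  case False
  have "\<bar>U r\<bar> \<le> 1 * 1"
    unfolding U_def abs_mult using False r D K_le by (intro mult_mono) (auto intro!: powr_le1)
  then have "\<bar>U r - 2 * Re (a * cis r)\<bar> \<le> 1 + 2 * cmod a" using Re_a_cis[of r] by linarith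
  also have "\<dots> \<le> C1" using C0 by (simp add: C1_def)
  also have "\<dots> \<le> C1 / r" using False r C1 by (simp add: field_simps)
  finally show ?thesis .
qed

lemma U_le: assumes r: "0 < r" shows "\<bar>U r\<bar> \<le> C1"
proof (cases "1 \<le> r")
  case True
  have "\<bar>U r - 2 * Re (a * cis r)\<bar> \<le> C0 / r" using K_asymp[OF True] by (simp add: U_def D_def)
  also have "\<dots> \<le> C0" using True C0 mult_left_mono[of 1 r C0] by (simp add: field_simps)
  finally show ?thesis using Re_a_cis[of r] by (simp add: C1_def)
next
  case False
  have "\<bar>U r\<bar> \<le> 1 * 1"
    unfolding U_def abs_mult using False r D K_le by (intro mult_mono) (auto intro!: powr_le1)
  also have "\<dots> \<le> C1" using C0 by (simp add: C1_def)
  finally show ?thesis .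
qed

lemma K_eq_U: "0 < r \<Longrightarrow> K r = r powr (- D / 2) * U r"
  by (simp add: U_def powr_minus field_simps)

lemma K_decay: assumes "0 < m" "m \<le> s" "0 < r" shows "\<bar>K (r * s)\<bar> \<le> C1 * m powr (- D / 2) * r powr (- D / 2)"
proof -
  have rs: "0 < r * s" using assms by simp
  have "s powr (- D / 2) \<le> m powr (- D / 2)" using assms D by (intro powr_mono2') auto
  then have "\<bar>K (r * s)\<bar> \<le> (r powr (- D / 2) * m powr (- D / 2)) * C1"
    unfolding K_eq_U[OF rs] abs_mult using U_le[OF rs] assms
    by (intro mult_mono) (auto simp: powr_mult)
  then show ?thesis by (simp add: mult_ac)
qed

text \<open>The extension operator in polar coordinates: \<open>F\<close> contains the Jacobian, and \<open>r\<close> is \<open>\<bar>x\<bar>\<close>.\<close>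
definition V :: "(real \<Rightarrow> complex) \<Rightarrow> real \<Rightarrow> real \<Rightarrow> complex" where
  "V F t r = (LINT s|lborel. F s * (cis (t * s\<^sup>2) * complex_of_real (K (r * s))))"

lemma V_measurable [measurable]:
  assumes [measurable]: "F \<in> borel_measurable borel"
  shows "(\<lambda>(t, r). V F t r) \<in> borel_measurable (borel \<Otimes>\<^sub>M borel)"
  unfolding V_def by measurable

definition mass :: "real \<Rightarrow> (real \<Rightarrow> complex) \<Rightarrow> (real \<Rightarrow> complex) \<Rightarrow> real \<Rightarrow> ennreal" where
  "mass q F G r = (\<integral>\<^sup>+ t. ennreal (cmod (V F t r * V G t r) powr q) \<partial>lborel)"

lemma mass_measurable [measurable]:
  assumes [measurable]: "F \<in> borel_measurable borel" "G \<in> borel_measurable borel"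
  shows "mass q F G \<in> borel_measurable borel"
proof -
  have [measurable]: "(\<lambda>x. V F (snd x) (fst x)) \<in> borel_measurable (borel \<Otimes>\<^sub>M borel)" "(\<lambda>x. V G (snd x) (fst x)) \<in> borel_measurable (borel \<Otimes>\<^sub>M borel)"
    using measurable_compose[OF measurable_Pair[OF measurable_snd measurable_fst] V_measurable] by simp_all
  show ?thesis unfolding mass_def[abs_def] 
    by (intro lborel.borel_measurable_nn_integral) (simp add: split_def)
qed

text \<open>The kernel at radius \<open>r\<close> acts as a multiplier in \<open>s\<close>. Bounded
  by 1, it gives an estimate that stays finite at the origin; bounded by a multiple of r^(-D/2) in
  each factor, it gives the decay r^(-D) of the product.\<close>

lemma fixed_radius:
  assumes M: "0 < M" and q: "1 \<le> q"
  shows "\<exists>C>0. \<forall>F G N N'. admissible 1 (dual2 q) F N \<longrightarrow> admissible M (dual2 q) G N' \<longrightarrow>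
     (\<forall>r. mass q F G r \<le> ennreal (C * (N * N') powr q)) \<and> (\<forall>r>0. mass q F G r \<le> ennreal (C * r powr (- D * q) * (N * N') powr q))"
proof -
  obtain C where C: "0 \<le> C" and H: "\<And>F G b b' \<kappa> \<kappa>' N N'. admissible 1 (dual2 q) F N \<Longrightarrow> admissible M (dual2 q) G N' \<Longrightarrow>
     b \<in> borel_measurable borel \<Longrightarrow> (\<forall>s\<in>{1..2*1}. cmod (b s) \<le> \<kappa>) \<Longrightarrow> 0 < \<kappa> \<Longrightarrow>
     b' \<in> borel_measurable borel \<Longrightarrow> (\<forall>s\<in>{M..2*M}. cmod (b' s) \<le> \<kappa>') \<Longrightarrow> 0 < \<kappa>' \<Longrightarrow>
     (\<integral>\<^sup>+ t. ennreal (cmod ((LINT s|lborel. F s * (cis (t * s\<^sup>2) * b s)) * (LINT s|lborel. G s * (cis (t * s\<^sup>2) * b' s))) powr q) \<partial>lborel)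
       \<le> ennreal (C * (\<kappa> * \<kappa>' * (N * N')) powr q)"
    using parabola_product_fixed_radius[OF zero_less_one M q] by blast
  define A where "A = C1 * 1 powr (- D / 2) * (C1 * M powr (- D / 2))"
  have A: "0 < A" using C1 M by (simp add: A_def)
  define C' where "C' = C + C * A powr q + 1"
  have C': "0 < C'" "C \<le> C'" "C * A powr q \<le> C'" using C by (auto simp: C'_def add_nonneg_pos add_increasing2)
  show ?thesis
  proof (intro exI[of _ C'] conjI allI impI C'(1))
    fix F G N N' assume F: "admissible 1 (dual2 q) F N" and G: "admissible M (dual2 q) G N'"
    have N: "0 < N" "0 < N'" using F G by (auto simp: admissible_def)
    show "mass q F G r \<le> ennreal (C' * (N * N') powr q)" for r
    proof -
      have "mass q F G r \<le> ennreal (C * (1 * 1 * (N * N')) powr q)"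
        unfolding mass_def V_def by (rule H[OF F G]) (use K_le in auto)
      also have "\<dots> \<le> ennreal (C' * (N * N') powr q)"
        using C' by (intro ennreal_leI) (auto intro!: mult_right_mono)
      finally show ?thesis .
    qed
    show "mass q F G r \<le> ennreal (C' * r powr (- D * q) * (N * N') powr q)" if r: "0 < r" for r
    proof -
      have "mass q F G r \<le> ennreal (C * ((C1 * 1 powr (- D / 2) * r powr (- D / 2)) * (C1 * M powr (- D / 2) * r powr (- D / 2)) * (N * N')) powr q)"
        unfolding mass_def V_def by (rule H[OF F G]) (use K_decay[of 1 _ r] K_decay[of M _ r] r M C1 in auto)
      also have "(C1 * 1 powr (- D / 2) * r powr (- D / 2)) * (C1 * M powr (- D / 2) * r powr (- D / 2)) * (N * N') = A * r powr (- D) * (N * N')"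
        using r by (simp add: A_def mult_ac powr_add[symmetric])
      also have "C * (A * r powr (- D) * (N * N')) powr q = (C * A powr q) * r powr (- D * q) * (N * N') powr q"
        using A r N by (simp add: powr_mult powr_powr)
      also have "ennreal \<dots> \<le> ennreal (C' * r powr (- D * q) * (N * N') powr q)"
        using C' by (intro ennreal_leI mult_right_mono) auto
      finally show ?thesis .
    qed
  qed
qed

text \<open>In this range the decay at a fixed radius beats the volume element by itself: the
  exponent D - D q is below -1, so the radial integral converges at infinity.\<close>

lemma strong_far:
  assumes M: "0 < M" and q: "1 < q" and qD: "1 < (q - 1) * D"
  shows "\<exists>C\<ge>0. \<forall>F G N N'. admissible 1 (dual2 q) F N \<longrightarrow> admissible M (dual2 q) G N' \<longrightarrow>
     (\<integral>\<^sup>+ r. mass q F G r * (ennreal (r powr D) * indicator {1..} r) \<partial>lborel) \<le> ennreal (C * (N * N') powr q)"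
proof -
  obtain C where C: "0 < C" and H: "\<And>F G N N' r. admissible 1 (dual2 q) F N \<Longrightarrow> admissible M (dual2 q) G N' \<Longrightarrow> 0 < r \<Longrightarrow>
      mass q F G r \<le> ennreal (C * r powr (- D * q) * (N * N') powr q)"
    using fixed_radius[OF M, of q] q by (meson less_imp_le)
  define W where "W = - (1 powr (- ((q - 1) * D) + 1)) / (- ((q - 1) * D) + 1)"
  have W: "0 \<le> W" using qD by (simp add: W_def field_simps)
  show ?thesis
  proof (intro exI[of _ "C * W"] conjI allI impI)
    show "0 \<le> C * W" using C W by simp
    fix F G N N' assume F: "admissible 1 (dual2 q) F N" and G: "admissible M (dual2 q) G N'"
    have "(\<integral>\<^sup>+ r. mass q F G r * (ennreal (r powr D) * indicator {1..} r) \<partial>lborel)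
      \<le> (\<integral>\<^sup>+ r. ennreal (C * (N * N') powr q) * (ennreal (r powr (- ((q - 1) * D))) * indicator {1..} r) \<partial>lborel)"
    proof (rule nn_integral_mono)
      fix r :: real
      show "mass q F G r * (ennreal (r powr D) * indicator {1..} r) \<le> ennreal (C * (N * N') powr q) * (ennreal (r powr (- ((q - 1) * D))) * indicator {1..} r)"
      proof (cases "1 \<le> r")
        case True
        have "mass q F G r * ennreal (r powr D) \<le> ennreal (C * r powr (- D * q) * (N * N') powr q) * ennreal (r powr D)"
          using True by (intro mult_right_mono H[OF F G]) auto
        also have "\<dots> = ennreal (C * (N * N') powr q) * ennreal (r powr (- ((q - 1) * D)))"
        proof -
          have "r powr (- D * q) * r powr D = r powr (- ((q - 1) * D))"
            using True by (simp add: powr_add[symmetric] algebra_simps)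
          then show ?thesis using C by (simp add: ennreal_mult[symmetric] mult_ac)
        qed
        finally show ?thesis using True by simp
      qed simp
    qed
    also have "\<dots> = ennreal (C * (N * N') powr q) * ennreal W"
      using qD unfolding W_def by (subst nn_integral_cmult) (auto simp: nn_integral_powr_to_inf)
    finally show "(\<integral>\<^sup>+ r. mass q F G r * (ennreal (r powr D) * indicator {1..} r) \<partial>lborel) \<le> ennreal (C * W * (N * N') powr q)"
      using C W by (simp add: ennreal_mult[symmetric] mult_ac)
  qed
qed

lemma near:
  assumes M: "0 < M" and q: "1 \<le> q"
  shows "\<exists>C\<ge>0. \<forall>F G N N'. admissible 1 (dual2 q) F N \<longrightarrow> admissible M (dual2 q) G N' \<longrightarrow>
     (\<integral>\<^sup>+ r. mass q F G r * (ennreal (r powr D) * indicator {0<..<1} r) \<partial>lborel) \<le> ennreal (C * (N * N') powr q)"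
proof -
  obtain C where C: "0 < C" and H: "\<And>F G N N' r. admissible 1 (dual2 q) F N \<Longrightarrow> admissible M (dual2 q) G N' \<Longrightarrow>
      mass q F G r \<le> ennreal (C * (N * N') powr q)"
    using fixed_radius[OF M q] by meson
  show ?thesis
  proof (intro exI[of _ C] conjI allI impI)
    show "0 \<le> C" using C by simp
    fix F G N N' assume F: "admissible 1 (dual2 q) F N" and G: "admissible M (dual2 q) G N'"
    have "(\<integral>\<^sup>+ r. mass q F G r * (ennreal (r powr D) * indicator {0<..<1} r) \<partial>lborel)
      \<le> (\<integral>\<^sup>+ r. ennreal (C * (N * N') powr q) * indicator {0<..<1} (r::real) \<partial>lborel)"
    proof (rule nn_integral_mono)
      fix r :: real
      show "mass q F G r * (ennreal (r powr D) * indicator {0<..<1} r) \<le> ennreal (C * (N * N') powr q) * indicator {0<..<1} r"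
      proof (cases "r \<in> {0<..<1}")
        case True
        have "mass q F G r * ennreal (r powr D) \<le> ennreal (C * (N * N') powr q) * 1"
          using True D by (intro mult_mono H[OF F G]) (auto intro!: powr_le1 simp flip: ennreal_1)
        then show ?thesis using True by simp
      qed simp
    qed
    also have "\<dots> = ennreal (C * (N * N') powr q)" by (simp add: nn_integral_cmult_indicator)
    finally show "(\<integral>\<^sup>+ r. mass q F G r * (ennreal (r powr D) * indicator {0<..<1} r) \<partial>lborel) \<le> ennreal (C * (N * N') powr q)" .
  qed
qed

end

section \<open>The bilinear \<open>L\<^sup>2\<close> estimate with weight
  \<open>r\<^sup>2\<^sup>D\<close>\<close>

context radial_kernel begin

text \<open>The weight r^(2D) cancels exactly the decay of both kernels in the square. What remains
  of the kernel is the exponential part \<open>m\<close> plus an error \<open>er\<close> of size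
  1/r. The pure \<open>m\<close> term is controlled by \<open>bilinear_parabola\<close>; every other
  term contains \<open>er\<close>, gains r^(-2) in the square over the fixed-radius bound, and is
  therefore integrable over r \<ge> 1.\<close>

lemma weighted_L2_far:
  assumes M: "0 < M" "M \<le> 1/4"
  shows "\<exists>C>0. \<forall>F G N N'. admissible 1 2 F N \<longrightarrow> admissible M 2 G N' \<longrightarrow>
     (\<integral>\<^sup>+ r. mass 2 F G r * (ennreal (r powr (2 * D)) * indicator {1..} r) \<partial>lborel) \<le> ennreal (C * (N * N') powr 2)"
proof -
  have q2: "1 \<le> (2::real)" by simp
  have dual_2: "1 \<le> dual2 2" "dual2 2 \<le> 2" by (simp_all add: dual2_def)
  obtain C where C: "0 \<le> C" and H: "\<And>F G b b' \<kappa> \<kappa>' N N'. admissible 1 (dual2 2) F N \<Longrightarrow> admissible M (dual2 2) G N' \<Longrightarrow>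
     b \<in> borel_measurable borel \<Longrightarrow> (\<forall>s\<in>{1..2*1}. cmod (b s) \<le> \<kappa>) \<Longrightarrow> 0 < \<kappa> \<Longrightarrow>
     b' \<in> borel_measurable borel \<Longrightarrow> (\<forall>s\<in>{M..2*M}. cmod (b' s) \<le> \<kappa>') \<Longrightarrow> 0 < \<kappa>' \<Longrightarrow>
     (\<integral>\<^sup>+ t. ennreal (cmod ((LINT s|lborel. F s * (cis (t * s\<^sup>2) * b s)) * (LINT s|lborel. G s * (cis (t * s\<^sup>2) * b' s))) powr 2) \<partial>lborel)
       \<le> ennreal (C * (\<kappa> * \<kappa>' * (N * N')) powr 2)"
    using parabola_product_fixed_radius[OF zero_less_one M(1) q2] by blast
  define w where "w = M powr (- D / 2)"
  have w: "0 < w" using M by (simp add: w_def)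
  define A2 where "A2 = C * (C1 * C1 * (2 * (2 * w))) powr 2"
  define A3 where "A3 = C * ((2 * cmod a) * (C1 / M) * (2 * (2 * w))) powr 2"
  define A1 where "A1 = 16 * (cmod a) ^ 4 * (36 * pi\<^sup>2) * w powr 2"
  have A: "0 \<le> A1" "0 \<le> A2" "0 \<le> A3" using C by (auto simp: A1_def A2_def A3_def)
  define CC where "CC = 3 * (A1 + A2 + A3) + 1"
  show ?thesis
  proof (intro exI[of _ CC] conjI allI impI)
    show "0 < CC" using A by (simp add: CC_def)
    fix F G N N' assume F: "admissible 1 2 F N" and G: "admissible M 2 G N'"
    have N: "0 < N" "0 < N'" using F G by (auto simp: admissible_def)
    have suppF: "F s = 0" if "s \<notin> {1..2}" for s using F that by (simp add: admissible_def)
    have suppG: "G s = 0" if "s \<notin> {M..2*M}" for s using G that by (simp add: admissible_def)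
    \<comment> \<open>The kernel \<open>K (r * s)\<close> is
      \<open>(r * s) powr (- D / 2) * U (r * s)\<close>; its power of \<open>s\<close> is moved into
      the inputs, and its power of \<open>r\<close> is absorbed by the weight.\<close>
    define F' where "F' s = F s * complex_of_real (s powr (- D / 2))" for s
    define G' where "G' s = G s * complex_of_real (s powr (- D / 2))" for s
    have w1: "cmod (complex_of_real (s powr (- D / 2))) \<le> 1" if "s \<in> {1..2*1}" for s
      using that D powr_mono[of "- D / 2" 0 s] by (simp only: norm_of_real) simp
    have wM: "cmod (complex_of_real (s powr (- D / 2))) \<le> w" if "s \<in> {M..2*M}" for s
      using that D M powr_mono2'[of "- D / 2" M s] by (simp only: norm_of_real w_def) simp
    have F': "admissible 1 2 F' (1 * N)"
      unfolding F'_def[abs_def] by (rule admissible_mult[OF F _ _ _ w1]) auto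
    have G': "admissible M 2 G' (w * N')"
      unfolding G'_def[abs_def] by (rule admissible_mult[OF G _ w _ wM]) auto
    \<comment> \<open>\<open>dual2 2\<close> is 4/3: the fixed-radius bound used for the error terms
      takes inputs in that exponent, reached from 2 because the supports are short
      intervals.\<close>
    have F'4: "admissible 1 (dual2 2) F' (2 * (1 * N))" by (rule admissible_exponent_mono[OF F' dual_2]) auto
    have G'4: "admissible M (dual2 2) G' (2 * (w * N'))" by (rule admissible_exponent_mono[OF G' dual_2]) (use M in auto)
    note [measurable] = admissible_measurable[OF F'] admissible_measurable[OF G'] admissible_measurable[OF F] admissible_measurable[OF G]
    have suppF': "F' s = 0" if "s \<notin> {1..2*1}" for s using suppF[of s] that by (simp add: F'_def)
    have suppG': "G' s = 0" if "s \<notin> {M..2*M}" for s using suppG[of s] that by (simp add: G'_def)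
    define T where "T H k t r = (LINT s|lborel. H s * (cis (t * s\<^sup>2) * complex_of_real (k (r * s))))" for H k t r
    define m where "m \<rho> = 2 * Re (a * cis \<rho>)" for \<rho>
    define er where "er \<rho> = U \<rho> - m \<rho>" for \<rho>
    have [measurable]: "m \<in> borel_measurable borel" "er \<in> borel_measurable borel" unfolding m_def[abs_def] er_def[abs_def] by measurable
    have mb: "\<bar>m \<rho>\<bar> \<le> 2 * cmod a" for \<rho> unfolding m_def by (rule Re_a_cis)
    have eb: "\<bar>er \<rho>\<bar> \<le> C1 / \<rho>" if "0 < \<rho>" for \<rho> unfolding m_def er_def by (rule U_asymp[OF that])
    have Tm[measurable]: "(\<lambda>t. T H k t r) \<in> borel_measurable borel" if [measurable]: "H \<in> borel_measurable borel" "k \<in> borel_measurable borel" for H k r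
      unfolding T_def by measurable
    have splitT: "T H U t r = T H m t r + T H er t r" if H: "integrable lborel H" and sH: "\<And>s. s \<notin> {\<mu>..2*\<mu>} \<Longrightarrow> H s = 0" and \<mu>: "0 < \<mu>" and r: "0 < r" for H \<mu> t r
    proof -
      have 1: "integrable lborel (\<lambda>s. H s * (cis (t * s\<^sup>2) * complex_of_real (m (r * s))))"
        by (rule integrable_parabola[OF H sH, where \<kappa>="2 * cmod a"]) (use mb in \<open>auto simp: norm_mult\<close>)
      have 2: "integrable lborel (\<lambda>s. H s * (cis (t * s\<^sup>2) * complex_of_real (er (r * s))))"
      proof (rule integrable_parabola[OF H sH, where \<kappa>="C1 / (r * \<mu>)"])
        fix s assume "s \<in> {\<mu>..2*\<mu>}"
        then have s: "0 < r * s" "r * \<mu> \<le> r * s" using \<mu> r by auto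
        have "\<bar>er (r * s)\<bar> \<le> C1 / (r * s)" by (rule eb[OF s(1)])
        also have "\<dots> \<le> C1 / (r * \<mu>)" using s C1 \<mu> r by (intro divide_left_mono) auto
        finally show "cmod (cis (t * s\<^sup>2) * complex_of_real (er (r * s))) \<le> C1 / (r * \<mu>)" by (simp add: norm_mult)
      qed auto
      have "T H U t r = (LINT s|lborel. H s * (cis (t * s\<^sup>2) * complex_of_real (m (r * s))) + H s * (cis (t * s\<^sup>2) * complex_of_real (er (r * s))))"
        unfolding T_def er_def by (intro Bochner_Integration.integral_cong refl) (simp add: algebra_simps)
      then show ?thesis unfolding T_def using Bochner_Integration.integral_add[OF 1 2] by simp
    qed
    have VT: "complex_of_real (r powr (D / 2)) * V H t r = T (\<lambda>s. H s * complex_of_real (s powr (- D / 2))) U t r" if sH: "\<And>s. s \<le> 0 \<Longrightarrow> H s = 0" and r: "0 < r" for H t r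
    proof -
      have "complex_of_real (r powr (D / 2)) * V H t r = (LINT s|lborel. complex_of_real (r powr (D / 2)) * (H s * (cis (t * s\<^sup>2) * complex_of_real (K (r * s)))))"
        unfolding V_def by simp
      also have "\<dots> = T (\<lambda>s. H s * complex_of_real (s powr (- D / 2))) U t r"
        unfolding T_def
      proof (intro Bochner_Integration.integral_cong refl)
        fix s
        show "complex_of_real (r powr (D / 2)) * (H s * (cis (t * s\<^sup>2) * complex_of_real (K (r * s)))) = H s * complex_of_real (s powr (- D / 2)) * (cis (t * s\<^sup>2) * complex_of_real (U (r * s)))"
        proof (cases "s \<le> 0")
          case False
          have "r powr (D / 2) * K (r * s) = s powr (- D / 2) * U (r * s)"
            using False r by (simp add: U_def powr_mult powr_minus field_simps)
          then have "complex_of_real (r powr (D / 2)) * complex_of_real (K (r * s)) = complex_of_real (s powr (- D / 2)) * complex_of_real (U (r * s))"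
            by (simp only: of_real_mult[symmetric])
          then show ?thesis by (simp add: mult_ac)
        qed (simp add: sH)
      qed
      finally show ?thesis .
    qed
    have VF: "complex_of_real (r powr (D / 2)) * V F t r = T F' m t r + T F' er t r" if "0 < r" for t r
      using VT[where H=F and t=t and r=r] splitT[where t=t and r=r and \<mu>=1, OF admissible_integrable[OF F'] suppF'] suppF that
      by (simp add: F'_def[abs_def] del: mult_1_right mult_1)
    have VG: "complex_of_real (r powr (D / 2)) * V G t r = T G' U t r" "T G' U t r = T G' m t r + T G' er t r" if "0 < r" for t r
      using VT[where H=G and t=t and r=r] splitT[where t=t and r=r and \<mu>=M, OF admissible_integrable[OF G'] suppG'] suppG that M
      by (simp_all add: G'_def[abs_def])
    \<comment> \<open>A telescoping expansion with three terms: the error of the first factor is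
      paired with the whole kernel \<open>U\<close> of the second, and the error of the second with
      the main part of the first.\<close>
    have pw: "cmod (V F t r * V G t r) powr 2 * r powr (2 * D) \<le>
       3 * (cmod (T F' m t r * T G' m t r) powr 2 + cmod (T F' er t r * T G' U t r) powr 2 + cmod (T F' m t r * T G' er t r) powr 2)" if r: "0 < r" for t r
    proof -
      have "cmod (V F t r * V G t r) powr 2 * r powr (2 * D) = cmod ((complex_of_real (r powr (D / 2)) * V F t r) * (complex_of_real (r powr (D / 2)) * V G t r)) powr 2"
        using r by (simp add: norm_mult powr_mult powr_powr mult_ac powr_add[symmetric])
      also have "(complex_of_real (r powr (D / 2)) * V F t r) * (complex_of_real (r powr (D / 2)) * V G t r)
        = T F' m t r * T G' m t r + T F' er t r * T G' U t r + T F' m t r * T G' er t r"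
        unfolding VF[OF r] VG(1)[OF r] unfolding VG(2)[OF r] by (simp add: algebra_simps)
      also have "cmod \<dots> powr 2 \<le> (cmod (T F' m t r * T G' m t r) + cmod (T F' er t r * T G' U t r) + cmod (T F' m t r * T G' er t r)) powr 2"
        by (intro powr_mono2) (auto intro!: norm_triangle_mono norm_triangle_ineq)
      also have "\<dots> \<le> 3 * (cmod (T F' m t r * T G' m t r) powr 2 + cmod (T F' er t r * T G' U t r) powr 2 + cmod (T F' m t r * T G' er t r) powr 2)"
      proof -
        have "(x + y + z)\<^sup>2 \<le> 3 * (x\<^sup>2 + y\<^sup>2 + z\<^sup>2)" for x y z :: real
          using sum_squares_bound[of x y] sum_squares_bound[of x z] sum_squares_bound[of y z]
          by (simp add: power2_eq_square algebra_simps)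
        then show ?thesis by simp
      qed
      finally show ?thesis .
    qed
    have t2: "(\<integral>\<^sup>+ t. ennreal (cmod (T F' er t r * T G' U t r) powr 2) \<partial>lborel) \<le> ennreal (A2 * (N * N') powr 2 * r powr (- 2))" if r: "1 \<le> r" for r
    proof -
      have "(\<integral>\<^sup>+ t. ennreal (cmod (T F' er t r * T G' U t r) powr 2) \<partial>lborel) \<le> ennreal (C * ((C1 / r) * C1 * ((2 * (1 * N)) * (2 * (w * N')))) powr 2)"
        unfolding T_def
      proof (rule H[OF F'4 G'4])
        show "\<forall>s\<in>{1..2*1}. cmod (complex_of_real (er (r * s))) \<le> C1 / r"
        proof
          fix s :: real assume "s \<in> {1..2*1}"
          then have s: "0 < r * s" "r * 1 \<le> r * s" using r by auto
          have "\<bar>er (r * s)\<bar> \<le> C1 / (r * s)" by (rule eb[OF s(1)])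
          also have "\<dots> \<le> C1 / r" using s C1 r by (intro divide_left_mono) auto
          finally show "cmod (complex_of_real (er (r * s))) \<le> C1 / r" by simp
        qed
        show "\<forall>s\<in>{M..2*M}. cmod (complex_of_real (U (r * s))) \<le> C1" using U_le M r by auto
      qed (use C1 r in auto)
      also have "C * ((C1 / r) * C1 * ((2 * (1 * N)) * (2 * (w * N')))) powr 2 = A2 * (N * N') powr 2 * r powr (- 2)"
        using r N w C1 by (simp add: A2_def powr_minus power_mult_distrib power_divide field_simps)
      finally show ?thesis .
    qed
    have t3: "(\<integral>\<^sup>+ t. ennreal (cmod (T F' m t r * T G' er t r) powr 2) \<partial>lborel) \<le> ennreal (A3 * (N * N') powr 2 * r powr (- 2))" if r: "1 \<le> r" for r
    proof -
      have "(\<integral>\<^sup>+ t. ennreal (cmod (T F' m t r * T G' er t r) powr 2) \<partial>lborel) \<le> ennreal (C * ((2 * cmod a) * (C1 / (r * M)) * ((2 * (1 * N)) * (2 * (w * N')))) powr 2)"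
        unfolding T_def
      proof (rule H[OF F'4 G'4])
        show "\<forall>s\<in>{M..2*M}. cmod (complex_of_real (er (r * s))) \<le> C1 / (r * M)"
        proof
          fix s :: real assume "s \<in> {M..2*M}"
          then have s: "0 < r * s" "r * M \<le> r * s" using r M by auto
          have "\<bar>er (r * s)\<bar> \<le> C1 / (r * s)" by (rule eb[OF s(1)])
          also have "\<dots> \<le> C1 / (r * M)" using s C1 r M by (intro divide_left_mono) auto
          finally show "cmod (complex_of_real (er (r * s))) \<le> C1 / (r * M)" by simp
        qed
        show "\<forall>s\<in>{1..2*1}. cmod (complex_of_real (m (r * s))) \<le> 2 * cmod a" using mb by auto
      qed (use C1 r M a in auto)
      also have "C * ((2 * cmod a) * (C1 / (r * M)) * ((2 * (1 * N)) * (2 * (w * N')))) powr 2 = A3 * (N * N') powr 2 * r powr (- 2)"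
        using r N w C1 M by (simp add: A3_def powr_minus power_mult_distrib power_divide field_simps)
      finally show ?thesis .
    qed
    define I where "I H e t r = (LINT s|lborel. H s * cis (t * s\<^sup>2 + r * (e * s)))" for H e t r
    have TI: "T H m t r = a * I H 1 t r + cnj a * I H (-1) t r" if H: "integrable lborel H" for H t r
    proof -
      have i: "integrable lborel (\<lambda>s. H s * cis (t * s\<^sup>2 + r * (e * s)))" for e
        by (rule Bochner_Integration.integrable_bound[OF H]) (use H in \<open>auto simp: norm_mult\<close>)
      have "T H m t r = (LINT s|lborel. a * (H s * cis (t * s\<^sup>2 + r * (1 * s))) + cnj a * (H s * cis (t * s\<^sup>2 + r * (-1 * s))))"
        unfolding T_def
      proof (intro Bochner_Integration.integral_cong refl)
        fix s
        have "complex_of_real (m (r * s)) = a * cis (r * s) + cnj (a * cis (r * s))"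
          unfolding m_def complex_add_cnj ..
        moreover have "cis (t * s\<^sup>2 + r * (1 * s)) = cis (t * s\<^sup>2) * cis (r * s)" "cis (t * s\<^sup>2 + r * (-1 * s)) = cis (t * s\<^sup>2) * cnj (cis (r * s))"
          by (simp_all add: cis_mult cis_cnj)
        ultimately show "H s * (cis (t * s\<^sup>2) * complex_of_real (m (r * s))) = a * (H s * cis (t * s\<^sup>2 + r * (1 * s))) + cnj a * (H s * cis (t * s\<^sup>2 + r * (-1 * s)))"
          by (simp only: complex_cnj_mult) (simp only: distrib_left mult_ac)
      qed
      also have "\<dots> = a * I H 1 t r + cnj a * I H (-1) t r"
        unfolding I_def using i[of 1] i[of "-1"] by simp
      finally show ?thesis .
    qed
    have Im[measurable]: "(\<lambda>z. I H e (fst z) (snd z)) \<in> borel_measurable (borel \<Otimes>\<^sub>M borel)" if [measurable]: "H \<in> borel_measurable borel" for H e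
      unfolding I_def by measurable
    have Im'[measurable]: "(\<lambda>t. I H e t r) \<in> borel_measurable borel" if [measurable]: "H \<in> borel_measurable borel" for H e r
      unfolding I_def by measurable
    \<comment> \<open>The main part \<open>m\<close> of the kernel is a sum of two conjugate
      exponentials, so each factor is a combination of two parabola extensions with opposite signs
      of \<open>r * s\<close>, and the product has four terms. \<open>bilinear_parabola\<close>
      treats every choice of signs.\<close>
    let ?E = "{1, -1::real}"
    have nF: "(\<integral>\<^sup>+ s. ennreal ((cmod (F' s))\<^sup>2) \<partial>lborel) \<le> ennreal (N powr 2)" using F' N by (simp add: admissible_def)
    have nG: "(\<integral>\<^sup>+ s. ennreal ((cmod (G' s))\<^sup>2) \<partial>lborel) \<le> ennreal ((w * N') powr 2)" using G' N w by (simp add: admissible_def)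
    have bil: "(\<integral>\<^sup>+ r. \<integral>\<^sup>+ t. ennreal ((cmod (I F' e t r * I G' e' t r))\<^sup>2) \<partial>lborel \<partial>lborel) \<le> ennreal (36 * pi\<^sup>2 * w powr 2 * (N * N') powr 2)" if "e \<in> ?E" "e' \<in> ?E" for e e'
    proof -
      have "(\<integral>\<^sup>+ r. \<integral>\<^sup>+ t. ennreal ((cmod (I F' e t r * I G' e' t r))\<^sup>2) \<partial>lborel \<partial>lborel) = (\<integral>\<^sup>+ z. ennreal ((cmod (I F' e (fst z) (snd z) * I G' e' (fst z) (snd z)))\<^sup>2) \<partial>(lborel \<Otimes>\<^sub>M lborel))"
        by (subst lborel_pair.nn_integral_snd[symmetric]) auto
      also have "\<dots> \<le> ennreal (36 * pi\<^sup>2) * ((\<integral>\<^sup>+ s. ennreal ((cmod (F' s))\<^sup>2) \<partial>lborel) * (\<integral>\<^sup>+ s. ennreal ((cmod (G' s))\<^sup>2) \<partial>lborel))"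
        unfolding I_def
        by (rule bilinear_parabola) (use that F' G' suppF' suppG' M in \<open>auto simp: admissible_def\<close>)
      also have "\<dots> \<le> ennreal (36 * pi\<^sup>2) * (ennreal (N powr 2) * ennreal ((w * N') powr 2))"
        by (intro mult_left_mono mult_mono nF nG) auto
      also have "\<dots> = ennreal (36 * pi\<^sup>2 * w powr 2 * (N * N') powr 2)"
        using N w by (simp add: ennreal_mult[symmetric] power_mult_distrib mult_ac)
      finally show ?thesis .
    qed
    have t1: "(\<integral>\<^sup>+ r. \<integral>\<^sup>+ t. ennreal (cmod (T F' m t r * T G' m t r) powr 2) \<partial>lborel \<partial>lborel) \<le> ennreal (A1 * (N * N') powr 2)"
    proof -
      have pt: "ennreal (cmod (T F' m t r * T G' m t r) powr 2) \<le> (\<Sum>e\<in>?E. \<Sum>e'\<in>?E. ennreal (4 * (cmod a)^4) * ennreal ((cmod (I F' e t r * I G' e' t r))\<^sup>2))" for t r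
      proof -
        have 1: "cmod (T H m t r) \<le> cmod a * (cmod (I H 1 t r) + cmod (I H (-1) t r))" if "integrable lborel H" for H
          unfolding TI[OF that] by (rule order_trans[OF norm_triangle_ineq]) (simp add: norm_mult algebra_simps)
        have 2: "(x + y)\<^sup>2 \<le> 2 * (x\<^sup>2 + y\<^sup>2)" for x y :: real
          using sum_squares_bound[of x y] by (simp add: power2_eq_square algebra_simps)
        have 3: "(cmod (T H m t r))\<^sup>2 \<le> (cmod a)\<^sup>2 * (2 * ((cmod (I H 1 t r))\<^sup>2 + (cmod (I H (-1) t r))\<^sup>2))" if "integrable lborel H" for H
        proof -
          have "(cmod (T H m t r))\<^sup>2 \<le> (cmod a * (cmod (I H 1 t r) + cmod (I H (-1) t r)))\<^sup>2"
            by (intro power_mono 1[OF that]) auto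
          also have "\<dots> \<le> (cmod a)\<^sup>2 * (2 * ((cmod (I H 1 t r))\<^sup>2 + (cmod (I H (-1) t r))\<^sup>2))"
            unfolding power_mult_distrib by (intro mult_left_mono 2) auto
          finally show ?thesis .
        qed
        have "cmod (T F' m t r * T G' m t r) powr 2 = (cmod (T F' m t r))\<^sup>2 * (cmod (T G' m t r))\<^sup>2"
          by (simp add: norm_mult power_mult_distrib)
        also have "\<dots> \<le> ((cmod a)\<^sup>2 * (2 * ((cmod (I F' 1 t r))\<^sup>2 + (cmod (I F' (-1) t r))\<^sup>2))) * ((cmod a)\<^sup>2 * (2 * ((cmod (I G' 1 t r))\<^sup>2 + (cmod (I G' (-1) t r))\<^sup>2)))"
          by (intro mult_mono 3 admissible_integrable[OF F'] admissible_integrable[OF G']) auto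
        also have "\<dots> = (\<Sum>e\<in>?E. \<Sum>e'\<in>?E. 4 * (cmod a)^4 * (cmod (I F' e t r * I G' e' t r))\<^sup>2)"
          by (simp add: norm_mult power_mult_distrib algebra_simps power4_eq_xxxx power2_eq_square)
        finally have "ennreal (cmod (T F' m t r * T G' m t r) powr 2) \<le> ennreal (\<Sum>e\<in>?E. \<Sum>e'\<in>?E. 4 * (cmod a)^4 * (cmod (I F' e t r * I G' e' t r))\<^sup>2)"
          by (rule ennreal_leI)
        also have "\<dots> = (\<Sum>e\<in>?E. \<Sum>e'\<in>?E. ennreal (4 * (cmod a)^4 * (cmod (I F' e t r * I G' e' t r))\<^sup>2))"
          by (subst sum_ennreal[symmetric], simp add: sum_nonneg, intro sum.cong refl sum_ennreal[symmetric]) simp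
        finally show ?thesis by (simp only: ennreal_mult zero_le_mult_iff zero_le_power2 zero_le_numeral norm_ge_zero zero_le_power simp_thms) 
      qed
      have "(\<integral>\<^sup>+ r. \<integral>\<^sup>+ t. ennreal (cmod (T F' m t r * T G' m t r) powr 2) \<partial>lborel \<partial>lborel) \<le>
        (\<integral>\<^sup>+ r. \<integral>\<^sup>+ t. (\<Sum>e\<in>?E. \<Sum>e'\<in>?E. ennreal (4 * (cmod a)^4) * ennreal ((cmod (I F' e t r * I G' e' t r))\<^sup>2)) \<partial>lborel \<partial>lborel)"
        by (intro nn_integral_mono pt)
      also have "\<dots> = (\<Sum>e\<in>?E. \<Sum>e'\<in>?E. ennreal (4 * (cmod a)^4) * (\<integral>\<^sup>+ r. \<integral>\<^sup>+ t. ennreal ((cmod (I F' e t r * I G' e' t r))\<^sup>2) \<partial>lborel \<partial>lborel))"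
      proof -
        have mm: "(\<lambda>r. \<integral>\<^sup>+ t. ennreal ((cmod (I F' e t r * I G' e' t r))\<^sup>2) \<partial>lborel) \<in> borel_measurable borel" for e e'
        proof -
          have [measurable]: "(\<lambda>x. I H e (snd x) (fst x)) \<in> borel_measurable (borel \<Otimes>\<^sub>M borel)" if [measurable]: "H \<in> borel_measurable borel" for H e
            unfolding I_def by measurable
          show ?thesis by (intro lborel.borel_measurable_nn_integral) (simp add: split_def)
        qed
        define Q where "Q e e' r = (\<integral>\<^sup>+ t. ennreal ((cmod (I F' e t r * I G' e' t r))\<^sup>2) \<partial>lborel)" for e e' r
        have [measurable]: "Q e e' \<in> borel_measurable borel" for e e' unfolding Q_def[abs_def] by (rule mm)
        have "(\<integral>\<^sup>+ t. (\<Sum>e\<in>?E. \<Sum>e'\<in>?E. ennreal (4 * (cmod a)^4) * ennreal ((cmod (I F' e t r * I G' e' t r))\<^sup>2)) \<partial>lborel)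
            = (\<Sum>e\<in>?E. \<Sum>e'\<in>?E. ennreal (4 * (cmod a)^4) * Q e e' r)" for r
          by (simp add: nn_integral_add nn_integral_cmult Q_def)
        then show ?thesis unfolding Q_def[symmetric]
          by (simp add: nn_integral_add nn_integral_cmult)
      qed
      also have "\<dots> \<le> (\<Sum>e\<in>?E. \<Sum>e'\<in>?E. ennreal (4 * (cmod a)^4) * ennreal (36 * pi\<^sup>2 * w powr 2 * (N * N') powr 2))"
        by (intro sum_mono mult_left_mono bil) auto
      also have "\<dots> = ennreal (A1 * (N * N') powr 2)"
        by (simp add: A1_def ennreal_mult[symmetric] ennreal_plus[symmetric] del: ennreal_plus flip: ennreal_numeral) 
      finally show ?thesis .
    qed
    have Tm2[measurable]: "(\<lambda>r. \<integral>\<^sup>+ t. ennreal (cmod (T F' m t r * T G' m t r) powr 2) \<partial>lborel) \<in> borel_measurable borel"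
    proof -
      have [measurable]: "(\<lambda>x. T H m (snd x) (fst x)) \<in> borel_measurable (borel \<Otimes>\<^sub>M borel)" if [measurable]: "H \<in> borel_measurable borel" for H
        unfolding T_def by measurable
      show ?thesis by (intro lborel.borel_measurable_nn_integral) (simp add: split_def)
    qed
    have "(\<integral>\<^sup>+ r. mass 2 F G r * (ennreal (r powr (2 * D)) * indicator {1..} r) \<partial>lborel)
      \<le> (\<integral>\<^sup>+ r. ennreal 3 * ((\<integral>\<^sup>+ t. ennreal (cmod (T F' m t r * T G' m t r) powr 2) \<partial>lborel) + ennreal ((A2 + A3) * (N * N') powr 2) * (ennreal (r powr (- 2)) * indicator {1..} r)) \<partial>lborel)"
    proof (rule nn_integral_mono)
      fix r :: real
      show "mass 2 F G r * (ennreal (r powr (2 * D)) * indicator {1..} r) \<le> ennreal 3 * ((\<integral>\<^sup>+ t. ennreal (cmod (T F' m t r * T G' m t r) powr 2) \<partial>lborel) + ennreal ((A2 + A3) * (N * N') powr 2) * (ennreal (r powr (- 2)) * indicator {1..} r))"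
      proof (cases "1 \<le> r")
        case True
        then have r: "0 < r" by simp
        have [measurable]: "(\<lambda>t. V F t r) \<in> borel_measurable borel" "(\<lambda>t. V G t r) \<in> borel_measurable borel"
          unfolding V_def by measurable
        have "mass 2 F G r * ennreal (r powr (2 * D)) = (\<integral>\<^sup>+ t. ennreal (cmod (V F t r * V G t r) powr 2 * r powr (2 * D)) \<partial>lborel)"
          unfolding mass_def by (subst nn_integral_multc[symmetric]) (auto simp: ennreal_mult)
        also have "\<dots> \<le> (\<integral>\<^sup>+ t. ennreal 3 * (ennreal (cmod (T F' m t r * T G' m t r) powr 2) + ennreal (cmod (T F' er t r * T G' U t r) powr 2) + ennreal (cmod (T F' m t r * T G' er t r) powr 2)) \<partial>lborel)"
          using pw[OF r] by (intro nn_integral_mono) (simp add: ennreal_mult[symmetric] ennreal_plus[symmetric] ennreal_leI del: ennreal_plus ennreal_numeral)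
        also have "\<dots> = ennreal 3 * ((\<integral>\<^sup>+ t. ennreal (cmod (T F' m t r * T G' m t r) powr 2) \<partial>lborel) + (\<integral>\<^sup>+ t. ennreal (cmod (T F' er t r * T G' U t r) powr 2) \<partial>lborel) + (\<integral>\<^sup>+ t. ennreal (cmod (T F' m t r * T G' er t r) powr 2) \<partial>lborel))"
          by (subst nn_integral_cmult, simp, subst nn_integral_add, simp, simp, subst nn_integral_add) simp_all
        also have "\<dots> \<le> ennreal 3 * ((\<integral>\<^sup>+ t. ennreal (cmod (T F' m t r * T G' m t r) powr 2) \<partial>lborel) + ennreal (A2 * (N * N') powr 2 * r powr (- 2)) + ennreal (A3 * (N * N') powr 2 * r powr (- 2)))"
          by (intro mult_left_mono add_mono t2 t3 True order_refl) auto
        also have "\<dots> = ennreal 3 * ((\<integral>\<^sup>+ t. ennreal (cmod (T F' m t r * T G' m t r) powr 2) \<partial>lborel) + ennreal ((A2 + A3) * (N * N') powr 2) * ennreal (r powr (- 2)))"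
          using A by (simp add: ennreal_mult[symmetric] ennreal_plus[symmetric] add.assoc distrib_right del: ennreal_plus ennreal_numeral)
        finally show ?thesis using True by simp
      qed simp
    qed
    also have "\<dots> = ennreal 3 * ((\<integral>\<^sup>+ r. \<integral>\<^sup>+ t. ennreal (cmod (T F' m t r * T G' m t r) powr 2) \<partial>lborel \<partial>lborel) + ennreal ((A2 + A3) * (N * N') powr 2) * 1)"
    proof -
      have one: "(\<integral>\<^sup>+ r. ennreal (r powr (- 2)) * indicator {1..} r \<partial>lborel) = (1::ennreal)"
        using nn_integral_powr_to_inf[of "-2" 1] by simp
      define Q where "Q r = (\<integral>\<^sup>+ t. ennreal (cmod (T F' m t r * T G' m t r) powr 2) \<partial>lborel)" for r
      have [measurable]: "Q \<in> borel_measurable borel" unfolding Q_def[abs_def] by (rule Tm2)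
      show ?thesis
        unfolding Q_def[symmetric] by (simp add: nn_integral_add nn_integral_cmult one)
    qed
    also have "\<dots> \<le> ennreal 3 * (ennreal (A1 * (N * N') powr 2) + ennreal ((A2 + A3) * (N * N') powr 2) * 1)"
      by (intro mult_left_mono add_mono t1) auto
    also have "\<dots> = ennreal (3 * (A1 + A2 + A3) * (N * N') powr 2)"
      using A by (simp add: ennreal_mult[symmetric] ennreal_plus[symmetric] algebra_simps del: ennreal_plus ennreal_numeral)
    also have "\<dots> \<le> ennreal (CC * (N * N') powr 2)"
      by (intro ennreal_leI mult_right_mono) (auto simp: CC_def)
    finally show "(\<integral>\<^sup>+ r. mass 2 F G r * (ennreal (r powr (2 * D)) * indicator {1..} r) \<partial>lborel) \<le> ennreal (CC * (N * N') powr 2)" .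
  qed
qed

end

section \<open>Estimates away from the origin\<close>

text \<open>Convexity of the power \<open>q\<close> with weights proportional to \<open>c i\<close>.
  If each \<open>x i powr q\<close> is of size \<open>c i powr q\<close> after integration, the
  right side is of size \<open>S powr q\<close> whatever the number of terms; this is what makes
  sums over many level sets harmless.\<close>

lemma powr_sum_Jensen:
  fixes c x :: "'i \<Rightarrow> real"
  assumes I: "finite I" and c: "\<And>i. i \<in> I \<Longrightarrow> 0 < c i" and x: "\<And>i. i \<in> I \<Longrightarrow> 0 \<le> x i" and S: "(\<Sum>i\<in>I. c i) \<le> S" and q: "1 \<le> q"
  shows "(\<Sum>i\<in>I. x i) powr q \<le> S powr (q - 1) * (\<Sum>i\<in>I. c i powr (1 - q) * x i powr q)"
proof -
  define I' where "I' = {i\<in>I. 0 < x i}"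
  have I': "finite I'" "I' \<subseteq> I" using I by (auto simp: I'_def)
  have sx: "(\<Sum>i\<in>I. x i) = (\<Sum>i\<in>I'. x i)"
    using I x by (intro sum.mono_neutral_right) (auto simp: I'_def less_le)
  show ?thesis
  proof (cases "I' = {}")
    case True
    then show ?thesis unfolding sx using q by (simp add: sum_nonneg)
  next
    case False
    define S' where "S' = (\<Sum>i\<in>I'. c i)"
    have S': "0 < S'" unfolding S'_def using I' False c by (intro sum_pos) auto
    have S'S: "S' \<le> S"
      unfolding S'_def using I I' c by (intro order_trans[OF sum_mono2 S]) (auto intro: less_imp_le)
    have "(\<Sum>i\<in>I'. x i) powr q = (\<Sum>i\<in>I'. (c i / S') *\<^sub>R (x i * S' / c i)) powr q"
      using S' c I' by (intro arg_cong[where f="\<lambda>x. x powr q"] sum.cong refl) (auto simp: less_imp_neq[THEN not_sym] subset_iff)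
    also have "\<dots> \<le> (\<Sum>i\<in>I'. (c i / S') * (x i * S' / c i) powr q)"
    proof (rule convex_on_sum[OF I'(1) False powr_convex[OF q]])
      show "(\<Sum>i\<in>I'. c i / S') = 1" using S' by (simp add: S'_def sum_divide_distrib[symmetric])
    qed (use S' c I' in \<open>auto simp: I'_def less_imp_le\<close>)
    also have "\<dots> = (\<Sum>i\<in>I'. S' powr (q - 1) * (c i powr (1 - q) * x i powr q))"
    proof (intro sum.cong refl)
      fix i assume "i \<in> I'"
      then have "0 < c i" "0 < x i" using c by (auto simp: I'_def)
      then show "c i / S' * (x i * S' / c i) powr q = S' powr (q - 1) * (c i powr (1 - q) * x i powr q)"
        using S' by (simp add: powr_mult powr_divide powr_diff field_simps)
    qed
    also have "\<dots> = S' powr (q - 1) * (\<Sum>i\<in>I'. c i powr (1 - q) * x i powr q)" by (simp add: sum_distrib_left)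
    also have "\<dots> \<le> S powr (q - 1) * (\<Sum>i\<in>I. c i powr (1 - q) * x i powr q)"
      using S' S'S q I I' by (intro mult_mono powr_mono2 sum_mono2) (auto intro: sum_nonneg)
    finally show ?thesis unfolding sx .
  qed
qed

text \<open>From y = y^(1-\<theta>) y^\<theta> the first factor is bounded through \<open>u\<close>;
  the second is at most \<mu>^\<theta> below the threshold \<mu> and at most \<mu>^(\<theta>-1) y
  above it. The result is affine in \<open>y\<close>, so it can be integrated over the radius with a
  threshold that varies with it.\<close>

lemma powr_interpolate:
  fixes y :: real
  assumes y: "0 \<le> y" "y \<le> u" and \<mu>: "0 < \<mu>" and \<theta>: "0 \<le> \<theta>" "\<theta> \<le> 1"
  shows "y \<le> u powr (1 - \<theta>) * \<mu> powr \<theta> + u powr (1 - \<theta>) * \<mu> powr (\<theta> - 1) * y"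
proof (cases "y = 0")
  case False
  then have y0: "0 < y" using y by simp
  have e: "y = y powr (1 - \<theta>) * y powr \<theta>" using y0 by (simp add: powr_add[symmetric])
  have 1: "y powr (1 - \<theta>) \<le> u powr (1 - \<theta>)" using y \<theta> by (intro powr_mono2) auto
  show ?thesis
  proof (cases "y \<le> \<mu>")
    case True
    have "y powr (1 - \<theta>) * y powr \<theta> \<le> u powr (1 - \<theta>) * \<mu> powr \<theta>"
      using True y \<theta> by (intro mult_mono 1 powr_mono2) auto
    then show ?thesis using e y by (simp add: add_increasing2)
  next
    case False
    have "y powr \<theta> = y powr (\<theta> - 1) * y" using y0 by (simp add: powr_diff)
    also have "\<dots> \<le> \<mu> powr (\<theta> - 1) * y" using False \<mu> \<theta> y by (intro mult_right_mono powr_mono2') auto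
    finally have "y powr (1 - \<theta>) * y powr \<theta> \<le> u powr (1 - \<theta>) * (\<mu> powr (\<theta> - 1) * y)"
      by (intro mult_mono 1) auto
    then show ?thesis using e by (simp add: add_increasing mult.assoc)
  qed
qed (use \<mu> in simp)

text \<open>The first term dominates below the threshold \<open>l\<close>, the second above it.
  Being linear in the first and second powers, the bound integrates to a relation between
  \<open>mass q\<close>, \<open>mass 1\<close> and \<open>mass 2\<close> with \<open>l\<close>
  free.\<close>

lemma powr_between_1_2:
  fixes x :: real
  assumes x: "0 \<le> x" and l: "0 < l" and q: "1 \<le> q" "q \<le> 2"
  shows "x powr q \<le> l powr (q - 1) * x powr 1 + l powr (q - 2) * x powr 2"
proof (cases "x = 0")
  case False
  then have x0: "0 < x" using x by simp
  show ?thesis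
  proof (cases "x \<le> l")
    case True
    have "x powr q = x powr (q - 1) * x powr 1" using x0 by (simp add: powr_diff)
    also have "\<dots> \<le> l powr (q - 1) * x powr 1" using True x q by (intro mult_right_mono powr_mono2) auto
    finally show ?thesis by (simp add: add_increasing2)
  next
    case False
    have "x powr q = x powr (q - 2) * x powr 2" using x0 by (simp add: powr_add[symmetric] del: powr_numeral)
    also have "\<dots> \<le> l powr (q - 2) * x powr 2" using False l q by (intro mult_right_mono powr_mono2') auto
    finally show ?thesis using x0 by (simp add: add_increasing)
  qed
qed simp

context radial_kernel begin

definition far :: "real \<Rightarrow> (real \<Rightarrow> complex) \<Rightarrow> (real \<Rightarrow> complex) \<Rightarrow> ennreal" where
  "far q F G = (\<integral>\<^sup>+ r. mass q F G r * (ennreal (r powr D) * indicator {1..} r) \<partial>lborel)"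

lemma V_measurable' [measurable]:
  assumes [measurable]: "F \<in> borel_measurable borel"
  shows "(\<lambda>t. V F t r) \<in> borel_measurable borel"
  unfolding V_def by measurable

lemma mass_interpolate:
  assumes [measurable]: "F \<in> borel_measurable borel" "G \<in> borel_measurable borel"
    and l: "0 < l" and q: "1 \<le> q" "q \<le> 2"
  shows "mass q F G r \<le> ennreal (l powr (q - 1)) * mass 1 F G r + ennreal (l powr (q - 2)) * mass 2 F G r"
proof -
  have "mass q F G r \<le> (\<integral>\<^sup>+ t. ennreal (l powr (q - 1)) * ennreal (cmod (V F t r * V G t r) powr 1) + ennreal (l powr (q - 2)) * ennreal (cmod (V F t r * V G t r) powr 2) \<partial>lborel)"
    unfolding mass_def
  proof (rule nn_integral_mono)
    fix t
    show "ennreal (cmod (V F t r * V G t r) powr q) \<le> ennreal (l powr (q - 1)) * ennreal (cmod (V F t r * V G t r) powr 1) + ennreal (l powr (q - 2)) * ennreal (cmod (V F t r * V G t r) powr 2)"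
      using powr_between_1_2[OF norm_ge_zero l q, of "V F t r * V G t r"]
      by (simp only: ennreal_mult[symmetric] ennreal_plus[symmetric] powr_ge_zero mult_nonneg_nonneg ennreal_leI)
  qed
  also have "\<dots> = ennreal (l powr (q - 1)) * mass 1 F G r + ennreal (l powr (q - 2)) * mass 2 F G r"
    unfolding mass_def by (subst nn_integral_add) (simp_all add: nn_integral_cmult)
  finally show ?thesis .
qed

text \<open>Both applications of Young's inequality use the powers of \<open>r\<close> which would be sharp if
  \<open>mass 2 F G r\<close> were equal to \<open>r\<^sup>-\<^sup>2\<^sup>D\<^sup>-\<^sup>1\<close>.\<close>
lemma interpolated_far:
  assumes M: "0 < M" "M \<le> 1/4" and q: "1 < q" "q \<le> 2" and \<theta>: "0 \<le> \<theta>" "\<theta> \<le> 1" and cond: "1 < (q - 1) * (D + \<theta>)"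
  shows "\<exists>C\<ge>0. \<forall>F G N1 N1' N2 N2'. admissible 1 (dual2 q) F N1 \<longrightarrow> admissible M (dual2 q) G N1' \<longrightarrow> admissible 1 2 F N2 \<longrightarrow> admissible M 2 G N2' \<longrightarrow>
     far q F G \<le> ennreal (C * ((N1 * N1') powr (1 - \<theta>) * (N2 * N2') powr \<theta>) powr q)"
proof -
  have dual_1: "dual2 1 = 2" by (simp add: dual2_def)
  obtain Ca where Ca: "0 < Ca" and Ha: "\<And>F G N N' r. admissible 1 (dual2 q) F N \<Longrightarrow> admissible M (dual2 q) G N' \<Longrightarrow> 0 < r \<Longrightarrow>
      mass q F G r \<le> ennreal (Ca * r powr (- D * q) * (N * N') powr q)"
    using fixed_radius[OF M(1), of q] q by (meson less_imp_le)
  obtain Cb where Cb: "0 < Cb" and Hb: "\<And>F G N N' r. admissible 1 2 F N \<Longrightarrow> admissible M 2 G N' \<Longrightarrow> 0 < r \<Longrightarrow>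
      mass 1 F G r \<le> ennreal (Cb * r powr (- D * 1) * (N * N') powr 1)"
    using fixed_radius[OF M(1), of 1] unfolding dual_1 by (meson order_refl)
  obtain Cc where Cc: "0 < Cc" and Hc: "\<And>F G N N'. admissible 1 2 F N \<Longrightarrow> admissible M 2 G N' \<Longrightarrow>
     (\<integral>\<^sup>+ r. mass 2 F G r * (ennreal (r powr (2 * D)) * indicator {1..} r) \<partial>lborel) \<le> ennreal (Cc * (N * N') powr 2)"
    using weighted_L2_far[OF M] by blast
  define e where "e = (q - 1) * (D + \<theta>)"
  define W where "W = - (1 powr (- e + 1)) / (- e + 1)"
  have W: "0 \<le> W" using cond by (simp add: W_def e_def field_simps)
  define CC where "CC = Ca powr (1 - \<theta>) * ((1 + Cb) * W + Cc)"
  have CC: "0 \<le> CC" using Ca Cb Cc W by (simp add: CC_def)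
  show ?thesis
  proof (intro exI[of _ CC] conjI allI impI CC)
    fix F G N1 N1' N2 N2'
    assume F1: "admissible 1 (dual2 q) F N1" and G1: "admissible M (dual2 q) G N1'" and F2: "admissible 1 2 F N2" and G2: "admissible M 2 G N2'"
    note [measurable] = admissible_measurable[OF F1] admissible_measurable[OF G1]
    define n1 n2 where "n1 = N1 * N1'" and "n2 = N2 * N2'"
    have n: "0 < n1" "0 < n2" using F1 G1 F2 G2 by (auto simp: n1_def n2_def admissible_def)
    define Z where "Z = Ca powr (1 - \<theta>) * (n1 powr (1 - \<theta>) * n2 powr \<theta>) powr q"
    have Z: "0 \<le> Z" by (simp add: Z_def)
    have pt: "mass q F G r * (ennreal (r powr D) * indicator {1..} r) \<le>
        ennreal (Z * (1 + Cb)) * (ennreal (r powr (- e)) * indicator {1..} r) + ennreal (Z * n2 powr (- 2)) * (mass 2 F G r * (ennreal (r powr (2 * D)) * indicator {1..} r))" for r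
    proof (cases "1 \<le> r")
      case True
      then have r: "0 < r" by simp
      \<comment> \<open>A product of height \<open>l\<close> lasting for a time \<open>r\<close> has
        \<open>mass 1\<close> equal to \<open>n2 * r powr (- D)\<close>, \<open>mass 2\<close> equal
        to n2^2 r^(-2D-1) and \<open>mass q\<close> equal to \<mu>. So \<open>l\<close> and \<mu>
        are the thresholds at which the two terms of each interpolation balance in this model case,
        while \<open>u\<close> is the Hausdorff-Young bound.\<close>
      define u where "u = Ca * r powr (- D * q) * n1 powr q"
      define \<mu> where "\<mu> = n2 powr q * r powr (- (D * q + (q - 1)))"
      define l where "l = n2 * r powr (- (D + 1))"
      have pos: "0 < u" "0 < \<mu>" "0 < l" using Ca r n by (auto simp: u_def \<mu>_def l_def)
      define a0 a1 where "a0 = u powr (1 - \<theta>) * \<mu> powr \<theta>" and "a1 = u powr (1 - \<theta>) * \<mu> powr (\<theta> - 1)"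
      have yu: "mass q F G r \<le> ennreal u" unfolding u_def n1_def by (rule Ha[OF F1 G1 r])
      have A: "mass q F G r \<le> ennreal a0 + ennreal a1 * mass q F G r"
      proof -
        have "mass q F G r < \<top>" using yu by (rule order.strict_trans1) simp
        then obtain y where y: "mass q F G r = ennreal y" "0 \<le> y" by (cases "mass q F G r") auto
        have "y \<le> u" using yu y pos by simp
        from powr_interpolate[OF y(2) this pos(2) \<theta>] show ?thesis
          unfolding y a0_def a1_def using y(2) by (simp add: ennreal_mult[symmetric] ennreal_plus[symmetric] ennreal_leI del: ennreal_plus)
      qed
      have B: "mass q F G r \<le> ennreal (l powr (q - 1)) * mass 1 F G r + ennreal (l powr (q - 2)) * mass 2 F G r"
        by (rule mass_interpolate) (use pos q in auto)
      have "mass 1 F G r \<le> ennreal (Cb * r powr (- D) * n2)"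
        using Hb[OF F2 G2 r] n by (simp add: n2_def)
      then have "mass q F G r \<le> ennreal a0 + ennreal a1 * (ennreal (l powr (q - 1)) * ennreal (Cb * r powr (- D) * n2) + ennreal (l powr (q - 2)) * mass 2 F G r)"
        by (intro order_trans[OF A] add_mono mult_left_mono order_trans[OF B] order_refl) auto
      then have "mass q F G r * ennreal (r powr D) \<le> (ennreal a0 + ennreal a1 * (ennreal (l powr (q - 1)) * ennreal (Cb * r powr (- D) * n2) + ennreal (l powr (q - 2)) * mass 2 F G r)) * ennreal (r powr D)"
        by (rule mult_right_mono) simp
      also have "\<dots> = ennreal (a0 * r powr D) + ennreal (a1 * l powr (q - 1) * (Cb * r powr (- D) * n2) * r powr D) + ennreal (a1 * l powr (q - 2) * r powr D) * mass 2 F G r"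
        using Cb n by (simp add: a0_def a1_def ennreal_mult algebra_simps)
      also have "a0 * r powr D = Z * r powr (- e)"
        unfolding a0_def u_def \<mu>_def Z_def e_def using Ca r n
        by (simp add: powr_def ln_mult flip: exp_add) (simp add: algebra_simps)
      also have "a1 * l powr (q - 1) * (Cb * r powr (- D) * n2) * r powr D = Cb * (Z * r powr (- e))"
      proof -
        have "a1 * l powr (q - 1) = Z * (r powr (- e) * n2 powr (- 1))"
          unfolding a1_def u_def \<mu>_def l_def Z_def e_def using Ca r n
          by (simp add: powr_def ln_mult flip: exp_add) (simp add: algebra_simps)
        moreover have "n2 powr (- 1) * n2 = 1" "r powr (- D) * r powr D = 1"
          using n r by (simp_all add: powr_minus)
        moreover have "Z * (r powr (- e) * n2 powr (- 1)) * (r powr (- D) * n2) * r powr D = (Z * r powr (- e)) * (n2 powr (- 1) * n2) * (r powr (- D) * r powr D)"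
          by (simp only: mult_ac)
        ultimately have "a1 * l powr (q - 1) * (r powr (- D) * n2) * r powr D = Z * r powr (- e)"
          by simp
        then show ?thesis using n by (simp add: mult_ac)
      qed
      also have "ennreal (a1 * l powr (q - 2) * r powr D) * mass 2 F G r \<le> ennreal (Z * n2 powr (- 2) * r powr (2 * D)) * mass 2 F G r"
      proof -
        have "a1 * l powr (q - 2) * r powr D = Z * n2 powr (- 2) * r powr (2 * D + 1 - e)"
          unfolding a1_def u_def \<mu>_def l_def Z_def e_def using Ca r n
          by (simp add: powr_def ln_mult flip: exp_add) (simp add: algebra_simps)
        \<comment> \<open>By \<open>cond\<close> the exponent \<open>e\<close> exceeds 1, which
          brings \<open>2 * D + 1 - e\<close> below the weight \<open>2 * D\<close> of
          \<open>weighted_L2_far\<close>. The same inequality makes \<open>r powr (- e)\<close>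
          integrable in the other two terms.\<close>
        also have "\<dots> \<le> Z * n2 powr (- 2) * r powr (2 * D)"
          using Z True cond by (intro mult_left_mono powr_mono) (auto simp: e_def)
        finally show ?thesis by (intro mult_right_mono ennreal_leI) auto
      qed
      finally have "mass q F G r * ennreal (r powr D) \<le> ennreal (Z * r powr (- e)) + ennreal (Cb * (Z * r powr (- e))) + ennreal (Z * n2 powr (- 2) * r powr (2 * D)) * mass 2 F G r"
        by (simp add: add_left_mono)
      also have "\<dots> = ennreal (Z * (1 + Cb)) * ennreal (r powr (- e)) + ennreal (Z * n2 powr (- 2)) * (mass 2 F G r * ennreal (r powr (2 * D)))"
      proof -
        have "ennreal (Z * r powr (- e)) + ennreal (Cb * (Z * r powr (- e))) = ennreal (Z * r powr (- e) + Cb * (Z * r powr (- e)))"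
          using Z Cb by (intro ennreal_plus[symmetric]) auto
        also have "Z * r powr (- e) + Cb * (Z * r powr (- e)) = Z * (1 + Cb) * r powr (- e)" by (simp only: distrib_left distrib_right mult_ac mult_1_right)
        also have "ennreal \<dots> = ennreal (Z * (1 + Cb)) * ennreal (r powr (- e))" using Z Cb by (intro ennreal_mult) auto
        finally have 1: "ennreal (Z * r powr (- e)) + ennreal (Cb * (Z * r powr (- e))) = ennreal (Z * (1 + Cb)) * ennreal (r powr (- e))" .
        have 2: "ennreal (Z * n2 powr (- 2) * r powr (2 * D)) = ennreal (Z * n2 powr (- 2)) * ennreal (r powr (2 * D))"
          using Z by (intro ennreal_mult) auto
        show ?thesis unfolding 1 2 by (simp only: mult_ac)
      qed
      finally show ?thesis using True by simp
    qed simp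
    have "far q F G \<le> (\<integral>\<^sup>+ r. ennreal (Z * (1 + Cb)) * (ennreal (r powr (- e)) * indicator {1..} r) + ennreal (Z * n2 powr (- 2)) * (mass 2 F G r * (ennreal (r powr (2 * D)) * indicator {1..} r)) \<partial>lborel)"
      unfolding far_def by (intro nn_integral_mono pt)
    also have "\<dots> = ennreal (Z * (1 + Cb)) * (\<integral>\<^sup>+ r. ennreal (r powr (- e)) * indicator {1..} r \<partial>lborel) + ennreal (Z * n2 powr (- 2)) * (\<integral>\<^sup>+ r. mass 2 F G r * (ennreal (r powr (2 * D)) * indicator {1..} r) \<partial>lborel)"
      by (subst nn_integral_add) (simp_all add: nn_integral_cmult)
    also have "\<dots> \<le> ennreal (Z * (1 + Cb)) * ennreal W + ennreal (Z * n2 powr (- 2)) * ennreal (Cc * n2 powr 2)"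
    proof (intro add_mono mult_left_mono)
      show "(\<integral>\<^sup>+ r. ennreal (r powr (- e)) * indicator {1..} r \<partial>lborel) \<le> ennreal W"
        unfolding W_def using cond by (subst nn_integral_powr_to_inf) (auto simp: e_def)
      show "(\<integral>\<^sup>+ r. mass 2 F G r * (ennreal (r powr (2 * D)) * indicator {1..} r) \<partial>lborel) \<le> ennreal (Cc * n2 powr 2)"
        unfolding n2_def by (rule Hc[OF F2 G2])
    qed auto
    also have "\<dots> = ennreal (CC * (n1 powr (1 - \<theta>) * n2 powr \<theta>) powr q)"
    proof -
      have "n2 powr (- 2) * n2 powr 2 = 1" using n by (simp add: powr_add[symmetric] del: powr_numeral)
      then have "Z * n2 powr (- 2) * (Cc * n2 powr 2) = Z * Cc" by (simp add: mult_ac)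
      then have "Z * (1 + Cb) * W + Z * n2 powr (- 2) * (Cc * n2 powr 2) = CC * (n1 powr (1 - \<theta>) * n2 powr \<theta>) powr q"
        by (simp only: CC_def Z_def) (simp add: algebra_simps)
      moreover have "ennreal (Z * (1 + Cb)) * ennreal W + ennreal (Z * n2 powr (- 2)) * ennreal (Cc * n2 powr 2) = ennreal (Z * (1 + Cb) * W + Z * n2 powr (- 2) * (Cc * n2 powr 2))"
        using Z Cb W Cc by (simp only: ennreal_mult[symmetric] ennreal_plus[symmetric] mult_nonneg_nonneg powr_ge_zero less_imp_le add_nonneg_nonneg zero_le_one)
      ultimately show ?thesis by simp
    qed
    finally show "far q F G \<le> ennreal (CC * ((N1 * N1') powr (1 - \<theta>) * (N2 * N2') powr \<theta>) powr q)"
      unfolding n1_def n2_def .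
  qed
qed

end

section \<open>Decomposition of the inputs by height\<close>

lemma nn_integral_pointwise_limit_le:
  fixes f :: "nat \<Rightarrow> 'a \<Rightarrow> ennreal"
  assumes [measurable]: "\<And>n. f n \<in> borel_measurable M"
    and lim: "\<And>x. x \<in> space M \<Longrightarrow> (\<lambda>n. f n x) \<longlonglongrightarrow> g x" and le: "\<And>n. (\<integral>\<^sup>+ x. f n x \<partial>M) \<le> C"
  shows "(\<integral>\<^sup>+ x. g x \<partial>M) \<le> C"
proof -
  have "(\<integral>\<^sup>+ x. g x \<partial>M) = (\<integral>\<^sup>+ x. liminf (\<lambda>n. f n x) \<partial>M)"
    by (intro nn_integral_cong lim_imp_Liminf[symmetric] lim) simp_all
  also have "\<dots> \<le> liminf (\<lambda>n. \<integral>\<^sup>+ x. f n x \<partial>M)" by (rule nn_integral_liminf) simp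
  also have "\<dots> \<le> liminf (\<lambda>n::nat. C)" by (rule Liminf_mono) (simp add: le)
  finally show ?thesis by (simp add: Liminf_const)
qed

text \<open>All heights up to 1 form the single level 0: on a support of bounded length they need no
  finer splitting, and the sum over levels has to converge in one direction only.\<close>

definition level :: "(real \<Rightarrow> complex) \<Rightarrow> nat \<Rightarrow> real \<Rightarrow> complex" where
  "level F j s = (if (if j = 0 then cmod (F s) \<le> 1 else 2 ^ (j - 1) < cmod (F s) \<and> cmod (F s) \<le> 2 ^ j) then F s else 0)"

lemma level_measurable [measurable]:
  assumes [measurable]: "F \<in> borel_measurable borel"
  shows "level F j \<in> borel_measurable borel"
proof (cases "j = 0")
  case True
  have "(\<lambda>s. if cmod (F s) \<le> 1 then F s else 0) \<in> borel_measurable borel" by measurable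
  then show ?thesis using True by (simp add: level_def[abs_def])
next
  case False
  have "(\<lambda>s. if 2 ^ (j - 1) < cmod (F s) \<and> cmod (F s) \<le> 2 ^ j then F s else 0) \<in> borel_measurable borel" by measurable
  then show ?thesis using False by (simp add: level_def[abs_def])
qed

lemma sum_level: "(\<Sum>j\<le>J. level F j s) = (if cmod (F s) \<le> 2 ^ J then F s else 0)"
proof (induction J)
  case (Suc J)
  have "cmod (F s) \<le> 2 ^ J \<Longrightarrow> cmod (F s) \<le> 2 * 2 ^ J" using zero_le_power[of "2::real" J] by linarith
  then show ?case using Suc by (auto simp: level_def)
qed (simp add: level_def)

lemma integrable_cut:
  fixes F :: "real \<Rightarrow> complex"
  assumes "integrable lborel F" "G \<in> borel_measurable borel" "\<And>s. G s = F s \<or> G s = 0"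
  shows "integrable lborel G"
proof (rule Bochner_Integration.integrable_bound[OF assms(1)])
  have "norm (G s) \<le> norm (F s)" for s using assms(3)[of s] by auto
  then show "AE s in lborel. norm (G s) \<le> norm (F s)" by simp
qed (use assms in simp)

lemma level_cases: "level F j s = F s \<or> level F j s = 0"
  by (simp add: level_def)

text \<open>On level j > 0 the height exceeds 2^(j-1), so lowering the exponent from
  \<open>p\<close> to \<open>p1\<close> gains the factor 2^(-(j-1)(p-p1)) in the integral. For j = 0
  the same formula has a value of at least 1, and there the integral is at most the length
  \<open>m \<le> 1\<close> of the support.\<close>

lemma admissible_level_low:
  assumes F: "admissible m p F 1" and p: "1 \<le> p1" "p1 \<le> p" and m: "0 < m" "m \<le> 1"
  shows "admissible m p1 (level F j) (2 powr (- (real j - 1) * (p - p1) / p1))"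
  unfolding admissible_def
proof (intro conjI allI impI)
  note [measurable] = admissible_measurable[OF F]
  have Fp: "(\<integral>\<^sup>+ s. ennreal (cmod (F s) powr p) \<partial>lborel) \<le> 1" using F by (simp add: admissible_def)
  have supp: "F s = 0" if "s \<notin> {m..2*m}" for s using F that by (simp add: admissible_def)
  show "integrable lborel (level F j)"
    by (rule integrable_cut[OF admissible_integrable[OF F]]) (simp, rule level_cases)
  show "level F j s = 0" if "s \<notin> {m..2*m}" for s using supp[OF that] by (simp add: level_def)
  have e: "(2 powr (- (real j - 1) * (p - p1) / p1)) powr p1 = 2 powr (- (real j - 1) * (p - p1))"
    using p by (simp add: powr_powr)
  show "(\<integral>\<^sup>+ s. ennreal (cmod (level F j s) powr p1) \<partial>lborel) \<le> ennreal ((2 powr (- (real j - 1) * (p - p1) / p1)) powr p1)"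
  proof (cases "j = 0")
    case True
    have "(\<integral>\<^sup>+ s. ennreal (cmod (level F j s) powr p1) \<partial>lborel) \<le> (\<integral>\<^sup>+ s. indicator {m..2*m} s \<partial>lborel)"
      using supp p True by (intro nn_integral_mono) (auto simp: level_def indicator_def intro!: powr_le1 simp flip: ennreal_1)
    also have "\<dots> = ennreal m" using m by simp
    also have "\<dots> \<le> ennreal (2 powr (- (real j - 1) * (p - p1)))"
      using True p m by (intro ennreal_leI order_trans[OF m(2)] ge_one_powr_ge_zero) auto
    finally show ?thesis unfolding e .
  next
    case False
    have j: "real j - 1 = real (j - 1)" using False by simp
    have "(\<integral>\<^sup>+ s. ennreal (cmod (level F j s) powr p1) \<partial>lborel) \<le> (\<integral>\<^sup>+ s. ennreal (2 powr (- (real j - 1) * (p - p1))) * ennreal (cmod (F s) powr p) \<partial>lborel)"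
    proof (rule nn_integral_mono)
      fix s
      show "ennreal (cmod (level F j s) powr p1) \<le> ennreal (2 powr (- (real j - 1) * (p - p1))) * ennreal (cmod (F s) powr p)"
      proof (cases "2 ^ (j - 1) < cmod (F s) \<and> cmod (F s) \<le> 2 ^ j")
        case True
        define z where "z = cmod (F s)"
        have z1: "2 powr (real j - 1) \<le> z" using True unfolding z_def j by (simp add: powr_realpow)
        have z: "2 powr (real j - 1) \<le> z" "0 < z" using z1 order.strict_trans2[OF _ z1, of 0] by auto
        have "z powr p1 = z powr (- (p - p1)) * z powr p" using z by (simp add: powr_add[symmetric])
        also have "\<dots> \<le> (2 powr (real j - 1)) powr (- (p - p1)) * z powr p"
          using z p by (intro mult_right_mono powr_mono2') auto
        also have "(2 powr (real j - 1)) powr (- (p - p1)) = 2 powr (- (real j - 1) * (p - p1))"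
          unfolding powr_powr by (simp add: algebra_simps)
        finally have "z powr p1 \<le> 2 powr (- (real j - 1) * (p - p1)) * z powr p" .
        then show ?thesis using True False by (simp add: level_def z_def ennreal_mult[symmetric] ennreal_leI)
      qed (use False p in \<open>auto simp: level_def\<close>)
    qed
    also have "\<dots> \<le> ennreal (2 powr (- (real j - 1) * (p - p1))) * 1"
      using Fp by (subst nn_integral_cmult) (auto simp del: mult_1_right intro!: mult_left_mono)
    finally show ?thesis unfolding e by simp
  qed
qed simp

text \<open>The height is at most 2^j on level j, so raising the exponent from \<open>p\<close> to 2
  costs 2^(j(2-p)) in the integral: the counterpart of the gain in
  \<open>admissible_level_low\<close>.\<close>

lemma admissible_level_high:
  assumes F: "admissible m p F 1" and p: "0 < p" "p \<le> 2"
  shows "admissible m 2 (level F j) (2 powr (real j * (2 - p) / 2))"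
  unfolding admissible_def
proof (intro conjI allI impI)
  note [measurable] = admissible_measurable[OF F]
  have Fp: "(\<integral>\<^sup>+ s. ennreal (cmod (F s) powr p) \<partial>lborel) \<le> 1" using F by (simp add: admissible_def)
  have supp: "F s = 0" if "s \<notin> {m..2*m}" for s using F that by (simp add: admissible_def)
  show "integrable lborel (level F j)"
    by (rule integrable_cut[OF admissible_integrable[OF F]]) (simp, rule level_cases)
  show "level F j s = 0" if "s \<notin> {m..2*m}" for s using supp[OF that] by (simp add: level_def)
  have e: "(2 powr (real j * (2 - p) / 2)) powr 2 = 2 powr (real j * (2 - p))"
    unfolding powr_powr by simp
  have "(\<integral>\<^sup>+ s. ennreal (cmod (level F j s) powr 2) \<partial>lborel) \<le> (\<integral>\<^sup>+ s. ennreal (2 powr (real j * (2 - p))) * ennreal (cmod (F s) powr p) \<partial>lborel)"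
  proof (rule nn_integral_mono)
    fix s
    show "ennreal (cmod (level F j s) powr 2) \<le> ennreal (2 powr (real j * (2 - p))) * ennreal (cmod (F s) powr p)"
    proof (cases "level F j s = 0")
      case False
      define z where "z = cmod (F s)"
      have l: "level F j s = F s" and z: "z \<le> 2 powr real j" "0 < z"
        using False by (auto simp: level_def z_def powr_realpow split: if_splits)
      have "z powr 2 = z powr (2 - p) * z powr p" using z by (simp add: powr_add[symmetric] del: powr_numeral)
      also have "\<dots> \<le> (2 powr real j) powr (2 - p) * z powr p"
        using z p by (intro mult_right_mono powr_mono2) auto
      finally have "z powr 2 \<le> 2 powr (real j * (2 - p)) * z powr p" by (simp add: powr_powr)
      then show ?thesis unfolding l z_def[symmetric] by (simp only: ennreal_mult[symmetric] powr_ge_zero ennreal_leI)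
    qed simp
  qed
  also have "\<dots> \<le> ennreal (2 powr (real j * (2 - p))) * 1"
    using Fp by (subst nn_integral_cmult) (auto simp del: mult_1_right intro!: mult_left_mono)
  finally show "(\<integral>\<^sup>+ s. ennreal (cmod (level F j s) powr 2) \<partial>lborel) \<le> ennreal ((2 powr (real j * (2 - p) / 2)) powr 2)"
    unfolding e by simp
qed simp

context radial_kernel begin

lemma integrable_V:
  assumes F: "integrable lborel F"
  shows "integrable lborel (\<lambda>s. F s * (cis (t * s\<^sup>2) * complex_of_real (K (r * s))))"
  by (rule Bochner_Integration.integrable_bound[OF F]) (use F K_le in \<open>auto simp: norm_mult intro!: mult_left_le\<close>)

lemma V_sum:
  assumes "finite I" "\<And>i. i \<in> I \<Longrightarrow> integrable lborel (F i)"
  shows "V (\<lambda>s. \<Sum>i\<in>I. F i s) t r = (\<Sum>i\<in>I. V (F i) t r)"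
proof -
  have "V (\<lambda>s. \<Sum>i\<in>I. F i s) t r = (LINT s|lborel. (\<Sum>i\<in>I. F i s * (cis (t * s\<^sup>2) * complex_of_real (K (r * s)))))"
    unfolding V_def by (simp add: sum_distrib_right)
  also have "\<dots> = (\<Sum>i\<in>I. V (F i) t r)"
    unfolding V_def by (rule Bochner_Integration.integral_sum) (intro integrable_V assms)
  finally show ?thesis .
qed

lemma V_cmult: "V (\<lambda>s. c * F s) t r = c * V F t r"
  unfolding V_def by (simp add: mult.assoc)

lemma mass_cmult: "mass q (\<lambda>s. b * F s) (\<lambda>s. c * G s) r = ennreal (cmod (b * c) powr q) * mass q F G r"
  if [measurable]: "F \<in> borel_measurable borel" "G \<in> borel_measurable borel"
proof -
  have "mass q (\<lambda>s. b * F s) (\<lambda>s. c * G s) r = (\<integral>\<^sup>+ t. ennreal (cmod (b * c) powr q) * ennreal (cmod (V F t r * V G t r) powr q) \<partial>lborel)"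
    unfolding mass_def V_cmult by (intro nn_integral_cong) (simp add: norm_mult powr_mult ennreal_mult[symmetric] mult_ac)
  then show ?thesis unfolding mass_def by (simp add: nn_integral_cmult)
qed

text \<open>The product of the two sums is a sum over pairs, and \<open>powr_sum_Jensen\<close> is
  applied pointwise with weights \<open>c i * c j\<close>. The bound involves \<open>S\<close> but
  not the number of pieces, so it is stable under adding more and more levels.\<close>

lemma far_sum_bound:
  assumes I: "finite I" and F: "\<And>i. i \<in> I \<Longrightarrow> integrable lborel (F i)" and G: "\<And>i. i \<in> I \<Longrightarrow> integrable lborel (G i)"
    and c: "\<And>i. i \<in> I \<Longrightarrow> 0 < c i" and S: "(\<Sum>i\<in>I. c i) \<le> S" and q: "1 \<le> q" and C: "0 \<le> C"
    and le: "\<And>i j. i \<in> I \<Longrightarrow> j \<in> I \<Longrightarrow> far q (F i) (G j) \<le> ennreal (C * (c i * c j) powr q)"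
  shows "far q (\<lambda>s. \<Sum>i\<in>I. F i s) (\<lambda>s. \<Sum>i\<in>I. G i s) \<le> ennreal (C * (S * S) powr q)"
proof -
  have [measurable]: "F i \<in> borel_measurable borel" "G i \<in> borel_measurable borel" if "i \<in> I" for i using F[OF that] G[OF that] by auto
  have S0: "0 \<le> S" using c by (intro order_trans[OF sum_nonneg S]) (auto intro: less_imp_le)
  have SS: "(\<Sum>z\<in>I\<times>I. c (fst z) * c (snd z)) \<le> S * S"
  proof -
    have "(\<Sum>z\<in>I\<times>I. c (fst z) * c (snd z)) = (\<Sum>i\<in>I. c i) * (\<Sum>i\<in>I. c i)"
      by (simp add: sum_product sum.cartesian_product split_def)
    also have "\<dots> \<le> S * S" using S S0 c by (intro mult_mono sum_nonneg) (auto intro: less_imp_le)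
    finally show ?thesis .
  qed
  let ?w = "\<lambda>z. (S * S) powr (q - 1) * (c (fst z) * c (snd z)) powr (1 - q)"
  have pt: "mass q (\<lambda>s. \<Sum>i\<in>I. F i s) (\<lambda>s. \<Sum>i\<in>I. G i s) r \<le> (\<Sum>z\<in>I\<times>I. ennreal (?w z) * mass q (F (fst z)) (G (snd z)) r)" for r
  proof -
    have "mass q (\<lambda>s. \<Sum>i\<in>I. F i s) (\<lambda>s. \<Sum>i\<in>I. G i s) r \<le> (\<integral>\<^sup>+ t. (\<Sum>z\<in>I\<times>I. ennreal (?w z) * ennreal (cmod (V (F (fst z)) t r * V (G (snd z)) t r) powr q)) \<partial>lborel)"
      unfolding mass_def
    proof (rule nn_integral_mono)
      fix t
      have "cmod (V (\<lambda>s. \<Sum>i\<in>I. F i s) t r * V (\<lambda>s. \<Sum>i\<in>I. G i s) t r) = cmod (\<Sum>z\<in>I\<times>I. V (F (fst z)) t r * V (G (snd z)) t r)"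
      proof -
        have 1: "V (\<lambda>s. \<Sum>i\<in>I. F i s) t r = (\<Sum>i\<in>I. V (F i) t r)" by (rule V_sum[OF I]) (rule F)
        have 2: "V (\<lambda>s. \<Sum>i\<in>I. G i s) t r = (\<Sum>i\<in>I. V (G i) t r)" by (rule V_sum[OF I]) (rule G)
        show ?thesis unfolding 1 2 sum_product sum.cartesian_product split_def ..
      qed
      also have "\<dots> \<le> (\<Sum>z\<in>I\<times>I. cmod (V (F (fst z)) t r * V (G (snd z)) t r))" by (rule norm_sum)
      finally have "cmod (V (\<lambda>s. \<Sum>i\<in>I. F i s) t r * V (\<lambda>s. \<Sum>i\<in>I. G i s) t r) powr q \<le> (\<Sum>z\<in>I\<times>I. cmod (V (F (fst z)) t r * V (G (snd z)) t r)) powr q"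
        using q by (intro powr_mono2) auto
      also have "\<dots> \<le> (S * S) powr (q - 1) * (\<Sum>z\<in>I\<times>I. (c (fst z) * c (snd z)) powr (1 - q) * cmod (V (F (fst z)) t r * V (G (snd z)) t r) powr q)"
        by (rule powr_sum_Jensen) (use I c SS q in auto)
      also have "\<dots> = (\<Sum>z\<in>I\<times>I. ?w z * cmod (V (F (fst z)) t r * V (G (snd z)) t r) powr q)"
        by (simp add: sum_distrib_left mult.assoc)
      finally have "ennreal (cmod (V (\<lambda>s. \<Sum>i\<in>I. F i s) t r * V (\<lambda>s. \<Sum>i\<in>I. G i s) t r) powr q) \<le> ennreal (\<Sum>z\<in>I\<times>I. ?w z * cmod (V (F (fst z)) t r * V (G (snd z)) t r) powr q)"
        by (rule ennreal_leI)
      also have "\<dots> = (\<Sum>z\<in>I\<times>I. ennreal (?w z) * ennreal (cmod (V (F (fst z)) t r * V (G (snd z)) t r) powr q))"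
        by (subst sum_ennreal[symmetric], simp, intro sum.cong refl ennreal_mult) auto
      finally show "ennreal (cmod (V (\<lambda>s. \<Sum>i\<in>I. F i s) t r * V (\<lambda>s. \<Sum>i\<in>I. G i s) t r) powr q) \<le> (\<Sum>z\<in>I\<times>I. ennreal (?w z) * ennreal (cmod (V (F (fst z)) t r * V (G (snd z)) t r) powr q))" .
    qed
    also have "\<dots> = (\<Sum>z\<in>I\<times>I. ennreal (?w z) * mass q (F (fst z)) (G (snd z)) r)"
    proof -
      have m: "(\<lambda>t. ennreal (cmod (V (F (fst z)) t r * V (G (snd z)) t r) powr q)) \<in> borel_measurable lborel" if "z \<in> I \<times> I" for z
      proof -
        have [measurable]: "F (fst z) \<in> borel_measurable borel" "G (snd z) \<in> borel_measurable borel" using that by auto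
        show ?thesis by measurable
      qed
      have "(\<integral>\<^sup>+ t. (\<Sum>z\<in>I\<times>I. ennreal (?w z) * ennreal (cmod (V (F (fst z)) t r * V (G (snd z)) t r) powr q)) \<partial>lborel)
          = (\<Sum>z\<in>I\<times>I. \<integral>\<^sup>+ t. ennreal (?w z) * ennreal (cmod (V (F (fst z)) t r * V (G (snd z)) t r) powr q) \<partial>lborel)"
        by (rule nn_integral_sum) (rule borel_measurable_times_ennreal[OF borel_measurable_const m])
      also have "\<dots> = (\<Sum>z\<in>I\<times>I. ennreal (?w z) * mass q (F (fst z)) (G (snd z)) r)"
        unfolding mass_def by (rule sum.cong[OF refl]) (rule nn_integral_cmult[OF m])
      finally show ?thesis .
    qed
    finally show ?thesis .
  qed
  have "far q (\<lambda>s. \<Sum>i\<in>I. F i s) (\<lambda>s. \<Sum>i\<in>I. G i s) \<le> (\<integral>\<^sup>+ r. (\<Sum>z\<in>I\<times>I. ennreal (?w z) * (mass q (F (fst z)) (G (snd z)) r * (ennreal (r powr D) * indicator {1..} r))) \<partial>lborel)"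
    unfolding far_def
  proof (rule nn_integral_mono)
    fix r
    show "mass q (\<lambda>s. \<Sum>i\<in>I. F i s) (\<lambda>s. \<Sum>i\<in>I. G i s) r * (ennreal (r powr D) * indicator {1..} r) \<le> (\<Sum>z\<in>I\<times>I. ennreal (?w z) * (mass q (F (fst z)) (G (snd z)) r * (ennreal (r powr D) * indicator {1..} r)))"
      using mult_right_mono[OF pt[of r], of "ennreal (r powr D) * indicator {1..} r"] by (simp add: sum_distrib_right mult.assoc)
  qed
  also have "\<dots> = (\<Sum>z\<in>I\<times>I. ennreal (?w z) * far q (F (fst z)) (G (snd z)))"
  proof -
    have m: "(\<lambda>r. mass q (F (fst z)) (G (snd z)) r * (ennreal (r powr D) * indicator {1..} r)) \<in> borel_measurable lborel" if "z \<in> I \<times> I" for z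
    proof -
      have [measurable]: "F (fst z) \<in> borel_measurable borel" "G (snd z) \<in> borel_measurable borel" using that by auto
      show ?thesis by measurable
    qed
    have "(\<integral>\<^sup>+ r. (\<Sum>z\<in>I\<times>I. ennreal (?w z) * (mass q (F (fst z)) (G (snd z)) r * (ennreal (r powr D) * indicator {1..} r))) \<partial>lborel)
        = (\<Sum>z\<in>I\<times>I. \<integral>\<^sup>+ r. ennreal (?w z) * (mass q (F (fst z)) (G (snd z)) r * (ennreal (r powr D) * indicator {1..} r)) \<partial>lborel)"
      by (rule nn_integral_sum) (rule borel_measurable_times_ennreal[OF borel_measurable_const m])
    also have "\<dots> = (\<Sum>z\<in>I\<times>I. ennreal (?w z) * far q (F (fst z)) (G (snd z)))"
      unfolding far_def by (rule sum.cong[OF refl]) (rule nn_integral_cmult[OF m])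
    finally show ?thesis .
  qed
  also have "\<dots> \<le> (\<Sum>z\<in>I\<times>I. ennreal (?w z) * ennreal (C * (c (fst z) * c (snd z)) powr q))"
    by (intro sum_mono mult_left_mono le) auto
  also have "\<dots> = (\<Sum>z\<in>I\<times>I. ennreal ((S * S) powr (q - 1) * C * (c (fst z) * c (snd z))))"
  proof (intro sum.cong refl)
    fix z assume "z \<in> I \<times> I"
    then have "0 < c (fst z) * c (snd z)" using c by auto
    then have "(c (fst z) * c (snd z)) powr (1 - q) * (c (fst z) * c (snd z)) powr q = c (fst z) * c (snd z)"
      by (simp add: powr_add[symmetric] del: zero_less_mult_iff)
    then have h: "?w z * (C * (c (fst z) * c (snd z)) powr q) = (S * S) powr (q - 1) * C * (c (fst z) * c (snd z))"
      by (simp only: mult_ac)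
    show "ennreal (?w z) * ennreal (C * (c (fst z) * c (snd z)) powr q) = ennreal ((S * S) powr (q - 1) * C * (c (fst z) * c (snd z)))"
      unfolding h[symmetric] using C by (intro ennreal_mult[symmetric]) auto
  qed
  also have "\<dots> = ennreal ((S * S) powr (q - 1) * C * (\<Sum>z\<in>I\<times>I. c (fst z) * c (snd z)))"
  proof -
    have nn: "0 \<le> c (fst z) * c (snd z)" if "z \<in> I \<times> I" for z
      using that c[of "fst z"] c[of "snd z"] by (auto intro: less_imp_le)
    show ?thesis
      by (subst sum_ennreal, intro mult_nonneg_nonneg[of "(S * S) powr (q - 1) * C"] nn mult_nonneg_nonneg C powr_ge_zero) (simp_all add: sum_distrib_left)
  qed
  also have "\<dots> \<le> ennreal ((S * S) powr (q - 1) * C * (S * S))"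
    using SS C by (intro ennreal_leI mult_left_mono) auto
  also have "(S * S) powr (q - 1) * C * (S * S) = C * (S * S) powr q"
  proof (cases "S = 0")
    case False
    then have "0 < S * S" using S0 by simp
    then have "(S * S) powr (q - 1) * (S * S) powr 1 = (S * S) powr q" unfolding powr_add[symmetric] by simp
    then show ?thesis using S0 by (simp add: mult_ac)
  qed simp
  finally show ?thesis .
qed

text \<open>A truncation at height 2^J is a finite sum of levels. As J grows, \<open>V\<close>
  converges pointwise by dominated convergence, with |H| as majorant, and Fatou's lemma for the
  double integral over time and radius transfers the uniform bound.\<close>

lemma far_truncation_limit:
  assumes F: "integrable lborel F" and G: "integrable lborel G" and q: "0 < q"
    and le: "\<And>J. far q (\<lambda>s. if cmod (F s) \<le> 2 ^ J then F s else 0) (\<lambda>s. if cmod (G s) \<le> 2 ^ J then G s else 0) \<le> C"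
  shows "far q F G \<le> C"
proof -
  define tr where "tr H J s = (if cmod (H s) \<le> 2 ^ J then H s else 0)" for H :: "real \<Rightarrow> complex" and J :: nat and s
  have [measurable]: "F \<in> borel_measurable borel" "G \<in> borel_measurable borel" using F G by auto
  have trm[measurable]: "tr H J \<in> borel_measurable borel" if [measurable]: "H \<in> borel_measurable borel" for H J
    unfolding tr_def[abs_def] by measurable
  have Vm: "(\<lambda>z. V H (snd z) (fst z)) \<in> borel_measurable (lborel \<Otimes>\<^sub>M lborel)" if [measurable]: "H \<in> borel_measurable borel" for H
    using measurable_compose[OF measurable_Pair[OF measurable_snd measurable_fst] V_measurable[OF that]] by simp
  have lim: "(\<lambda>J. V (tr H J) t r) \<longlonglongrightarrow> V H t r" if H: "integrable lborel H" for H t r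
    unfolding V_def
  proof (rule integral_dominated_convergence[where w="\<lambda>s. cmod (H s)"])
    have [measurable]: "H \<in> borel_measurable borel" using H by auto
    show "(\<lambda>s. H s * (cis (t * s\<^sup>2) * complex_of_real (K (r * s)))) \<in> borel_measurable lborel" by measurable
    show "(\<lambda>s. tr H i s * (cis (t * s\<^sup>2) * complex_of_real (K (r * s)))) \<in> borel_measurable lborel" for i by measurable
    show "integrable lborel (\<lambda>s. cmod (H s))" using H by simp
    show "AE s in lborel. (\<lambda>i. tr H i s * (cis (t * s\<^sup>2) * complex_of_real (K (r * s)))) \<longlonglongrightarrow> H s * (cis (t * s\<^sup>2) * complex_of_real (K (r * s)))"
    proof (intro AE_I2 tendsto_mult tendsto_const)
      fix s
      obtain n where n: "cmod (H s) < 2 ^ n" using real_arch_pow[of 2 "cmod (H s)"] by auto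
      have "tr H i s = H s" if "n \<le> i" for i
      proof -
        have "(2::real) ^ n \<le> 2 ^ i" using that by (intro power_increasing) auto
        then have "cmod (H s) \<le> 2 ^ i" using n by linarith
        then show ?thesis by (simp add: tr_def)
      qed
      then show "(\<lambda>i. tr H i s) \<longlonglongrightarrow> H s" by (intro tendsto_eventually eventually_sequentiallyI[of n]) auto
    qed
    show "AE s in lborel. norm (tr H i s * (cis (t * s\<^sup>2) * complex_of_real (K (r * s)))) \<le> cmod (H s)" for i
      using K_le by (auto simp: tr_def norm_mult intro!: mult_left_le)
  qed
  have pair: "far q H H' = (\<integral>\<^sup>+ z. ennreal (cmod (V H (snd z) (fst z) * V H' (snd z) (fst z)) powr q) * (ennreal (fst z powr D) * indicator {1..} (fst z)) \<partial>(lborel \<Otimes>\<^sub>M lborel))"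
    if [measurable]: "H \<in> borel_measurable borel" "H' \<in> borel_measurable borel" for H H'
  proof -
    note [measurable] = Vm[OF that(1)] Vm[OF that(2)]
    show ?thesis
      unfolding far_def mass_def
      by (subst lborel.nn_integral_fst[symmetric]) (auto simp: nn_integral_multc intro!: nn_integral_cong)
  qed
  show ?thesis
    unfolding pair[OF \<open>F \<in> borel_measurable borel\<close> \<open>G \<in> borel_measurable borel\<close>]
  proof (rule nn_integral_pointwise_limit_le)
    show "(\<integral>\<^sup>+ z. ennreal (cmod (V (tr F J) (snd z) (fst z) * V (tr G J) (snd z) (fst z)) powr q) * (ennreal (fst z powr D) * indicator {1..} (fst z)) \<partial>(lborel \<Otimes>\<^sub>M lborel)) \<le> C" for J
      using le[of J] by (subst pair[symmetric]) (simp_all add: tr_def[abs_def])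
    show "(\<lambda>z. ennreal (cmod (V (tr F J) (snd z) (fst z) * V (tr G J) (snd z) (fst z)) powr q) * (ennreal (fst z powr D) * indicator {1..} (fst z))) \<in> borel_measurable (lborel \<Otimes>\<^sub>M lborel)" for J
    proof -
      note [measurable] = Vm[OF trm[of F J]] Vm[OF trm[of G J]]
      show ?thesis by measurable
    qed
    show "(\<lambda>J. ennreal (cmod (V (tr F J) (snd z) (fst z) * V (tr G J) (snd z) (fst z)) powr q) * (ennreal (fst z powr D) * indicator {1..} (fst z)))
        \<longlonglongrightarrow> ennreal (cmod (V F (snd z) (fst z) * V G (snd z) (fst z)) powr q) * (ennreal (fst z powr D) * indicator {1..} (fst z))" for z
      using q by (intro tendsto_mult_ennreal tendsto_ennrealI tendsto_powr' tendsto_norm tendsto_mult lim F G tendsto_const) (auto simp: indicator_def)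
  qed
qed

text \<open>Level j enters \<open>interpolated_far\<close> through n1^(1-\<theta>) n2^\<theta>, the
  gain of the lower exponent against the loss of the exponent 2. This equals a constant times 2^(-e
  j), and \<open>eps\<close> says precisely that e > 0; the sizes of the levels then form a
  convergent geometric series.\<close>

lemma level_set_far:
  assumes M: "0 < M" "M \<le> 1/4" and q: "1 < q" "q \<le> 2" and \<theta>: "0 \<le> \<theta>" "\<theta> \<le> 1" and cond: "1 < (q - 1) * (D + \<theta>)"
    and p: "dual2 q \<le> p" "p \<le> 2" and eps: "1 < p * ((1 - \<theta>) / dual2 q + \<theta> / 2)"
  shows "\<exists>C\<ge>0. \<forall>F G. admissible 1 p F 1 \<longrightarrow> admissible M p G 1 \<longrightarrow> far q F G \<le> ennreal C"
proof -
  define p1 where "p1 = dual2 q"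
  have p1: "1 \<le> p1" "p1 \<le> p" using dual2(1)[of q] q p by (auto simp: p1_def)
  obtain C where C: "0 \<le> C" and H: "\<And>F G N1 N1' N2 N2'. admissible 1 p1 F N1 \<Longrightarrow> admissible M p1 G N1' \<Longrightarrow> admissible 1 2 F N2 \<Longrightarrow> admissible M 2 G N2' \<Longrightarrow>
     far q F G \<le> ennreal (C * ((N1 * N1') powr (1 - \<theta>) * (N2 * N2') powr \<theta>) powr q)"
    using interpolated_far[OF M q \<theta> cond] unfolding p1_def by blast
  define n1 where "n1 j = 2 powr (- (real j - 1) * (p - p1) / p1)" for j
  define n2 where "n2 j = 2 powr (real j * (2 - p) / 2)" for j
  define c where "c j = n1 j powr (1 - \<theta>) * n2 j powr \<theta>" for j
  define e where "e = p * ((1 - \<theta>) / p1 + \<theta> / 2) - 1"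
  define c0 where "c0 = 2 powr ((1 - \<theta>) * (p - p1) / p1)"
  have e: "0 < e" using eps by (simp add: e_def p1_def)
  have c_eq: "c j = c0 * (2 powr (- e)) ^ j" for j
  proof -
    have "c j = 2 powr ((1 - \<theta>) * (- (real j - 1) * (p - p1) / p1) + \<theta> * (real j * (2 - p) / 2))"
      by (simp add: c_def n1_def n2_def powr_powr powr_add mult.commute)
    also have "(1 - \<theta>) * (- (real j - 1) * (p - p1) / p1) + \<theta> * (real j * (2 - p) / 2) = (1 - \<theta>) * (p - p1) / p1 + (- e) * real j"
      using p1 by (simp add: e_def field_simps)
    finally have "c j = c0 * 2 powr ((- e) * real j)" by (simp only: c0_def powr_add)
    also have "2 powr ((- e) * real j) = (2 powr (- e)) ^ j" by (simp only: powr_powr[symmetric]) (simp add: powr_realpow)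
    finally show ?thesis .
  qed
  have c_pos: "0 < c j" for j by (simp add: c_def n1_def n2_def)
  have r1: "2 powr (- e) < 1" using e powr_less_mono[of "- e" 0 "2::real"] by simp
  define S where "S = c0 / (1 - 2 powr (- e))"
  have S: "(\<Sum>j\<le>J. c j) \<le> S" for J
  proof -
    have "(\<Sum>j\<le>J. c j) = c0 * (\<Sum>j\<in>{..J}. (2 powr (- e)) ^ j)" by (simp add: c_eq sum_distrib_left)
    also have "\<dots> \<le> c0 * (\<Sum>j. (2 powr (- e)) ^ j)"
      using r1 by (intro mult_left_mono sum_le_suminf summable_geometric) (auto simp: c0_def)
    also have "\<dots> = S" using r1 by (simp add: S_def suminf_geometric)
    finally show ?thesis .
  qed
  show ?thesis
  proof (intro exI[of _ "C * (S * S) powr q"] conjI allI impI)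
    show "0 \<le> C * (S * S) powr q" using C by simp
    fix F G assume F: "admissible 1 p F 1" and G: "admissible M p G 1"
    show "far q F G \<le> ennreal (C * (S * S) powr q)"
    proof (rule far_truncation_limit)
      show "integrable lborel F" "integrable lborel G" using F G by (auto simp: admissible_def)
      show "0 < q" using q by simp
      fix J
      have M1: "M \<le> 1" using M by simp
      have p0: "0 < p" using p1 by simp
      have a1: "admissible 1 p1 (level F j) (n1 j)" "admissible M p1 (level G j) (n1 j)" for j
        unfolding n1_def by (rule admissible_level_low[OF F p1 zero_less_one order_refl], rule admissible_level_low[OF G p1 M(1) M1])
      have a2: "admissible 1 2 (level F j) (n2 j)" "admissible M 2 (level G j) (n2 j)" for j
        unfolding n2_def by (rule admissible_level_high[OF F p0 p(2)], rule admissible_level_high[OF G p0 p(2)])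
      have "far q (\<lambda>s. \<Sum>j\<in>{..J}. level F j s) (\<lambda>s. \<Sum>j\<in>{..J}. level G j s) \<le> ennreal (C * (S * S) powr q)"
      proof (rule far_sum_bound[where c=c])
        show "integrable lborel (level F i)" "integrable lborel (level G i)" for i
          using a1[of i] by (auto simp: admissible_def)
        show "far q (level F i) (level G j) \<le> ennreal (C * (c i * c j) powr q)" for i j
        proof -
          have "far q (level F i) (level G j) \<le> ennreal (C * ((n1 i * n1 j) powr (1 - \<theta>) * (n2 i * n2 j) powr \<theta>) powr q)"
            by (rule H[OF a1 a2])
          also have "(n1 i * n1 j) powr (1 - \<theta>) * (n2 i * n2 j) powr \<theta> = c i * c j"
            by (simp add: c_def n1_def n2_def powr_mult)
          finally show ?thesis .
        qed
      qed (use c_pos S q C in auto)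
      then show "far q (\<lambda>s. if cmod (F s) \<le> 2 ^ J then F s else 0) (\<lambda>s. if cmod (G s) \<le> 2 ^ J then G s else 0) \<le> ennreal (C * (S * S) powr q)"
        by (simp only: sum_level)
    qed
  qed
qed

end

section \<open>The radial estimate in the full range of exponents\<close>

context radial_kernel begin

lemma far_cmult:
  assumes [measurable]: "F \<in> borel_measurable borel" "G \<in> borel_measurable borel"
  shows "far q (\<lambda>s. b * F s) (\<lambda>s. c * G s) = ennreal (cmod (b * c) powr q) * far q F G"
  unfolding far_def by (simp add: mass_cmult mult.assoc nn_integral_cmult)

lemma admissible_normalize:
  assumes F: "admissible m p F N" and p: "0 \<le> p"
  shows "admissible m p (\<lambda>s. F s * complex_of_real (1 / N)) 1"
proof -
  have N: "0 < N" using F by (simp add: admissible_def)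
  have "admissible m p (\<lambda>s. F s * complex_of_real (1 / N)) (1 / N * N)"
    by (rule admissible_mult[OF F]) (use N p in \<open>auto simp: norm_divide\<close>)
  then show ?thesis using N by simp
qed

text \<open>Three regimes. If (q - 1) D > 1, the fixed-radius decay suffices. At p = 2 the estimate
  with \<theta> = 1 applies to the inputs as they stand. Otherwise q \<le> 2, because D \<ge> 1, and
  \<theta> has to satisfy both the radial and the summation condition of
  \<open>level_set_far\<close>.\<close>

lemma far_bound:
  assumes M: "0 < M" "M \<le> 1/4" and q: "1 < q" and p: "dual2 q \<le> p" "p \<le> 2" and cond: "2 / p + (D + 2) / q < D + 2"
  shows "\<exists>C\<ge>0. \<forall>F G N N'. admissible 1 p F N \<longrightarrow> admissible M p G N' \<longrightarrow> far q F G \<le> ennreal (C * (N * N') powr q)"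
proof -
  have p1: "1 \<le> dual2 q" "1 < p" using dual2(1)[of q] q p by auto
  have M1: "M \<le> 1" using M by simp
  consider "1 < (q - 1) * D" | "(q - 1) * D \<le> 1" "p = 2" | "(q - 1) * D \<le> 1" "p < 2" using p by linarith
  then show ?thesis
  proof cases
    case 1
    obtain C where C: "0 \<le> C" and H: "\<And>F G N N'. admissible 1 (dual2 q) F N \<Longrightarrow> admissible M (dual2 q) G N' \<Longrightarrow> far q F G \<le> ennreal (C * (N * N') powr q)"
      using strong_far[OF M(1) q 1] unfolding far_def by blast
    show ?thesis
    proof (intro exI[of _ "C * 4 powr q"] conjI allI impI)
      show "0 \<le> C * 4 powr q" using C by simp
      fix F G N N' assume F: "admissible 1 p F N" and G: "admissible M p G N'"
      have N: "0 < N" "0 < N'" using F G by (auto simp: admissible_def)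
      have "far q F G \<le> ennreal (C * ((2 * N) * (2 * N')) powr q)"
        by (intro H admissible_exponent_mono[OF F p1(1) p(1)] admissible_exponent_mono[OF G p1(1) p(1)] M M1) auto
      also have "((2 * N) * (2 * N')) powr q = 4 powr q * (N * N') powr q"
        using N by (simp add: powr_mult[symmetric])
      finally show "far q F G \<le> ennreal (C * 4 powr q * (N * N') powr q)" by (simp add: mult.assoc)
    qed
  next
    case 2
    have q2: "q \<le> 2"
    proof -
      have "(q - 1) * 1 \<le> (q - 1) * D" using q D by (intro mult_left_mono) auto
      then show ?thesis using 2 by simp
    qed
    have c: "1 < (q - 1) * (D + 1)"
      using cond 2(2) q by (simp add: field_simps)
    obtain C where C: "0 \<le> C" and H: "\<And>F G N1 N1' N2 N2'. admissible 1 (dual2 q) F N1 \<Longrightarrow> admissible M (dual2 q) G N1' \<Longrightarrow> admissible 1 2 F N2 \<Longrightarrow> admissible M 2 G N2' \<Longrightarrow>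
       far q F G \<le> ennreal (C * ((N1 * N1') powr (1 - 1) * (N2 * N2') powr 1) powr q)"
      using interpolated_far[OF M q q2 zero_le_one order_refl c] by blast
    show ?thesis
    proof (intro exI[of _ C] conjI allI impI C)
      fix F G N N' assume F: "admissible 1 p F N" and G: "admissible M p G N'"
      have N: "0 < N" "0 < N'" using F G by (auto simp: admissible_def)
      have "far q F G \<le> ennreal (C * (((2 * N) * (2 * N')) powr (1 - 1) * (N * N') powr 1) powr q)"
        by (intro H admissible_exponent_mono[OF F p1(1) p(1)] admissible_exponent_mono[OF G p1(1) p(1)] M M1) (use F G 2 in auto)
      then show "far q F G \<le> ennreal (C * (N * N') powr q)" using N by simp
    qed
  next
    case 3
    have q2: "q \<le> 2"
    proof -
      have "(q - 1) * 1 \<le> (q - 1) * D" using q D by (intro mult_left_mono) auto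
      then show ?thesis using 3 by simp
    qed
    \<comment> \<open>With \<open>tx\<close> for \<theta> (q - 1), convergence in \<open>r\<close>
      means \<open>1 - (q - 1) * D < tx\<close>, and summability over the levels means
      \<open>tx < h\<close>. The hypothesis \<open>cond\<close> says that this interval is nonempty,
      and \<open>tx\<close> is its midpoint; p < 2 gives \<open>h < q - 1\<close>, hence \<theta>
      \<le> 1.\<close>
    define h where "h = 2 * q - 1 - 2 * q / p"
    define tx where "tx = (1 - (q - 1) * D + h) / 2"
    define \<theta> where "\<theta> = tx / (q - 1)"
    have hq: "h < q - 1"
    proof -
      have "q * p < 2 * q" using 3 q by simp
      then have "q < 2 * q / p" using p1 by (simp add: field_simps)
      then show ?thesis by (simp add: h_def)
    qed
    have hD: "1 - (q - 1) * D < h"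
    proof -
      have "(2 / p + (D + 2) / q) * q < (D + 2) * q" using cond q by (intro mult_strict_right_mono) auto
      moreover have "(D + 2) / q * q = D + 2" using q by simp
      moreover have "(2 / p + (D + 2) / q) * q = 2 * q / p + (D + 2) / q * q" by (simp only: distrib_right times_divide_eq_left)
      ultimately have "2 * q / p + (D + 2) < (D + 2) * q" by simp
      then show ?thesis by (simp add: h_def algebra_simps)
    qed
    have tx: "0 < tx" "tx < q - 1" "tx < h" "1 < (q - 1) * D + tx" using hq hD 3 by (auto simp: tx_def field_simps)
    have \<theta>: "0 \<le> \<theta>" "\<theta> \<le> 1" using tx q by (auto simp: \<theta>_def)
    have c: "1 < (q - 1) * (D + \<theta>)" using tx q by (simp add: \<theta>_def distrib_left)
    have eps: "1 < p * ((1 - \<theta>) / dual2 q + \<theta> / 2)"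
    proof -
      have "(1 - \<theta>) / dual2 q + \<theta> / 2 = (2 * q - 1 - \<theta> * (q - 1)) / (2 * q)"
        using q by (simp add: dual2_def field_simps)
      also have "\<theta> * (q - 1) = tx" using q by (simp add: \<theta>_def)
      finally have E: "p * ((1 - \<theta>) / dual2 q + \<theta> / 2) = p * (2 * q - 1 - tx) / (2 * q)" by simp
      have "2 * q / p < 2 * q - 1 - tx" using tx by (simp add: h_def)
      then have "2 * q < p * (2 * q - 1 - tx)" using p1 by (simp add: field_simps)
      then show ?thesis unfolding E using q by (subst less_divide_eq) simp
    qed
    obtain C where C: "0 \<le> C" and H: "\<And>F G. admissible 1 p F 1 \<Longrightarrow> admissible M p G 1 \<Longrightarrow> far q F G \<le> ennreal C"
      using level_set_far[OF M q q2 \<theta> c p eps] by blast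
    show ?thesis
    proof (intro exI[of _ C] conjI allI impI C)
      fix F G N N' assume F: "admissible 1 p F N" and G: "admissible M p G N'"
      have N: "0 < N" "0 < N'" using F G by (auto simp: admissible_def)
      have p0: "0 \<le> p" using p1 by simp
      let ?F = "\<lambda>s. F s * complex_of_real (1 / N)" and ?G = "\<lambda>s. G s * complex_of_real (1 / N')"
      note F1 = admissible_normalize[OF F p0] and G1 = admissible_normalize[OF G p0]
      have "far q F G = far q (\<lambda>s. complex_of_real N * ?F s) (\<lambda>s. complex_of_real N' * ?G s)"
        using N by simp
      also have "\<dots> = ennreal (cmod (complex_of_real N * complex_of_real N') powr q) * far q ?F ?G"
        by (rule far_cmult[OF admissible_measurable[OF F1] admissible_measurable[OF G1]])
      also have "\<dots> \<le> ennreal ((N * N') powr q) * ennreal C"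
        using N by (intro mult_mono H[OF F1 G1]) (auto simp: norm_mult)
      also have "\<dots> = ennreal (C * (N * N') powr q)" using C by (simp add: ennreal_mult[symmetric] mult.commute)
      finally show "far q F G \<le> ennreal (C * (N * N') powr q)" .
    qed
  qed
qed

theorem radial_estimate:
  assumes M: "0 < M" "M \<le> 1/4" and q: "1 < q" and p: "dual2 q \<le> p" "p \<le> 2" and cond: "2 / p + (D + 2) / q < D + 2"
  shows "\<exists>C\<ge>0. \<forall>F G N N'. admissible 1 p F N \<longrightarrow> admissible M p G N' \<longrightarrow>
    (\<integral>\<^sup>+ r. mass q F G r * (ennreal (r powr D) * indicator {0<..} r) \<partial>lborel) \<le> ennreal (C * (N * N') powr q)"
proof -
  have p1: "1 \<le> dual2 q" "1 < p" using dual2(1)[of q] q p by auto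
  have M1: "M \<le> 1" and q1: "1 \<le> q" using M q by auto
  obtain Ca where Ca: "0 \<le> Ca" and Ha: "\<And>F G N N'. admissible 1 (dual2 q) F N \<Longrightarrow> admissible M (dual2 q) G N' \<Longrightarrow>
     (\<integral>\<^sup>+ r. mass q F G r * (ennreal (r powr D) * indicator {0<..<1} r) \<partial>lborel) \<le> ennreal (Ca * (N * N') powr q)"
    using near[OF M(1) q1] by blast
  obtain Cb where Cb: "0 \<le> Cb" and Hb: "\<And>F G N N'. admissible 1 p F N \<Longrightarrow> admissible M p G N' \<Longrightarrow> far q F G \<le> ennreal (Cb * (N * N') powr q)"
    using far_bound[OF assms] by blast
  show ?thesis
  proof (intro exI[of _ "Ca * 4 powr q + Cb"] conjI allI impI)
    show "0 \<le> Ca * 4 powr q + Cb" using Ca Cb by simp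
    fix F G N N' assume F: "admissible 1 p F N" and G: "admissible M p G N'"
    note [measurable] = admissible_measurable[OF F] admissible_measurable[OF G]
    have N: "0 < N" "0 < N'" using F G by (auto simp: admissible_def)
    have "(\<integral>\<^sup>+ r. mass q F G r * (ennreal (r powr D) * indicator {0<..} r) \<partial>lborel)
      \<le> (\<integral>\<^sup>+ r. mass q F G r * (ennreal (r powr D) * indicator {0<..<1} r) + mass q F G r * (ennreal (r powr D) * indicator {1..} r) \<partial>lborel)"
      by (intro nn_integral_mono) (auto simp: indicator_def)
    also have "\<dots> = (\<integral>\<^sup>+ r. mass q F G r * (ennreal (r powr D) * indicator {0<..<1} r) \<partial>lborel) + far q F G"
      unfolding far_def by (rule nn_integral_add) measurable
    also have "\<dots> \<le> ennreal (Ca * ((2 * N) * (2 * N')) powr q) + ennreal (Cb * (N * N') powr q)"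
      by (intro add_mono Ha Hb[OF F G] admissible_exponent_mono[OF F p1(1) p(1)] admissible_exponent_mono[OF G p1(1) p(1)] M M1) auto
    also have "((2 * N) * (2 * N')) powr q = 4 powr q * (N * N') powr q"
      using N by (simp add: powr_mult[symmetric])
    also have "ennreal (Ca * (4 powr q * (N * N') powr q)) + ennreal (Cb * (N * N') powr q) = ennreal ((Ca * 4 powr q + Cb) * (N * N') powr q)"
      using Ca Cb by (subst ennreal_plus[symmetric]) (auto simp: distrib_right mult.assoc)
    finally show "(\<integral>\<^sup>+ r. mass q F G r * (ennreal (r powr D) * indicator {0<..} r) \<partial>lborel) \<le> ennreal ((Ca * 4 powr q + Cb) * (N * N') powr q)" .
  qed
qed

end

section \<open>Oscillatory integrals and wave packets\<close>

lemma continuous_on_cis' [continuous_intros]: "continuous_on S f \<Longrightarrow> continuous_on S (\<lambda>x. cis (f x))"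
  unfolding cis_conv_exp by (intro continuous_intros)

text \<open>Integration by parts against \<open>1 / \<phi>'\<close>, for a quadratic phase \<open>\<phi>\<close> without stationary point.\<close>
lemma nonstationary_phase:
  fixes T r k :: real
  assumes ab: "\<alpha> \<le> \<beta>" and T: "0 \<le> T" and pos: "0 < 2 * T * \<alpha> + r"
  shows "cmod (integral {\<alpha>..\<beta>} (\<lambda>s. cis (T * s\<^sup>2 + r * s + k))) \<le> 2 / (2 * T * \<alpha> + r)"
proof -
  define \<phi>' where "\<phi>' s = 2 * T * s + r" for s
  have p: "2 * T * \<alpha> + r \<le> \<phi>' s" if "\<alpha> \<le> s" for s
    unfolding \<phi>'_def using that T by (intro add_right_mono mult_left_mono) auto
  have p0: "0 < \<phi>' s" if "\<alpha> \<le> s" for s using p[OF that] pos by linarith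
  let ?e = "\<lambda>s. cis (T * s\<^sup>2 + r * s + k)"
  let ?G = "\<lambda>s. ?e s * complex_of_real (1 / \<phi>' s)"
  have cisd: "(?e has_vector_derivative (\<i> * complex_of_real (\<phi>' s)) * ?e s) (at s within A)" for s A
  proof -
    have ph: "((\<lambda>s. T * s\<^sup>2 + r * s + k) has_real_derivative \<phi>' s) (at s within A)"
      by (auto intro!: derivative_eq_intros simp: \<phi>'_def)
    have c: "((\<lambda>s. cos (T * s\<^sup>2 + r * s + k)) has_real_derivative - sin (T * s\<^sup>2 + r * s + k) * \<phi>' s) (at s within A)"
      "((\<lambda>s. sin (T * s\<^sup>2 + r * s + k)) has_real_derivative cos (T * s\<^sup>2 + r * s + k) * \<phi>' s) (at s within A)"
      by (rule DERIV_chain2[OF DERIV_cos ph], rule DERIV_chain2[OF DERIV_sin ph])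
    have e: "cis x = complex_of_real (cos x) + \<i> * complex_of_real (sin x)" for x by (simp add: complex_eq_iff)
    have "((\<lambda>s. complex_of_real (cos (T * s\<^sup>2 + r * s + k)) + \<i> * complex_of_real (sin (T * s\<^sup>2 + r * s + k))) has_vector_derivative
       complex_of_real (- sin (T * s\<^sup>2 + r * s + k) * \<phi>' s) + \<i> * complex_of_real (cos (T * s\<^sup>2 + r * s + k) * \<phi>' s)) (at s within A)"
      by (intro has_vector_derivative_add has_vector_derivative_mult_right has_vector_derivative_of_real c)
    moreover have "complex_of_real (- sin x * y) + \<i> * complex_of_real (cos x * y) = (\<i> * complex_of_real y) * (complex_of_real (cos x) + \<i> * complex_of_real (sin x))" for x y
      by (simp add: complex_eq_iff)
    ultimately show ?thesis unfolding e by simp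
  qed
  have invd: "((\<lambda>s. complex_of_real (1 / \<phi>' s)) has_vector_derivative complex_of_real (- (2 * T) / (\<phi>' s)\<^sup>2)) (at s within A)" if "\<alpha> \<le> s" for s A
  proof -
    have "((\<lambda>s. 1 / \<phi>' s) has_real_derivative - (2 * T) / (\<phi>' s)\<^sup>2) (at s within A)"
      unfolding \<phi>'_def using p0[OF that] by (auto intro!: derivative_eq_intros simp: \<phi>'_def power2_eq_square)
    then show ?thesis by (rule has_vector_derivative_of_real)
  qed
  have D1: "((\<lambda>s. ?e s * complex_of_real (1 / \<phi>' s)) has_vector_derivative (\<i> * ?e s + ?e s * complex_of_real (- (2 * T) / (\<phi>' s)\<^sup>2))) (at s within {\<alpha>..\<beta>})" if "s \<in> {\<alpha>..\<beta>}" for s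
  proof -
    have "\<alpha> \<le> s" using that by simp
    have "complex_of_real (\<phi>' s) * complex_of_real (1 / \<phi>' s) = 1" using p0[OF \<open>\<alpha> \<le> s\<close>] by (simp flip: of_real_mult)
    then have eq: "?e s * complex_of_real (- (2 * T) / (\<phi>' s)\<^sup>2) + (\<i> * complex_of_real (\<phi>' s)) * ?e s * complex_of_real (1 / \<phi>' s) = \<i> * ?e s + ?e s * complex_of_real (- (2 * T) / (\<phi>' s)\<^sup>2)"
      by (simp only: mult.assoc mult.left_commute[of _ "?e s"]) (simp add: algebra_simps)
    show ?thesis using has_vector_derivative_mult[OF cisd invd[OF \<open>\<alpha> \<le> s\<close>]] unfolding eq .
  qed
  have ftc: "((\<lambda>s. \<i> * ?e s + ?e s * complex_of_real (- (2 * T) / (\<phi>' s)\<^sup>2)) has_integral (?G \<beta> - ?G \<alpha>)) {\<alpha>..\<beta>}"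
    by (rule fundamental_theorem_of_calculus[OF ab D1])
  have cont: "continuous_on {\<alpha>..\<beta>} ?e" by (intro continuous_intros)
  have c\<phi>: "continuous_on {\<alpha>..\<beta>} \<phi>'" unfolding \<phi>'_def[abs_def] by (intro continuous_intros)
  have ne: "\<phi>' s \<noteq> 0" if "s \<in> {\<alpha>..\<beta>}" for s using p0[of s] that by simp
  have contp: "continuous_on {\<alpha>..\<beta>} (\<lambda>s. 2 * T / (\<phi>' s)\<^sup>2)"
    using ne by (intro continuous_intros c\<phi>) auto
  have i1: "?e integrable_on {\<alpha>..\<beta>}" by (rule integrable_continuous_real[OF cont])
  have contq: "continuous_on {\<alpha>..\<beta>} (\<lambda>s. ?e s * complex_of_real (- (2 * T) / (\<phi>' s)\<^sup>2))"
    using ne by (intro continuous_intros c\<phi>) auto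
  have i2: "(\<lambda>s. ?e s * complex_of_real (- (2 * T) / (\<phi>' s)\<^sup>2)) integrable_on {\<alpha>..\<beta>}" by (rule integrable_continuous_real[OF contq])
  \<comment> \<open>The derivative of the phase is monotone, so the modulus of the error term is an
    exact derivative. Its integral contains \<open>- 1 / \<phi>' \<beta>\<close>, which cancels a
    boundary term and leaves a bound that depends on the left endpoint only.\<close>
  have "((\<lambda>s. 2 * T / (\<phi>' s)\<^sup>2) has_integral (- (1 / \<phi>' \<beta>) - - (1 / \<phi>' \<alpha>))) {\<alpha>..\<beta>}"
  proof (rule fundamental_theorem_of_calculus[OF ab])
    fix s assume "s \<in> {\<alpha>..\<beta>}"
    then have "\<alpha> \<le> s" by simp
    have "((\<lambda>s. - (1 / \<phi>' s)) has_real_derivative 2 * T / (\<phi>' s)\<^sup>2) (at s within {\<alpha>..\<beta>})"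
      unfolding \<phi>'_def using p0[OF \<open>\<alpha> \<le> s\<close>] by (auto intro!: derivative_eq_intros simp: \<phi>'_def power2_eq_square)
    then show "((\<lambda>s. - (1 / \<phi>' s)) has_vector_derivative 2 * T / (\<phi>' s)\<^sup>2) (at s within {\<alpha>..\<beta>})"
      by (simp add: has_real_derivative_iff_has_vector_derivative)
  qed
  then have iT: "integral {\<alpha>..\<beta>} (\<lambda>s. 2 * T / (\<phi>' s)\<^sup>2) = 1 / \<phi>' \<alpha> - 1 / \<phi>' \<beta>" by (simp add: integral_unique)
  have "cmod (integral {\<alpha>..\<beta>} (\<lambda>s. ?e s * complex_of_real (- (2 * T) / (\<phi>' s)\<^sup>2))) \<le> integral {\<alpha>..\<beta>} (\<lambda>s. 2 * T / (\<phi>' s)\<^sup>2)"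
    using T by (intro integral_norm_bound_integral i2 integrable_continuous_real contp) (simp add: norm_mult norm_divide norm_power)
  then have b2: "cmod (integral {\<alpha>..\<beta>} (\<lambda>s. ?e s * complex_of_real (- (2 * T) / (\<phi>' s)\<^sup>2))) \<le> 1 / \<phi>' \<alpha> - 1 / \<phi>' \<beta>" unfolding iT .
  have i3: "(\<lambda>s. \<i> * ?e s) integrable_on {\<alpha>..\<beta>}" by (intro integrable_continuous_real continuous_intros)
  have "integral {\<alpha>..\<beta>} (\<lambda>s. \<i> * ?e s) = \<i> * integral {\<alpha>..\<beta>} ?e"
    by (rule Henstock_Kurzweil_Integration.integral_mult_right)
  with Henstock_Kurzweil_Integration.integral_add[OF i3 i2] integral_unique[OF ftc]
  have "\<i> * integral {\<alpha>..\<beta>} ?e + integral {\<alpha>..\<beta>} (\<lambda>s. ?e s * complex_of_real (- (2 * T) / (\<phi>' s)\<^sup>2)) = ?G \<beta> - ?G \<alpha>"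
    by metis
  then have "\<i> * integral {\<alpha>..\<beta>} ?e = ?G \<beta> - ?G \<alpha> - integral {\<alpha>..\<beta>} (\<lambda>s. ?e s * complex_of_real (- (2 * T) / (\<phi>' s)\<^sup>2))"
    by (simp add: algebra_simps)
  moreover have "cmod (integral {\<alpha>..\<beta>} ?e) = cmod (\<i> * integral {\<alpha>..\<beta>} ?e)" by (simp only: norm_mult norm_ii mult_1)
  ultimately have "cmod (integral {\<alpha>..\<beta>} ?e) = cmod (?G \<beta> - ?G \<alpha> - integral {\<alpha>..\<beta>} (\<lambda>s. ?e s * complex_of_real (- (2 * T) / (\<phi>' s)\<^sup>2)))"
    by (simp only:)
  also have "\<dots> \<le> cmod (?G \<beta>) + cmod (?G \<alpha>) + (1 / \<phi>' \<alpha> - 1 / \<phi>' \<beta>)"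
    using b2 norm_triangle_ineq4[of "?G \<beta> - ?G \<alpha>" "integral {\<alpha>..\<beta>} (\<lambda>s. ?e s * complex_of_real (- (2 * T) / (\<phi>' s)\<^sup>2))"] norm_triangle_ineq4[of "?G \<beta>" "?G \<alpha>"]
    by linarith
  also have "\<dots> = 2 / \<phi>' \<alpha>"
    using p0[of \<alpha>] p0[OF ab] by (simp add: norm_mult norm_divide)
  finally show ?thesis by (simp add: \<phi>'_def)
qed

lemma sin_cubic_lower_bound: assumes "0 \<le> (x::real)" shows "x - x ^ 3 / 6 \<le> sin x"
proof -
  have c: "0 \<le> cos y - 1 + y\<^sup>2 / 2" if "0 \<le> y" for y :: real
  proof -
    have "(\<lambda>y. cos y - 1 + y\<^sup>2 / 2) 0 \<le> (\<lambda>y. cos y - 1 + y\<^sup>2 / 2) y"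
    proof (rule DERIV_nonneg_imp_nondecreasing[OF that])
      fix z :: real assume "0 \<le> z"
      moreover have "((\<lambda>y. cos y - 1 + y\<^sup>2 / 2) has_real_derivative (- sin z + z)) (at z)" by (auto intro!: derivative_eq_intros)
      ultimately show "\<exists>D. ((\<lambda>y. cos y - 1 + y\<^sup>2 / 2) has_real_derivative D) (at z) \<and> 0 \<le> D"
        using sin_x_le_x[of z] by (intro exI[of _ "- sin z + z"]) auto
    qed
    then show ?thesis by simp
  qed
  have "(\<lambda>x. sin x - x + x ^ 3 / 6) 0 \<le> (\<lambda>x. sin x - x + x ^ 3 / 6) x"
  proof (rule DERIV_nonneg_imp_nondecreasing[OF assms])
    fix z :: real assume "0 \<le> z"
    moreover have "((\<lambda>x. sin x - x + x ^ 3 / 6) has_real_derivative (cos z - 1 + z\<^sup>2 / 2)) (at z)"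
      by (auto intro!: derivative_eq_intros)
    ultimately show "\<exists>D. ((\<lambda>x. sin x - x + x ^ 3 / 6) has_real_derivative D) (at z) \<and> 0 \<le> D" using c[of z] by blast
  qed
  then show ?thesis by simp
qed

text \<open>The integral is cut where \<open>v * sqrt T\<close> equals 8/5. Up to there the cubic
  lower bound for the sine gives about 0.726 / sqrt T; beyond, \<open>nonstationary_phase\<close>
  costs at most 0.625 / sqrt T. The difference is just above 1 / (10 sqrt T), which fixes both the
  cut and the constant.\<close>

lemma fresnel_lower_bound:
  assumes T: "0 < T" and b: "8 / 5 \<le> b * sqrt T"
  shows "1 / (10 * sqrt T) \<le> integral {0..b} (\<lambda>v. sin (T * v\<^sup>2))"
proof -
  define R where "R = sqrt T"
  have R: "0 < R" "R\<^sup>2 = T" using T by (auto simp: R_def)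
  define c where "c = 8 / (5 * R)"
  have c: "0 < c" "c \<le> b" "R * c = 8 / 5" using R b by (auto simp: c_def R_def field_simps)
  have int: "(\<lambda>v. sin (T * v\<^sup>2)) integrable_on {x..y}" for x y
    by (intro integrable_continuous_real continuous_intros)
  have core: "(8/5)^3 / (3 * R) - (8/5)^7 / (42 * R) \<le> integral {0..c} (\<lambda>v. sin (T * v\<^sup>2))"
  proof -
    have "((\<lambda>v. T * v\<^sup>2 - (T * v\<^sup>2) ^ 3 / 6) has_integral ((T * c^3 / 3 - T^3 * c^7 / 42) - (T * 0^3 / 3 - T^3 * 0^7 / 42))) {0..c}"
    proof (rule fundamental_theorem_of_calculus)
      fix x assume "x \<in> {0..c}"
      have "((\<lambda>c. T * c^3 / 3 - T^3 * c^7 / 42) has_real_derivative (T * x\<^sup>2 - (T * x\<^sup>2) ^ 3 / 6)) (at x within {0..c})"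
        by (auto intro!: derivative_eq_intros simp: power_mult_distrib simp flip: power_mult)
      then show "((\<lambda>c. T * c^3 / 3 - T^3 * c^7 / 42) has_vector_derivative (T * x\<^sup>2 - (T * x\<^sup>2) ^ 3 / 6)) (at x within {0..c})"
        by (simp add: has_real_derivative_iff_has_vector_derivative)
    qed (use c in simp)
    then have hi: "((\<lambda>v. T * v\<^sup>2 - (T * v\<^sup>2) ^ 3 / 6) has_integral (T * c^3 / 3 - T^3 * c^7 / 42)) {0..c}" by simp
    have "T * c^3 / 3 - T^3 * c^7 / 42 \<le> integral {0..c} (\<lambda>v. sin (T * v\<^sup>2))"
      unfolding integral_unique[OF hi, symmetric]
      by (rule integral_le) (use hi int T in \<open>auto intro!: sin_cubic_lower_bound\<close>)
    also have "T * c^3 / 3 - T^3 * c^7 / 42 = (8/5)^3 / (3 * R) - (8/5)^7 / (42 * R)"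
      unfolding R(2)[symmetric] c_def using R(1) by (simp add: power_divide power_mult_distrib flip: power_mult) (simp add: field_simps power_add[symmetric] eval_nat_numeral)
    finally show ?thesis .
  qed
  have tail: "- 5 / (8 * R) \<le> integral {c..b} (\<lambda>v. sin (T * v\<^sup>2))"
  proof -
    have ic: "(\<lambda>v. cis (T * v\<^sup>2)) integrable_on {c..b}" by (intro integrable_continuous_real continuous_intros)
    have "cmod (integral {c..b} (\<lambda>s. cis (T * s\<^sup>2 + 0 * s + 0))) \<le> 2 / (2 * T * c + 0)"
      by (rule nonstationary_phase) (use c T in auto)
    then have 1: "cmod (integral {c..b} (\<lambda>s. cis (T * s\<^sup>2))) \<le> 1 / (T * c)" by simp
    have "integral {c..b} (\<lambda>v. sin (T * v\<^sup>2)) = Im (integral {c..b} (\<lambda>v. cis (T * v\<^sup>2)))"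
      using has_integral_linear[OF integrable_integral[OF ic] bounded_linear_Im] by (simp add: o_def integral_unique)
    moreover have "1 / (T * c) = 5 / (8 * R)"
      unfolding R(2)[symmetric] c_def using R(1) by (simp add: power2_eq_square field_simps)
    ultimately show ?thesis using 1 abs_Im_le_cmod[of "integral {c..b} (\<lambda>s. cis (T * s\<^sup>2))"] by simp
  qed
  have "integral {0..b} (\<lambda>v. sin (T * v\<^sup>2)) = integral {0..c} (\<lambda>v. sin (T * v\<^sup>2)) + integral {c..b} (\<lambda>v. sin (T * v\<^sup>2))"
    using c by (intro Henstock_Kurzweil_Integration.integral_combine[symmetric] int; linarith)
  moreover have "1 / (10 * R) \<le> (8/5)^3 / (3 * R) - (8/5)^7 / (42 * R) + - 5 / (8 * R)"
    using R(1) by (simp add: field_simps eval_nat_numeral)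
  ultimately show ?thesis using core tail unfolding R_def by linarith
qed

text \<open>Completing the square centres the phase at \<open>s0\<close> up to a unimodular factor.
  The two sides of \<open>s0\<close> are Fresnel integrals with positive imaginary parts, so they
  cannot cancel.\<close>

lemma stationary_phase_lower_bound:
  assumes T: "0 < T" and b: "8 / 5 \<le> (\<beta> - s0) * sqrt T" and a: "8 / 5 \<le> (s0 - \<alpha>) * sqrt T" and r: "r = 2 * T * s0"
  shows "1 / (5 * sqrt T) \<le> cmod (integral {\<alpha>..\<beta>} (\<lambda>s. cis (T * s\<^sup>2 - r * s)))"
proof -
  have sT: "0 < sqrt T" using T by simp
  have "0 < (\<beta> - s0) * sqrt T" "0 < (s0 - \<alpha>) * sqrt T" using a b by linarith+
  then have ab: "\<alpha> \<le> s0" "s0 \<le> \<beta>"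
    using sT by (simp_all only: zero_less_mult_iff) linarith+
  have int: "(\<lambda>s. cis (T * (s - s0)\<^sup>2)) integrable_on {x..y}" "(\<lambda>s. sin (T * (s - s0)\<^sup>2)) integrable_on {x..y}" for x y
    by (intro integrable_continuous_real continuous_intros)+
  have e: "cis (T * s\<^sup>2 - r * s) = cis (- T * s0\<^sup>2) * cis (T * (s - s0)\<^sup>2)" for s
    unfolding cis_mult r by (rule arg_cong[where f=cis]) (simp add: power2_diff algebra_simps)
  have "cmod (integral {\<alpha>..\<beta>} (\<lambda>s. cis (T * s\<^sup>2 - r * s))) = cmod (integral {\<alpha>..\<beta>} (\<lambda>s. cis (T * (s - s0)\<^sup>2)))"
    unfolding e by (simp add: norm_mult)
  moreover have "integral {\<alpha>..\<beta>} (\<lambda>s. sin (T * (s - s0)\<^sup>2)) = Im (integral {\<alpha>..\<beta>} (\<lambda>s. cis (T * (s - s0)\<^sup>2)))"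
    using has_integral_linear[OF integrable_integral[OF int(1)] bounded_linear_Im, of \<alpha> \<beta>] by (simp add: o_def integral_unique)
  moreover have "integral {\<alpha>..\<beta>} (\<lambda>s. sin (T * (s - s0)\<^sup>2)) = integral {\<alpha>..s0} (\<lambda>s. sin (T * (s - s0)\<^sup>2)) + integral {s0..\<beta>} (\<lambda>s. sin (T * (s - s0)\<^sup>2))"
    using ab by (intro Henstock_Kurzweil_Integration.integral_combine[symmetric] int; linarith)
  moreover have "integral {s0..\<beta>} (\<lambda>s. sin (T * (s - s0)\<^sup>2)) = integral {0..\<beta> - s0} (\<lambda>v. sin (T * v\<^sup>2))"
    using integral_shift_Icc_real[of 0 "\<beta> - s0" "\<lambda>s. sin (T * (s - s0)\<^sup>2)" s0] by (simp add: o_def)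
  moreover have "integral {\<alpha>..s0} (\<lambda>s. sin (T * (s - s0)\<^sup>2)) = integral {0..s0 - \<alpha>} (\<lambda>v. sin (T * v\<^sup>2))"
  proof -
    have "integral {\<alpha>..s0} (\<lambda>s. sin (T * (s - s0)\<^sup>2)) = integral {\<alpha> - s0..0} (\<lambda>v. sin (T * v\<^sup>2))"
      using integral_shift_Icc_real[of "\<alpha> - s0" 0 "\<lambda>s. sin (T * (s - s0)\<^sup>2)" s0] by (simp add: o_def)
    also have "\<dots> = integral {0..s0 - \<alpha>} (\<lambda>v. sin (T * v\<^sup>2))"
      using Henstock_Kurzweil_Integration.integral_reflect_real[of "s0 - \<alpha>" 0 "\<lambda>v. sin (T * v\<^sup>2)"] by simp
    finally show ?thesis .
  qed
  moreover have "1 / (5 * sqrt T) = 1 / (10 * sqrt T) + 1 / (10 * sqrt T)" using sT by (simp add: field_simps)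
  ultimately show ?thesis
    using fresnel_lower_bound[OF T b] fresnel_lower_bound[OF T a] abs_Im_le_cmod[of "integral {\<alpha>..\<beta>} (\<lambda>s. cis (T * (s - s0)\<^sup>2))"]
    by linarith
qed

lemma cos_ge_half: assumes "\<bar>x::real\<bar> \<le> 1" shows "1 / 2 \<le> cos x"
proof -
  have "cos (pi / 3) \<le> cos \<bar>x\<bar>" using assms pi_gt3 by (intro cos_monotone_0_pi_le) auto
  then show ?thesis by (simp add: cos_60)
qed

text \<open>Rotating by \<open>cis (- k)\<close> leaves a phase of at most one radian, so the real
  part of the integrand is at least 1/2 throughout.\<close>

lemma slow_phase_lower_bound:
  assumes ab: "\<alpha> \<le> \<beta>" and ph: "\<And>s. s \<in> {\<alpha>..\<beta>} \<Longrightarrow> \<bar>\<phi> s - k\<bar> \<le> 1" and cont: "continuous_on {\<alpha>..\<beta>} \<phi>"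
  shows "(\<beta> - \<alpha>) / 2 \<le> cmod (integral {\<alpha>..\<beta>} (\<lambda>s. cis (\<phi> s)))"
proof -
  have ic: "(\<lambda>s. cis (\<phi> s - k)) integrable_on {\<alpha>..\<beta>}" by (intro integrable_continuous_real continuous_intros cont)
  have e: "cis (\<phi> s) = cis k * cis (\<phi> s - k)" for s by (simp add: cis_mult)
  have "integral {\<alpha>..\<beta>} (\<lambda>s. 1 / 2) \<le> integral {\<alpha>..\<beta>} (\<lambda>s. cos (\<phi> s - k))"
    by (intro integral_le integrable_continuous_real continuous_intros cont cos_ge_half ph) auto
  also have "\<dots> = Re (integral {\<alpha>..\<beta>} (\<lambda>s. cis (\<phi> s - k)))"
    using has_integral_linear[OF integrable_integral[OF ic] bounded_linear_Re] by (simp add: o_def integral_unique)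
  also have "\<dots> \<le> cmod (integral {\<alpha>..\<beta>} (\<lambda>s. cis (\<phi> s - k)))" by (rule complex_Re_le_cmod)
  also have "\<dots> = cmod (integral {\<alpha>..\<beta>} (\<lambda>s. cis (\<phi> s)))" unfolding e by (simp add: norm_mult)
  finally show ?thesis using ab by simp
qed

section \<open>Lower bounds for wave packets\<close>

context radial_kernel begin

text \<open>The power of \<open>s\<close> cancels the decay of the kernel in \<open>s\<close>; the modulation makes the
  phase \<open>(t + \<tau>) s\<^sup>2 - r s\<close> stationary in or next to \<open>[\<alpha>, \<beta>]\<close> when \<open>r\<close> is comparable to \<open>\<tau>\<close>.\<close>
definition packet :: "real \<Rightarrow> real \<Rightarrow> real \<Rightarrow> real \<Rightarrow> complex" where
  "packet \<alpha> \<beta> \<tau> s = (if s \<in> {\<alpha>..\<beta>} then complex_of_real (s powr (D / 2)) * cis (\<tau> * s\<^sup>2) else 0)"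

lemma packet_measurable [measurable]: "packet \<alpha> \<beta> \<tau> \<in> borel_measurable borel"
  unfolding packet_def[abs_def] by measurable

lemma lborel_integral_eq_integral_cis:
  fixes \<phi> :: "real \<Rightarrow> real"
  assumes "continuous_on {\<alpha>..\<beta>} \<phi>"
  shows "set_integrable lborel {\<alpha>..\<beta>} (\<lambda>s. cis (\<phi> s))" "(LINT s:{\<alpha>..\<beta>}|lborel. cis (\<phi> s)) = integral {\<alpha>..\<beta>} (\<lambda>s. cis (\<phi> s))"
proof -
  show i: "set_integrable lborel {\<alpha>..\<beta>} (\<lambda>s. cis (\<phi> s))"
    unfolding set_integrable_def by (rule borel_integrable_compact[OF compact_Icc continuous_on_cis'[OF assms]])
  show "(LINT s:{\<alpha>..\<beta>}|lborel. cis (\<phi> s)) = integral {\<alpha>..\<beta>} (\<lambda>s. cis (\<phi> s))"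
    by (rule set_borel_integral_eq_integral(2)[OF i])
qed

text \<open>The kernel consists of two conjugate exponentials and an error of size 1/r. In the
  applications T is positive, and then only the phase T s^2 - r s can be stationary for s > 0; the
  other exponential and the error are subtracted as perturbations.\<close>

lemma V_packet_lower_bound:
  fixes \<alpha> \<beta> \<tau> t r :: real
  assumes \<alpha>: "0 < \<alpha>" "\<alpha> \<le> \<beta>" and r: "0 < r"
  defines "T \<equiv> t + \<tau>"
  shows "cmod a * cmod (integral {\<alpha>..\<beta>} (\<lambda>s. cis (T * s\<^sup>2 - r * s))) - cmod a * cmod (integral {\<alpha>..\<beta>} (\<lambda>s. cis (T * s\<^sup>2 + r * s)))
      - C1 / (r * \<alpha>) * (\<beta> - \<alpha>) \<le> r powr (D / 2) * cmod (V (packet \<alpha> \<beta> \<tau>) t r)"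
proof -
  define A where "A = (LINT s:{\<alpha>..\<beta>}|lborel. cis (T * s\<^sup>2 + r * s))"
  define B where "B = (LINT s:{\<alpha>..\<beta>}|lborel. cis (T * s\<^sup>2 - r * s))"
  define er where "er s = U (r * s) - 2 * Re (a * cis (r * s))" for s
  define E where "E = (LINT s:{\<alpha>..\<beta>}|lborel. cis (T * s\<^sup>2) * complex_of_real (er s))"
  have [measurable]: "er \<in> borel_measurable borel" unfolding er_def[abs_def] by measurable
  have A: "set_integrable lborel {\<alpha>..\<beta>} (\<lambda>s. cis (T * s\<^sup>2 + r * s))" "A = integral {\<alpha>..\<beta>} (\<lambda>s. cis (T * s\<^sup>2 + r * s))"
    unfolding A_def by (intro lborel_integral_eq_integral_cis continuous_intros)+
  have B: "set_integrable lborel {\<alpha>..\<beta>} (\<lambda>s. cis (T * s\<^sup>2 - r * s))" "B = integral {\<alpha>..\<beta>} (\<lambda>s. cis (T * s\<^sup>2 - r * s))"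
    unfolding B_def by (intro lborel_integral_eq_integral_cis continuous_intros)+
  have eb: "\<bar>er s\<bar> \<le> C1 / (r * \<alpha>)" if "s \<in> {\<alpha>..\<beta>}" for s
  proof -
    have s: "0 < r * s" "r * \<alpha> \<le> r * s" using that \<alpha> r by auto
    have "\<bar>er s\<bar> \<le> C1 / (r * s)" unfolding er_def by (rule U_asymp[OF s(1)])
    also have "\<dots> \<le> C1 / (r * \<alpha>)" using s C1 \<alpha> r by (intro divide_left_mono) auto
    finally show ?thesis .
  qed
  have ci: "integrable lborel (\<lambda>s. indicator {\<alpha>..\<beta>} s * (C1 / (r * \<alpha>)) :: real)"
    using \<alpha> by (intro integrable_mult_left integrable_real_indicator) auto
  have Ei: "set_integrable lborel {\<alpha>..\<beta>} (\<lambda>s. cis (T * s\<^sup>2) * complex_of_real (er s))"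
    unfolding set_integrable_def
    by (rule Bochner_Integration.integrable_bound[OF ci])
       (use eb C1 r \<alpha> in \<open>auto simp: indicator_def norm_mult intro!: AE_I2 order_trans[OF eb]\<close>)
  have Eb: "cmod E \<le> C1 / (r * \<alpha>) * (\<beta> - \<alpha>)"
  proof -
    have "cmod E \<le> (LINT s|lborel. cmod (indicator {\<alpha>..\<beta>} s *\<^sub>R (cis (T * s\<^sup>2) * complex_of_real (er s))))"
      unfolding E_def set_lebesgue_integral_def by (rule integral_norm_bound)
    also have "\<dots> \<le> (LINT s|lborel. indicator {\<alpha>..\<beta>} s * (C1 / (r * \<alpha>)))"
      by (rule integral_mono[OF integrable_norm[OF Ei[unfolded set_integrable_def]] ci]) (use eb in \<open>auto simp: indicator_def norm_mult\<close>)
    also have "\<dots> = C1 / (r * \<alpha>) * (\<beta> - \<alpha>)" using \<alpha> by simp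
    finally show ?thesis .
  qed
  have "complex_of_real (r powr (D / 2)) * V (packet \<alpha> \<beta> \<tau>) t r = (LINT s|lborel. complex_of_real (r powr (D / 2)) * (packet \<alpha> \<beta> \<tau> s * (cis (t * s\<^sup>2) * complex_of_real (K (r * s)))))"
    unfolding V_def by simp
  also have "\<dots> = (LINT s|lborel. a * (indicator {\<alpha>..\<beta>} s *\<^sub>R cis (T * s\<^sup>2 + r * s)) + cnj a * (indicator {\<alpha>..\<beta>} s *\<^sub>R cis (T * s\<^sup>2 - r * s)) + indicator {\<alpha>..\<beta>} s *\<^sub>R (cis (T * s\<^sup>2) * complex_of_real (er s)))"
  proof (intro Bochner_Integration.integral_cong refl)
    fix s
    show "complex_of_real (r powr (D / 2)) * (packet \<alpha> \<beta> \<tau> s * (cis (t * s\<^sup>2) * complex_of_real (K (r * s)))) =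
       a * (indicator {\<alpha>..\<beta>} s *\<^sub>R cis (T * s\<^sup>2 + r * s)) + cnj a * (indicator {\<alpha>..\<beta>} s *\<^sub>R cis (T * s\<^sup>2 - r * s)) + indicator {\<alpha>..\<beta>} s *\<^sub>R (cis (T * s\<^sup>2) * complex_of_real (er s))"
    proof (cases "s \<in> {\<alpha>..\<beta>}")
      case True
      then have s: "0 < s" using \<alpha> by auto
      have k: "r powr (D / 2) * (s powr (D / 2) * K (r * s)) = U (r * s)"
        using s r by (simp add: U_def powr_mult)
      have u: "complex_of_real (U (r * s)) = a * cis (r * s) + cnj a * cis (- (r * s)) + complex_of_real (er s)"
      proof -
        have "complex_of_real (2 * Re (a * cis (r * s))) = a * cis (r * s) + cnj (a * cis (r * s))"
          unfolding complex_add_cnj ..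
        then show ?thesis by (simp add: er_def cis_cnj)
      qed
      have "complex_of_real (r powr (D / 2)) * (packet \<alpha> \<beta> \<tau> s * (cis (t * s\<^sup>2) * complex_of_real (K (r * s)))) = (cis (t * s\<^sup>2) * cis (\<tau> * s\<^sup>2)) * complex_of_real (r powr (D / 2) * (s powr (D / 2) * K (r * s)))"
        using True by (simp add: packet_def mult_ac)
      also have "\<dots> = cis (T * s\<^sup>2) * complex_of_real (U (r * s))"
        unfolding k cis_mult T_def by (simp add: distrib_right)
      also have "\<dots> = a * (cis (T * s\<^sup>2) * cis (r * s)) + cnj a * (cis (T * s\<^sup>2) * cis (- (r * s))) + cis (T * s\<^sup>2) * complex_of_real (er s)"
        unfolding u by (simp add: algebra_simps)
      finally show ?thesis using True unfolding cis_mult by simp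
    qed (auto simp: packet_def)
  qed
  also have "\<dots> = a * A + cnj a * B + E"
    unfolding A_def B_def E_def set_lebesgue_integral_def
    using A(1) B(1) Ei unfolding set_integrable_def
    by (simp del: mult_scaleR_right)
  finally have VE: "complex_of_real (r powr (D / 2)) * V (packet \<alpha> \<beta> \<tau>) t r = a * A + cnj a * B + E" .
  have "r powr (D / 2) * cmod (V (packet \<alpha> \<beta> \<tau>) t r) = cmod (a * A + cnj a * B + E)"
    unfolding VE[symmetric] by (simp add: norm_mult)
  moreover have "cmod (cnj a * B) \<le> cmod (a * A + cnj a * B + E) + cmod (a * A) + cmod E"
    using norm_triangle_ineq4[of "a * A + cnj a * B + E" "a * A + E"] norm_triangle_ineq[of "a * A" E] by (simp add: algebra_simps)
  ultimately show ?thesis using Eb unfolding A(2)[symmetric] B(2)[symmetric] by (simp add: norm_mult)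
qed

lemma powr_radius_lower_bound:
  assumes R: "0 < R" and r: "0 < r" "r \<le> 2 * R" and v: "c * R powr (- e) \<le> r powr (D / 2) * v" and c: "0 \<le> c"
  shows "c * 2 powr (- D / 2) * R powr (- (D / 2 + e)) \<le> v"
proof -
  have "2 powr (- D / 2) * R powr (- D / 2) = (2 * R) powr (- D / 2)" using R by (simp add: powr_mult)
  also have "\<dots> \<le> r powr (- D / 2)" using r D by (intro powr_mono2') auto
  finally have 1: "2 powr (- D / 2) * R powr (- D / 2) \<le> r powr (- D / 2)" .
  have "c * 2 powr (- D / 2) * R powr (- (D / 2 + e)) = (2 powr (- D / 2) * R powr (- D / 2)) * (c * R powr (- e))"
    by (simp add: powr_add[symmetric] algebra_simps)
  also have "\<dots> \<le> r powr (- D / 2) * (r powr (D / 2) * v)"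
    by (intro mult_mono 1 v) (use c in auto)
  also have "\<dots> = v" using r by (simp add: mult.assoc[symmetric] powr_add[symmetric])
  finally show ?thesis .
qed

text \<open>The modulation R / (3 \<mu>) puts the stationary point r / (2T) at 3/2 \<mu>, the middle
  of the interval, when t = 0 and r = R. The ranges of \<open>t\<close> and \<open>r\<close> are
  narrow enough to keep it at distance at least 3/10 \<mu> from both ends. The stationary
  contribution is of order R^(-1/2) and beats the remaining ones, of order 1/R.\<close>

lemma wide_packet:
  assumes \<mu>: "0 < \<mu>" "\<mu> \<le> 1"
  shows "\<exists>c>0. \<exists>R0>0. \<forall>R\<ge>R0. \<forall>t r. 0 \<le> t \<longrightarrow> t \<le> R / 32 \<longrightarrow> R \<le> r \<longrightarrow> r \<le> 33 / 32 * R \<longrightarrow>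
    c * R powr (- (D / 2 + 1 / 2)) \<le> cmod (V (packet \<mu> (2 * \<mu>) (R / (3 * \<mu>))) t r)"
proof -
  define c1 where "c1 = cmod a * sqrt \<mu> / 10"
  have c1: "0 < c1" using a \<mu> by (simp add: c1_def)
  \<comment> \<open>The bound 86/\<mu> gives \<open>8 / 5 \<le> 3 / 10 * \<mu> * sqrt T\<close>, as
    required for the stationary phase, since 86 \<ge> 3 (16/3)^2. The other entry makes the terms of
    order 1/R at most half of the stationary term, and \<open>c1\<close> is the half that
    remains.\<close>
  define R0 where "R0 = max (86 / \<mu>) (((2 * cmod a + C1) / c1)\<^sup>2)"
  have R0: "0 < R0" using \<mu> by (simp add: R0_def less_max_iff_disj)
  have pos: "0 < c1 * 2 powr (- D / 2)" using c1 by simp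
  show ?thesis
  proof (rule exI[of _ "c1 * 2 powr (- D / 2)"], rule conjI[OF pos], rule exI[of _ R0], rule conjI[OF R0], intro conjI allI impI)
    fix R t r assume RR: "R0 \<le> R" and t: "0 \<le> t" "t \<le> R / 32" and rr: "R \<le> r" "r \<le> 33 / 32 * R"
    have R: "0 < R" "86 / \<mu> \<le> R" "((2 * cmod a + C1) / c1)\<^sup>2 \<le> R" using RR R0 by (auto simp: R0_def)
    have r: "0 < r" "r \<le> 2 * R" using R rr by auto
    define T where "T = t + R / (3 * \<mu>)"
    have T1: "R / (3 * \<mu>) \<le> T" using t by (simp add: T_def)
    have T0: "0 < T" using T1 R \<mu> by (smt (verit) divide_pos_pos)
    have T2: "T * \<mu> \<le> R * (35 / 96)"
    proof -
      have "t * \<mu> \<le> R / 32 * 1" using t \<mu> R by (intro mult_mono) auto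
      moreover have "T * \<mu> = t * \<mu> + R / 3" using \<mu> by (simp add: T_def distrib_right)
      ultimately show ?thesis by linarith
    qed
    define s0 where "s0 = r / (2 * T)"
    have TR: "R \<le> 3 * (T * \<mu>)" using T1 \<mu> by (simp add: field_simps)
    have s0_le: "s0 \<le> 99 / 64 * \<mu>"
    proof -
      have "r \<le> 33 / 32 * (3 * (T * \<mu>))" using rr TR by linarith
      then show ?thesis using T0 by (simp add: s0_def field_simps)
    qed
    have s0_ge: "13 / 10 * \<mu> \<le> s0"
    proof -
      have "13 / 10 * (2 * (T * \<mu>)) \<le> r" using T2 rr R by linarith
      then show ?thesis using T0 by (simp add: s0_def field_simps)
    qed
    have sT: "8 / 5 \<le> 3 / 10 * \<mu> * sqrt T"
    proof -
      have "86 \<le> R * \<mu>" using R \<mu> by (simp add: field_simps)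
      also have "\<dots> \<le> 3 * (T * \<mu>) * \<mu>" using TR \<mu> by (intro mult_right_mono) auto
      finally have "(16 / 3)\<^sup>2 \<le> \<mu>\<^sup>2 * T" by (simp add: power2_eq_square mult_ac)
      then have "16 / 3 \<le> sqrt (\<mu>\<^sup>2 * T)" by (intro real_le_rsqrt) simp
      then show ?thesis using \<mu> by (simp add: real_sqrt_mult)
    qed
    have stat: "1 / (5 * sqrt T) \<le> cmod (integral {\<mu>..2 * \<mu>} (\<lambda>s. cis (T * s\<^sup>2 - r * s)))"
    proof (rule stationary_phase_lower_bound[OF T0])
      show "r = 2 * T * s0" using T0 by (simp add: s0_def)
      have "3 / 10 * \<mu> * sqrt T \<le> (2 * \<mu> - s0) * sqrt T" using s0_le T0 \<mu> by (intro mult_right_mono) auto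
      then show "8 / 5 \<le> (2 * \<mu> - s0) * sqrt T" using sT by linarith
      have "3 / 10 * \<mu> * sqrt T \<le> (s0 - \<mu>) * sqrt T" using s0_ge T0 \<mu> by (intro mult_right_mono) auto
      then show "8 / 5 \<le> (s0 - \<mu>) * sqrt T" using sT by linarith
    qed
    have nonstat: "cmod (integral {\<mu>..2 * \<mu>} (\<lambda>s. cis (T * s\<^sup>2 + r * s))) \<le> 2 / R"
    proof -
      have p: "R \<le> 2 * T * \<mu> + r" using T0 \<mu> rr by (simp add: add_increasing)
      have "cmod (integral {\<mu>..2 * \<mu>} (\<lambda>s. cis (T * s\<^sup>2 + r * s + 0))) \<le> 2 / (2 * T * \<mu> + r)"
        by (rule nonstationary_phase) (use T0 \<mu> p R in auto)
      also have "\<dots> \<le> 2 / R" using p R by (intro divide_left_mono) auto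
      finally show ?thesis by simp
    qed
    have sR: "0 < sqrt R" using R by simp
    have st: "sqrt \<mu> / (5 * sqrt R) \<le> 1 / (5 * sqrt T)"
    proof -
      have "sqrt (T * \<mu>) \<le> sqrt R" using T2 R by (intro real_sqrt_le_mono) linarith
      then show ?thesis using T0 sR by (simp add: real_sqrt_mult field_simps)
    qed
    have big: "(2 * cmod a + C1) / R \<le> c1 / sqrt R"
    proof -
      have "(2 * cmod a + C1) / c1 \<le> sqrt R" using R by (intro real_le_rsqrt) auto
      then have "2 * cmod a + C1 \<le> c1 * sqrt R" using c1 by (simp add: field_simps)
      then have "(2 * cmod a + C1) / R \<le> c1 * sqrt R / R" using R by (intro divide_right_mono) auto
      also have "\<dots> = c1 / sqrt R" using R by (simp add: real_div_sqrt flip: times_divide_eq_right) (simp add: field_simps)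
      finally show ?thesis .
    qed
    have "R powr (- (1 / 2)) = 1 / sqrt R" unfolding powr_minus_divide using R by (simp add: powr_half_sqrt)
    then have "c1 * R powr (- (1 / 2)) = cmod a * (sqrt \<mu> / (5 * sqrt R)) - c1 / sqrt R"
      by (simp add: c1_def)
    also have "\<dots> \<le> cmod a * cmod (integral {\<mu>..2 * \<mu>} (\<lambda>s. cis (T * s\<^sup>2 - r * s))) - (2 * cmod a + C1) / R"
      by (intro diff_mono mult_left_mono order_trans[OF st stat] big) auto
    also have "\<dots> \<le> cmod a * cmod (integral {\<mu>..2 * \<mu>} (\<lambda>s. cis (T * s\<^sup>2 - r * s))) - cmod a * cmod (integral {\<mu>..2 * \<mu>} (\<lambda>s. cis (T * s\<^sup>2 + r * s))) - C1 / (r * \<mu>) * (2 * \<mu> - \<mu>)"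
    proof -
      have "cmod a * cmod (integral {\<mu>..2 * \<mu>} (\<lambda>s. cis (T * s\<^sup>2 + r * s))) \<le> cmod a * (2 / R)" using nonstat by (intro mult_left_mono) auto
      moreover have "C1 / (r * \<mu>) * (2 * \<mu> - \<mu>) \<le> C1 / R"
        using \<mu> rr R r C1 by (simp add: frac_le less_imp_le)
      moreover have "(2 * cmod a + C1) / R = cmod a * (2 / R) + C1 / R" by (simp add: add_divide_distrib)
      ultimately show ?thesis by linarith
    qed
    also have "\<dots> \<le> r powr (D / 2) * cmod (V (packet \<mu> (2 * \<mu>) (R / (3 * \<mu>))) t r)"
      unfolding T_def by (rule V_packet_lower_bound) (use \<mu> r in auto)
    finally show "c1 * 2 powr (- D / 2) * R powr (- (D / 2 + 1 / 2)) \<le> cmod (V (packet \<mu> (2 * \<mu>) (R / (3 * \<mu>))) t r)"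
      using R r c1 by (intro powr_radius_lower_bound) auto
  qed
qed

text \<open>The modulation R / (2 \<mu>) puts the stationary point at the left end \<mu> when t = 0
  and r = R, so the phase has slope at most R/8 on an interval of length 8/R and varies by at most
  1. The main term is then at least 4 |a| / R, against |a| / R for the other exponential and 2 |a| /
  R for the error of the kernel; |a| / R is left.\<close>

lemma narrow_packet:
  assumes \<mu>: "0 < \<mu>" "\<mu> \<le> 1"
  shows "\<exists>c>0. \<exists>R0>0. \<forall>R\<ge>R0. 8 / R \<le> \<mu> \<and> (\<forall>t r. 0 \<le> t \<longrightarrow> t \<le> R / 32 \<longrightarrow> R \<le> r \<longrightarrow> r \<le> 33 / 32 * R \<longrightarrow>
    c * R powr (- (D / 2 + 1)) \<le> cmod (V (packet \<mu> (\<mu> + 8 / R) (R / (2 * \<mu>))) t r))"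
proof -
  \<comment> \<open>The terms \<open>4 + 64 / \<mu>\<close> bound the curvature part
    \<open>T * \<delta>\<close> of the slope by R/16 and also give \<open>8 / R \<le> \<mu>\<close>;
    the last term makes the error of the kernel at most \<open>cmod a / 4\<close> per unit
    length.\<close>
  define R0 where "R0 = 4 + 64 / \<mu> + 4 * C1 / (\<mu> * cmod a)"
  have R0: "0 < R0" using \<mu> C1 a by (simp add: R0_def add_pos_nonneg)
  have ca: "0 < cmod a" using a by simp
  have pos: "0 < cmod a * 2 powr (- D / 2)" using a by simp
  show ?thesis
  proof (rule exI[of _ "cmod a * 2 powr (- D / 2)"], rule conjI[OF pos], rule exI[of _ R0], rule conjI[OF R0], intro conjI allI impI)
    fix R assume RR: "R0 \<le> R"
    have R: "0 < R" "4 + 64 / \<mu> \<le> R" "4 * C1 / (\<mu> * cmod a) \<le> R"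
      using RR R0 \<mu> C1 a by (auto simp: R0_def intro: order_trans[rotated])
    have R8: "64 / \<mu> \<le> R" using R by linarith
    then show "8 / R \<le> \<mu>" using R \<mu> by (simp add: field_simps)
    fix t r assume t: "0 \<le> t" "t \<le> R / 32" and rr: "R \<le> r" "r \<le> 33 / 32 * R"
    have r: "0 < r" "r \<le> 2 * R" using R rr by auto
    define T where "T = t + R / (2 * \<mu>)"
    define \<delta> where "\<delta> = 8 / R"
    have \<delta>: "0 < \<delta>" using R by (simp add: \<delta>_def)
    have T0: "0 < T" using t R \<mu> by (simp add: T_def add_nonneg_pos)
    have Tm: "2 * T * \<mu> = 2 * t * \<mu> + R" using \<mu> by (simp add: T_def field_simps)
    have tm: "0 \<le> t * \<mu>" "t * \<mu> \<le> R / 32"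
      using t \<mu> R mult_mono[of t "R / 32" \<mu> 1] by auto
    have slow: "\<delta> / 2 \<le> cmod (integral {\<mu>..\<mu> + \<delta>} (\<lambda>s. cis (T * s\<^sup>2 - r * s)))"
    proof -
      have "(\<mu> + \<delta> - \<mu>) / 2 \<le> cmod (integral {\<mu>..\<mu> + \<delta>} (\<lambda>s. cis (T * s\<^sup>2 - r * s)))"
      proof (rule slow_phase_lower_bound[where k="T * \<mu>\<^sup>2 - r * \<mu>"])
        show "continuous_on {\<mu>..\<mu> + \<delta>} (\<lambda>s. T * s\<^sup>2 - r * s)" by (intro continuous_intros)
        fix s assume s: "s \<in> {\<mu>..\<mu> + \<delta>}"
        have "\<bar>T * s\<^sup>2 - r * s - (T * \<mu>\<^sup>2 - r * \<mu>)\<bar> = \<bar>s - \<mu>\<bar> * \<bar>(2 * T * \<mu> - r) + T * (s - \<mu>)\<bar>"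
          unfolding abs_mult[symmetric] by (simp add: algebra_simps power2_eq_square)
        also have "\<dots> \<le> \<delta> * (R / 16 + T * \<delta>)"
        proof (intro mult_mono)
          show "\<bar>s - \<mu>\<bar> \<le> \<delta>" using s by auto
          have "\<bar>2 * T * \<mu> - r\<bar> \<le> R / 16" using tm rr R unfolding Tm by linarith
          moreover have "0 \<le> T * (s - \<mu>)" "T * (s - \<mu>) \<le> T * \<delta>" using s T0 by auto
          ultimately show "\<bar>(2 * T * \<mu> - r) + T * (s - \<mu>)\<bar> \<le> R / 16 + T * \<delta>" by linarith
        qed (use \<delta> in auto)
        also have "\<dots> \<le> \<delta> * (R / 16 + (1 / 4 + 4 / \<mu>))"
        proof -
          have "T * \<delta> \<le> (R / 32 + R / (2 * \<mu>)) * \<delta>" using t \<delta> by (intro mult_right_mono) (auto simp: T_def)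
          also have "\<dots> = 1 / 4 + 4 / \<mu>" using R \<mu> by (simp add: \<delta>_def field_simps)
          finally show ?thesis using \<delta> by (intro mult_left_mono add_left_mono) auto
        qed
        also have "\<dots> \<le> \<delta> * (R / 16 + R / 16)"
          using R \<delta> by (intro mult_left_mono add_left_mono) auto
        also have "\<dots> = 1" using R by (simp add: \<delta>_def)
        finally show "\<bar>T * s\<^sup>2 - r * s - (T * \<mu>\<^sup>2 - r * \<mu>)\<bar> \<le> 1" .
      qed (use \<delta> in auto)
      then show ?thesis by simp
    qed
    have nonstat: "cmod (integral {\<mu>..\<mu> + \<delta>} (\<lambda>s. cis (T * s\<^sup>2 + r * s))) \<le> 1 / R"
    proof -
      have p: "2 * R \<le> 2 * T * \<mu> + r" using tm rr unfolding Tm by linarith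
      have "cmod (integral {\<mu>..\<mu> + \<delta>} (\<lambda>s. cis (T * s\<^sup>2 + r * s + 0))) \<le> 2 / (2 * T * \<mu> + r)"
        by (rule nonstationary_phase) (use T0 \<mu> p R \<delta> in auto)
      also have "\<dots> \<le> 2 / (2 * R)" using p R by (intro divide_left_mono) auto
      finally show ?thesis by simp
    qed
    have err: "C1 / (r * \<mu>) * (\<mu> + \<delta> - \<mu>) \<le> 2 * cmod a / R"
    proof -
      have "C1 / (r * \<mu>) \<le> C1 / (R * \<mu>)" using C1 \<mu> R rr by (intro divide_left_mono) auto
      also have "\<dots> \<le> cmod a / 4"
      proof -
        have "4 * C1 \<le> R * (\<mu> * cmod a)" using R(3) \<mu> ca by (simp add: pos_divide_le_eq)
        then show ?thesis using R \<mu> by (simp add: field_simps)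
      qed
      finally have "C1 / (r * \<mu>) * \<delta> \<le> cmod a / 4 * \<delta>" using \<delta> by (intro mult_right_mono) auto
      then show ?thesis by (simp add: \<delta>_def)
    qed
    have "cmod a * R powr (- 1) = cmod a * (\<delta> / 2) - cmod a * (1 / R) - 2 * cmod a / R"
      using R by (simp add: powr_minus \<delta>_def field_simps)
    also have "\<dots> \<le> cmod a * cmod (integral {\<mu>..\<mu> + \<delta>} (\<lambda>s. cis (T * s\<^sup>2 - r * s))) - cmod a * cmod (integral {\<mu>..\<mu> + \<delta>} (\<lambda>s. cis (T * s\<^sup>2 + r * s))) - C1 / (r * \<mu>) * (\<mu> + \<delta> - \<mu>)"
      by (intro diff_mono mult_left_mono slow nonstat err) auto
    also have "\<dots> \<le> r powr (D / 2) * cmod (V (packet \<mu> (\<mu> + \<delta>) (R / (2 * \<mu>))) t r)"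
      unfolding T_def by (rule V_packet_lower_bound) (use \<mu> r \<delta> in auto)
    finally show "cmod a * 2 powr (- D / 2) * R powr (- (D / 2 + 1)) \<le> cmod (V (packet \<mu> (\<mu> + 8 / R) (R / (2 * \<mu>))) t r)"
      unfolding \<delta>_def using R r by (intro powr_radius_lower_bound) auto
  qed
qed

text \<open>Near the origin the kernel is at least 1/2. On the interval s^2 - \<mu>^2 is at most 3
  \<delta>, so the phase relative to the left end stays below 1 as long as t \<delta> \<le> 1/3, and
  its cosine is at least 1/2 too: the contributions add up without cancellation.\<close>

lemma short_packet:
  assumes \<mu>: "0 < \<mu>" "\<mu> \<le> 1" and \<delta>: "0 < \<delta>" "\<delta> \<le> \<mu>" and t: "0 \<le> t" "t * \<delta> \<le> 1 / 3" and r: "0 \<le> r" "r \<le> \<rho>"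
    and K: "\<And>y. 0 \<le> y \<Longrightarrow> y \<le> 2 * \<rho> \<Longrightarrow> 1 / 2 \<le> K y"
  shows "\<delta> / 4 \<le> cmod (V (\<lambda>s. indicator {\<mu>..\<mu> + \<delta>} s) t r)"
proof -
  let ?i = "\<lambda>s::real. indicator {\<mu>..\<mu> + \<delta>} s :: real"
  have i1: "integrable lborel (\<lambda>s. ?i s * c)" for c :: real by (intro integrable_mult_left integrable_real_indicator) (auto simp: emeasure_lborel_Icc_eq)
  have i2: "integrable lborel (\<lambda>s. ?i s * (cos (t * (s\<^sup>2 - \<mu>\<^sup>2)) * K (r * s)))"
    by (rule Bochner_Integration.integrable_bound[OF i1[of 1]])
       (use K_le in \<open>auto simp: indicator_def abs_mult intro!: mult_le_one\<close>)
  have i3: "integrable lborel (\<lambda>s. complex_of_real (?i s) * (cis (t * (s\<^sup>2 - \<mu>\<^sup>2)) * complex_of_real (K (r * s))))"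
    by (rule Bochner_Integration.integrable_bound[OF i1[of 1]])
       (use K_le in \<open>auto simp: indicator_def norm_mult\<close>)
  have "\<delta> / 4 = (LINT s|lborel. ?i s * (1 / 4))" using \<delta> by simp
  also have "\<dots> \<le> (LINT s|lborel. ?i s * (cos (t * (s\<^sup>2 - \<mu>\<^sup>2)) * K (r * s)))"
  proof (rule integral_mono[OF i1 i2])
    fix s
    show "?i s * (1 / 4) \<le> ?i s * (cos (t * (s\<^sup>2 - \<mu>\<^sup>2)) * K (r * s))"
    proof (cases "s \<in> {\<mu>..\<mu> + \<delta>}")
      case True
      then have s: "\<mu> \<le> s" "s - \<mu> \<le> \<delta>" "s + \<mu> \<le> 3" "s \<le> 2" "0 \<le> s" using \<mu> \<delta> by auto
      have "s\<^sup>2 - \<mu>\<^sup>2 = (s - \<mu>) * (s + \<mu>)" by (simp add: power2_eq_square algebra_simps)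
      also have "\<dots> \<le> \<delta> * 3" using s \<mu> \<delta> by (intro mult_mono) auto
      finally have "t * (s\<^sup>2 - \<mu>\<^sup>2) \<le> t * (\<delta> * 3)" using t by (intro mult_left_mono) auto
      moreover have "0 \<le> t * (s\<^sup>2 - \<mu>\<^sup>2)" using t s \<mu> by (intro mult_nonneg_nonneg) (auto intro: power_mono)
      ultimately have c: "1 / 2 \<le> cos (t * (s\<^sup>2 - \<mu>\<^sup>2))" using t by (intro cos_ge_half) auto
      have "r * s \<le> \<rho> * 2" using r s by (intro mult_mono) auto
      then have k: "1 / 2 \<le> K (r * s)" using r s by (intro K) auto
      have "(1 / 2) * (1 / 2) \<le> cos (t * (s\<^sup>2 - \<mu>\<^sup>2)) * K (r * s)" using c k by (intro mult_mono) auto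
      then show ?thesis using True by simp
    qed simp
  qed
  also have "\<dots> = Re (LINT s|lborel. complex_of_real (?i s) * (cis (t * (s\<^sup>2 - \<mu>\<^sup>2)) * complex_of_real (K (r * s))))"
    by (subst integral_Re[OF i3, symmetric]) simp
  also have "\<dots> \<le> cmod (LINT s|lborel. complex_of_real (?i s) * (cis (t * (s\<^sup>2 - \<mu>\<^sup>2)) * complex_of_real (K (r * s))))"
    by (rule complex_Re_le_cmod)
  also have "(LINT s|lborel. complex_of_real (?i s) * (cis (t * (s\<^sup>2 - \<mu>\<^sup>2)) * complex_of_real (K (r * s)))) = (LINT s|lborel. cis (- (t * \<mu>\<^sup>2)) * (complex_of_real (?i s) * (cis (t * s\<^sup>2) * complex_of_real (K (r * s)))))"
  proof (intro Bochner_Integration.integral_cong refl)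
    fix s
    have "cis (t * (s\<^sup>2 - \<mu>\<^sup>2)) = cis (- (t * \<mu>\<^sup>2)) * cis (t * s\<^sup>2)" unfolding cis_mult by (simp add: right_diff_distrib)
    then show "complex_of_real (?i s) * (cis (t * (s\<^sup>2 - \<mu>\<^sup>2)) * complex_of_real (K (r * s))) = cis (- (t * \<mu>\<^sup>2)) * (complex_of_real (?i s) * (cis (t * s\<^sup>2) * complex_of_real (K (r * s))))"
      by simp
  qed
  also have "\<dots> = cis (- (t * \<mu>\<^sup>2)) * V (\<lambda>s. complex_of_real (?i s)) t r"
    unfolding V_def by simp
  also have "(\<lambda>s. complex_of_real (?i s)) = (\<lambda>s. indicator {\<mu>..\<mu> + \<delta>} s)" by (auto simp: indicator_def)
  finally show ?thesis by (simp add: norm_mult)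
qed

end

section \<open>From the paraboloid to profiles\<close>

abbreviation shell_measure :: "real \<Rightarrow> (real \<times> (real ^ 'd::finite)) measure" where
  "shell_measure m \<equiv> restrict_space sigma_measure (shell m)"

definition pole :: "real ^ 'd::finite" where "pole = axis undefined 1"

lemma norm_pole [simp]: "norm pole = 1" by (simp add: pole_def norm_axis_1)

definition polar_weight :: "'d::finite itself \<Rightarrow> real \<Rightarrow> real" where
  "polar_weight _ s = real CARD('d) * unit_ball_vol (real CARD('d)) * s ^ (CARD('d) - 1)"

lemma polar_weight_measurable [measurable]: "polar_weight TYPE('d::finite) \<in> borel_measurable borel"
  unfolding polar_weight_def[abs_def] by measurable

lemma polar_weight_mono: "0 \<le> s \<Longrightarrow> s \<le> s' \<Longrightarrow> polar_weight TYPE('d::finite) s \<le> polar_weight TYPE('d) s'"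
  unfolding polar_weight_def by (intro mult_left_mono power_mono mult_nonneg_nonneg) auto

lemma polar_weight_pos: "0 < s \<Longrightarrow> 0 < polar_weight TYPE('d::finite) s"
  unfolding polar_weight_def by (intro mult_pos_pos zero_less_power) (auto simp: unit_ball_vol_pos)

lemma radial_measure_polar_weight:
  "radial_measure CARD('d::finite) = density lborel (\<lambda>s. ennreal (polar_weight TYPE('d) s) * indicator {0<..} s)"
  by (simp add: radial_measure_def polar_weight_def)

definition profile :: "real \<Rightarrow> (real \<times> (real ^ 'd::finite) \<Rightarrow> complex) \<Rightarrow> real \<Rightarrow> complex" where
  "profile m f s = (if s \<in> {m..2*m} then f (s\<^sup>2, s *\<^sub>R pole) else 0)"

text \<open>The polar Jacobian is included, so that this is the function to which \<open>V\<close>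
  is applied.\<close>

definition weighted_profile :: "real \<Rightarrow> (real \<times> (real ^ 'd::finite) \<Rightarrow> complex) \<Rightarrow> real \<Rightarrow> complex" where
  "weighted_profile m f s = profile m f s * complex_of_real (polar_weight TYPE('d) s)"

lemma sets_sigma_measure [simp, measurable_cong]: "sets sigma_measure = sets borel"
  by (simp add: sigma_measure_def)

lemma space_sigma_measure [simp]: "space sigma_measure = UNIV"
  by (simp add: sigma_measure_def)

lemma shell_in_borel [measurable]: "(shell m :: (real \<times> (real ^ 'd::finite)) set) \<in> sets borel"
proof -
  have "closed (shell m :: (real \<times> (real ^ 'd)) set)"
    unfolding shell_def paraboloid_def case_prod_unfold mem_Collect_eq
    by (intro closed_Collect_conj closed_Collect_eq closed_Collect_le continuous_intros)
  then show ?thesis by (rule borel_closed)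
qed

lemma mem_shell_iff: "((norm \<xi>)\<^sup>2, \<xi>) \<in> shell m \<longleftrightarrow> norm \<xi> \<in> {m..2*m}"
  by (simp add: shell_def paraboloid_def)

lemma mem_shell_pole: "0 < m \<Longrightarrow> s \<in> {m..2*m} \<Longrightarrow> (s\<^sup>2, s *\<^sub>R pole) \<in> shell m"
  by (simp add: shell_def paraboloid_def)

lemma profile_measurable:
  fixes f :: "real \<times> (real ^ 'd::finite) \<Rightarrow> complex"
  assumes f: "f \<in> borel_measurable (shell_measure m)" and m: "0 < m"
  shows "profile m f \<in> borel_measurable borel"
proof -
  have [measurable]: "(\<lambda>z. indicator (shell m) z *\<^sub>R f z) \<in> borel_measurable borel"
    using f by (subst (asm) borel_measurable_restrict_space_iff) (auto cong: measurable_cong_sets)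
  have "(\<lambda>s. (s\<^sup>2, s *\<^sub>R (pole :: real ^ 'd))) \<in> borel_measurable borel"
    by (intro borel_measurable_continuous_onI continuous_intros)
  then have "(\<lambda>s. indicator {m..2*m} s *\<^sub>R (indicator (shell m) (s\<^sup>2, s *\<^sub>R (pole :: real ^ 'd)) *\<^sub>R f (s\<^sup>2, s *\<^sub>R pole))) \<in> borel_measurable borel"
    by measurable
  moreover have "profile m f = (\<lambda>s. indicator {m..2*m} s *\<^sub>R (indicator (shell m) (s\<^sup>2, s *\<^sub>R (pole :: real ^ 'd)) *\<^sub>R f (s\<^sup>2, s *\<^sub>R pole)))"
    using mem_shell_pole[OF m] by (auto simp: profile_def fun_eq_iff indicator_def)
  ultimately show ?thesis by simp
qed

text \<open>Rotations act transitively on spheres once the dimension is at least 2, so the values on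
  the ray through \<open>pole\<close> determine \<open>f\<close> on the shell. Off the shell both
  sides are 0.\<close>

lemma profile_norm:
  fixes f :: "real \<times> (real ^ 'd::finite) \<Rightarrow> complex"
  assumes f: "f \<in> cyl_class m" and d: "2 \<le> CARD('d)"
  shows "f ((norm \<xi>)\<^sup>2, \<xi>) = profile m f (norm \<xi>)"
proof (cases "norm \<xi> \<in> {m..2*m}")
  case True
  have "f ((norm \<xi>)\<^sup>2, \<xi>) = f ((norm \<xi>)\<^sup>2, norm \<xi> *\<^sub>R pole)"
  proof (cases "\<xi> = 0")
    case False
    obtain A :: "real ^ 'd ^ 'd" where A: "rotation_matrix A" "A *v axis undefined 1 = sgn \<xi>"
      by (rule rotation_matrix_exists_basis[OF d, of "sgn \<xi>"]) (use False in \<open>auto simp: norm_sgn\<close>)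
    have "A *v (norm \<xi> *\<^sub>R pole) = norm \<xi> *\<^sub>R sgn \<xi>"
      using A(2) by (simp add: pole_def matrix_vector_mult_scaleR)
    also have "\<dots> = \<xi>" by (simp add: sgn_div_norm False)
    finally have *: "A *v (norm \<xi> *\<^sub>R pole) = \<xi>" .
    have "((norm \<xi>)\<^sup>2, norm \<xi> *\<^sub>R (pole :: real ^ 'd)) \<in> paraboloid" by (simp add: paraboloid_def)
    then have "f ((norm \<xi>)\<^sup>2, A *v (norm \<xi> *\<^sub>R pole)) = f ((norm \<xi>)\<^sup>2, norm \<xi> *\<^sub>R pole)"
      using f A(1) unfolding cyl_class_def cylindrically_symmetric_def by fast
    then show ?thesis unfolding * .
  qed simp
  then show ?thesis using True by (simp add: profile_def)
next
  case False
  have "((norm \<xi>)\<^sup>2, \<xi>) \<in> paraboloid - shell m" using False by (simp add: mem_shell_iff) (simp add: paraboloid_def)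
  then show ?thesis using f False by (auto simp: profile_def cyl_class_def)
qed

lemma nn_integral_shell:
  fixes f :: "real \<times> (real ^ 'd::finite) \<Rightarrow> complex" and h :: "complex \<Rightarrow> ennreal"
  assumes f: "f \<in> cyl_class m" "f \<in> borel_measurable (shell_measure m)" and d: "2 \<le> CARD('d)" and m: "0 < m"
    and h [measurable]: "h \<in> borel_measurable borel"
  shows "(\<integral>\<^sup>+ z. h (f z) \<partial>shell_measure m) =
    (\<integral>\<^sup>+ s. h (profile m f s) * (ennreal (polar_weight TYPE('d) s) * indicator {m..2*m} s) \<partial>lborel)"
proof -
  have [measurable]: "profile m f \<in> borel_measurable borel" by (rule profile_measurable[OF f(2) m])
  have f': "(\<lambda>z. indicator (shell m) z *\<^sub>R f z) \<in> borel_measurable borel"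
    using f(2) by (subst (asm) borel_measurable_restrict_space_iff) (auto cong: measurable_cong_sets)
  have hf: "(\<lambda>z. h (indicator (shell m) z *\<^sub>R f z) * indicator (shell m) z) \<in> borel_measurable borel"
    using f' by measurable
  have par: "(\<lambda>\<xi>::real ^ 'd. ((norm \<xi>)\<^sup>2, \<xi>)) \<in> lborel \<rightarrow>\<^sub>M borel"
    by (intro borel_measurable_continuous_onI continuous_intros | subst measurable_lborel2)+
  have "(\<integral>\<^sup>+ z. h (f z) \<partial>shell_measure m) = (\<integral>\<^sup>+ z. h (f z) * indicator (shell m) z \<partial>sigma_measure)"
    by (subst nn_integral_restrict_space) auto
  also have "\<dots> = (\<integral>\<^sup>+ z. h (indicator (shell m) z *\<^sub>R f z) * indicator (shell m) z \<partial>sigma_measure)"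
    by (intro nn_integral_cong) (auto simp: indicator_def)
  also have "\<dots> = (\<integral>\<^sup>+ \<xi>. h (indicator (shell m) ((norm \<xi>)\<^sup>2, \<xi>) *\<^sub>R f ((norm \<xi>)\<^sup>2, \<xi>)) * indicator (shell m) ((norm \<xi>)\<^sup>2, \<xi>) \<partial>lborel)"
    unfolding sigma_measure_def using hf par by (subst nn_integral_distr) auto
  also have "\<dots> = (\<integral>\<^sup>+ \<xi>. h (profile m f (norm (\<xi>::real ^ 'd))) * indicator {m..2*m} (norm \<xi>) \<partial>lborel)"
    using profile_norm[OF f(1) d] by (intro nn_integral_cong) (auto simp: indicator_def mem_shell_iff)
  also have "\<dots> = (\<integral>\<^sup>+ s. h (profile m f s) * indicator {m..2*m} s \<partial>radial_measure CARD('d))"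
    using nn_integral_radial[where 'a="real ^ 'd", of "\<lambda>s. h (profile m f s) * indicator {m..2*m} s"] by simp
  also have "\<dots> = (\<integral>\<^sup>+ s. ennreal (polar_weight TYPE('d) s) * indicator {0<..} s * (h (profile m f s) * indicator {m..2*m} s) \<partial>lborel)"
    unfolding radial_measure_polar_weight by (subst nn_integral_density) auto
  also have "\<dots> = (\<integral>\<^sup>+ s. h (profile m f s) * (ennreal (polar_weight TYPE('d) s) * indicator {m..2*m} s) \<partial>lborel)"
    using m by (intro nn_integral_cong) (auto simp: indicator_def mult_ac)
  finally show ?thesis .
qed

lemma finite_shell_measure:
  assumes m: "0 < m" and d: "2 \<le> CARD('d::finite)"
  shows "finite_measure (shell_measure m :: (real \<times> (real ^ 'd)) measure)"
proof
  \<comment> \<open>The zero function serves as a member of \<open>cyl_class\<close>: applying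
    \<open>nn_integral_shell\<close> with a constant \<open>h\<close> then computes the mass of the
    shell itself.\<close>
  let ?f = "\<lambda>z::real \<times> (real ^ 'd). if z \<in> paraboloid - shell m then 0 else 0 :: complex"
  have f: "?f \<in> cyl_class m" by (auto simp: cyl_class_def cylindrically_symmetric_def)
  have "emeasure (shell_measure m :: (real \<times> (real ^ 'd)) measure) (space (shell_measure m)) = (\<integral>\<^sup>+ z. (\<lambda>_. 1) (?f z) \<partial>(shell_measure m :: (real \<times> (real ^ 'd)) measure))"
    by simp
  also have "\<dots> = (\<integral>\<^sup>+ s. (\<lambda>_. 1) (profile m ?f s) * (ennreal (polar_weight TYPE('d) s) * indicator {m..2*m} s) \<partial>lborel)"
    by (rule nn_integral_shell[OF f _ d m]) auto
  also have "\<dots> \<le> (\<integral>\<^sup>+ s. ennreal (polar_weight TYPE('d) (2*m)) * indicator {m..2*m} s \<partial>lborel)"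
    using m by (intro nn_integral_mono) (auto simp: indicator_def intro!: ennreal_leI polar_weight_mono)
  also have "\<dots> < \<infinity>" using m by (simp add: nn_integral_cmult ennreal_mult_less_top)
  finally show "emeasure (shell_measure m :: (real \<times> (real ^ 'd)) measure) (space (shell_measure m)) \<noteq> \<infinity>" by simp
qed

text \<open>Cutting at height \<open>N\<close> gives |f|^r \<le> N^r + N^(r-P) |f|^P for the finite
  exponent \<open>P\<close>; the first term integrates to the total mass times N^r, the second to at
  most N^r. For p = \<infinity> the height is at most \<open>N\<close> almost everywhere.\<close>

lemma (in finite_measure) Lp_norm_exponent_mono:
  assumes f [measurable]: "f \<in> borel_measurable M" and N: "0 < N" "Lp_norm M p f \<le> ennreal N" and r: "1 \<le> r" "ennreal r \<le> p"
  shows "(\<integral>\<^sup>+ x. ennreal (cmod (f x) powr r) \<partial>M) \<le> ennreal (N powr r * (measure M (space M) + 1))"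
proof (cases "p = \<infinity>")
  case True
  have "AE x in M. ennreal (cmod (f x)) \<le> ennreal N"
  proof -
    have "esssup M (\<lambda>x. ennreal (cmod (f x))) \<le> ennreal N" using N True by (simp add: Lp_norm_def)
    then show ?thesis using esssup_AE[where M=M and f="\<lambda>x. ennreal (cmod (f x))"] by (auto elim!: eventually_mono intro: order_trans)
  qed
  then have "(\<integral>\<^sup>+ x. ennreal (cmod (f x) powr r) \<partial>M) \<le> (\<integral>\<^sup>+ x. ennreal (N powr r) \<partial>M)"
    using N r by (intro nn_integral_mono_AE) (auto intro!: ennreal_leI powr_mono2 elim!: AE_mp)
  also have "\<dots> = ennreal (N powr r * measure M (space M))" by (simp add: emeasure_eq_measure ennreal_mult)
  also have "\<dots> \<le> ennreal (N powr r * (measure M (space M) + 1))" by (intro ennreal_leI mult_left_mono) auto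
  finally show ?thesis .
next
  case False
  define P where "P = enn2real p"
  have P: "r \<le> P" "0 < P" using r False ennreal_le_iff[of P r]
    unfolding P_def by (auto simp: enn2real_eq_posreal_iff) (cases p; auto)+
  define I where "I = (\<integral>\<^sup>+ x. ennreal (cmod (f x) powr P) \<partial>M)"
  have I: "I \<noteq> \<infinity>" "enn2real I powr (1 / P) \<le> N"
    using N False by (auto simp: Lp_norm_def Let_def I_def P_def top_unique split: if_splits)
  have "(enn2real I powr (1 / P)) powr P \<le> N powr P" using I P by (intro powr_mono2) auto
  then have "enn2real I \<le> N powr P" using P by (simp add: powr_powr)
  then have IN: "I \<le> ennreal (N powr P)" using I(1) by (cases I) auto
  have "(\<integral>\<^sup>+ x. ennreal (cmod (f x) powr r) \<partial>M) \<le> (\<integral>\<^sup>+ x. ennreal (N powr r) + ennreal (N powr (r - P)) * ennreal (cmod (f x) powr P) \<partial>M)"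
  proof (rule nn_integral_mono)
    fix x
    have "cmod (f x) powr r \<le> N powr r + N powr (r - P) * cmod (f x) powr P"
    proof (cases "cmod (f x) \<le> N")
      case True
      then have "cmod (f x) powr r \<le> N powr r" using r by (intro powr_mono2) auto
      then show ?thesis by (simp add: add_increasing2)
    next
      case False
      then have "cmod (f x) powr r = cmod (f x) powr (r - P) * cmod (f x) powr P" using N by (simp add: powr_add[symmetric])
      also have "\<dots> \<le> N powr (r - P) * cmod (f x) powr P" using False N P by (intro mult_right_mono powr_mono2') auto
      finally show ?thesis by (simp add: add_increasing)
    qed
    then show "ennreal (cmod (f x) powr r) \<le> ennreal (N powr r) + ennreal (N powr (r - P)) * ennreal (cmod (f x) powr P)"
      by (simp add: ennreal_mult[symmetric] ennreal_plus[symmetric] ennreal_leI del: ennreal_plus)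
  qed
  also have "\<dots> = ennreal (N powr r) * emeasure M (space M) + ennreal (N powr (r - P)) * I"
    by (simp add: nn_integral_add nn_integral_cmult I_def)
  also have "\<dots> \<le> ennreal (N powr r) * emeasure M (space M) + ennreal (N powr (r - P)) * ennreal (N powr P)"
    by (intro add_left_mono mult_left_mono IN) auto
  also have "\<dots> = ennreal (N powr r * (measure M (space M) + 1))"
    using N by (simp add: emeasure_eq_measure ennreal_mult[symmetric] ennreal_plus[symmetric] powr_add[symmetric] distrib_left del: ennreal_plus)
  finally show ?thesis .
qed

text \<open>The passage from d\<sigma> to Lebesgue measure on [m, 2m]. The weight occurs to the
  power \<open>r\<close> in the norm of \<open>weighted_profile\<close> but only once in d\<sigma>,
  and the surplus power is bounded on the shell. At the same time the exponent \<open>p\<close>,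
  possibly infinite, is lowered to the real exponent \<open>r\<close>.\<close>

lemma weighted_profile_admissible:
  assumes m: "0 < m" and d: "2 \<le> CARD('d::finite)" and r: "1 \<le> r" "ennreal r \<le> p"
  shows "\<exists>c>0. \<forall>(f :: real \<times> (real ^ 'd) \<Rightarrow> complex) N. f \<in> cyl_class m \<longrightarrow> f \<in> borel_measurable (shell_measure m) \<longrightarrow>
    0 < N \<longrightarrow> Lp_norm (shell_measure m) p f \<le> ennreal N \<longrightarrow> admissible m r (weighted_profile m f) (c * N)"
proof -
  let ?\<mu> = "shell_measure m :: (real \<times> (real ^ 'd)) measure"
  interpret finite_measure ?\<mu> by (rule finite_shell_measure[OF m d])
  define W where "W = polar_weight TYPE('d) (2*m)"
  have W: "0 < W" using m by (simp add: W_def polar_weight_pos)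
  define B where "B = measure ?\<mu> (space ?\<mu>) + 1"
  have B: "0 < B" by (simp add: B_def add_nonneg_pos)
  have bound: "(\<integral>\<^sup>+ s. ennreal (cmod (weighted_profile m f s) powr r') \<partial>lborel) \<le> ennreal (W powr (r' - 1) * B * N powr r')"
    if f: "f \<in> cyl_class m" "f \<in> borel_measurable ?\<mu>" and N: "0 < N" "Lp_norm ?\<mu> p f \<le> ennreal N" and r': "1 \<le> r'" "ennreal r' \<le> p"
    for f :: "real \<times> (real ^ 'd) \<Rightarrow> complex" and N r'
  proof -
    have [measurable]: "profile m f \<in> borel_measurable borel" by (rule profile_measurable[OF f(2) m])
    have "(\<integral>\<^sup>+ s. ennreal (cmod (weighted_profile m f s) powr r') \<partial>lborel) \<le>
      (\<integral>\<^sup>+ s. ennreal (W powr (r' - 1)) * (ennreal (cmod (profile m f s) powr r') * (ennreal (polar_weight TYPE('d) s) * indicator {m..2*m} s)) \<partial>lborel)"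
    proof (rule nn_integral_mono)
      fix s
      show "ennreal (cmod (weighted_profile m f s) powr r') \<le> ennreal (W powr (r' - 1)) * (ennreal (cmod (profile m f s) powr r') * (ennreal (polar_weight TYPE('d) s) * indicator {m..2*m} s))"
      proof (cases "s \<in> {m..2*m}")
        case True
        let ?w = "polar_weight TYPE('d) s"
        have w: "0 < ?w" "?w \<le> W" using True m by (auto simp: W_def intro!: polar_weight_pos polar_weight_mono)
        have "cmod (weighted_profile m f s) powr r' = cmod (profile m f s) powr r' * (?w powr (r' - 1) * ?w powr 1)"
          using w unfolding powr_add[symmetric] by (simp add: weighted_profile_def norm_mult powr_mult)
        also have "\<dots> \<le> cmod (profile m f s) powr r' * (W powr (r' - 1) * ?w powr 1)"
          using w r' by (intro mult_left_mono mult_right_mono powr_mono2) auto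
        also have "\<dots> = W powr (r' - 1) * (cmod (profile m f s) powr r' * ?w)" using w by simp
        finally show ?thesis using True w by (simp add: ennreal_mult[symmetric] ennreal_leI)
      qed (auto simp: weighted_profile_def profile_def)
    qed
    also have "\<dots> = ennreal (W powr (r' - 1)) * (\<integral>\<^sup>+ z. ennreal (cmod (f z) powr r') \<partial>?\<mu>)"
      by (subst nn_integral_cmult, measurable) (simp add: nn_integral_shell[OF f d m, of "\<lambda>z. ennreal (cmod z powr r')"])
    also have "\<dots> \<le> ennreal (W powr (r' - 1)) * ennreal (N powr r' * B)"
      unfolding B_def by (intro mult_left_mono Lp_norm_exponent_mono[OF f(2) N r']) auto
    also have "\<dots> = ennreal (W powr (r' - 1) * B * N powr r')" using B by (simp add: ennreal_mult[symmetric] mult_ac)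
    finally show ?thesis .
  qed
  have p1: "1 \<le> p" using r by (metis ennreal_leI ennreal_1 order_trans)
  define c where "c = (W powr (r - 1) * B) powr (1 / r)"
  have c: "0 < c" using W B by (simp add: c_def)
  show ?thesis
  proof (intro exI[of _ c] conjI allI impI c)
    fix f :: "real \<times> (real ^ 'd) \<Rightarrow> complex" and N
    assume f: "f \<in> cyl_class m" "f \<in> borel_measurable ?\<mu>" and N: "0 < N" "Lp_norm ?\<mu> p f \<le> ennreal N"
    have [measurable]: "profile m f \<in> borel_measurable borel" by (rule profile_measurable[OF f(2) m])
    have "(\<integral>\<^sup>+ s. ennreal (cmod (weighted_profile m f s)) \<partial>lborel) \<le> ennreal (W powr (1 - 1) * B * N powr 1)"
      using bound[OF f N, of 1] p1 by simp
    then have "integrable lborel (weighted_profile m f)"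
      unfolding weighted_profile_def[abs_def] by (intro integrableI_bounded) (auto intro: le_less_trans)
    moreover have "(c * N) powr r = W powr (r - 1) * B * N powr r"
      using W B r N by (simp add: c_def powr_mult powr_powr)
    ultimately show "admissible m r (weighted_profile m f) (c * N)"
      unfolding admissible_def using bound[OF f N r] c N by (auto simp: weighted_profile_def profile_def)
  qed
qed

section \<open>Bounds for \<open>Lp_norm\<close> from integrals and from measures of sets\<close>

lemma Lp_norm_le:
  assumes q: "q \<noteq> \<infinity>" "0 < enn2real q" and B: "0 \<le> B"
    and I: "(\<integral>\<^sup>+ x. ennreal (cmod (f x) powr enn2real q) \<partial>\<mu>) \<le> ennreal (B powr enn2real q)"
  shows "Lp_norm \<mu> q f \<le> ennreal B"
proof -
  have fin: "(\<integral>\<^sup>+ x. ennreal (cmod (f x) powr enn2real q) \<partial>\<mu>) \<noteq> \<infinity>" using I by (auto simp: top_unique)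
  have "enn2real (\<integral>\<^sup>+ x. ennreal (cmod (f x) powr enn2real q) \<partial>\<mu>) \<le> B powr enn2real q"
    using I by (intro enn2real_leI) auto
  then have "enn2real (\<integral>\<^sup>+ x. ennreal (cmod (f x) powr enn2real q) \<partial>\<mu>) powr (1 / enn2real q) \<le> (B powr enn2real q) powr (1 / enn2real q)"
    using q by (intro powr_mono2) auto
  also have "\<dots> = B" using q B by (simp add: powr_powr)
  finally show ?thesis using q fin by (simp add: Lp_norm_def ennreal_leI)
qed

lemma Lp_norm_ge:
  assumes q: "q \<noteq> \<infinity>" "0 < enn2real q" and b: "0 \<le> b"
    and I: "ennreal (b powr enn2real q) \<le> (\<integral>\<^sup>+ x. ennreal (cmod (f x) powr enn2real q) \<partial>\<mu>)"
  shows "ennreal b \<le> Lp_norm \<mu> q f"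
proof (cases "(\<integral>\<^sup>+ x. ennreal (cmod (f x) powr enn2real q) \<partial>\<mu>) = \<infinity>")
  case False
  then have "b powr enn2real q \<le> enn2real (\<integral>\<^sup>+ x. ennreal (cmod (f x) powr enn2real q) \<partial>\<mu>)"
    using I by (metis enn2real_ennreal enn2real_mono infinity_ennreal_def less_top powr_ge_zero)
  then have "(b powr enn2real q) powr (1 / enn2real q) \<le> enn2real (\<integral>\<^sup>+ x. ennreal (cmod (f x) powr enn2real q) \<partial>\<mu>) powr (1 / enn2real q)"
    using q by (intro powr_mono2) auto
  moreover have "(b powr enn2real q) powr (1 / enn2real q) = b" using q b by (simp add: powr_powr)
  ultimately show ?thesis using q False by (simp add: Lp_norm_def ennreal_leI)
qed (use q in \<open>simp add: Lp_norm_def\<close>)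

lemma Lp_norm_ge_on_set:
  assumes q: "q \<noteq> \<infinity>" "0 < enn2real q" and b: "0 \<le> b" and v: "0 \<le> v"
    and A: "A \<in> sets \<mu>" "ennreal v \<le> emeasure \<mu> A" and f: "\<And>x. x \<in> A \<Longrightarrow> b \<le> cmod (f x)"
  shows "ennreal (b * v powr (1 / enn2real q)) \<le> Lp_norm \<mu> q f"
proof (rule Lp_norm_ge[OF q])
  have "ennreal ((b * v powr (1 / enn2real q)) powr enn2real q) = ennreal (b powr enn2real q) * ennreal v"
    using q b v by (simp add: powr_mult powr_powr ennreal_mult)
  also have "\<dots> \<le> ennreal (b powr enn2real q) * emeasure \<mu> A" by (intro mult_left_mono A) auto
  also have "\<dots> = (\<integral>\<^sup>+ x. ennreal (b powr enn2real q) * indicator A x \<partial>\<mu>)" using A by (simp add: nn_integral_cmult_indicator)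
  also have "\<dots> \<le> (\<integral>\<^sup>+ x. ennreal (cmod (f x) powr enn2real q) \<partial>\<mu>)"
    using f b q by (intro nn_integral_mono) (auto simp: indicator_def intro!: ennreal_leI powr_mono2)
  finally show "ennreal ((b * v powr (1 / enn2real q)) powr enn2real q) \<le> (\<integral>\<^sup>+ x. ennreal (cmod (f x) powr enn2real q) \<partial>\<mu>)" .
qed (use b in auto)

lemma enn2real_pos: "1 \<le> q \<Longrightarrow> q \<noteq> \<infinity> \<Longrightarrow> 0 < enn2real q"
  by (auto simp: enn2real_positive_iff less_top dest: order.strict_trans2[OF zero_less_one])

lemma Lp_norm_bounded_support_le:
  assumes p: "1 \<le> p" and f [measurable]: "f \<in> borel_measurable \<mu>" and B: "0 \<le> B" "\<And>x. x \<in> space \<mu> \<Longrightarrow> cmod (f x) \<le> B"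
    and A: "A \<in> sets \<mu>" "emeasure \<mu> A \<le> ennreal v" "0 < v" and f0: "\<And>x. x \<in> space \<mu> \<Longrightarrow> x \<notin> A \<Longrightarrow> f x = 0"
  shows "Lp_norm \<mu> p f \<le> ennreal (B * v powr enn2real (1 / p))"
proof (cases "p = \<infinity>")
  case True
  have "esssup \<mu> (\<lambda>x. ennreal (cmod (f x))) \<le> ennreal B"
    using B by (intro esssup_I AE_I2) (auto intro: ennreal_leI)
  then show ?thesis using True A by (simp add: Lp_norm_def)
next
  case False
  have P: "0 < enn2real p" by (rule enn2real_pos[OF p False])
  have k: "enn2real (1 / p) = 1 / enn2real p"
    using P False by (cases p) (auto simp: ennreal_1[symmetric] divide_ennreal simp del: ennreal_1)
  show ?thesis
  proof (rule Lp_norm_le[OF False P])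
    have "(\<integral>\<^sup>+ x. ennreal (cmod (f x) powr enn2real p) \<partial>\<mu>) \<le> (\<integral>\<^sup>+ x. ennreal (B powr enn2real p) * indicator A x \<partial>\<mu>)"
    proof (rule nn_integral_mono)
      fix x assume "x \<in> space \<mu>"
      then show "ennreal (cmod (f x) powr enn2real p) \<le> ennreal (B powr enn2real p) * indicator A x"
        using P B(2)[of x] f0[of x] by (cases "x \<in> A") (auto intro!: ennreal_leI powr_mono2)
    qed
    also have "\<dots> = ennreal (B powr enn2real p) * emeasure \<mu> A" using A by (simp add: nn_integral_cmult_indicator)
    also have "\<dots> \<le> ennreal (B powr enn2real p) * ennreal v" by (intro mult_left_mono A) auto
    also have "\<dots> = ennreal ((B * v powr enn2real (1 / p)) powr enn2real p)"
      unfolding k using P B A by (simp add: powr_mult powr_powr ennreal_mult)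
    finally show "(\<integral>\<^sup>+ x. ennreal (cmod (f x) powr enn2real p) \<partial>\<mu>) \<le> \<dots>" .
  qed (use B in auto)
qed

section \<open>The bilinear estimates on the paraboloid\<close>

locale paraboloid_kernel =
  radial_kernel "CARD('d)" "\<lambda>r. sphere_hat (r *\<^sub>R (pole :: real ^ 'd::finite))" a C0 for a C0
begin

lemma extension_eq_V:
  fixes f :: "real \<times> (real ^ 'd) \<Rightarrow> complex"
  assumes f: "f \<in> cyl_class m" "f \<in> borel_measurable (shell_measure m)" and m: "0 < m"
    and i: "integrable lborel (weighted_profile m f)"
  shows "extension f (t, x) = V (weighted_profile m f) t (norm x)"
proof -
  have [measurable]: "profile m f \<in> borel_measurable borel" by (rule profile_measurable[OF f(2) m])
  define G where "G s = profile m f s * cis (t * s\<^sup>2)" for s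
  have [measurable]: "G \<in> borel_measurable borel" unfolding G_def[abs_def] by measurable
  define w where "w s = polar_weight TYPE('d) s * indicator {0<..} s" for s :: real
  have [measurable]: "w \<in> borel_measurable borel" unfolding w_def[abs_def] by measurable
  have w: "0 \<le> w s" for s
    using polar_weight_pos[of s, where 'd='d] by (auto simp: w_def indicator_def)
  have rm: "radial_measure DIM(real ^ 'd) = density lborel (\<lambda>s. ennreal (w s))"
    by (simp add: radial_measure_polar_weight w_def) (intro arg_cong[where f="density lborel"] ext, simp add: indicator_def)
  have wG: "w s *\<^sub>R G s = weighted_profile m f s * cis (t * s\<^sup>2)" for s
    using m by (auto simp: w_def G_def weighted_profile_def profile_def indicator_def scaleR_conv_of_real mult_ac)
  have "integrable lborel (\<lambda>s. weighted_profile m f s * cis (t * s\<^sup>2))"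
    by (rule Bochner_Integration.integrable_bound[OF i]) (use i in \<open>auto simp: norm_mult\<close>)
  then have Gi: "integrable (radial_measure DIM(real ^ 'd)) G"
    unfolding rm by (subst integrable_density) (auto simp: w wG)
  have "extension f (t, x) = (LINT \<xi>|lborel. G (norm \<xi>) * exp (\<i> * complex_of_real (x \<bullet> \<xi>)))"
    unfolding extension_def prod.case G_def
    by (intro Bochner_Integration.integral_cong refl) (simp add: profile_norm[OF f(1) d] cis_conv_exp distrib_left exp_add mult_ac)
  also have "\<dots> = (LINT s|radial_measure DIM(real ^ 'd). G s * complex_of_real (sphere_hat (s *\<^sub>R x)))"
    by (rule radial_exponential_integral[OF Gi])
  also have "\<dots> = (LINT s|lborel. w s *\<^sub>R (G s * complex_of_real (sphere_hat (s *\<^sub>R x))))"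
    unfolding rm by (subst integral_density) (auto simp: w)
  also have "\<dots> = V (weighted_profile m f) t (norm x)"
    unfolding V_def
  proof (intro Bochner_Integration.integral_cong refl)
    fix s
    have "sphere_hat (s *\<^sub>R x) = sphere_hat ((norm x * s) *\<^sub>R (pole :: real ^ 'd))"
      by (rule sphere_hat_radial) (simp add: abs_mult)
    then show "w s *\<^sub>R (G s * complex_of_real (sphere_hat (s *\<^sub>R x))) =
        weighted_profile m f s * (cis (t * s\<^sup>2) * complex_of_real (sphere_hat ((norm x * s) *\<^sub>R (pole :: real ^ 'd))))"
      using wG[of s] by (simp flip: mult_scaleR_left)
  qed
  finally show ?thesis .
qed

lemma V_norm_measurable:
  assumes "F \<in> borel_measurable borel"
  shows "(\<lambda>z :: real \<times> (real ^ 'd). V F (fst z) (norm (snd z))) \<in> borel_measurable (borel \<Otimes>\<^sub>M borel)"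
proof -
  have "(\<lambda>z :: real \<times> (real ^ 'd). (fst z, norm (snd z))) \<in> borel \<Otimes>\<^sub>M borel \<rightarrow>\<^sub>M borel \<Otimes>\<^sub>M borel" by measurable
  from measurable_compose[OF this V_measurable[OF assms]] show ?thesis by simp
qed

lemma nn_integral_V_product:
  assumes [measurable]: "F \<in> borel_measurable borel" "G \<in> borel_measurable borel"
  shows "(\<integral>\<^sup>+ z. ennreal (cmod (V F (fst z) (norm (snd z :: real ^ 'd)) * V G (fst z) (norm (snd z))) powr q) \<partial>lborel) =
    ennreal (real CARD('d) * unit_ball_vol (real CARD('d))) * (\<integral>\<^sup>+ r. mass q F G r * (ennreal (r powr D) * indicator {0<..} r) \<partial>lborel)"
proof -
  note [measurable] = V_norm_measurable[OF assms(1)] V_norm_measurable[OF assms(2)]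
  let ?\<kappa> = "real CARD('d) * unit_ball_vol (real CARD('d))"
  have "(\<integral>\<^sup>+ z. ennreal (cmod (V F (fst z) (norm (snd z :: real ^ 'd)) * V G (fst z) (norm (snd z))) powr q) \<partial>lborel) =
    (\<integral>\<^sup>+ z. ennreal (cmod (V F (fst z) (norm (snd z :: real ^ 'd)) * V G (fst z) (norm (snd z))) powr q) \<partial>(lborel \<Otimes>\<^sub>M lborel))"
    by (simp add: lborel_prod)
  also have "\<dots> = (\<integral>\<^sup>+ x. mass q F G (norm (x :: real ^ 'd)) \<partial>lborel)"
    unfolding mass_def by (subst lborel_pair.nn_integral_snd[symmetric]) (auto simp: split_def)
  also have "\<dots> = (\<integral>\<^sup>+ s. mass q F G s \<partial>radial_measure CARD('d))"
    using nn_integral_radial[where 'a="real ^ 'd", of "mass q F G"] by simp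
  also have "\<dots> = (\<integral>\<^sup>+ r. ennreal (polar_weight TYPE('d) r) * indicator {0<..} r * mass q F G r \<partial>lborel)"
    unfolding radial_measure_polar_weight by (subst nn_integral_density) auto
  also have "\<dots> = (\<integral>\<^sup>+ r. ennreal ?\<kappa> * (mass q F G r * (ennreal (r powr D) * indicator {0<..} r)) \<partial>lborel)"
  proof (rule nn_integral_cong)
    fix r
    show "ennreal (polar_weight TYPE('d) r) * indicator {0<..} r * mass q F G r = ennreal ?\<kappa> * (mass q F G r * (ennreal (r powr D) * indicator {0<..} r))"
    proof (cases "0 < r")
      case True
      have "r powr D = r ^ (CARD('d) - 1)" unfolding D_def using True by (rule powr_realpow)
      then have "polar_weight TYPE('d) r = ?\<kappa> * r powr D" by (simp add: polar_weight_def)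
      then show ?thesis using True by (simp add: ennreal_mult mult_ac)
    qed simp
  qed
  also have "\<dots> = ennreal ?\<kappa> * (\<integral>\<^sup>+ r. mass q F G r * (ennreal (r powr D) * indicator {0<..} r) \<partial>lborel)"
    by (subst nn_integral_cmult) auto
  finally show ?thesis .
qed

lemma V_le_admissible_1:
  assumes F: "admissible m 1 F N"
  shows "cmod (V F t r) \<le> N"
proof -
  have Fi: "integrable lborel F" and N: "0 < N" using F by (auto simp: admissible_def)
  have "ennreal (LINT s|lborel. cmod (F s)) = (\<integral>\<^sup>+ s. ennreal (cmod (F s)) \<partial>lborel)"
    using Fi by (intro nn_integral_eq_integral[symmetric]) auto
  also have "\<dots> \<le> ennreal N" using F N by (simp add: admissible_def)
  finally have *: "(LINT s|lborel. cmod (F s)) \<le> N" using N by simp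
  have "cmod (V F t r) \<le> (LINT s|lborel. cmod (F s * (cis (t * s\<^sup>2) * complex_of_real (sphere_hat ((r * s) *\<^sub>R (pole :: real ^ 'd))))))"
    unfolding V_def by (rule integral_norm_bound)
  also have "\<dots> \<le> (LINT s|lborel. cmod (F s))"
    by (intro integral_mono integrable_norm integrable_V Fi) (use K_le in \<open>auto simp: norm_mult intro!: mult_left_le\<close>)
  finally show ?thesis using * by linarith
qed

text \<open>Norms may be replaced by arbitrary positive upper bounds: adding 1/(k+1) to each norm
  makes it positive, even if the function vanishes, and letting k tend to infinity recovers the
  product of the norms.\<close>

lemma bilinear_estimateI:
  assumes M: "0 < M" and p: "1 \<le> p" and C: "0 \<le> C"
    and H: "\<And>(f :: real \<times> (real ^ 'd) \<Rightarrow> complex) (g :: real \<times> (real ^ 'd) \<Rightarrow> complex) N N'. f \<in> cyl_class 1 \<Longrightarrow> f \<in> borel_measurable (shell_measure 1) \<Longrightarrow>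
      g \<in> cyl_class M \<Longrightarrow> g \<in> borel_measurable (shell_measure M) \<Longrightarrow> 0 < N \<Longrightarrow> 0 < N' \<Longrightarrow>
      Lp_norm (shell_measure 1) p f \<le> ennreal N \<Longrightarrow> Lp_norm (shell_measure M) p g \<le> ennreal N' \<Longrightarrow>
      Lp_norm lborel q (\<lambda>z :: real \<times> (real ^ 'd). V (weighted_profile 1 f) (fst z) (norm (snd z)) * V (weighted_profile M g) (fst z) (norm (snd z))) \<le> ennreal (C * (N * N'))"
  shows "bilinear_estimate TYPE('d) M p q C"
  unfolding bilinear_estimate_def
proof (intro allI impI, elim IntE)
  fix f g :: "real \<times> (real ^ 'd) \<Rightarrow> complex"
  assume f: "f \<in> cyl_class 1" "f \<in> Lp_space (shell_measure 1) p" and g: "g \<in> cyl_class M" "g \<in> Lp_space (shell_measure M) p"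
  have fm: "f \<in> borel_measurable (shell_measure 1)" and gm: "g \<in> borel_measurable (shell_measure M)"
    using f g by (auto simp: Lp_space_def)
  obtain A where A: "Lp_norm (shell_measure 1) p f = ennreal A" "0 \<le> A"
    using f by (cases "Lp_norm (shell_measure 1) p f") (auto simp: Lp_space_def)
  obtain B where B: "Lp_norm (shell_measure M) p g = ennreal B" "0 \<le> B"
    using g by (cases "Lp_norm (shell_measure M) p g") (auto simp: Lp_space_def)
  obtain c1 where "\<forall>(f :: real \<times> (real ^ 'd) \<Rightarrow> complex) N. f \<in> cyl_class 1 \<longrightarrow> f \<in> borel_measurable (shell_measure 1) \<longrightarrow>
    0 < N \<longrightarrow> Lp_norm (shell_measure 1) p f \<le> ennreal N \<longrightarrow> admissible 1 1 (weighted_profile 1 f) (c1 * N)"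
    using weighted_profile_admissible[OF _ d, of 1 1 p] p by auto
  then have fi: "integrable lborel (weighted_profile 1 f)"
    using f fm A by (auto simp: admissible_def dest!: spec[of _ f] spec[of _ "A + 1"] intro: ennreal_leI)
  obtain c2 where "\<forall>(f :: real \<times> (real ^ 'd) \<Rightarrow> complex) N. f \<in> cyl_class M \<longrightarrow> f \<in> borel_measurable (shell_measure M) \<longrightarrow>
    0 < N \<longrightarrow> Lp_norm (shell_measure M) p f \<le> ennreal N \<longrightarrow> admissible M 1 (weighted_profile M f) (c2 * N)"
    using weighted_profile_admissible[OF M d, of 1 p] p by auto
  then have gi: "integrable lborel (weighted_profile M g)"
    using g gm B by (auto simp: admissible_def dest!: spec[of _ g] spec[of _ "B + 1"] intro: ennreal_leI)
  have eq: "(\<lambda>z. extension f z * extension g z) = (\<lambda>z. V (weighted_profile 1 f) (fst z) (norm (snd z)) * V (weighted_profile M g) (fst z) (norm (snd z)))"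
    using extension_eq_V[OF f(1) fm zero_less_one fi] extension_eq_V[OF g(1) gm M gi] by (auto simp: fun_eq_iff)
  let ?X = "Lp_norm lborel q (\<lambda>z. extension f z * extension g z)"
  have "?X \<le> ennreal (C * ((A + inverse (real (Suc k))) * (B + inverse (real (Suc k)))))" for k
    unfolding eq by (rule H[OF f(1) fm g(1) gm]) (use A B in \<open>auto intro!: ennreal_leI add_nonneg_pos\<close>)
  moreover have "(\<lambda>k. ennreal (C * ((A + inverse (real (Suc k))) * (B + inverse (real (Suc k)))))) \<longlonglongrightarrow> ennreal (C * ((A + 0) * (B + 0)))"
    by (intro tendsto_ennrealI tendsto_mult tendsto_add tendsto_const LIMSEQ_inverse_real_of_nat)
  ultimately have "?X \<le> ennreal (C * ((A + 0) * (B + 0)))" by (intro LIMSEQ_le_const) auto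
  then show "?X \<le> ennreal C * Lp_norm (shell_measure 1) p f * Lp_norm (shell_measure M) p g"
    using A B C by (simp add: ennreal_mult mult.assoc)
qed

text \<open>The kernel and the exponentials are bounded by 1, so each extension is bounded by the
  \<open>L\<^sup>1\<close> norm of its profile, and on a shell of finite measure that is controlled
  by every \<open>L\<^sup>p\<close> norm.\<close>

lemma bilinear_estimate_infinity:
  assumes M: "0 < M" and p: "1 \<le> p"
  shows "\<exists>C\<ge>0. bilinear_estimate TYPE('d) M p \<infinity> C"
proof -
  obtain c1 where c1: "0 < c1" and H1: "\<And>(f :: real \<times> (real ^ 'd) \<Rightarrow> complex) N. f \<in> cyl_class 1 \<Longrightarrow> f \<in> borel_measurable (shell_measure 1) \<Longrightarrow>
    0 < N \<Longrightarrow> Lp_norm (shell_measure 1) p f \<le> ennreal N \<Longrightarrow> admissible 1 1 (weighted_profile 1 f) (c1 * N)"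
    using weighted_profile_admissible[OF _ d, of 1 1 p] p by auto
  obtain c2 where c2: "0 < c2" and H2: "\<And>(f :: real \<times> (real ^ 'd) \<Rightarrow> complex) N. f \<in> cyl_class M \<Longrightarrow> f \<in> borel_measurable (shell_measure M) \<Longrightarrow>
    0 < N \<Longrightarrow> Lp_norm (shell_measure M) p f \<le> ennreal N \<Longrightarrow> admissible M 1 (weighted_profile M f) (c2 * N)"
    using weighted_profile_admissible[OF M d, of 1 p] p by auto
  have "bilinear_estimate TYPE('d) M p \<infinity> (c1 * c2)"
  proof (rule bilinear_estimateI[OF M p])
    fix f g :: "real \<times> (real ^ 'd) \<Rightarrow> complex" and N N'
    assume f: "f \<in> cyl_class 1" "f \<in> borel_measurable (shell_measure 1)" and g: "g \<in> cyl_class M" "g \<in> borel_measurable (shell_measure M)"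
      and N: "0 < N" "0 < N'" and Nf: "Lp_norm (shell_measure 1) p f \<le> ennreal N" and Ng: "Lp_norm (shell_measure M) p g \<le> ennreal N'"
    let ?F = "weighted_profile 1 f" and ?G = "weighted_profile M g"
    have F: "admissible 1 1 ?F (c1 * N)" and G: "admissible M 1 ?G (c2 * N')"
      by (intro H1 H2 f g N Nf Ng)+
    have [measurable]: "?F \<in> borel_measurable borel" "?G \<in> borel_measurable borel"
      using F G by (auto simp: admissible_def)
    note [measurable] = V_norm_measurable[of ?F] V_norm_measurable[of ?G]
    have "(\<lambda>z :: real \<times> (real ^ 'd). ennreal (cmod (V ?F (fst z) (norm (snd z)) * V ?G (fst z) (norm (snd z))))) \<in> borel_measurable (borel \<Otimes>\<^sub>M borel)"
      by measurable
    then have meas: "(\<lambda>z :: real \<times> (real ^ 'd). ennreal (cmod (V ?F (fst z) (norm (snd z)) * V ?G (fst z) (norm (snd z))))) \<in> borel_measurable lborel"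
      by (simp add: borel_prod)
    have "cmod (V ?F t r * V ?G t r) \<le> c1 * N * (c2 * N')" for t r
      unfolding norm_mult using N c1 by (intro mult_mono V_le_admissible_1[OF F] V_le_admissible_1[OF G]) auto
    then have "esssup lborel (\<lambda>z :: real \<times> (real ^ 'd). ennreal (cmod (V ?F (fst z) (norm (snd z)) * V ?G (fst z) (norm (snd z))))) \<le> ennreal (c1 * N * (c2 * N'))"
      by (intro esssup_I[OF meas] AE_I2 ennreal_leI)
    then show "Lp_norm lborel \<infinity> (\<lambda>z :: real \<times> (real ^ 'd). V ?F (fst z) (norm (snd z)) * V ?G (fst z) (norm (snd z))) \<le> ennreal (c1 * c2 * (N * N'))"
      by (simp add: Lp_norm_def mult_ac)
  qed (use c1 c2 in auto)
  then show ?thesis using c1 c2 by (intro exI[of _ "c1 * c2"]) auto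
qed

text \<open>\<open>r\<close> is the working exponent: it lies in the range between
  \<open>dual2 q\<close> and 2 covered by \<open>radial_estimate\<close>, and
  \<open>weighted_profile_admissible\<close> descends to it from \<open>p\<close>.\<close>

lemma bilinear_estimate_finite:
  assumes M: "0 < M" "M \<le> 1 / 4" and p: "1 \<le> p" and q: "1 < q"
    and r: "dual2 q \<le> r" "r \<le> 2" "ennreal r \<le> p" and cond: "2 / r + (D + 2) / q < D + 2"
  shows "\<exists>C\<ge>0. bilinear_estimate TYPE('d) M p (ennreal q) C"
proof -
  have r1: "1 \<le> r" using dual2(1)[of q] q r by auto
  obtain c1 where c1: "0 < c1" and H1: "\<And>(f :: real \<times> (real ^ 'd) \<Rightarrow> complex) N. f \<in> cyl_class 1 \<Longrightarrow> f \<in> borel_measurable (shell_measure 1) \<Longrightarrow>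
    0 < N \<Longrightarrow> Lp_norm (shell_measure 1) p f \<le> ennreal N \<Longrightarrow> admissible 1 r (weighted_profile 1 f) (c1 * N)"
    using weighted_profile_admissible[OF zero_less_one d r1 r(3)] by auto
  obtain c2 where c2: "0 < c2" and H2: "\<And>(f :: real \<times> (real ^ 'd) \<Rightarrow> complex) N. f \<in> cyl_class M \<Longrightarrow> f \<in> borel_measurable (shell_measure M) \<Longrightarrow>
    0 < N \<Longrightarrow> Lp_norm (shell_measure M) p f \<le> ennreal N \<Longrightarrow> admissible M r (weighted_profile M f) (c2 * N)"
    using weighted_profile_admissible[OF M(1) d r1 r(3)] by auto
  obtain C where C: "0 \<le> C" and H: "\<And>F G N N'. admissible 1 r F N \<Longrightarrow> admissible M r G N' \<Longrightarrow>
    (\<integral>\<^sup>+ s. mass q F G s * (ennreal (s powr D) * indicator {0<..} s) \<partial>lborel) \<le> ennreal (C * (N * N') powr q)"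
    using radial_estimate[OF M q r(1,2) cond] by blast
  define \<kappa> where "\<kappa> = real CARD('d) * unit_ball_vol (real CARD('d))"
  have \<kappa>: "0 \<le> \<kappa>" by (simp add: \<kappa>_def)
  define E where "E = (\<kappa> * C) powr (1 / q) * (c1 * c2)"
  have E: "0 \<le> E" using c1 c2 by (simp add: E_def)
  have "bilinear_estimate TYPE('d) M p (ennreal q) E"
  proof (rule bilinear_estimateI[OF M(1) p E])
    fix f g :: "real \<times> (real ^ 'd) \<Rightarrow> complex" and N N'
    assume f: "f \<in> cyl_class 1" "f \<in> borel_measurable (shell_measure 1)" and g: "g \<in> cyl_class M" "g \<in> borel_measurable (shell_measure M)"
      and N: "0 < N" "0 < N'" and Nf: "Lp_norm (shell_measure 1) p f \<le> ennreal N" and Ng: "Lp_norm (shell_measure M) p g \<le> ennreal N'"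
    let ?F = "weighted_profile 1 f" and ?G = "weighted_profile M g"
    have F: "admissible 1 r ?F (c1 * N)" and G: "admissible M r ?G (c2 * N')"
      by (intro H1 H2 f g N Nf Ng)+
    have m: "?F \<in> borel_measurable borel" "?G \<in> borel_measurable borel"
      using F G by (auto simp: admissible_def)
    show "Lp_norm lborel (ennreal q) (\<lambda>z :: real \<times> (real ^ 'd). V ?F (fst z) (norm (snd z)) * V ?G (fst z) (norm (snd z))) \<le> ennreal (E * (N * N'))"
    proof (rule Lp_norm_le)
      have "(\<integral>\<^sup>+ z. ennreal (cmod (V ?F (fst z) (norm (snd z :: real ^ 'd)) * V ?G (fst z) (norm (snd z))) powr q) \<partial>lborel) =
         ennreal \<kappa> * (\<integral>\<^sup>+ s. mass q ?F ?G s * (ennreal (s powr D) * indicator {0<..} s) \<partial>lborel)"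
        unfolding \<kappa>_def by (rule nn_integral_V_product[OF m])
      also have "\<dots> \<le> ennreal \<kappa> * ennreal (C * (c1 * N * (c2 * N')) powr q)" by (intro mult_left_mono H F G) auto
      also have "\<dots> = ennreal ((E * (N * N')) powr q)"
        using q \<kappa> C c1 c2 N by (simp add: E_def powr_mult powr_powr ennreal_mult[symmetric] mult_ac)
      finally show "(\<integral>\<^sup>+ z. ennreal (cmod (V ?F (fst z) (norm (snd z :: real ^ 'd)) * V ?G (fst z) (norm (snd z))) powr enn2real (ennreal q)) \<partial>lborel) \<le>
          ennreal ((E * (N * N')) powr enn2real (ennreal q))" using q by simp
    qed (use q N E in auto)
  qed
  then show ?thesis using E by blast
qed

end

section \<open>Necessary conditions\<close>

lemma powr_growth_le:
  fixes A B R0 x y :: real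
  assumes A: "0 < A" and R0: "0 < R0" and H: "\<And>R. R0 \<le> R \<Longrightarrow> A * R powr x \<le> B * R powr y"
  shows "x \<le> y"
proof (rule ccontr)
  assume "\<not> x \<le> y"
  then have xy: "0 < x - y" by simp
  define R where "R = max R0 ((\<bar>B / A\<bar> + 1) powr (1 / (x - y)))"
  have "B / A < ((\<bar>B / A\<bar> + 1) powr (1 / (x - y))) powr (x - y)" using xy abs_ge_self[of "B / A"] by (simp add: powr_powr)
  also have "\<dots> \<le> R powr (x - y)" using xy by (intro powr_mono2) (auto simp: R_def)
  finally have R: "B / A < R powr (x - y)" "R0 \<le> R" by (auto simp: R_def)
  then have "0 < R" using R0 by simp
  have "B * R powr y < A * R powr (x - y) * R powr y"
    using R(1) A \<open>0 < R\<close> by (intro mult_strict_right_mono) (auto simp: pos_divide_less_eq mult.commute)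
  also have "\<dots> = A * R powr x" by (simp add: mult.assoc powr_add[symmetric])
  finally show False using H[OF R(2)] by simp
qed

text \<open>Division by the Jacobian makes \<open>weighted_profile\<close> return \<open>H\<close>
  itself, so test functions on the paraboloid can be prescribed directly as inputs of
  \<open>V\<close>.\<close>

definition radial_test :: "(real \<Rightarrow> complex) \<Rightarrow> real \<times> (real ^ 'd::finite) \<Rightarrow> complex" where
  "radial_test H z = H (norm (snd z)) / complex_of_real (polar_weight TYPE('d) (norm (snd z)))"

lemma radial_test_cyl_class:
  assumes H: "\<And>s. s \<notin> {m..2*m} \<Longrightarrow> H s = 0"
  shows "(radial_test H :: real \<times> (real ^ 'd::finite) \<Rightarrow> complex) \<in> cyl_class m"
proof -
  have "norm (A *v \<xi>) = norm \<xi>" if "rotation_matrix A" for A :: "real ^ 'd ^ 'd" and \<xi>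
    using that orthogonal_transformation_norm[of "(*v) A" \<xi>]
    by (simp add: rotation_matrix_def orthogonal_transformation_matrix matrix_vector_mul_linear)
  moreover have "H (norm (snd z)) = 0" if "z \<in> paraboloid - shell m" for z :: "real \<times> (real ^ 'd)"
    using that by (intro H) (auto simp: shell_def)
  ultimately show ?thesis by (auto simp: cyl_class_def cylindrically_symmetric_def radial_test_def)
qed

lemma radial_test_measurable:
  assumes [measurable]: "H \<in> borel_measurable borel"
  shows "(radial_test H :: real \<times> (real ^ 'd::finite) \<Rightarrow> complex) \<in> borel_measurable (shell_measure m)"
proof (rule measurable_restrict_space1)
  have "(\<lambda>s. H s / complex_of_real (polar_weight TYPE('d) s)) \<in> borel_measurable borel" by measurable
  moreover have "(\<lambda>z. norm (snd z)) \<in> borel_measurable (borel :: (real \<times> (real ^ 'd)) measure)"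
    by (intro borel_measurable_continuous_onI continuous_intros)
  ultimately have "(radial_test H :: real \<times> (real ^ 'd) \<Rightarrow> complex) \<in> borel_measurable borel"
    unfolding radial_test_def[abs_def] by (rule measurable_compose[rotated])
  then show "(radial_test H :: real \<times> (real ^ 'd) \<Rightarrow> complex) \<in> borel_measurable sigma_measure"
    by (simp cong: measurable_cong_sets)
qed

lemma weighted_profile_radial_test:
  assumes m: "0 < m" and H: "\<And>s. s \<notin> {m..2*m} \<Longrightarrow> H s = 0"
  shows "weighted_profile m (radial_test H :: real \<times> (real ^ 'd::finite) \<Rightarrow> complex) = H"
proof
  fix s
  show "weighted_profile m (radial_test H :: real \<times> (real ^ 'd) \<Rightarrow> complex) s = H s"
  proof (cases "s \<in> {m..2*m}")
    case True
    then have "0 < s" using m by simp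
    then show ?thesis using True polar_weight_pos[of s, where 'd='d] by (simp add: weighted_profile_def profile_def radial_test_def)
  qed (use H in \<open>auto simp: weighted_profile_def profile_def\<close>)
qed

lemma emeasure_shell_annulus_le:
  assumes m: "0 < m" and \<delta>: "0 < \<delta>" "\<delta> \<le> m" and d: "2 \<le> CARD('d::finite)"
  shows "{z \<in> shell m. norm (snd z) \<in> {m..m+\<delta>}} \<in> sets (shell_measure m :: (real \<times> (real ^ 'd)) measure)" (is "?A \<in> _")
    and "emeasure (shell_measure m :: (real \<times> (real ^ 'd)) measure) {z \<in> shell m. norm (snd z) \<in> {m..m+\<delta>}} \<le> ennreal (polar_weight TYPE('d) (2*m) * \<delta>)"
proof -
  have "closed {z :: real \<times> (real ^ 'd). m \<le> norm (snd z) \<and> norm (snd z) \<le> m + \<delta>}"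
    by (intro closed_Collect_conj closed_Collect_le continuous_intros)
  then have [measurable]: "{z :: real \<times> (real ^ 'd). m \<le> norm (snd z) \<and> norm (snd z) \<le> m + \<delta>} \<in> sets borel" by (rule borel_closed)
  have "?A = {z :: real \<times> (real ^ 'd). m \<le> norm (snd z) \<and> norm (snd z) \<le> m + \<delta>} \<inter> shell m" by auto
  then show A: "?A \<in> sets (shell_measure m :: (real \<times> (real ^ 'd)) measure)" by (simp add: sets_restrict_space_iff)
  \<comment> \<open>The factor \<open>polar_weight\<close> cancels the division in
    \<open>radial_test\<close>, so on the shell the test function is the indicator of the annulus
    and its integral is the measure sought.\<close>
  define H where "H s = complex_of_real (indicator {m..m+\<delta>} s * polar_weight TYPE('d) s)" for s
  have [measurable]: "H \<in> borel_measurable borel" unfolding H_def[abs_def] by measurable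
  have H0: "s \<notin> {m..2*m} \<Longrightarrow> H s = 0" for s using \<delta> by (auto simp: H_def)
  let ?f = "radial_test H :: real \<times> (real ^ 'd) \<Rightarrow> complex"
  have f1: "ennreal (cmod (?f z)) = indicator ?A z" if "z \<in> space (shell_measure m)" for z
  proof -
    have z: "z \<in> shell m" using that by (simp add: space_restrict_space)
    then have "0 < norm (snd z)" using m unfolding shell_def by auto
    from polar_weight_pos[OF this, where 'd='d] z show ?thesis
      by (auto simp: radial_test_def H_def indicator_def)
  qed
  have "emeasure (shell_measure m :: (real \<times> (real ^ 'd)) measure) ?A = (\<integral>\<^sup>+ z. ennreal (cmod (?f z)) \<partial>shell_measure m)"
    unfolding nn_integral_indicator[OF A, symmetric] by (intro nn_integral_cong) (simp add: f1)
  also have "\<dots> = (\<integral>\<^sup>+ s. ennreal (cmod (profile m ?f s)) * (ennreal (polar_weight TYPE('d) s) * indicator {m..2*m} s) \<partial>lborel)"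
    by (rule nn_integral_shell[OF radial_test_cyl_class[OF H0] radial_test_measurable d m]) auto
  also have "\<dots> \<le> (\<integral>\<^sup>+ s. ennreal (polar_weight TYPE('d) (2*m)) * indicator {m..m+\<delta>} s \<partial>lborel)"
  proof (rule nn_integral_mono)
    fix s
    show "ennreal (cmod (profile m ?f s)) * (ennreal (polar_weight TYPE('d) s) * indicator {m..2*m} s) \<le> ennreal (polar_weight TYPE('d) (2*m)) * indicator {m..m+\<delta>} s"
    proof (cases "s \<in> {m..m+\<delta>}")
      case True
      then have "0 < s" "s \<in> {m..2*m}" using m \<delta> by auto
      then show ?thesis using True polar_weight_pos[of s, where 'd='d]
        by (auto simp: profile_def radial_test_def H_def intro!: ennreal_leI polar_weight_mono)
    qed (auto simp: profile_def radial_test_def H_def)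
  qed
  also have "\<dots> = ennreal (polar_weight TYPE('d) (2*m) * \<delta>)"
    using \<delta> m polar_weight_pos[of "2*m", where 'd='d] by (simp add: nn_integral_cmult_indicator ennreal_mult)
  finally show "emeasure (shell_measure m :: (real \<times> (real ^ 'd)) measure) ?A \<le> ennreal (polar_weight TYPE('d) (2*m) * \<delta>)" .
qed

lemma Lp_norm_radial_test_le:
  assumes m: "0 < m" and \<delta>: "0 < \<delta>" "\<delta> \<le> m" and d: "2 \<le> CARD('d::finite)" and p: "1 \<le> p"
    and H: "H \<in> borel_measurable borel" "\<And>s. s \<notin> {m..m+\<delta>} \<Longrightarrow> H s = 0" "\<And>s. cmod (H s) \<le> B"
  shows "Lp_norm (shell_measure m) p (radial_test H :: real \<times> (real ^ 'd) \<Rightarrow> complex) \<le>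
    ennreal (B / polar_weight TYPE('d) m * (polar_weight TYPE('d) (2*m) * \<delta>) powr enn2real (1 / p))"
proof (rule Lp_norm_bounded_support_le[OF p radial_test_measurable[OF H(1)] _ _ emeasure_shell_annulus_le[OF m \<delta> d]])
  have B: "0 \<le> B" using order_trans[OF norm_ge_zero H(3)] .
  have w: "0 < polar_weight TYPE('d) m" "0 < polar_weight TYPE('d) (2*m)" using m by (auto intro: polar_weight_pos)
  show "0 \<le> B / polar_weight TYPE('d) m" using B w by simp
  show "0 < polar_weight TYPE('d) (2*m) * \<delta>" using w \<delta> by simp
  fix z :: "real \<times> (real ^ 'd)" assume "z \<in> space (shell_measure m)"
  then have z: "z \<in> shell m" "m \<le> norm (snd z)" by (auto simp: space_restrict_space shell_def)
  then have "polar_weight TYPE('d) m \<le> polar_weight TYPE('d) (norm (snd z))" using m by (intro polar_weight_mono) auto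
  then show "cmod (radial_test H z) \<le> B / polar_weight TYPE('d) m"
    unfolding radial_test_def norm_divide using w H(3) B by (intro frac_le) auto
  show "z \<notin> {z \<in> shell m. norm (snd z) \<in> {m..m+\<delta>}} \<Longrightarrow> radial_test H z = 0"
    using z H(2) by (auto simp: radial_test_def)
qed

lemma emeasure_cylinder_ge:
  assumes r: "0 < r0" "r0 \<le> r1" and t: "0 \<le> t0"
  shows "{0..t0} \<times> {x :: real ^ 'd::finite. norm x \<in> {r0..r1}} \<in> sets lborel"
    and "ennreal (t0 * (polar_weight TYPE('d) r0 * (r1 - r0))) \<le> emeasure lborel ({0..t0} \<times> {x :: real ^ 'd. norm x \<in> {r0..r1}})"
proof -
  let ?S = "{x :: real ^ 'd. norm x \<in> {r0..r1}}"
  have "closed {x :: real ^ 'd. r0 \<le> norm x \<and> norm x \<le> r1}"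
    by (intro closed_Collect_conj closed_Collect_le continuous_intros)
  then have S [measurable]: "?S \<in> sets borel" by (simp add: borel_closed)
  have "{0..t0} \<times> ?S \<in> sets (borel \<Otimes>\<^sub>M borel)" by measurable
  then show "{0..t0} \<times> ?S \<in> sets lborel" unfolding borel_prod sets_lborel .
  have w: "0 < polar_weight TYPE('d) r0" by (rule polar_weight_pos[OF r(1)])
  have "ennreal (polar_weight TYPE('d) r0 * (r1 - r0)) = (\<integral>\<^sup>+ s. ennreal (polar_weight TYPE('d) r0) * indicator {r0..r1} s \<partial>lborel)"
    using r w by (simp add: nn_integral_cmult_indicator ennreal_mult)
  also have "\<dots> \<le> (\<integral>\<^sup>+ s. ennreal (polar_weight TYPE('d) s) * indicator {0<..} s * indicator {r0..r1} s \<partial>lborel)"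
    using r by (intro nn_integral_mono) (auto simp: indicator_def intro!: ennreal_leI polar_weight_mono)
  also have "\<dots> = (\<integral>\<^sup>+ s. indicator {r0..r1} s \<partial>radial_measure CARD('d))"
    unfolding radial_measure_polar_weight by (subst nn_integral_density) auto
  also have "\<dots> = (\<integral>\<^sup>+ x. indicator {r0..r1} (norm (x :: real ^ 'd)) \<partial>lborel)"
    using nn_integral_radial[where 'a="real ^ 'd", of "indicator {r0..r1}"] by simp
  also have "\<dots> = (\<integral>\<^sup>+ x. indicator ?S x \<partial>lborel)" by (intro nn_integral_cong) (simp add: indicator_def)
  also have "\<dots> = emeasure lborel ?S" by (rule nn_integral_indicator) (use S in simp)
  finally have 1: "ennreal (polar_weight TYPE('d) r0 * (r1 - r0)) \<le> emeasure lborel ?S" .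
  have "ennreal (t0 * (polar_weight TYPE('d) r0 * (r1 - r0))) = emeasure lborel {0..t0} * ennreal (polar_weight TYPE('d) r0 * (r1 - r0))"
    using t r w by (simp add: ennreal_mult)
  also have "\<dots> \<le> emeasure lborel {0..t0} * emeasure lborel ?S" by (intro mult_left_mono 1) auto
  also have "\<dots> = emeasure (lborel \<Otimes>\<^sub>M lborel) ({0..t0} \<times> ?S)"
    by (rule lborel.emeasure_pair_measure_Times[symmetric]) auto
  finally show "ennreal (t0 * (polar_weight TYPE('d) r0 * (r1 - r0))) \<le> emeasure lborel ({0..t0} \<times> ?S)"
    by (simp add: lborel_prod)
qed

section \<open>Testing the estimate and comparing powers of R\<close>

context paraboloid_kernel begin

text \<open>From below, the product has height at least \<open>c\<^sup>2\<close> on the set of times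
  up to \<open>t0\<close> and radii between \<open>r0\<close> and \<open>r1\<close>, whose volume is
  at least \<open>t0 * (w r0 * (r1 - r0))\<close>. From above, each input is bounded by
  \<open>B\<close> over the smallest Jacobian on its shell, and its support has d\<sigma>-measure at
  most the largest Jacobian times its length.\<close>

lemma test_inequality:
  assumes be: "bilinear_estimate TYPE('d) M p q C" and C: "0 \<le> C" and M: "0 < M" and p: "1 \<le> p" and q: "1 \<le> q" "q \<noteq> \<infinity>"
    and \<delta>: "0 < \<delta>1" "\<delta>1 \<le> 1" "0 < \<delta>2" "\<delta>2 \<le> M"
    and H1: "H1 \<in> borel_measurable borel" "\<And>s. s \<notin> {1..1+\<delta>1} \<Longrightarrow> H1 s = 0" "\<And>s. cmod (H1 s) \<le> B"
    and H2: "H2 \<in> borel_measurable borel" "\<And>s. s \<notin> {M..M+\<delta>2} \<Longrightarrow> H2 s = 0" "\<And>s. cmod (H2 s) \<le> B"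
    and r: "0 < r0" "r0 \<le> r1" and t0: "0 \<le> t0" and c: "0 \<le> c"
    and V: "\<And>t r. 0 \<le> t \<Longrightarrow> t \<le> t0 \<Longrightarrow> r0 \<le> r \<Longrightarrow> r \<le> r1 \<Longrightarrow> c \<le> cmod (V H1 t r) \<and> c \<le> cmod (V H2 t r)"
  defines "w \<equiv> polar_weight TYPE('d)" and "k \<equiv> enn2real (1 / p)"
  shows "c\<^sup>2 * (t0 * (w r0 * (r1 - r0))) powr (1 / enn2real q) \<le> C * (B / w 1 * (w 2 * \<delta>1) powr k) * (B / w M * (w (2*M) * \<delta>2) powr k)"
proof -
  let ?f = "radial_test H1 :: real \<times> (real ^ 'd) \<Rightarrow> complex" and ?g = "radial_test H2 :: real \<times> (real ^ 'd) \<Rightarrow> complex"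
  have B: "0 \<le> B" using order_trans[OF norm_ge_zero H1(3)] .
  have w: "0 < w s" if "0 < s" for s using that by (simp add: w_def polar_weight_pos)
  have q0: "0 < enn2real q" by (rule enn2real_pos[OF q])
  have H1': "H1 s = 0" if "s \<notin> {1..2*1}" for s using that \<delta> by (intro H1) auto
  have H2': "H2 s = 0" if "s \<notin> {M..2*M}" for s using that \<delta> by (intro H2) auto
  have wf: "weighted_profile 1 ?f = H1" by (rule weighted_profile_radial_test[OF _ H1']) auto
  have wg: "weighted_profile M ?g = H2" by (rule weighted_profile_radial_test[OF M H2'])
  have int: "integrable lborel H" if "H \<in> borel_measurable borel" "\<And>s. s \<notin> {m..m'} \<Longrightarrow> H s = 0" "\<And>s. cmod (H s) \<le> B" for H and m m' :: real
  proof (rule Bochner_Integration.integrable_bound[where f="\<lambda>s. indicator {m..m'} s * B"])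
    show "integrable lborel (\<lambda>s. indicator {m..m'} s * B)"
      by (intro integrable_mult_left integrable_real_indicator) (auto simp: emeasure_lborel_Icc_eq)
    show "AE s in lborel. cmod (H s) \<le> norm (indicator {m..m'} s * B)" using that(2,3) B by (intro AE_I2) (auto simp: indicator_def)
  qed (use that in auto)
  have fc: "?f \<in> cyl_class 1" by (rule radial_test_cyl_class[OF H1'])
  have gc: "?g \<in> cyl_class M" by (rule radial_test_cyl_class[OF H2'])
  note fm = radial_test_measurable[where 'd='d, OF H1(1), of 1] and gm = radial_test_measurable[where 'd='d, OF H2(1), of M]
  have fN: "Lp_norm (shell_measure 1) p ?f \<le> ennreal (B / w 1 * (w 2 * \<delta>1) powr k)"
    using Lp_norm_radial_test_le[OF zero_less_one \<delta>(1,2) d p H1] by (simp add: w_def k_def)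
  have gN: "Lp_norm (shell_measure M) p ?g \<le> ennreal (B / w M * (w (2*M) * \<delta>2) powr k)"
    using Lp_norm_radial_test_le[OF M \<delta>(3,4) d p H2] by (simp add: w_def k_def)
  have ef: "extension ?f (t, x) = V H1 t (norm x)" for t x
    using extension_eq_V[OF fc fm] int[OF H1] by (simp add: wf)
  have eg: "extension ?g (t, x) = V H2 t (norm x)" for t x
    using extension_eq_V[OF gc gm M] int[OF H2] by (simp add: wg)
  have "ennreal (c\<^sup>2 * (t0 * (w r0 * (r1 - r0))) powr (1 / enn2real q)) \<le> Lp_norm lborel q (\<lambda>z. extension ?f z * extension ?g z)"
    unfolding w_def
  proof (rule Lp_norm_ge_on_set[OF q(2) q0 _ _ emeasure_cylinder_ge[OF r t0]])
    show "0 \<le> t0 * (polar_weight TYPE('d) r0 * (r1 - r0))" using t0 w[of r0] r by (simp add: w_def)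
    fix z assume "z \<in> {0..t0} \<times> {x :: real ^ 'd. norm x \<in> {r0..r1}}"
    then obtain t x where z: "z = (t, x)" "0 \<le> t" "t \<le> t0" "r0 \<le> norm x" "norm x \<le> r1" by auto
    show "c\<^sup>2 \<le> cmod (extension ?f z * extension ?g z)"
      unfolding z(1) ef eg norm_mult power2_eq_square using V[OF z(2-5)] c by (intro mult_mono) auto
  qed auto
  also have "\<dots> \<le> ennreal C * Lp_norm (shell_measure 1) p ?f * Lp_norm (shell_measure M) p ?g"
    using be fc gc fm gm le_less_trans[OF fN ennreal_less_top] le_less_trans[OF gN ennreal_less_top]
    unfolding bilinear_estimate_def Lp_space_def by simp
  also have "\<dots> \<le> ennreal C * ennreal (B / w 1 * (w 2 * \<delta>1) powr k) * ennreal (B / w M * (w (2*M) * \<delta>2) powr k)"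
    by (intro mult_mono fN gN) auto
  also have "\<dots> = ennreal (C * (B / w 1 * (w 2 * \<delta>1) powr k) * (B / w M * (w (2*M) * \<delta>2) powr k))"
    using C B w[of 1] w[of M] M by (simp add: ennreal_mult[symmetric])
  finally show ?thesis using C B w[of 1] w[of M] M by (subst (asm) ennreal_le_iff) auto
qed

text \<open>For test functions of height \<open>B\<close> supported on intervals of length \<open>R\<^sup>-\<^sup>l\<close>, both sides of the
  estimate are powers of \<open>R\<close>, and the exponents are compared as \<open>R \<rightarrow> \<infinity>\<close>.\<close>
lemma necessary_condition:
  assumes be: "bilinear_estimate TYPE('d) M p q C" and C: "0 \<le> C" and M: "0 < M" and p: "1 \<le> p" and q: "1 \<le> q" "q \<noteq> \<infinity>"
    and pos: "0 < c" "0 < v" "0 < R0" "0 < L1" "0 < L2"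
    and H: "\<And>R. R0 \<le> R \<Longrightarrow> \<exists>H1 H2 t0 r0 r1. H1 \<in> borel_measurable borel \<and> H2 \<in> borel_measurable borel \<and>
      (\<forall>s. (s \<notin> {1..1 + L1 * R powr (-l)} \<longrightarrow> H1 s = 0) \<and> (s \<notin> {M..M + L2 * R powr (-l)} \<longrightarrow> H2 s = 0) \<and> cmod (H1 s) \<le> B \<and> cmod (H2 s) \<le> B) \<and>
      L1 * R powr (-l) \<le> 1 \<and> L2 * R powr (-l) \<le> M \<and> 0 < r0 \<and> r0 \<le> r1 \<and> 0 \<le> t0 \<and> v * R powr \<omega> \<le> t0 * (r0 powr D * (r1 - r0)) \<and>
      (\<forall>t r. 0 \<le> t \<longrightarrow> t \<le> t0 \<longrightarrow> r0 \<le> r \<longrightarrow> r \<le> r1 \<longrightarrow> c * R powr (-g) \<le> cmod (V H1 t r) \<and> c * R powr (-g) \<le> cmod (V H2 t r))"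
  shows "\<omega> / enn2real q + 2 * l * enn2real (1 / p) \<le> 2 * g"
proof -
  define Q where "Q = enn2real q"
  have Q: "0 < Q" unfolding Q_def by (rule enn2real_pos[OF q])
  define k where "k = enn2real (1 / p)"
  define w where "w = polar_weight TYPE('d)"
  have w: "0 < w s" if "0 < s" for s using that by (simp add: w_def polar_weight_pos)
  define \<kappa> where "\<kappa> = real CARD('d) * unit_ball_vol (real CARD('d))"
  have \<kappa>: "0 < \<kappa>" by (simp add: \<kappa>_def)
  have w\<kappa>: "w s = \<kappa> * s powr D" if "0 < s" for s
  proof -
    have "s powr D = s ^ (CARD('d) - 1)" unfolding D_def using that by (rule powr_realpow)
    then show ?thesis by (simp add: w_def \<kappa>_def polar_weight_def)
  qed
  define A where "A = c\<^sup>2 * (\<kappa> * v) powr (1 / Q)"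
  define E where "E = C * (B / w 1 * (w 2 * L1) powr k) * (B / w M * (w (2*M) * L2) powr k)"
  have growth: "A * R powr (\<omega> / Q - 2 * g) \<le> E * R powr (- 2 * l * k)" if R: "R0 \<le> R" for R
  proof -
    have R0: "0 < R" using R pos by simp
    obtain H1 H2 t0 r0 r1 where h: "H1 \<in> borel_measurable borel" "H2 \<in> borel_measurable borel"
      "\<And>s. s \<notin> {1..1 + L1 * R powr (-l)} \<Longrightarrow> H1 s = 0" "\<And>s. s \<notin> {M..M + L2 * R powr (-l)} \<Longrightarrow> H2 s = 0" "\<And>s. cmod (H1 s) \<le> B" "\<And>s. cmod (H2 s) \<le> B"
      "L1 * R powr (-l) \<le> 1" "L2 * R powr (-l) \<le> M" "0 < r0" "r0 \<le> r1" "0 \<le> t0" and vol: "v * R powr \<omega> \<le> t0 * (r0 powr D * (r1 - r0))"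
      and Vb: "\<And>t r. 0 \<le> t \<Longrightarrow> t \<le> t0 \<Longrightarrow> r0 \<le> r \<Longrightarrow> r \<le> r1 \<Longrightarrow> c * R powr (-g) \<le> cmod (V H1 t r) \<and> c * R powr (-g) \<le> cmod (V H2 t r)"
      using H[OF R] by blast
    have pl: "0 < L1 * R powr (-l)" "0 < L2 * R powr (-l)" using pos R0 by auto
    have "A * R powr (\<omega> / Q - 2 * g) = (c * R powr (-g))\<^sup>2 * (\<kappa> * (v * R powr \<omega>)) powr (1 / Q)"
      using R0 Q pos \<kappa> by (simp add: A_def powr_mult powr_powr power_mult_distrib powr_power powr_add[symmetric] mult_ac) (simp add: powr_diff powr_minus field_simps)?
    also have "\<dots> \<le> (c * R powr (-g))\<^sup>2 * (t0 * (w r0 * (r1 - r0))) powr (1 / Q)"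
    proof (intro mult_left_mono powr_mono2)
      have "\<kappa> * (v * R powr \<omega>) \<le> \<kappa> * (t0 * (r0 powr D * (r1 - r0)))" using vol \<kappa> by (intro mult_left_mono) auto
      then show "\<kappa> * (v * R powr \<omega>) \<le> t0 * (w r0 * (r1 - r0))" using h(9) by (simp add: w\<kappa> mult_ac)
    qed (use Q pos \<kappa> in auto)
    also have "\<dots> \<le> C * (B / w 1 * (w 2 * (L1 * R powr (-l))) powr k) * (B / w M * (w (2*M) * (L2 * R powr (-l))) powr k)"
      unfolding Q_def w_def k_def
      by (rule test_inequality[OF be C M p q pl(1) h(7) pl(2) h(8) h(1) h(3) h(5) h(2) h(4) h(6) h(9-11)]) (use Vb pos in auto)
    also have "\<dots> = E * R powr (- 2 * l * k)"
    proof -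
      have "R powr (- 2 * l * k) = R powr (-l * k) * R powr (-l * k)" by (simp add: powr_add[symmetric] mult_ac)
      then show ?thesis using pos w[of 2] w[of "2*M"] M R0 by (simp add: E_def powr_mult powr_powr mult_ac)
    qed
    finally show ?thesis .
  qed
  have A: "0 < A" using pos \<kappa> by (simp add: A_def)
  have "\<omega> / Q - 2 * g \<le> - 2 * l * k" by (rule powr_growth_le[OF A pos(3) growth])
  then show ?thesis by (simp add: Q_def k_def algebra_simps)
qed

end

lemma ennreal_divide_exponent:
  assumes "1 \<le> p" "0 \<le> c"
  shows "ennreal c / p = ennreal (c * enn2real (1 / p))"
proof (cases p)
  case (real P)
  then have "1 \<le> P" using assms(1) by (simp flip: ennreal_1)
  then have "1 / p = ennreal (1 / P)" using real(2) by (simp add: divide_ennreal flip: ennreal_1)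
  then show ?thesis using real \<open>1 \<le> P\<close> assms(2) by (simp add: divide_ennreal)
qed simp

section \<open>The three families of examples\<close>

context paraboloid_kernel begin

lemma packet_bound:
  assumes "0 < \<alpha>" "\<beta> \<le> 2"
  shows "cmod (packet \<alpha> \<beta> \<tau> s) \<le> 2 powr (D / 2)"
proof (cases "s \<in> {\<alpha>..\<beta>}")
  case True
  then have "s powr (D / 2) \<le> 2 powr (D / 2)" using assms D by (intro powr_mono2) auto
  then show ?thesis using True by (simp add: packet_def norm_mult)
qed (auto simp: packet_def)

lemma kernel_near_0: "\<exists>\<rho>>0. \<forall>y. 0 \<le> y \<longrightarrow> y \<le> 2 * \<rho> \<longrightarrow> 1 / 2 \<le> sphere_hat (y *\<^sub>R (pole :: real ^ 'd))"
proof -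
  have "isCont (\<lambda>r. sphere_hat (r *\<^sub>R (pole :: real ^ 'd))) 0"
    by (rule DERIV_isCont[OF sphere_hat_deriv]) simp
  then obtain e where e: "0 < e" "\<And>r. dist r 0 < e \<Longrightarrow> dist (sphere_hat (r *\<^sub>R (pole :: real ^ 'd))) (sphere_hat (0 *\<^sub>R (pole :: real ^ 'd))) < 1 / 2"
    unfolding continuous_at_eps_delta using half_gt_zero[OF zero_less_one] by blast
  have "1 / 2 \<le> sphere_hat (r *\<^sub>R (pole :: real ^ 'd))" if "\<bar>r\<bar> < e" for r
  proof -
    have "\<bar>sphere_hat (r *\<^sub>R (pole :: real ^ 'd)) - 1\<bar> < 1 / 2"
      using e(2)[of r] that by (simp add: sphere_hat_0 dist_real_def)
    then show ?thesis by linarith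
  qed
  then show ?thesis using e(1) by (intro exI[of _ "e / 3"]) auto
qed

text \<open>The supports do not shrink (l = 0), so the exponent p drops out. Both factors have
  height R^(-(D+1)/2) on a region of volume R^(D+2), and the comparison leaves (D + 2)/q \<le> D +
  1, which is q \<ge> n/(n-1).\<close>

lemma wide_packet_condition:
  assumes be: "bilinear_estimate TYPE('d) M p q C" and C: "0 \<le> C" and M: "0 < M" "M \<le> 1" and p: "1 \<le> p" and q: "1 \<le> q" "q \<noteq> \<infinity>"
  shows "(D + 2) / enn2real q \<le> D + 1"
proof -
  obtain c1 R1 where 1: "0 < c1" "0 < R1" and P1: "\<And>R t r. R1 \<le> R \<Longrightarrow> 0 \<le> t \<Longrightarrow> t \<le> R / 32 \<Longrightarrow> R \<le> r \<Longrightarrow> r \<le> 33 / 32 * R \<Longrightarrow>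
    c1 * R powr (- (D / 2 + 1 / 2)) \<le> cmod (V (packet 1 (2 * 1) (R / (3 * 1))) t r)"
    using wide_packet[OF zero_less_one order_refl] by blast
  obtain c2 R2 where 2: "0 < c2" "0 < R2" and P2: "\<And>R t r. R2 \<le> R \<Longrightarrow> 0 \<le> t \<Longrightarrow> t \<le> R / 32 \<Longrightarrow> R \<le> r \<Longrightarrow> r \<le> 33 / 32 * R \<Longrightarrow>
    c2 * R powr (- (D / 2 + 1 / 2)) \<le> cmod (V (packet M (2 * M) (R / (3 * M))) t r)"
    using wide_packet[OF M] by blast
  have c: "0 < min c1 c2" "0 < max R1 R2" using 1 2 by auto
  have "(D + 2) / enn2real q + 2 * 0 * enn2real (1 / p) \<le> 2 * (D / 2 + 1 / 2)"
  proof (rule necessary_condition[OF be C M(1) p q c(1) _ c(2) zero_less_one M(1), where v="1 / 1024" and B="2 powr (D / 2)"])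
    fix R assume R: "max R1 R2 \<le> R"
    then have R0: "0 < R" using 1 by auto
    have vol: "1 / 1024 * R powr (D + 2) \<le> R / 32 * (R powr D * (33 / 32 * R - R))"
      using R0 by (simp add: powr_add power2_eq_square)
    show "\<exists>H1 H2 t0 r0 r1. H1 \<in> borel_measurable borel \<and> H2 \<in> borel_measurable borel \<and>
      (\<forall>s. (s \<notin> {1..1 + 1 * R powr (-0)} \<longrightarrow> H1 s = 0) \<and> (s \<notin> {M..M + M * R powr (-0)} \<longrightarrow> H2 s = 0) \<and> cmod (H1 s) \<le> 2 powr (D / 2) \<and> cmod (H2 s) \<le> 2 powr (D / 2)) \<and>
      1 * R powr (-0) \<le> 1 \<and> M * R powr (-0) \<le> M \<and> 0 < r0 \<and> r0 \<le> r1 \<and> 0 \<le> t0 \<and> 1 / 1024 * R powr (D + 2) \<le> t0 * (r0 powr D * (r1 - r0)) \<and>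
      (\<forall>t r. 0 \<le> t \<longrightarrow> t \<le> t0 \<longrightarrow> r0 \<le> r \<longrightarrow> r \<le> r1 \<longrightarrow>
        min c1 c2 * R powr (-(D / 2 + 1 / 2)) \<le> cmod (V H1 t r) \<and> min c1 c2 * R powr (-(D / 2 + 1 / 2)) \<le> cmod (V H2 t r))"
    proof (rule exI[of _ "packet 1 (2 * 1) (R / (3 * 1))"], rule exI[of _ "packet M (2 * M) (R / (3 * M))"], rule exI[of _ "R / 32"], rule exI[of _ R], rule exI[of _ "33 / 32 * R"],
        intro conjI allI impI vol)
      show "cmod (packet 1 (2 * 1) (R / (3 * 1)) s) \<le> 2 powr (D / 2)" "cmod (packet M (2 * M) (R / (3 * M)) s) \<le> 2 powr (D / 2)" for s
        using M by (auto intro!: packet_bound)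
      fix t r assume t: "0 \<le> t" "t \<le> R / 32" "R \<le> r" "r \<le> 33 / 32 * R"
      have "min c1 c2 * R powr (- (D / 2 + 1 / 2)) \<le> c1 * R powr (- (D / 2 + 1 / 2))" by (intro mult_right_mono) auto
      then show "min c1 c2 * R powr (- (D / 2 + 1 / 2)) \<le> cmod (V (packet 1 (2 * 1) (R / (3 * 1))) t r)" using P1[OF _ t] R by linarith
      have "min c1 c2 * R powr (- (D / 2 + 1 / 2)) \<le> c2 * R powr (- (D / 2 + 1 / 2))" by (intro mult_right_mono) auto
      then show "min c1 c2 * R powr (- (D / 2 + 1 / 2)) \<le> cmod (V (packet M (2 * M) (R / (3 * M))) t r)" using P2[OF _ t] R by linarith
    qed (use R0 M in \<open>auto simp: packet_def[of _ _ _ s for s]\<close>)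
  qed auto
  then show ?thesis by simp
qed

text \<open>Shrinking the supports to length 8/R (l = 1) gains R^(-1/p) in each input norm, while
  the heights drop only from R^(-(D+1)/2) to R^(-D/2-1) on a region of the same volume
  R^(D+2).\<close>

lemma narrow_packet_condition:
  assumes be: "bilinear_estimate TYPE('d) M p q C" and C: "0 \<le> C" and M: "0 < M" "M \<le> 1" and p: "1 \<le> p" and q: "1 \<le> q" "q \<noteq> \<infinity>"
  shows "2 * enn2real (1 / p) + (D + 2) / enn2real q \<le> D + 2"
proof -
  obtain c1 R1 where 1: "0 < c1" "0 < R1" and L1: "\<And>R. R1 \<le> R \<Longrightarrow> 8 / R \<le> 1" and P1: "\<And>R t r. R1 \<le> R \<Longrightarrow> 0 \<le> t \<Longrightarrow> t \<le> R / 32 \<Longrightarrow> R \<le> r \<Longrightarrow> r \<le> 33 / 32 * R \<Longrightarrow>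
    c1 * R powr (- (D / 2 + 1)) \<le> cmod (V (packet 1 (1 + 8 / R) (R / (2 * 1))) t r)"
    using narrow_packet[OF zero_less_one order_refl] by blast
  obtain c2 R2 where 2: "0 < c2" "0 < R2" and L2: "\<And>R. R2 \<le> R \<Longrightarrow> 8 / R \<le> M" and P2: "\<And>R t r. R2 \<le> R \<Longrightarrow> 0 \<le> t \<Longrightarrow> t \<le> R / 32 \<Longrightarrow> R \<le> r \<Longrightarrow> r \<le> 33 / 32 * R \<Longrightarrow>
    c2 * R powr (- (D / 2 + 1)) \<le> cmod (V (packet M (M + 8 / R) (R / (2 * M))) t r)"
    using narrow_packet[OF M] by blast
  have c: "0 < min c1 c2" "0 < max R1 R2" using 1 2 by auto
  have "(D + 2) / enn2real q + 2 * 1 * enn2real (1 / p) \<le> 2 * (D / 2 + 1)"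
  proof (rule necessary_condition[OF be C M(1) p q c(1) _ c(2), where ?L1.0=8 and ?L2.0=8 and v="1 / 1024" and B="2 powr (D / 2)"])
    fix R assume R: "max R1 R2 \<le> R"
    then have R0: "0 < R" using 1 by auto
    have l: "8 * R powr (-1) = 8 / R" using R0 by (simp add: powr_minus_divide)
    have vol: "1 / 1024 * R powr (D + 2) \<le> R / 32 * (R powr D * (33 / 32 * R - R))"
      using R0 by (simp add: powr_add power2_eq_square)
    show "\<exists>H1 H2 t0 r0 r1. H1 \<in> borel_measurable borel \<and> H2 \<in> borel_measurable borel \<and>
      (\<forall>s. (s \<notin> {1..1 + 8 * R powr (-1)} \<longrightarrow> H1 s = 0) \<and> (s \<notin> {M..M + 8 * R powr (-1)} \<longrightarrow> H2 s = 0) \<and> cmod (H1 s) \<le> 2 powr (D / 2) \<and> cmod (H2 s) \<le> 2 powr (D / 2)) \<and>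
      8 * R powr (-1) \<le> 1 \<and> 8 * R powr (-1) \<le> M \<and> 0 < r0 \<and> r0 \<le> r1 \<and> 0 \<le> t0 \<and> 1 / 1024 * R powr (D + 2) \<le> t0 * (r0 powr D * (r1 - r0)) \<and>
      (\<forall>t r. 0 \<le> t \<longrightarrow> t \<le> t0 \<longrightarrow> r0 \<le> r \<longrightarrow> r \<le> r1 \<longrightarrow>
        min c1 c2 * R powr (-(D / 2 + 1)) \<le> cmod (V H1 t r) \<and> min c1 c2 * R powr (-(D / 2 + 1)) \<le> cmod (V H2 t r))"
      unfolding l
    proof (rule exI[of _ "packet 1 (1 + 8 / R) (R / (2 * 1))"], rule exI[of _ "packet M (M + 8 / R) (R / (2 * M))"], rule exI[of _ "R / 32"], rule exI[of _ R], rule exI[of _ "33 / 32 * R"],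
        intro conjI allI impI vol)
      show "8 / R \<le> 1" "8 / R \<le> M" using L1 L2 R by auto
      then show "cmod (packet 1 (1 + 8 / R) (R / (2 * 1)) s) \<le> 2 powr (D / 2)" "cmod (packet M (M + 8 / R) (R / (2 * M)) s) \<le> 2 powr (D / 2)" for s
        using M by (auto intro!: packet_bound)
      fix t r assume t: "0 \<le> t" "t \<le> R / 32" "R \<le> r" "r \<le> 33 / 32 * R"
      have "min c1 c2 * R powr (- (D / 2 + 1)) \<le> c1 * R powr (- (D / 2 + 1))" by (intro mult_right_mono) auto
      then show "min c1 c2 * R powr (- (D / 2 + 1)) \<le> cmod (V (packet 1 (1 + 8 / R) (R / (2 * 1))) t r)" using P1[OF _ t] R by linarith
      have "min c1 c2 * R powr (- (D / 2 + 1)) \<le> c2 * R powr (- (D / 2 + 1))" by (intro mult_right_mono) auto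
      then show "min c1 c2 * R powr (- (D / 2 + 1)) \<le> cmod (V (packet M (M + 8 / R) (R / (2 * M))) t r)" using P2[OF _ t] R by linarith
    qed (use R0 M in \<open>auto simp: packet_def[of _ _ _ s for s]\<close>)
  qed auto
  then show ?thesis by simp
qed

text \<open>Intervals of length 1/R produce heights of order 1/R in a fixed annulus near the origin
  for times up to R/3. The volume grows only like R, so volume exponent, height exponent and l are
  all 1.\<close>

lemma short_packet_condition:
  assumes be: "bilinear_estimate TYPE('d) M p q C" and C: "0 \<le> C" and M: "0 < M" "M \<le> 1" and p: "1 \<le> p" and q: "1 \<le> q" "q \<noteq> \<infinity>"
  shows "2 * enn2real (1 / p) + 1 / enn2real q \<le> 2"
proof -
  obtain \<rho> where \<rho>: "0 < \<rho>" and K: "\<And>y. 0 \<le> y \<Longrightarrow> y \<le> 2 * \<rho> \<Longrightarrow> 1 / 2 \<le> sphere_hat (y *\<^sub>R (pole :: real ^ 'd))"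
    using kernel_near_0 by blast
  have v: "0 < 1 / 3 * ((\<rho> / 2) powr D * (\<rho> - \<rho> / 2))" using \<rho> by simp
  have iM: "0 < 1 / M" using M by simp
  have "1 / enn2real q + 2 * 1 * enn2real (1 / p) \<le> 2 * 1"
  proof (rule necessary_condition[OF be C M(1) p q _ v iM zero_less_one zero_less_one, where c="1 / 4" and B=1])
    fix R assume R: "1 / M \<le> R"
    then have R0: "0 < R" using iM by linarith
    have l: "1 * R powr (-1) = 1 / R" using R0 by (simp add: powr_minus_divide)
    have RM: "1 / R \<le> M" using R M R0 by (simp add: field_simps)
    have vol: "1 / 3 * ((\<rho> / 2) powr D * (\<rho> - \<rho> / 2)) * R powr 1 \<le> R / 3 * ((\<rho> / 2) powr D * (\<rho> - \<rho> / 2))"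
      using R0 by simp
    show "\<exists>H1 H2 t0 r0 r1. H1 \<in> borel_measurable borel \<and> H2 \<in> borel_measurable borel \<and>
      (\<forall>s. (s \<notin> {1..1 + 1 * R powr (-1)} \<longrightarrow> H1 s = 0) \<and> (s \<notin> {M..M + 1 * R powr (-1)} \<longrightarrow> H2 s = 0) \<and> cmod (H1 s) \<le> 1 \<and> cmod (H2 s) \<le> 1) \<and>
      1 * R powr (-1) \<le> 1 \<and> 1 * R powr (-1) \<le> M \<and> 0 < r0 \<and> r0 \<le> r1 \<and> 0 \<le> t0 \<and> 1 / 3 * ((\<rho> / 2) powr D * (\<rho> - \<rho> / 2)) * R powr 1 \<le> t0 * (r0 powr D * (r1 - r0)) \<and>
      (\<forall>t r. 0 \<le> t \<longrightarrow> t \<le> t0 \<longrightarrow> r0 \<le> r \<longrightarrow> r \<le> r1 \<longrightarrow>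
        1 / 4 * R powr (-1) \<le> cmod (V H1 t r) \<and> 1 / 4 * R powr (-1) \<le> cmod (V H2 t r))"
      unfolding l
    proof (rule exI[of _ "\<lambda>s. indicator {1..1 + 1 / R} s"], rule exI[of _ "\<lambda>s. indicator {M..M + 1 / R} s"], rule exI[of _ "R / 3"], rule exI[of _ "\<rho> / 2"], rule exI[of _ \<rho>],
        intro conjI allI impI vol RM)
      fix t r assume t: "0 \<le> t" "t \<le> R / 3" and r: "\<rho> / 2 \<le> r" "r \<le> \<rho>"
      have e: "1 / 4 * R powr (-1) = 1 / R / 4" using R0 by (simp add: powr_minus_divide)
      have tR: "t * (1 / R) \<le> 1 / 3" using t R0 by (simp add: field_simps)
      have R1: "0 < 1 / R" "1 / R \<le> 1" "0 \<le> r" using R0 order_trans[OF RM M(2)] r \<rho> by auto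
      show "1 / 4 * R powr (-1) \<le> cmod (V (\<lambda>s. indicator {1..1 + 1 / R} s) t r)"
        unfolding e by (rule short_packet[OF zero_less_one order_refl R1(1,2) t(1) tR R1(3) r(2) K])
      show "1 / 4 * R powr (-1) \<le> cmod (V (\<lambda>s. indicator {M..M + 1 / R} s) t r)"
        unfolding e by (rule short_packet[OF M R1(1) RM t(1) tR R1(3) r(2) K])
    qed (use R0 RM M \<rho> order_trans[OF RM M(2)] in \<open>auto simp: indicator_def\<close>)
  qed auto
  then show ?thesis by simp
qed

lemma bilinear_estimate_range:
  fixes p q :: ennreal
  assumes n: "n \<ge> 3" "CARD('d) = n - 1" and M: "0 < M" "M \<le> 1 / 4" and p: "1 \<le> p" and q: "1 \<le> q"
  shows "(q > of_nat n / of_nat (n - 1) \<and> 2 / p + of_nat n / q < of_nat n \<and> 2 / p + 1 / q \<le> 2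
            \<longrightarrow> (\<exists>C\<ge>0. bilinear_estimate TYPE('d) M p q C))
       \<and> ((\<exists>C\<ge>0. bilinear_estimate TYPE('d) M p q C)
            \<longrightarrow> q \<ge> of_nat n / of_nat (n - 1) \<and> 2 / p + of_nat n / q \<le> of_nat n \<and> 2 / p + 1 / q \<le> 2)"
proof -
  have Dn: "real n = D + 2" "real (n - 1) = D + 1" using n D by auto
  \<comment> \<open>\<open>k\<close> is 1/p as a real number, equal to 0 for p = \<infinity>; with
    it the conditions on extended exponents become real inequalities.\<close>
  define k where "k = enn2real (1 / p)"
  have k0: "0 \<le> k" by (simp add: k_def)
  have p2: "2 / p = ennreal (2 * k)" using ennreal_divide_exponent[OF p, of 2] by (simp add: k_def)
  have n0: "(of_nat n :: ennreal) = ennreal (D + 2)" "(of_nat (n - 1) :: ennreal) = ennreal (D + 1)"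
    unfolding Dn[symmetric] by (simp_all add: ennreal_of_nat_eq_real_of_nat)
  have nq: "(of_nat n :: ennreal) / of_nat (n - 1) = ennreal ((D + 2) / (D + 1))"
    unfolding n0 using D by (intro divide_ennreal) auto
  have k1: "k \<le> 1"
  proof (cases p)
    case (real P)
    then have "1 \<le> P" using p by (simp flip: ennreal_1)
    then have "1 / p = ennreal (1 / P)" using real(2) by (simp add: divide_ennreal flip: ennreal_1)
    then show ?thesis using \<open>1 \<le> P\<close> by (simp add: k_def)
  qed (simp add: k_def)
  show ?thesis
  proof (cases q)
    \<comment> \<open>At q = \<infinity> the necessary conditions hold automatically, since 2/p
      \<le> 2 \<le> n, and the estimate is \<open>bilinear_estimate_infinity\<close>.\<close>
    case top
    have "ennreal (2 * k) \<le> ennreal (D + 2)" "ennreal (2 * k) \<le> ennreal 2"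
      by (rule ennreal_leI, use k0 k1 D in linarith)+
    then show ?thesis
      using bilinear_estimate_infinity[OF M(1) p] top
      unfolding p2 nq n0 by (auto simp del: ennreal_plus)
  next
    case (real Q)
    have Q: "1 \<le> Q" using q real by (simp flip: ennreal_1)
    have q1: "1 / q = ennreal (1 / Q)" using Q real by (simp add: divide_ennreal flip: ennreal_1)
    have qn: "of_nat n / q = ennreal ((D + 2) / Q)"
      unfolding n0 real(2) by (rule divide_ennreal) (use Q D in auto)
    have sums: "2 / p + of_nat n / q = ennreal (2 * k + (D + 2) / Q)" "2 / p + 1 / q = ennreal (2 * k + 1 / Q)"
      unfolding p2 q1 qn using Q k0 D by (simp_all add: ennreal_plus)
    have c1: "q > of_nat n / of_nat (n - 1) \<longleftrightarrow> (D + 2) / (D + 1) < Q" "q \<ge> of_nat n / of_nat (n - 1) \<longleftrightarrow> (D + 2) / (D + 1) \<le> Q"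
      unfolding nq real(2) using Q D by (auto simp: ennreal_less_iff)
    have c2: "2 / p + of_nat n / q < of_nat n \<longleftrightarrow> 2 * k + (D + 2) / Q < D + 2" "2 / p + of_nat n / q \<le> of_nat n \<longleftrightarrow> 2 * k + (D + 2) / Q \<le> D + 2"
      unfolding sums unfolding n0 using Q D k0 by (auto simp: ennreal_less_iff simp del: ennreal_plus)
    have c3: "2 / p + 1 / q \<le> 2 \<longleftrightarrow> 2 * k + 1 / Q \<le> 2"
      unfolding sums by (simp flip: ennreal_numeral)
    show ?thesis
      unfolding c1 c2 c3
    proof (intro conjI impI)
      assume H: "(D + 2) / (D + 1) < Q \<and> 2 * k + (D + 2) / Q < D + 2 \<and> 2 * k + 1 / Q \<le> 2"
      have "1 < (D + 2) / (D + 1)" using D by simp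
      then have Q1: "1 < Q" using H by linarith
      show "\<exists>C\<ge>0. bilinear_estimate TYPE('d) M p q C"
      proof (cases "2 \<le> p")
        case True
        \<comment> \<open>For p \<ge> 2 the working exponent is 2, at which the condition of
          \<open>bilinear_estimate_finite\<close> is \<open>1 + (D + 2) / Q < D + 2\<close>; that is
          the hypothesis q > n/(n-1).\<close>
        have "(D + 2) / Q < D + 1" using H D(1) Q by (simp add: field_simps)
        then show ?thesis
          unfolding real(2) using True dual2(2)[OF Q]
          by (intro bilinear_estimate_finite[OF M p Q1, of 2]) auto
      next
        case False
        then obtain P where P: "p = ennreal P" "1 \<le> P" "P \<le> 2"
          using p by (cases p) (auto simp: not_le simp flip: ennreal_1 ennreal_numeral)
        then have kP: "k = 1 / P" by (simp add: k_def divide_ennreal flip: ennreal_1)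
        \<comment> \<open>The hypothesis 2/p + 1/q \<le> 2, solved for p: it says that
          \<open>P\<close> is at least \<open>dual2 Q\<close>, so p itself can be the working
          exponent.\<close>
        have "2 * Q / (2 * Q - 1) \<le> P"
        proof -
          have "2 * Q + P \<le> 2 * Q * P" using H P Q unfolding kP by (simp add: field_simps)
          then show ?thesis using Q by (simp add: pos_divide_le_eq algebra_simps)
        qed
        then show ?thesis
          unfolding real(2) using P H Q by (intro bilinear_estimate_finite[OF M p Q1, of P]) (auto simp: dual2_def kP)
      qed
    next
      assume "\<exists>C\<ge>0. bilinear_estimate TYPE('d) M p q C"
      then obtain C where C: "0 \<le> C" "bilinear_estimate TYPE('d) M p q C" by blast
      have M1: "M \<le> 1" and qf: "q \<noteq> \<infinity>" and eq: "enn2real q = Q" using M real by auto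
      show "2 * k + (D + 2) / Q \<le> D + 2"
        using narrow_packet_condition[OF C(2,1) M(1) M1 p q qf] by (simp add: k_def eq)
      show "2 * k + 1 / Q \<le> 2"
        using short_packet_condition[OF C(2,1) M(1) M1 p q qf] by (simp add: k_def eq)
      have "(D + 2) / Q \<le> D + 1"
        using wide_packet_condition[OF C(2,1) M(1) M1 p q qf] by (simp add: eq)
      then show "(D + 2) / (D + 1) \<le> Q" using Q D(1) by (simp add: field_simps)
    qed
  qed
qed

end

lemma paraboloid_kernel_exists:
  assumes "2 \<le> CARD('d::finite)"
  shows "\<exists>a C0. paraboloid_kernel TYPE('d) a C0"
proof -
  obtain a C0 where a: "a \<noteq> 0" "0 \<le> C0" and asy: "\<And>r. 1 \<le> r \<Longrightarrow> \<bar>r powr (real (CARD('d) - 1) / 2) * sphere_hat (r *\<^sub>R (pole :: real ^ 'd)) - 2 * Re (a * cis r)\<bar> \<le> C0 / r"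
    using sphere_hat_asymptotics[of "pole :: real ^ 'd"] by auto
  have "(\<lambda>r. sphere_hat (r *\<^sub>R (pole :: real ^ 'd))) \<in> borel_measurable borel" by measurable
  then have "paraboloid_kernel TYPE('d) a C0"
    by unfold_locales (use assms a asy abs_sphere_hat_le in auto)
  then show ?thesis by blast
qed

theorem corollary2p7:
  fixes n :: nat and M :: real and p q :: ennreal
  assumes "n \<ge> 3" and "CARD('d::finite) = n - 1"
    and "dyadic M" and "0 < M" and "M \<le> 1 / 4"
    and "1 \<le> p" and "1 \<le> q"
  shows "(q > of_nat n / of_nat (n - 1) \<and> 2 / p + of_nat n / q < of_nat n \<and> 2 / p + 1 / q \<le> 2
            \<longrightarrow> (\<exists>C\<ge>0. bilinear_estimate TYPE('d) M p q C))
       \<and> ((\<exists>C\<ge>0. bilinear_estimate TYPE('d) M p q C)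
            \<longrightarrow> q \<ge> of_nat n / of_nat (n - 1) \<and> 2 / p + of_nat n / q \<le> of_nat n \<and> 2 / p + 1 / q \<le> 2)"
proof -
  obtain a C0 where "paraboloid_kernel TYPE('d) a C0" using paraboloid_kernel_exists[where 'd='d] assms(1,2) by fastforce
  from paraboloid_kernel.bilinear_estimate_range[OF this assms(1,2,4-7)] show ?thesis .
qed

end
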